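(* Let $\Omega\subset\mathbb{R}^d$ be a piecewise $C^1$-domain whose boundary is accessible from the exterior. For $\varepsilon\in(0,1)$ let $$\alpha_\varepsilon(h)=\varepsilon^{-1}\,\mathbf{1}_{B_\varepsilon(0)}(h),\qquad \mu_\varepsilon(h)=\frac{d(d+2)}{\mathcal{H}^{d-1}(\mathbb{S}^{d-1})}\,\varepsilon^{-d-1}\,\mathbf{1}_{B_\varepsilon(0)}(h).$$ Let $F\in C^1(\overline\Omega;\mathbb{R}^d)$ and let $(f_\varepsilon)_{\varepsilon\in(0,1)}$ be the corresponding family of nonlocal vector fields generated by $F$ with respect to $(\alpha_\varepsilon)_\varepsilon$. Then $$\int_{\Omega^c}\mathcal{N}_\varepsilon f_\varepsilon(x)\,\mathrm{d}x\;\longrightarrow\;\int_{\partial\Omega}F(x)\cdot\vec{n}(x)\,\mathrm{d}\sigma_{d-1}(x)\qquad\text{as }\varepsilon\to0^+ .$$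
   Context: A domain is an open bounded connected subset of $\mathbb{R}^d$. $\vec{n}$ is the outward unit normal vector, $\sigma_{d-1}$ the $(d-1)$-dimensional surface measure, $\mathcal{H}^{d-1}$ the $(d-1)$-dimensional Hausdorff measure, $\mathbb{S}^{d-1}$ the unit sphere, $B_\varepsilon(0)$ the ball of radius $\varepsilon$ centred at $0$, $|\cdot|$ Lebesgue measure of sets, $\Omega^c=\mathbb{R}^d\setminus\Omega$, and $\Omega^c_\varepsilon=\{x\in\Omega^c:\operatorname{dist}(x,\partial\Omega)<\varepsilon\}$. Piecewise $C^1$-domain: a bounded domain $\Omega$ whose boundary is Lipschitz-continuous and decomposes into $N+1$ disjoint sets $\partial\Omega=G_1\cup\dots\cup G_N\cup B$ such that $\mathcal{H}^{d-1}(B)=0$, each $G_i$ is connected, and the outward unit normal vector $\vec{n}|_{G_i}$ is uniformly continuous. Exterior $\varepsilon$-neighborhood: for $M\subset\partial\Omega$ with outward unit normal vector $\vec{n}$ and $\varepsilon>0$, $M^\varepsilon=\{x\in\Omega^c: x=z+t\vec{n}(z)\text{ for some }z\in M,\ t\in(0,\varepsilon)\}$. Accessible from the exterior: for a piecewise $C^1$-domain $\Omega$ with boundary decomposition $\partial\Omega=G_1\cup\dots\cup G_N\cup B$ into disjoint sets, where $\mathcal{H}^{d-1}(B)=0$, each $G_i$ is connected and $\vec{n}|_{G_i}$ is uniformly continuous, $\partial\Omega$ is accessible from the exterior if for every $i\in\{1,\dots,N\}$ and every $\delta>0$ there are a set $G_{i,\delta}\subset G_i$ and $\varepsilon_0>0$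 (depending on $\delta$) such that $G_{i,\delta}\subset G_{i,\eta}$ for all $0<\eta\le\delta$, such that $G_{i,\delta}^\varepsilon\cap G_{j,\delta}^\varepsilon=\emptyset$ for all $i\ne j$ and $\varepsilon\in(0,\varepsilon_0)$, and such that $$\bigcup_{\delta>0}G_{i,\delta}=G_i\quad\text{and}\quad\lim_{\delta\to0}\lim_{\varepsilon\to0}\varepsilon^{-1}|B(\delta,\varepsilon)|=0,\qquad B(\delta,\varepsilon)=\Omega^c_\varepsilon\setminus\Big(\bigcup_{i=1}^NG_{i,\delta}^\varepsilon\Big).$$ The vector field $F$ is assumed to be extended to a compactly supported $C^1$ vector field on $\mathbb{R}^d$, again denoted $F$. The nonlocal vector field generated by $F$ with respect to $\alpha_\varepsilon$ is $$f_\varepsilon(x,y)=\alpha_\varepsilon(x-y)\int_0^1F\big(x+t(y-x)\big)\cdot(y-x)\,\mathrm{d}t\quad(x\neq y),\qquad f_\varepsilon(x,x)=0 .$$ The nonlocal normal operator is $$\mathcal{N}_\varepsilon f(x)=-2\int_\Omega f(x,y)\,\mu_\varepsilon(y-x)\,\mathrm{d}y,\qquad x\in\Omega^c .$$ *)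

theory Defs
  imports "HOL-Analysis.Analysis"
begin

text \<open>
  Normalised so that the \<open>k\<close>-dimensional measure agrees with Lebesgue measure on \<open>k\<close>-dimensional
  spaces; \<open>unit_ball_vol k\<close> is the volume of the \<open>k\<close>-dimensional unit ball. The empty set has
  weight \<open>0\<close> also for \<open>k = 0\<close>, where all other sets have weight \<open>1\<close>. Covering sets have to be
  bounded because \<open>diameter\<close> is meaningless on unbounded sets.
\<close>

definition hausdorff_weight :: "nat \<Rightarrow> 'a::metric_space set \<Rightarrow> ennreal" where
  "hausdorff_weight k S =
     (if S = {} then 0 else ennreal (unit_ball_vol (real k) * (diameter S / 2) ^ k))"

definition hausdorff_premeasure :: "nat \<Rightarrow> real \<Rightarrow> 'a::metric_space set \<Rightarrow> ennreal" where
  "hausdorff_premeasure k \<delta> A =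
     (INF C \<in> {C :: nat \<Rightarrow> 'a set. A \<subseteq> (\<Union>i. C i) \<and> (\<forall>i. bounded (C i) \<and> diameter (C i) \<le> \<delta>)}.
        \<Sum>i. hausdorff_weight k (C i))"

definition hausdorff_outer :: "nat \<Rightarrow> 'a::metric_space set \<Rightarrow> ennreal" where
  "hausdorff_outer k A = (SUP \<delta> \<in> {0<..}. hausdorff_premeasure k \<delta> A)"

text \<open>The measure lives on the Caratheodory-measurable sets, so it is complete.\<close>

definition hausdorff_measure :: "nat \<Rightarrow> 'a::metric_space measure" where
  "hausdorff_measure k =
     measure_of UNIV (lambda_system UNIV (Pow UNIV) (hausdorff_outer k)) (hausdorff_outer k)"

definition surface_measure :: "'a::euclidean_space set \<Rightarrow> 'a measure" where
  "surface_measure \<Omega> = restrict_space (hausdorff_measure (DIM('a) - 1)) (frontier \<Omega>)"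

text \<open>
  In the ball around \<open>z\<close> the set \<open>\<Omega>\<close> is the part strictly below the graph, in direction \<open>e\<close>, of the
  Lipschitz function \<open>\<gamma>\<close> on the hyperplane orthogonal to \<open>e\<close>. The orthogonal projection of \<open>x\<close>
  to that hyperplane is \<open>x - (x \<bullet> e) *\<^sub>R e\<close>.
\<close>

definition lipschitz_chart ::
    "'a::euclidean_space set \<Rightarrow> 'a \<Rightarrow> real \<Rightarrow> 'a \<Rightarrow> ('a \<Rightarrow> real) \<Rightarrow> bool" where
  "lipschitz_chart \<Omega> z r e \<gamma> \<longleftrightarrow>
     0 < r \<and> norm e = 1 \<and> (\<exists>L. L-lipschitz_on {y. y \<bullet> e = 0} \<gamma>) \<and>
     (\<forall>x\<in>ball z r. x \<in> \<Omega> \<longleftrightarrow> x \<bullet> e < \<gamma> (x - (x \<bullet> e) *\<^sub>R e))"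

definition lipschitz_boundary :: "'a::euclidean_space set \<Rightarrow> bool" where
  "lipschitz_boundary \<Omega> \<longleftrightarrow> (\<forall>z\<in>frontier \<Omega>. \<exists>r e \<gamma>. lipschitz_chart \<Omega> z r e \<gamma>)"

text \<open>
  Here \<open>g\<close> is the gradient of \<open>\<gamma>\<close> at the foot point of \<open>z\<close>, taken within the hyperplane; the
  normal is the classical \<open>(- \<nabla>\<gamma>, 1) / sqrt (1 + \<bar>\<nabla>\<gamma>\<bar>\<^sup>2)\<close>.
\<close>

definition is_outward_unit_normal :: "'a::euclidean_space set \<Rightarrow> 'a \<Rightarrow> 'a \<Rightarrow> bool" where
  "is_outward_unit_normal \<Omega> z \<nu> \<longleftrightarrow>
     z \<in> frontier \<Omega> \<and>
     (\<exists>r e \<gamma> g. lipschitz_chart \<Omega> z r e \<gamma> \<and> g \<bullet> e = 0 \<and>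
        (\<gamma> has_derivative (\<lambda>h. g \<bullet> h)) (at (z - (z \<bullet> e) *\<^sub>R e) within {y. y \<bullet> e = 0}) \<and>
        \<nu> = (1 / sqrt (1 + (norm g)\<^sup>2)) *\<^sub>R (e - g))"

definition outward_normal :: "'a::euclidean_space set \<Rightarrow> 'a \<Rightarrow> 'a" where
  "outward_normal \<Omega> z = (THE \<nu>. is_outward_unit_normal \<Omega> z \<nu>)"

definition piecewise_C1_decomposition ::
    "'a::euclidean_space set \<Rightarrow> nat \<Rightarrow> (nat \<Rightarrow> 'a set) \<Rightarrow> 'a set \<Rightarrow> bool" where
  "piecewise_C1_decomposition \<Omega> N G B \<longleftrightarrow>
     frontier \<Omega> = (\<Union>i\<in>{1..N}. G i) \<union> B \<and>
     disjoint_family_on G {1..N} \<and> (\<forall>i\<in>{1..N}. G i \<inter> B = {}) \<and>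
     hausdorff_outer (DIM('a) - 1) B = 0 \<and>
     (\<forall>i\<in>{1..N}. connected (G i) \<and>
        (\<forall>z\<in>G i. \<exists>\<nu>. is_outward_unit_normal \<Omega> z \<nu>) \<and>
        uniformly_continuous_on (G i) (outward_normal \<Omega>))"

definition piecewise_C1_domain :: "'a::euclidean_space set \<Rightarrow> bool" where
  "piecewise_C1_domain \<Omega> \<longleftrightarrow>
     open \<Omega> \<and> bounded \<Omega> \<and> connected \<Omega> \<and> lipschitz_boundary \<Omega> \<and>
     (\<exists>N G B. piecewise_C1_decomposition \<Omega> N G B)"

text \<open>\<open>M\<close> is meant to be a set of boundary points of \<open>\<Omega>\<close> at which the normal exists.\<close>

definition exterior_nbhd :: "'a::euclidean_space set \<Rightarrow> 'a set \<Rightarrow> real \<Rightarrow> 'a set" where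
  "exterior_nbhd \<Omega> M \<epsilon> =
     {x \<in> - \<Omega>. \<exists>z\<in>M. \<exists>t\<in>{0<..<\<epsilon>}. x = z + t *\<^sub>R outward_normal \<Omega> z}"

definition exterior_layer :: "'a::euclidean_space set \<Rightarrow> real \<Rightarrow> 'a set" where
  "exterior_layer \<Omega> \<epsilon> = {x \<in> - \<Omega>. infdist x (frontier \<Omega>) < \<epsilon>}"

definition uncovered_layer ::
    "'a::euclidean_space set \<Rightarrow> nat \<Rightarrow> (nat \<Rightarrow> real \<Rightarrow> 'a set) \<Rightarrow> real \<Rightarrow> real \<Rightarrow> 'a set" where
  "uncovered_layer \<Omega> N GG \<delta> \<epsilon> =
     exterior_layer \<Omega> \<epsilon> - (\<Union>i\<in>{1..N}. exterior_nbhd \<Omega> (GG i \<delta>) \<epsilon>)"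

text \<open>
  \<open>GG i \<delta>\<close> is the set \<open>G\<^sub>i\<^sub>,\<^sub>\<delta>\<close> and \<open>l \<delta>\<close> the inner limit. Measurability of the uncovered layer is
  required explicitly, since \<open>measure\<close> silently returns \<open>0\<close> on non-measurable sets.
\<close>

definition accessible_wrt ::
    "'a::euclidean_space set \<Rightarrow> nat \<Rightarrow> (nat \<Rightarrow> 'a set) \<Rightarrow> bool" where
  "accessible_wrt \<Omega> N G \<longleftrightarrow>
     (\<exists>(GG :: nat \<Rightarrow> real \<Rightarrow> 'a set) (\<epsilon>0 :: real \<Rightarrow> real) (l :: real \<Rightarrow> real).
        (\<forall>i\<in>{1..N}. \<forall>\<delta>>0. GG i \<delta> \<subseteq> G i) \<and>
        (\<forall>i\<in>{1..N}. \<forall>\<eta> \<delta>. 0 < \<eta> \<and> \<eta> \<le> \<delta> \<longrightarrow> GG i \<delta> \<subseteq> GG i \<eta>) \<and>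
        (\<forall>\<delta>>0. 0 < \<epsilon>0 \<delta>) \<and>
        (\<forall>\<delta>>0. \<forall>\<epsilon>\<in>{0<..<\<epsilon>0 \<delta>}. \<forall>i\<in>{1..N}. \<forall>j\<in>{1..N}. i \<noteq> j \<longrightarrow>
           exterior_nbhd \<Omega> (GG i \<delta>) \<epsilon> \<inter> exterior_nbhd \<Omega> (GG j \<delta>) \<epsilon> = {}) \<and>
        (\<forall>i\<in>{1..N}. (\<Union>\<delta>\<in>{0<..}. GG i \<delta>) = G i) \<and>
        (\<forall>\<^sub>F \<delta> in at_right 0. \<forall>\<^sub>F \<epsilon> in at_right 0. uncovered_layer \<Omega> N GG \<delta> \<epsilon> \<in> sets lebesgue) \<and>
        (\<forall>\<^sub>F \<delta> in at_right 0.
           ((\<lambda>\<epsilon>. measure lebesgue (uncovered_layer \<Omega> N GG \<delta> \<epsilon>) / \<epsilon>) \<longlongrightarrow> l \<delta>) (at_right 0)) \<and>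
        (l \<longlongrightarrow> 0) (at_right 0))"

definition accessible_from_exterior :: "'a::euclidean_space set \<Rightarrow> bool" where
  "accessible_from_exterior \<Omega> \<longleftrightarrow>
     (\<exists>N G B. piecewise_C1_decomposition \<Omega> N G B \<and> accessible_wrt \<Omega> N G)"

definition C1_on_closure :: "'a::euclidean_space set \<Rightarrow> ('a \<Rightarrow> 'a) \<Rightarrow> bool" where
  "C1_on_closure \<Omega> F \<longleftrightarrow>
     continuous_on (closure \<Omega>) F \<and>
     (\<exists>D :: 'a \<Rightarrow> 'a \<Rightarrow>\<^sub>L 'a. continuous_on (closure \<Omega>) D \<and>
        (\<forall>x\<in>\<Omega>. (F has_derivative blinfun_apply (D x)) (at x)))"

definition compact_C1_extension ::
    "'a::euclidean_space set \<Rightarrow> ('a \<Rightarrow> 'a) \<Rightarrow> ('a \<Rightarrow> 'a) \<Rightarrow> bool" where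
  "compact_C1_extension \<Omega> F Fx \<longleftrightarrow>
     (\<forall>x\<in>closure \<Omega>. Fx x = F x) \<and> C1_on_closure UNIV Fx \<and> compact (closure {x. Fx x \<noteq> 0})"

definition nonlocal_field ::
    "('a::euclidean_space \<Rightarrow> real) \<Rightarrow> ('a \<Rightarrow> 'a) \<Rightarrow> 'a \<Rightarrow> 'a \<Rightarrow> real" where
  "nonlocal_field \<alpha> F x y =
     (if x = y then 0
      else \<alpha> (x - y) * (LINT t:{0..1}|lborel. F (x + t *\<^sub>R (y - x)) \<bullet> (y - x)))"

definition nonlocal_normal ::
    "'a::euclidean_space set \<Rightarrow> ('a \<Rightarrow> real) \<Rightarrow> ('a \<Rightarrow> 'a \<Rightarrow> real) \<Rightarrow> 'a \<Rightarrow> real" where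
  "nonlocal_normal \<Omega> \<mu> f x = - 2 * (LINT y:\<Omega>|lborel. f x y * \<mu> (y - x))"

definition alpha_kernel :: "real \<Rightarrow> 'a::euclidean_space \<Rightarrow> real" where
  "alpha_kernel \<epsilon> h = (1 / \<epsilon>) * indicator (ball 0 \<epsilon>) h"

definition mu_kernel :: "real \<Rightarrow> 'a::euclidean_space \<Rightarrow> real" where
  "mu_kernel \<epsilon> h =
     real (DIM('a) * (DIM('a) + 2))
       / measure (hausdorff_measure (DIM('a) - 1)) (sphere (0 :: 'a) 1)
       * (1 / \<epsilon> ^ (DIM('a) + 1)) * indicator (ball 0 \<epsilon>) h"

end

theory Submission
  imports Defs
begin

text \<open>
  By antisymmetry of \<open>f\<close> the nonlocal flux through \<open>-\<Omega>\<close> is an integral over \<open>\<Omega>\<close> of averages of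
  line integrals of \<open>F\<close> over small balls; Taylor's formula and the second moments of the ball give
  its limit, the integral of \<open>div F\<close> over \<open>\<Omega>\<close>. The boundary integral is then obtained from the
  Gauss theorem for Lipschitz domains with respect to the Hausdorff measure. For the latter, the
  isodiametric inequality (from Brunn--Minkowski with midpoints) identifies the Hausdorff measure on
  a hyperplane with the flat measure. Where the normal is uniformly continuous, the boundary is
  locally almost flat, hence the oblique projection of the surface measure along a direction \<open>w\<close>
  transversal to the boundary has density \<open>w \<bullet> n\<close>. Integrating a derivative along lines parallel
  to \<open>w\<close> and a partition of unity give the theorem.
\<close>

section \<open>Hausdorff measure as a metric outer measure\<close>

text \<open>The surface integral refers to a measure defined by coverings, and the normal is
  controlled only off a null set, so no parametrisation of the boundary is integrated. Instead the
  normal is recast as the chart-free condition \<open>pinched_at\<close>: up to distance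
  \<open>\<delta>\<close> the boundary stays in a thin double cone. For a fixed direction and scale
  this condition is closed in the point, which cuts the boundary into countably many nearly flat
  Borel pieces; narrowing the cones makes the density exact. Since weights are computed from
  diameters, even the flat case needs the isodiametric inequality. A Lipschitz chart provides a
  whole ball of transversal directions, and both sides of the Gauss identity are linear in the
  direction, so that ball suffices for all directions. Balls satisfy the same abstract assumptions;
  the Gauss theorem for them yields the area of the unit sphere occurring in
  \<open>mu_kernel\<close> as well as the second moments. This explains the constant of the kernel:
  the second moment in each coordinate direction becomes one, and the factor 2 of the normal
  operator cancels the factor 1/2 that Taylor's formula produces along a segment.\<close>

lemma hausdorff_weight_empty [simp]: "hausdorff_weight k {} = 0"
  by (simp add: hausdorff_weight_def)

lemma hausdorff_premeasure_le:
  assumes "A \<subseteq> (\<Union>i. C i)" "\<And>i. bounded (C i)" "\<And>i. diameter (C i) \<le> \<delta>"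
  shows "hausdorff_premeasure k \<delta> A \<le> (\<Sum>i. hausdorff_weight k (C i))"
  unfolding hausdorff_premeasure_def using assms by (intro INF_lower) auto

lemma hausdorff_premeasure_mono:
  assumes "A \<subseteq> B" "\<delta> \<le> \<delta>'"
  shows "hausdorff_premeasure k \<delta>' A \<le> hausdorff_premeasure k \<delta> B"
  unfolding hausdorff_premeasure_def using assms
  by (intro INF_superset_mono) (auto intro: order_trans)

lemma hausdorff_premeasure_close:
  assumes "hausdorff_premeasure k \<delta> A < c"
  obtains C where "A \<subseteq> (\<Union>i. C i)" "\<And>i. bounded (C i)" "\<And>i. diameter (C i) \<le> \<delta>"
    "(\<Sum>i. hausdorff_weight k (C i)) < c"
  using assms unfolding hausdorff_premeasure_def INF_less_iff by auto

text \<open>Near-optimal covers of the single sets, with errors \<open>e * (1/2)^Suc n\<close> of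
  total \<open>e\<close>, are merged into one sequence through \<open>prod_decode\<close>.\<close>

lemma hausdorff_premeasure_UN:
  "hausdorff_premeasure k \<delta> (\<Union>i::nat. A i) \<le> (\<Sum>i. hausdorff_premeasure k \<delta> (A i))"
proof (rule ennreal_le_epsilon)
  let ?O = "hausdorff_premeasure k \<delta>"
  fix e :: real assume "0 < e" "(\<Sum>n. ?O (A n)) < top"
  then have *: "?O (A n) < ?O (A n) + e * (1/2)^Suc n" for n
    by (auto simp add: less_top dest!: ennreal_suminf_lessD)
  have "\<exists>C. A n \<subseteq> (\<Union>i. C i) \<and> (\<forall>i. bounded (C i)) \<and> (\<forall>i. diameter (C i) \<le> \<delta>) \<and>
          (\<Sum>i. hausdorff_weight k (C i)) < ?O (A n) + e * (1/2)^Suc n" for n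
    using hausdorff_premeasure_close[OF *] by metis
  then obtain B where B: "\<And>n. A n \<subseteq> (\<Union>i. B n i)" "\<And>n i. bounded (B n i)"
    "\<And>n i. diameter (B n i) \<le> \<delta>"
    and Ble: "\<And>n. (\<Sum>i. hausdorff_weight k (B n i)) < ?O (A n) + e * (1/2)^Suc n"
    by metis
  define C where "C = case_prod B o prod_decode"
  have "(\<Union>i. A i) \<subseteq> (\<Union>i. C i)"
    using B(1) by (auto simp add: C_def subset_eq) (metis prod.case prod_encode_inverse)
  then have "?O (\<Union>i. A i) \<le> (\<Sum>i. hausdorff_weight k (C i))"
    by (rule hausdorff_premeasure_le) (auto simp: C_def B split: prod.split)
  also have "\<dots> = (\<Sum>n. \<Sum>i. hausdorff_weight k (B n i))"
    unfolding C_def comp_def by (intro suminf_ennreal_2dimen) auto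
  also have "\<dots> \<le> (\<Sum>n. ?O (A n) + e * (1/2) ^ Suc n)"
    by (intro suminf_le less_imp_le[OF Ble]) auto
  also have "... = (\<Sum>n. ?O (A n)) + (\<Sum>n. ennreal e * ennreal ((1/2) ^ Suc n))"
    using \<open>0 < e\<close> by (subst suminf_add[symmetric])
      (auto simp del: ennreal_suminf_cmult simp add: ennreal_mult[symmetric])
  also have "\<dots> = (\<Sum>n. ?O (A n)) + e"
    unfolding ennreal_suminf_cmult
    by (subst suminf_ennreal_eq[OF zero_le_power power_half_series]) auto
  finally show "?O (\<Union>i. A i) \<le> (\<Sum>n. ?O (A n)) + e" .
qed

lemma hausdorff_premeasure_le_outer:
  "0 < \<delta> \<Longrightarrow> hausdorff_premeasure k \<delta> A \<le> hausdorff_outer k A"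
  unfolding hausdorff_outer_def by (rule SUP_upper) auto

lemma hausdorff_outer_mono: "A \<subseteq> B \<Longrightarrow> hausdorff_outer k A \<le> hausdorff_outer k B"
  unfolding hausdorff_outer_def by (intro SUP_mono) (auto intro!: hausdorff_premeasure_mono)

lemma hausdorff_outer_empty [simp]: "hausdorff_outer k ({} :: 'a::metric_space set) = 0"
proof -
  have "hausdorff_premeasure k \<delta> ({} :: 'a set) = 0" if "\<delta> > 0" for \<delta>
  proof -
    have "hausdorff_premeasure k \<delta> ({} :: 'a set) \<le> (\<Sum>i::nat. hausdorff_weight k ({} :: 'a set))"
      by (rule hausdorff_premeasure_le[where C="\<lambda>_. {}"]) (use that in auto)
    also have "\<dots> = 0" by (simp only: hausdorff_weight_empty suminf_zero)
    finally show ?thesis by simp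
  qed
  then show ?thesis unfolding hausdorff_outer_def by (auto intro!: SUP_eq_const)
qed

lemma hausdorff_outer_UN:
  "hausdorff_outer k (\<Union>i::nat. A i) \<le> (\<Sum>i. hausdorff_outer k (A i))"
  unfolding hausdorff_outer_def [of k "\<Union>i. A i"]
  by (intro SUP_least order_trans[OF hausdorff_premeasure_UN] suminf_le)
     (auto intro: hausdorff_premeasure_le_outer)

lemma hausdorff_outer_Un: "hausdorff_outer k (A \<union> B) \<le> hausdorff_outer k A + hausdorff_outer k B"
proof -
  have "hausdorff_outer k (\<Union>i. binaryset A B i) \<le> (\<Sum>i. hausdorff_outer k (binaryset A B i))"
    by (rule hausdorff_outer_UN)
  also have "\<dots> = hausdorff_outer k A + hausdorff_outer k B"
    using binaryset_sums[of "hausdorff_outer k" A B] by (simp add: sums_iff)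
  finally show ?thesis by (simp add: UN_binaryset_eq)
qed

text \<open>Premeasures grow as the mesh shrinks, so the supremum is a sequential limit and
  inequalities between sums of premeasures survive the passage to it.\<close>

lemma hausdorff_outer_LIMSEQ:
  "(\<lambda>n. hausdorff_premeasure k (1 / Suc n) A) \<longlonglongrightarrow> hausdorff_outer k A"
proof -
  have "hausdorff_outer k A = (SUP n. hausdorff_premeasure k (1 / Suc n) A)"
  proof (rule antisym)
    show "hausdorff_outer k A \<le> (SUP n. hausdorff_premeasure k (1 / Suc n) A)"
      unfolding hausdorff_outer_def
    proof (rule SUP_mono)
      fix \<delta> :: real assume "\<delta> \<in> {0<..}"
      then obtain n where "1 / Suc n < \<delta>" using nat_approx_posE by auto
      then show "\<exists>m\<in>UNIV. hausdorff_premeasure k \<delta> A \<le> hausdorff_premeasure k (1 / Suc m) A"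
        by (intro bexI[of _ n] hausdorff_premeasure_mono) auto
    qed
  qed (auto intro!: SUP_least hausdorff_premeasure_le_outer)
  moreover have "incseq (\<lambda>n. hausdorff_premeasure k (1 / Suc n) A)"
    by (intro monoI hausdorff_premeasure_mono) (auto intro!: frac_le)
  ultimately show ?thesis using LIMSEQ_SUP by metis
qed

text \<open>A set of diameter below \<open>\<eta>\<close> cannot meet both \<open>A\<close> and
  \<open>B\<close>, so every admissible cover of the union splits into a cover of each.\<close>

lemma hausdorff_premeasure_separated:
  assumes "\<And>a b. a \<in> A \<Longrightarrow> b \<in> B \<Longrightarrow> \<eta> \<le> dist a b" "\<delta> < \<eta>"
  shows "hausdorff_premeasure k \<delta> A + hausdorff_premeasure k \<delta> B \<le> hausdorff_premeasure k \<delta> (A \<union> B)"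
  unfolding hausdorff_premeasure_def [of k \<delta> "A \<union> B"]
proof (rule INF_greatest, clarsimp)
  fix C :: "nat \<Rightarrow> 'a set"
  assume C: "A \<subseteq> \<Union> (range C)" "B \<subseteq> \<Union> (range C)" "\<forall>i. bounded (C i) \<and> diameter (C i) \<le> \<delta>"
  define D where "D i = (if C i \<inter> A \<noteq> {} then C i else {})" for i
  define E where "E i = (if C i \<inter> A \<noteq> {} then {} else C i)" for i
  have disj: "C i \<inter> B = {}" if "C i \<inter> A \<noteq> {}" for i
  proof (rule ccontr)
    assume "C i \<inter> B \<noteq> {}"
    with that obtain a b where ab: "a \<in> C i" "a \<in> A" "b \<in> C i" "b \<in> B" by auto
    then have "dist a b \<le> \<delta>" using diameter_bounded_bound[of "C i" a b] C(3) by (meson order_trans)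
    then show False using assms ab by force
  qed
  \<comment> \<open>The discarded members are replaced by empty sets, whose diameter is 0 and has to
    be admissible too.\<close>
  have \<delta>: "0 \<le> \<delta>" using C(3) diameter_ge_0 order_trans by blast
  have "hausdorff_premeasure k \<delta> A \<le> (\<Sum>i. hausdorff_weight k (D i))"
  proof (rule hausdorff_premeasure_le)
    show "A \<subseteq> (\<Union>i. D i)"
    proof
      fix a assume a: "a \<in> A"
      with C(1) obtain i where "a \<in> C i" by auto
      with a have "a \<in> D i" by (auto simp: D_def)
      then show "a \<in> (\<Union>i. D i)" by blast
    qed
  qed (use C \<delta> in \<open>auto simp: D_def\<close>)
  moreover have "hausdorff_premeasure k \<delta> B \<le> (\<Sum>i. hausdorff_weight k (E i))"
  proof (rule hausdorff_premeasure_le)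
    show "B \<subseteq> (\<Union>i. E i)"
    proof
      fix b assume b: "b \<in> B"
      with C(2) obtain i where i: "b \<in> C i" by auto
      with b disj[of i] have "b \<in> E i" by (auto simp: E_def)
      then show "b \<in> (\<Union>i. E i)" by blast
    qed
  qed (use C \<delta> in \<open>auto simp: E_def\<close>)
  ultimately have "hausdorff_premeasure k \<delta> A + hausdorff_premeasure k \<delta> B
      \<le> (\<Sum>i. hausdorff_weight k (D i)) + (\<Sum>i. hausdorff_weight k (E i))"
    by (rule add_mono)
  also have "\<dots> = (\<Sum>i. hausdorff_weight k (D i) + hausdorff_weight k (E i))"
    by (intro suminf_add) auto
  also have "(\<lambda>i. hausdorff_weight k (D i) + hausdorff_weight k (E i)) = (\<lambda>i. hausdorff_weight k (C i))"
    by (auto simp: D_def E_def)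
  finally show "hausdorff_premeasure k \<delta> A + hausdorff_premeasure k \<delta> B \<le> (\<Sum>i. hausdorff_weight k (C i))" .
qed

lemma hausdorff_outer_separated:
  assumes "\<And>a b. a \<in> A \<Longrightarrow> b \<in> B \<Longrightarrow> \<eta> \<le> dist a b" "0 < \<eta>"
  shows "hausdorff_outer k A + hausdorff_outer k B \<le> hausdorff_outer k (A \<union> B)"
proof (rule LIMSEQ_le)
  show "(\<lambda>n. hausdorff_premeasure k (1 / Suc n) A + hausdorff_premeasure k (1 / Suc n) B)
      \<longlonglongrightarrow> hausdorff_outer k A + hausdorff_outer k B"
    by (intro tendsto_add hausdorff_outer_LIMSEQ)
  obtain N where N: "1 / Suc N < \<eta>" using nat_approx_posE \<open>0 < \<eta>\<close> by auto
  show "\<exists>N. \<forall>n\<ge>N. hausdorff_premeasure k (1 / Suc n) A + hausdorff_premeasure k (1 / Suc n) B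
      \<le> hausdorff_premeasure k (1 / Suc n) (A \<union> B)"
  proof (intro exI[of _ N] allI impI)
    fix n assume "N \<le> n"
    then have "1 / Suc n \<le> 1 / Suc N" by (intro frac_le) auto
    with N have "1 / Suc n < \<eta>" by linarith
    then show "hausdorff_premeasure k (1 / Suc n) A + hausdorff_premeasure k (1 / Suc n) B
        \<le> hausdorff_premeasure k (1 / Suc n) (A \<union> B)"
      using assms by (intro hausdorff_premeasure_separated) auto
  qed
qed (rule hausdorff_outer_LIMSEQ)

lemma hausdorff_outer_space: "outer_measure_space (Pow UNIV) (hausdorff_outer k)"
  unfolding outer_measure_space_def positive_def increasing_def countably_subadditive_def
  by (auto intro: hausdorff_outer_mono hausdorff_outer_UN)

text \<open>
  Caratheodory's criterion: the layers \<open>R n\<close> of points at distance about \<open>1/n\<close> from the closed set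
  \<open>X\<close> with indices of equal parity are separated, so that their outer measures are summable.
\<close>

lemma hausdorff_outer_closed_split:
  assumes "closed X"
  shows "hausdorff_outer k (A \<inter> X) + hausdorff_outer k (A - X) \<le> hausdorff_outer k A"
proof (cases "X = {} \<or> hausdorff_outer k A = top")
  case True
  then show ?thesis by auto
next
  case False
  then have ne: "X \<noteq> {}" and fin: "hausdorff_outer k A < top" by (auto simp: less_top)
  let ?H = "hausdorff_outer k"
  define L where "L n = {a\<in>A. 1 / Suc n \<le> infdist a X}" for n
  define R where "R n = {a\<in>A. 1 / Suc (Suc n) \<le> infdist a X \<and> infdist a X < 1 / Suc n}" for n
  have step: "(\<Sum>j<N. ?H (R (2 * j + p))) \<le> ?H (\<Union>j<N. R (2 * j + p))" for N p
  proof (induction N)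
    case (Suc N)
    let ?U = "\<Union>j<N. R (2 * j + p)"
    have "?H ?U + ?H (R (2 * N + p)) \<le> ?H (?U \<union> R (2 * N + p))"
    proof (cases N)
      case 0
      then show ?thesis by simp
    next
      case (Suc M)
      define m where "m = 2 * N + p"
      have m: "m > 0" using Suc m_def by simp
      show ?thesis unfolding m_def [symmetric]
      proof (rule hausdorff_outer_separated)
        fix a b assume "a \<in> ?U" "b \<in> R m"
        then obtain j where j: "j < N" "a \<in> R (2 * j + p)" by auto
        \<comment> \<open>For \<open>j < N\<close> the index \<open>2 * j + p\<close> is at most
          \<open>m - 2\<close>. Points of that layer have distance at least \<open>1 / m\<close>
          from \<open>X\<close>, those of \<open>R m\<close> less than \<open>1 / (m + 1)\<close>;
          skipping every other layer leaves this gap.\<close>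
        have "1 / real m \<le> 1 / Suc (Suc (2 * j + p))" using j m by (intro frac_le) (auto simp: m_def)
        then have "1 / real m \<le> infdist a X" "infdist b X < 1 / Suc m"
          using j \<open>b \<in> R m\<close> by (auto simp: R_def)
        moreover have "infdist a X \<le> infdist b X + dist a b" by (rule infdist_triangle)
        ultimately show "1 / real m - 1 / Suc m \<le> dist a b" by linarith
      next
        show "0 < 1 / real m - 1 / Suc m" using m by (simp add: field_simps add_pos_pos)
      qed
    qed
    then have "?H ?U + ?H (R (2 * N + p)) \<le> ?H (\<Union>j<Suc N. R (2 * j + p))"
      by (simp add: lessThan_Suc Un_commute)
    then show ?case using Suc by (simp add: order_trans[OF add_right_mono])
  qed simp
  have parity: "(\<Sum>j. ?H (R (2 * j + p))) \<le> ?H A" for p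
  proof (rule suminf_le_const)
    show "(\<Sum>j<N. ?H (R (2 * j + p))) \<le> ?H A" for N
      by (rule order_trans[OF step hausdorff_outer_mono]) (auto simp: R_def)
  qed simp
  have "(\<Sum>n. ?H (R n)) \<le> ?H A + ?H A"
  proof (rule suminf_le_const)
    fix N
    have "(\<Sum>n<N. ?H (R n)) \<le> (\<Sum>n<2*N. ?H (R n))" by (intro sum_mono2) auto
    also have "\<dots> = (\<Sum>j<N. ?H (R (2 * j + 0))) + (\<Sum>j<N. ?H (R (2 * j + 1)))"
      by (induction N) (auto simp: algebra_simps)
    also have "\<dots> \<le> ?H A + ?H A"
      by (intro add_mono order_trans[OF sum_le_suminf parity]) auto
    finally show "(\<Sum>n<N. ?H (R n)) \<le> ?H A + ?H A" .
  qed simp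
  then have sumfin: "(\<Sum>n. ?H (R n)) < top" using fin by (simp add: order_le_less_trans)
  define r where "r n = enn2real (?H (R n))" for n
  have Hr: "?H (R n) = ennreal (r n)" for n
    using ennreal_suminf_lessD[OF sumfin, of n] by (simp add: r_def)
  have rs: "summable r" using sumfin unfolding Hr
    by (intro summable_suminf_not_top) (auto simp: r_def)
  have "?H (A \<inter> X) + ?H (A - X) \<le> ?H A + ennreal (\<Sum>j. r (n + j))" for n
  proof -
    have "A - X \<subseteq> L n \<union> (\<Union>j. R (n + j))"
    proof
      fix a assume a: "a \<in> A - X"
      have pos: "infdist a X > 0" using a assms ne by (simp add: infdist_pos_not_in_closed)
      define i where "i = nat \<lfloor>1 / infdist a X\<rfloor>"
      have "real i \<le> 1 / infdist a X" "1 / infdist a X < real i + 1"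
        using pos unfolding i_def by (auto simp: of_nat_nat)
      then have i: "i * infdist a X \<le> 1" "1 < (i + 1) * infdist a X" using pos by (auto simp: field_simps)
      show "a \<in> L n \<union> (\<Union>j. R (n + j))"
      proof (cases "1 / Suc n \<le> infdist a X")
        case False
        then have f: "infdist a X * (1 + n) < 1" by (auto simp: field_simps)
        \<comment> \<open>The first threshold that the distance of \<open>a\<close> reaches. It is
          not among the first \<open>n + 1\<close>, so \<open>a\<close> lies in the layer
          \<open>R (m - 1)\<close> with \<open>m - 1 \<ge> n\<close>.\<close>
        define m where "m = (LEAST m. 1 / Suc m \<le> infdist a X)"
        have "1 / Suc i \<le> infdist a X" using i by (simp add: field_simps)
        then have 1: "1 / Suc m \<le> infdist a X" unfolding m_def by (rule LeastI)
        have "m > n"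
        proof (rule ccontr)
          assume "\<not> n < m"
          then have "1 / Suc n \<le> 1 / Suc m" by (intro frac_le) auto
          with 1 False show False by linarith
        qed
        then obtain j where j: "m = Suc (n + j)" using less_iff_Suc_add by auto
        have "\<not> 1 / Suc (n + j) \<le> infdist a X"
          using not_less_Least[of "n + j" "\<lambda>m. 1 / Suc m \<le> infdist a X"] j m_def by auto
        with 1 j a show ?thesis by (auto simp: R_def)
      qed (use a in \<open>auto simp: L_def\<close>)
    qed
    then have "?H (A - X) \<le> ?H (L n) + ?H (\<Union>j. R (n + j))"
      by (meson hausdorff_outer_mono hausdorff_outer_Un order_trans)
    also have "?H (\<Union>j. R (n + j)) \<le> (\<Sum>j. ?H (R (n + j)))" by (rule hausdorff_outer_UN)
    also have "\<dots> = ennreal (\<Sum>j. r (n + j))"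
      unfolding Hr using summable_ignore_initial_segment[OF rs, of n]
      by (intro suminf_ennreal2) (auto simp: r_def add.commute)
    finally have "?H (A \<inter> X) + ?H (A - X) \<le> (?H (A \<inter> X) + ?H (L n)) + ennreal (\<Sum>j. r (n + j))"
      by (simp add: add_left_mono add.assoc)
    also have "?H (A \<inter> X) + ?H (L n) \<le> ?H (A \<inter> X \<union> L n)"
    proof (rule hausdorff_outer_separated)
      fix a b assume ab: "a \<in> A \<inter> X" "b \<in> L n"
      then have "infdist b X \<le> dist b a" by (intro infdist_le) auto
      then show "1 / Suc n \<le> dist a b" using ab by (auto simp: L_def dist_commute)
    qed auto
    also have "\<dots> \<le> ?H A" by (intro hausdorff_outer_mono) (auto simp: L_def)
    finally show ?thesis by (simp add: add_right_mono)
  qed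
  moreover have "(\<lambda>n. ?H A + ennreal (\<Sum>j. r (n + j))) \<longlonglongrightarrow> ?H A + ennreal 0"
    using suminf_exist_split2[OF rs] by (intro tendsto_intros tendsto_ennrealI) (simp add: add.commute)
  ultimately show ?thesis by (intro LIMSEQ_le_const) auto
qed

lemma hausdorff_lambda_system:
  "measure_space UNIV (lambda_system UNIV (Pow UNIV) (hausdorff_outer k)) (hausdorff_outer k)"
  by (rule sigma_algebra.caratheodory_lemma[OF sigma_algebra_Pow hausdorff_outer_space])

lemma sets_hausdorff_measure:
  "sets (hausdorff_measure k) = lambda_system UNIV (Pow UNIV) (hausdorff_outer k)"
proof -
  interpret sigma_algebra UNIV "lambda_system UNIV (Pow UNIV) (hausdorff_outer k)"
    using hausdorff_lambda_system unfolding measure_space_def by blast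
  show ?thesis unfolding hausdorff_measure_def using sigma_sets_eq by (simp del: Pow_UNIV)
qed

lemma space_hausdorff_measure [simp]: "space (hausdorff_measure k) = UNIV"
  by (simp add: hausdorff_measure_def)

lemma emeasure_hausdorff_measure:
  assumes "A \<in> sets (hausdorff_measure k)"
  shows "emeasure (hausdorff_measure k) A = hausdorff_outer k A"
proof (rule emeasure_measure_of[OF hausdorff_measure_def])
  show "positive (sets (hausdorff_measure k)) (hausdorff_outer k)"
    "countably_additive (sets (hausdorff_measure k)) (hausdorff_outer k)"
    using hausdorff_lambda_system unfolding measure_space_def sets_hausdorff_measure by auto
qed (use assms in auto)

lemma hausdorff_lambda_systemI:
  assumes "\<And>A. hausdorff_outer k (A \<inter> X) + hausdorff_outer k (A - X) \<le> hausdorff_outer k A"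
  shows "X \<in> sets (hausdorff_measure k)"
proof -
  have "hausdorff_outer k (A \<inter> X) + hausdorff_outer k (A - X) = hausdorff_outer k A" for A
  proof (rule antisym[OF assms])
    show "hausdorff_outer k A \<le> hausdorff_outer k (A \<inter> X) + hausdorff_outer k (A - X)"
      using hausdorff_outer_Un[of k "A \<inter> X" "A - X"] by (simp add: Int_Diff_Un)
  qed
  moreover have "algebra UNIV (Pow UNIV :: 'a set set)" by (rule sigma_algebra.axioms[OF sigma_algebra_Pow])
  ultimately show ?thesis by (simp add: sets_hausdorff_measure algebra.lambda_system_eq)
qed

lemma sets_borel_subset_hausdorff: "sets borel \<subseteq> sets (hausdorff_measure k)"
proof -
  have "sigma_sets UNIV (Collect closed) \<subseteq> sets (hausdorff_measure k)"
    by (rule sigma_algebra.sigma_sets_subset[OF sets.sigma_algebra_axioms, of _ "hausdorff_measure k", simplified])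
       (auto intro: hausdorff_lambda_systemI hausdorff_outer_closed_split)
  then show ?thesis by (simp add: borel_eq_closed)
qed

lemma hausdorff_null_sets:
  assumes "hausdorff_outer k A = 0"
  shows "A \<in> sets (hausdorff_measure k)"
proof (rule hausdorff_lambda_systemI)
  fix X
  have "hausdorff_outer k (X \<inter> A) \<le> 0" using assms hausdorff_outer_mono[of "X \<inter> A" A k] by simp
  then show "hausdorff_outer k (X \<inter> A) + hausdorff_outer k (X - A) \<le> hausdorff_outer k X"
    by (simp add: hausdorff_outer_mono)
qed

lemma emeasure_hausdorff_borel:
  "A \<in> sets borel \<Longrightarrow> emeasure (hausdorff_measure k) A = hausdorff_outer k A"
  using emeasure_hausdorff_measure sets_borel_subset_hausdorff by blast

section \<open>Hausdorff measure of Lipschitz images\<close>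

lemma hausdorff_weight_image_le:
  fixes f :: "'a::euclidean_space \<Rightarrow> 'b::euclidean_space"
  assumes "L-lipschitz_on S f" "bounded S"
  shows "hausdorff_weight k (f ` S) \<le> ennreal (L ^ k) * hausdorff_weight k S"
proof (cases "S = {}")
  case False
  have L: "0 \<le> L" using assms(1) by (rule lipschitz_on_nonneg)
  have "diameter (f ` S) \<le> L * diameter S"
  proof (rule diameter_le)
    fix x y assume "x \<in> f ` S" "y \<in> f ` S"
    then obtain a b where ab: "a \<in> S" "b \<in> S" "x = f a" "y = f b" by auto
    have "dist x y \<le> L * dist a b" using ab lipschitz_onD[OF assms(1)] by auto
    also have "\<dots> \<le> L * diameter S"
      using ab assms(2) L by (intro mult_left_mono diameter_bounded_bound)
    finally show "norm (x - y) \<le> L * diameter S" by (simp add: dist_norm)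
  qed (use False in auto)
  then have "(diameter (f ` S) / 2) ^ k \<le> (L * (diameter S / 2)) ^ k"
    using diameter_ge_0[OF bounded_uniformly_continuous_image[OF lipschitz_on_uniformly_continuous[OF assms(1)] assms(2)]]
    by (intro power_mono) auto
  then have "(diameter (f ` S) / 2) ^ k \<le> L ^ k * (diameter S / 2) ^ k"
    by (simp only: power_mult_distrib)
  then show ?thesis using False L diameter_ge_0[OF assms(2)]
    by (simp add: hausdorff_weight_def ennreal_mult[symmetric] ennreal_leI mult_left_mono mult.left_commute)
qed simp

lemma hausdorff_outer_lipschitz_image:
  fixes f :: "'a::euclidean_space \<Rightarrow> 'b::euclidean_space"
  assumes f: "L-lipschitz_on S f" and "0 < L"
  shows "hausdorff_outer k (f ` S) \<le> ennreal (L ^ k) * hausdorff_outer k S"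
proof -
  have L: "0 \<le> L" using assms(1) by (rule lipschitz_on_nonneg)
  have "hausdorff_premeasure k \<delta> (f ` S) \<le> ennreal (L ^ k) * hausdorff_outer k S" if \<delta>: "\<delta> > 0" for \<delta>
  proof -
    \<comment> \<open>Chosen so that images of sets of diameter \<open>\<delta>'\<close> have
      diameter at most \<open>\<delta>\<close>.\<close>
    define \<delta>' where "\<delta>' = \<delta> / (L + 1)"
    have \<delta>': "0 < \<delta>'" "L * \<delta>' \<le> \<delta>" using L \<delta> by (auto simp: \<delta>'_def field_simps)
    have "hausdorff_premeasure k \<delta> (f ` S) \<le> ennreal (L ^ k) * hausdorff_premeasure k \<delta>' S"
    proof -
      have "hausdorff_premeasure k \<delta> (f ` S) \<le> ennreal (L ^ k) * (\<Sum>i. hausdorff_weight k (C i))"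
        if C: "S \<subseteq> \<Union> (range C)" "\<forall>i. bounded (C i) \<and> diameter (C i) \<le> \<delta>'" for C :: "nat \<Rightarrow> _"
      proof -
        \<comment> \<open>The covering sets are cut down to \<open>S\<close> before they are mapped,
          because \<open>f\<close> is Lipschitz only there.\<close>
        have fi: "L-lipschitz_on (S \<inter> C i) f" for i using f by (rule lipschitz_on_subset) auto
        have b: "bounded (S \<inter> C i)" for i using C(2) by (auto intro: bounded_subset)
        have dle: "diameter (S \<inter> C i) \<le> diameter (C i)" for i
          using C(2) by (intro diameter_subset) auto
        have "hausdorff_premeasure k \<delta> (f ` S) \<le> (\<Sum>i. hausdorff_weight k (f ` (S \<inter> C i)))"
        proof (rule hausdorff_premeasure_le)
          show "bounded (f ` (S \<inter> C i))" for i
            by (rule bounded_uniformly_continuous_image[OF lipschitz_on_uniformly_continuous[OF fi] b])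
          show "diameter (f ` (S \<inter> C i)) \<le> \<delta>" for i
          proof (rule diameter_le)
            fix x y assume "x \<in> f ` (S \<inter> C i)" "y \<in> f ` (S \<inter> C i)"
            then obtain u v where ab: "u \<in> S \<inter> C i" "v \<in> S \<inter> C i" "x = f u" "y = f v" by blast
            have "dist x y \<le> L * dist u v" using ab lipschitz_onD[OF fi] by auto
            also have "\<dots> \<le> L * \<delta>'"
              using diameter_bounded_bound[OF b ab(1,2)] dle[of i] C(2) L
              by (intro mult_left_mono) (auto intro: order_trans)
            also have "\<dots> \<le> \<delta>" by (rule \<delta>'(2))
            finally show "norm (x - y) \<le> \<delta>" by (simp add: dist_norm)
          qed (use \<delta> in auto)
          show "f ` S \<subseteq> (\<Union>i. f ` (S \<inter> C i))" using C(1) by blast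
        qed
        also have "\<dots> \<le> (\<Sum>i. ennreal (L ^ k) * hausdorff_weight k (C i))"
        proof (intro suminf_le)
          fix i
          have "hausdorff_weight k (f ` (S \<inter> C i)) \<le> ennreal (L ^ k) * hausdorff_weight k (S \<inter> C i)"
            by (rule hausdorff_weight_image_le[OF fi b])
          also have "hausdorff_weight k (S \<inter> C i) \<le> hausdorff_weight k (C i)"
            using dle[of i] diameter_ge_0[OF b[of i]]
            by (auto simp: hausdorff_weight_def intro!: ennreal_leI mult_left_mono power_mono)
          finally show "hausdorff_weight k (f ` (S \<inter> C i)) \<le> ennreal (L ^ k) * hausdorff_weight k (C i)"
            by (simp add: mult_left_mono)
        qed auto
        finally show ?thesis by simp
      qed
      \<comment> \<open>Dividing by the constant brings the estimate into the form of a lower bound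
        for each member of the infimum; \<open>0 < L\<close> allows the constant to be multiplied
        back.\<close>
      then have "hausdorff_premeasure k \<delta> (f ` S) / ennreal (L ^ k) \<le> hausdorff_premeasure k \<delta>' S"
        unfolding hausdorff_premeasure_def [of k \<delta>' S] using \<open>0 < L\<close>
        by (intro INF_greatest divide_le_posI_ennreal) (auto simp: mult.commute)
      then have "hausdorff_premeasure k \<delta> (f ` S) / ennreal (L ^ k) * ennreal (L ^ k)
          \<le> hausdorff_premeasure k \<delta>' S * ennreal (L ^ k)"
        by (rule mult_right_mono) simp
      then have "hausdorff_premeasure k \<delta> (f ` S) \<le> hausdorff_premeasure k \<delta>' S * ennreal (L ^ k)"
        using \<open>0 < L\<close> by (simp add: ennreal_divide_times)
      then show ?thesis by (simp add: mult.commute)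
    qed
    also have "\<dots> \<le> ennreal (L ^ k) * hausdorff_outer k S"
      using \<delta>' by (intro mult_left_mono hausdorff_premeasure_le_outer) auto
    finally show ?thesis .
  qed
  then show ?thesis unfolding hausdorff_outer_def [of k "f ` S"] by (intro SUP_least) auto
qed

section \<open>Slicing Lebesgue measure by parallel hyperplanes\<close>

definition perp_proj :: "'a::euclidean_space \<Rightarrow> 'a \<Rightarrow> 'a" where
  "perp_proj \<nu> x = x - (x \<bullet> \<nu>) *\<^sub>R \<nu>"

text \<open>
  The \<open>(d - 1)\<close>-dimensional Lebesgue measure on the hyperplane orthogonal to the unit vector \<open>\<nu>\<close>,
  as a measure on the ambient space: the base of a cylinder of height one has the volume of the
  cylinder.
\<close>

definition slice_measure :: "'a::euclidean_space \<Rightarrow> 'a measure" where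
  "slice_measure \<nu> =
     distr (density lborel (indicator {x. 0 \<le> x \<bullet> \<nu> \<and> x \<bullet> \<nu> \<le> 1})) borel (perp_proj \<nu>)"

lemma perp_proj_measurable [measurable]: "perp_proj \<nu> \<in> borel_measurable borel"
  unfolding perp_proj_def by measurable

lemma continuous_on_perp_proj: "continuous_on S (perp_proj \<nu>)"
  unfolding perp_proj_def by (intro continuous_intros)

lemma perp_proj_inner: "norm \<nu> = 1 \<Longrightarrow> perp_proj \<nu> x \<bullet> \<nu> = 0"
  by (simp add: perp_proj_def inner_diff_left norm_eq_1)

lemma perp_proj_add_scaleR: "norm \<nu> = 1 \<Longrightarrow> perp_proj \<nu> (x + t *\<^sub>R \<nu>) = perp_proj \<nu> x"
  by (simp add: perp_proj_def inner_add_left norm_eq_1 algebra_simps)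

lemma perp_proj_decomp: "perp_proj \<nu> x + (x \<bullet> \<nu>) *\<^sub>R \<nu> = x"
  by (simp add: perp_proj_def)

lemma perp_proj_id: "x \<bullet> \<nu> = 0 \<Longrightarrow> perp_proj \<nu> x = x"
  by (simp add: perp_proj_def)

lemma perp_proj_add: "perp_proj \<nu> (x + y) = perp_proj \<nu> x + perp_proj \<nu> y"
  by (simp add: perp_proj_def inner_add_left algebra_simps)

lemma perp_proj_scaleR: "perp_proj \<nu> (c *\<^sub>R x) = c *\<^sub>R perp_proj \<nu> x"
  by (simp add: perp_proj_def algebra_simps)

lemma norm_perp_proj_decomp:
  assumes "norm \<nu> = 1"
  shows "(norm x)\<^sup>2 = (norm (perp_proj \<nu> x))\<^sup>2 + (x \<bullet> \<nu>)\<^sup>2"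
  using assms unfolding power2_norm_eq_inner perp_proj_def
  by (simp add: inner_diff_left inner_diff_right norm_eq_1 power2_eq_square inner_commute)

lemma norm_perp_proj_le:
  assumes "norm \<nu> = 1"
  shows "norm (perp_proj \<nu> x) \<le> norm x"
proof (rule power2_le_imp_le)
  show "(norm (perp_proj \<nu> x))\<^sup>2 \<le> (norm x)\<^sup>2"
    unfolding norm_perp_proj_decomp[OF assms, of x] by simp
qed simp

lemma sets_slice_measure [measurable_cong, simp]: "sets (slice_measure \<nu>) = sets borel"
  by (simp add: slice_measure_def)

lemma space_slice_measure [simp]: "space (slice_measure \<nu>) = UNIV"
  by (simp add: slice_measure_def)

lemma emeasure_eq_nn_integral:
  assumes "A \<in> sets M" "\<And>x. f x = indicator A x"
  shows "emeasure M A = (\<integral>\<^sup>+x. f x \<partial>M)"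
  using assms by simp

lemma emeasure_slice_measure:
  assumes [measurable]: "A \<in> sets borel"
  shows "emeasure (slice_measure \<nu>) A = emeasure lborel {x. perp_proj \<nu> x \<in> A \<and> 0 \<le> x \<bullet> \<nu> \<and> x \<bullet> \<nu> \<le> 1}"
proof -
  have "emeasure (slice_measure \<nu>) A
      = emeasure (density lborel (indicator {x. 0 \<le> x \<bullet> \<nu> \<and> x \<bullet> \<nu> \<le> 1})) {x. perp_proj \<nu> x \<in> A}"
    unfolding slice_measure_def by (subst emeasure_distr) (auto simp: vimage_def)
  also have "\<dots> = emeasure lborel ({x. 0 \<le> x \<bullet> \<nu> \<and> x \<bullet> \<nu> \<le> 1} \<inter> {x. perp_proj \<nu> x \<in> A})"
    by (subst emeasure_density) (auto intro!: emeasure_eq_nn_integral[symmetric] simp: indicator_def)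
  also have "{x. 0 \<le> x \<bullet> \<nu> \<and> x \<bullet> \<nu> \<le> 1} \<inter> {x. perp_proj \<nu> x \<in> A}
      = {x. perp_proj \<nu> x \<in> A \<and> 0 \<le> x \<bullet> \<nu> \<and> x \<bullet> \<nu> \<le> 1}" by auto
  finally show ?thesis .
qed

lemma nn_integral_lborel_shift:
  fixes f :: "'a::euclidean_space \<Rightarrow> ennreal"
  assumes [measurable]: "f \<in> borel_measurable borel"
  shows "(\<integral>\<^sup>+x. f (x + c) \<partial>lborel) = (\<integral>\<^sup>+x. f x \<partial>lborel)"
proof -
  have "(\<integral>\<^sup>+x. f x \<partial>lborel) = (\<integral>\<^sup>+x. f x \<partial>distr lborel borel ((+) c))"
    by (simp add: lborel_distr_plus)
  also have "\<dots> = (\<integral>\<^sup>+x. f (x + c) \<partial>lborel)"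
    by (subst nn_integral_distr) (auto simp: add.commute)
  finally show ?thesis by simp
qed

lemma emeasure_lborel_shift:
  fixes A :: "'a::euclidean_space set"
  assumes [measurable]: "A \<in> sets borel"
  shows "emeasure lborel {x. x + c \<in> A} = emeasure lborel A"
proof -
  have "emeasure lborel {x. x + c \<in> A} = (\<integral>\<^sup>+x. indicator A (x + c) \<partial>lborel)"
    by (rule emeasure_eq_nn_integral) (auto simp: indicator_def)
  then show ?thesis by (simp add: nn_integral_lborel_shift)
qed

lemma emeasure_lborel_scale:
  fixes A :: "'a::euclidean_space set"
  assumes [measurable]: "A \<in> sets borel" and "0 < r"
  shows "emeasure lborel A = ennreal (r ^ DIM('a)) * emeasure lborel {x. r *\<^sub>R x \<in> A}"
proof -
  have "emeasure lborel A = emeasure (density (distr lborel borel (\<lambda>x. 0 + r *\<^sub>R x)) (\<lambda>_. ennreal (\<bar>r\<bar> ^ DIM('a)))) A"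
    using lborel_affine[of r "0::'a"] assms(2) by simp
  also have "\<dots> = ennreal (r ^ DIM('a)) * emeasure lborel {x. r *\<^sub>R x \<in> A}"
    using assms(2) by (simp add: emeasure_density nn_integral_cmult emeasure_distr vimage_def)
  finally show ?thesis .
qed

text \<open>
  The Haar uniqueness argument in direction \<open>\<nu>\<close>: insert the factor
  \<open>\<integral> 1[-1,0] (y - x \<bullet> \<nu>) dy = 1\<close>, exchange the integrals and shift \<open>x\<close> by \<open>y *\<^sub>R \<nu>\<close>.
\<close>

lemma emeasure_slice_product:
  fixes \<nu> :: "'a::euclidean_space"
  assumes \<nu>: "norm \<nu> = 1" and [measurable]: "A \<in> sets borel" "B \<in> sets borel"
  shows "emeasure lborel {x. perp_proj \<nu> x \<in> A \<and> x \<bullet> \<nu> \<in> B} = emeasure (slice_measure \<nu>) A * emeasure lborel B"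
proof -
  let ?I = "{-1..0::real}"
  have "emeasure lborel {x. perp_proj \<nu> x \<in> A \<and> x \<bullet> \<nu> \<in> B}
      = (\<integral>\<^sup>+x. indicator A (perp_proj \<nu> x) * indicator B (x \<bullet> \<nu>) \<partial>lborel)"
    by (rule emeasure_eq_nn_integral) (auto simp: indicator_def)
  also have "\<dots> = (\<integral>\<^sup>+x. (\<integral>\<^sup>+y. indicator A (perp_proj \<nu> x) * indicator B (x \<bullet> \<nu>) * indicator ?I (y - x \<bullet> \<nu>) \<partial>lborel) \<partial>lborel)"
  proof (rule nn_integral_cong)
    fix x
    have "(\<integral>\<^sup>+y. indicator ?I (y - x \<bullet> \<nu>) \<partial>lborel) = (1 :: ennreal)"
      using nn_integral_lborel_shift[of "indicator ?I" "- (x \<bullet> \<nu>)"] by simp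
    then show "indicator A (perp_proj \<nu> x) * indicator B (x \<bullet> \<nu>)
       = (\<integral>\<^sup>+y. indicator A (perp_proj \<nu> x) * indicator B (x \<bullet> \<nu>) * indicator ?I (y - x \<bullet> \<nu>) \<partial>lborel)"
      by (subst nn_integral_cmult) auto
  qed
  also have "\<dots> = (\<integral>\<^sup>+y. (\<integral>\<^sup>+x. indicator A (perp_proj \<nu> x) * indicator B (x \<bullet> \<nu>) * indicator ?I (y - x \<bullet> \<nu>) \<partial>lborel) \<partial>lborel)"
    by (rule lborel_pair.Fubini'[symmetric]) measurable
  also have "\<dots> = (\<integral>\<^sup>+y. (\<integral>\<^sup>+x. indicator A (perp_proj \<nu> x) * indicator B (x \<bullet> \<nu> + y) * indicator ?I (- (x \<bullet> \<nu>)) \<partial>lborel) \<partial>lborel)"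
  proof (rule nn_integral_cong)
    fix y :: real
    show "(\<integral>\<^sup>+x. indicator A (perp_proj \<nu> x) * indicator B (x \<bullet> \<nu>) * indicator ?I (y - x \<bullet> \<nu>) \<partial>lborel)
      = (\<integral>\<^sup>+x. indicator A (perp_proj \<nu> x) * indicator B (x \<bullet> \<nu> + y) * indicator ?I (- (x \<bullet> \<nu>)) \<partial>lborel)"
      using \<nu> by (subst nn_integral_lborel_shift[where c="y *\<^sub>R \<nu>", symmetric])
        (auto simp: perp_proj_add_scaleR inner_add_left norm_eq_1)
  qed
  also have "\<dots> = (\<integral>\<^sup>+x. (\<integral>\<^sup>+y. indicator A (perp_proj \<nu> x) * indicator B (x \<bullet> \<nu> + y) * indicator ?I (- (x \<bullet> \<nu>)) \<partial>lborel) \<partial>lborel)"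
    by (rule lborel_pair.Fubini') measurable
  also have "\<dots> = (\<integral>\<^sup>+x. indicator A (perp_proj \<nu> x) * indicator ?I (- (x \<bullet> \<nu>)) * emeasure lborel B \<partial>lborel)"
  proof (rule nn_integral_cong)
    fix x
    have "(\<integral>\<^sup>+y. indicator B (x \<bullet> \<nu> + y) \<partial>lborel) = emeasure lborel B"
      using nn_integral_lborel_shift[of "indicator B" "x \<bullet> \<nu>"] by (simp add: add.commute)
    then show "(\<integral>\<^sup>+y. indicator A (perp_proj \<nu> x) * indicator B (x \<bullet> \<nu> + y) * indicator ?I (- (x \<bullet> \<nu>)) \<partial>lborel)
       = indicator A (perp_proj \<nu> x) * indicator ?I (- (x \<bullet> \<nu>)) * emeasure lborel B"
      by (simp add: nn_integral_multc nn_integral_cmult mult_ac)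
  qed
  also have "\<dots> = (\<integral>\<^sup>+x. indicator {x. perp_proj \<nu> x \<in> A \<and> 0 \<le> x \<bullet> \<nu> \<and> x \<bullet> \<nu> \<le> 1} x \<partial>lborel) * emeasure lborel B"
    by (subst nn_integral_multc) (auto intro!: arg_cong2[where f="(*)"] emeasure_eq_nn_integral[symmetric] simp: indicator_def)
  also have "\<dots> = emeasure (slice_measure \<nu>) A * emeasure lborel B"
    by (simp add: emeasure_slice_measure)
  finally show ?thesis .
qed

lemma slice_measure_cball_finite:
  fixes \<nu> :: "'a::euclidean_space"
  assumes \<nu>: "norm \<nu> = 1"
  shows "emeasure (slice_measure \<nu>) (cball 0 r) < \<infinity>"
proof -
  have b: "bounded {x. perp_proj \<nu> x \<in> cball 0 r \<and> 0 \<le> x \<bullet> \<nu> \<and> x \<bullet> \<nu> \<le> 1}"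
  proof (rule boundedI[of _ "r + 1"], clarsimp)
    fix x assume x: "norm (perp_proj \<nu> x) \<le> r" "0 \<le> x \<bullet> \<nu>" "x \<bullet> \<nu> \<le> 1"
    have "norm (perp_proj \<nu> x + (x \<bullet> \<nu>) *\<^sub>R \<nu>) \<le> norm (perp_proj \<nu> x) + norm ((x \<bullet> \<nu>) *\<^sub>R \<nu>)"
      by (rule norm_triangle_ineq)
    then show "norm x \<le> r + 1" using x \<nu> by (simp add: perp_proj_decomp)
  qed
  have "cball (0::'a) r \<in> sets borel" by simp
  then show ?thesis using emeasure_bounded_finite[OF b] by (simp only: emeasure_slice_measure)
qed

lemma sigma_finite_slice_measure:
  assumes \<nu>: "norm \<nu> = 1"
  shows "sigma_finite_measure (slice_measure \<nu>)"
proof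
  show "\<exists>A. countable A \<and> A \<subseteq> sets (slice_measure \<nu>) \<and> \<Union> A = space (slice_measure \<nu>)
      \<and> (\<forall>a\<in>A. emeasure (slice_measure \<nu>) a \<noteq> \<infinity>)"
    using slice_measure_cball_finite[OF \<nu>]
    by (intro exI[of _ "range (\<lambda>n::nat. cball 0 (real n))"])
       (auto simp: less_top real_arch_simple)
qed

lemma slice_pair_measure:
  assumes \<nu>: "norm \<nu> = 1"
  shows "slice_measure \<nu> \<Otimes>\<^sub>M lborel = distr lborel (borel \<Otimes>\<^sub>M borel) (\<lambda>x. (perp_proj \<nu> x, x \<bullet> \<nu>))"
proof (rule pair_measure_eqI)
  show "sigma_finite_measure (slice_measure \<nu>)" by (rule sigma_finite_slice_measure[OF \<nu>])
  show "sigma_finite_measure (lborel :: real measure)" by (rule lborel.sigma_finite_measure_axioms)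
  show "sets (slice_measure \<nu> \<Otimes>\<^sub>M (lborel::real measure)) = sets (distr lborel (borel \<Otimes>\<^sub>M borel) (\<lambda>x. (perp_proj \<nu> x, x \<bullet> \<nu>)))"
    by (simp cong: sets_pair_measure_cong)
  fix A and B :: "real set" assume "A \<in> sets (slice_measure \<nu>)" "B \<in> sets lborel"
  then have [measurable]: "A \<in> sets borel" "B \<in> sets borel" by auto
  show "emeasure (slice_measure \<nu>) A * emeasure lborel B
      = emeasure (distr lborel (borel \<Otimes>\<^sub>M borel) (\<lambda>x. (perp_proj \<nu> x, x \<bullet> \<nu>))) (A \<times> B)"
    by (subst emeasure_distr) (auto simp: emeasure_slice_product[OF \<nu>, symmetric] vimage_def)
qed

text \<open>Fubini for the splitting into a hyperplane and its normal line. Lines inside serve for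
  integrating derivatives and for measuring cylinders, hyperplanes inside for cutting balls and
  covers at a fixed height.\<close>

lemma nn_integral_slice:
  fixes f :: "'a::euclidean_space \<Rightarrow> ennreal"
  assumes \<nu>: "norm \<nu> = 1" and [measurable]: "f \<in> borel_measurable borel"
  shows "(\<integral>\<^sup>+x. f x \<partial>lborel) = (\<integral>\<^sup>+y. \<integral>\<^sup>+t. f (y + t *\<^sub>R \<nu>) \<partial>lborel \<partial>slice_measure \<nu>)" (is ?A)
    and "(\<integral>\<^sup>+x. f x \<partial>lborel) = (\<integral>\<^sup>+t. \<integral>\<^sup>+y. f (y + t *\<^sub>R \<nu>) \<partial>slice_measure \<nu> \<partial>lborel)" (is ?B)
proof -
  interpret S: sigma_finite_measure "slice_measure \<nu>" by (rule sigma_finite_slice_measure[OF \<nu>])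
  interpret pair_sigma_finite "slice_measure \<nu>" "lborel :: real measure" ..
  have [measurable]: "(\<lambda>(y, t). f (y + t *\<^sub>R \<nu>)) \<in> borel_measurable (slice_measure \<nu> \<Otimes>\<^sub>M lborel)"
    by (subst measurable_cong_sets[OF sets_pair_measure_cong[of _ borel _ borel] refl]) auto
  have m2: "(\<lambda>x. f (fst x + snd x *\<^sub>R \<nu>)) \<in> borel_measurable (borel \<Otimes>\<^sub>M borel)" by measurable
  have "(\<integral>\<^sup>+x. f x \<partial>lborel) = (\<integral>\<^sup>+z. f (fst z + snd z *\<^sub>R \<nu>) \<partial>(slice_measure \<nu> \<Otimes>\<^sub>M lborel))"
    unfolding slice_pair_measure[OF \<nu>]
    by (subst nn_integral_distr) (use m2 in \<open>auto simp: perp_proj_decomp\<close>)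
  also have "\<dots> = (\<integral>\<^sup>+(y, t). f (y + t *\<^sub>R \<nu>) \<partial>(slice_measure \<nu> \<Otimes>\<^sub>M lborel))"
    by (simp add: case_prod_unfold)
  finally have *: "(\<integral>\<^sup>+x. f x \<partial>lborel) = (\<integral>\<^sup>+(y, t). f (y + t *\<^sub>R \<nu>) \<partial>(slice_measure \<nu> \<Otimes>\<^sub>M lborel))" .
  show ?A unfolding * by (subst lborel.nn_integral_fst[symmetric]) auto
  show ?B unfolding * by (subst nn_integral_snd[symmetric]) auto
qed

lemma integral_slice:
  fixes f :: "'a::euclidean_space \<Rightarrow> real"
  assumes \<nu>: "norm \<nu> = 1" and f: "integrable lborel f"
  shows "(LINT x|lborel. f x) = (LINT y|slice_measure \<nu>. LINT t|lborel. f (y + t *\<^sub>R \<nu>))"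
proof -
  interpret S: sigma_finite_measure "slice_measure \<nu>" by (rule sigma_finite_slice_measure[OF \<nu>])
  interpret pair_sigma_finite "slice_measure \<nu>" "lborel :: real measure" ..
  have [measurable]: "f \<in> borel_measurable borel" using f by auto
  have m: "(\<lambda>x. f (fst x + snd x *\<^sub>R \<nu>)) \<in> borel_measurable (borel \<Otimes>\<^sub>M borel)" by measurable
  have "integrable (slice_measure \<nu> \<Otimes>\<^sub>M lborel) (\<lambda>x. f (fst x + snd x *\<^sub>R \<nu>))"
    unfolding slice_pair_measure[OF \<nu>] using f
    by (subst integrable_distr_eq[OF _ m]) (auto simp: perp_proj_decomp)
  then have i: "integrable (slice_measure \<nu> \<Otimes>\<^sub>M lborel) (\<lambda>(y, t). f (y + t *\<^sub>R \<nu>))"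
    by (simp add: case_prod_unfold)
  have "(LINT x|lborel. f x) = (LINT z|(slice_measure \<nu> \<Otimes>\<^sub>M lborel). f (fst z + snd z *\<^sub>R \<nu>))"
    unfolding slice_pair_measure[OF \<nu>]
    by (subst integral_distr[OF _ m]) (auto simp: perp_proj_decomp)
  then show ?thesis using integral_fst[OF i] by (simp add: case_prod_unfold)
qed

lemma slice_measure_AE_perp:
  assumes \<nu>: "norm \<nu> = 1"
  shows "AE y in slice_measure \<nu>. y \<bullet> \<nu> = 0"
proof (rule AE_I)
  show "emeasure (slice_measure \<nu>) {y. y \<bullet> \<nu> \<noteq> 0} = 0"
    using \<nu> by (subst emeasure_slice_measure) (auto simp: perp_proj_inner)
  show "{y. y \<bullet> \<nu> \<noteq> 0} \<in> sets (slice_measure \<nu>)" by simp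
qed auto

section \<open>Invariance and normalisation of the slice measure\<close>

lemma slice_measure_shift:
  assumes \<nu>: "norm \<nu> = 1" and v: "v \<bullet> \<nu> = 0" and [measurable]: "A \<in> sets borel"
  shows "emeasure (slice_measure \<nu>) {y. y + v \<in> A} = emeasure (slice_measure \<nu>) A"
proof -
  have "{x. perp_proj \<nu> x \<in> {y. y + v \<in> A} \<and> 0 \<le> x \<bullet> \<nu> \<and> x \<bullet> \<nu> \<le> 1}
     = {x. x + v \<in> {x. perp_proj \<nu> x \<in> A \<and> 0 \<le> x \<bullet> \<nu> \<and> x \<bullet> \<nu> \<le> 1}}"
    using v by (auto simp: perp_proj_add perp_proj_id inner_add_left)
  moreover have "{x. perp_proj \<nu> x \<in> A \<and> 0 \<le> x \<bullet> \<nu> \<and> x \<bullet> \<nu> \<le> 1} \<in> sets borel" by measurable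
  moreover have "{y. y + v \<in> A} \<in> sets borel" by measurable
  ultimately show ?thesis
    using emeasure_lborel_shift by (simp only: emeasure_slice_measure assms)
qed

text \<open>Rescaling a cylinder of height one by \<open>r\<close> gives one of height
  \<open>1 / r\<close> over the unit ball; this height accounts for the exponent being one less than
  the dimension.\<close>

lemma slice_measure_cball_scale:
  fixes \<nu> :: "'a::euclidean_space"
  assumes \<nu>: "norm \<nu> = 1" and r: "0 < r"
  shows "emeasure (slice_measure \<nu>) (cball 0 r) = ennreal (r ^ (DIM('a) - 1)) * emeasure (slice_measure \<nu>) (cball 0 1)"
proof -
  let ?X = "{x. perp_proj \<nu> x \<in> cball 0 r \<and> 0 \<le> x \<bullet> \<nu> \<and> x \<bullet> \<nu> \<le> 1}"
  have [measurable]: "cball (0::'a) r \<in> sets borel" by simp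
  have "emeasure (slice_measure \<nu>) (cball 0 r) = emeasure lborel ?X" by (simp add: emeasure_slice_measure)
  also have "\<dots> = ennreal (r ^ DIM('a)) * emeasure lborel {x. r *\<^sub>R x \<in> ?X}"
    by (rule emeasure_lborel_scale[OF _ r]) measurable
  also have "{x. r *\<^sub>R x \<in> ?X} = {x. perp_proj \<nu> x \<in> cball 0 1 \<and> x \<bullet> \<nu> \<in> {0..1/r}}"
    using r by (auto simp: perp_proj_scaleR field_simps zero_le_mult_iff)
  also have "emeasure lborel \<dots> = emeasure (slice_measure \<nu>) (cball 0 1) * ennreal (1 / r)"
    using r by (subst emeasure_slice_product[OF \<nu>]) auto
  also have "ennreal (r ^ DIM('a)) * (emeasure (slice_measure \<nu>) (cball 0 1) * ennreal (1 / r))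
      = ennreal (r ^ DIM('a) * (1 / r)) * emeasure (slice_measure \<nu>) (cball 0 1)"
    using r by (subst ennreal_mult) (auto simp: mult_ac)
  also have "r ^ DIM('a) * (1 / r) = r ^ (DIM('a) - 1)"
    using r by (simp add: power_diff)
  finally show ?thesis .
qed

text \<open>The Beta factor is the integral of \<open>sqrt (1 - t\<^sup>2) ^ n\<close> over [-1,1],
  as it arises on slicing a ball.\<close>

lemma unit_ball_vol_Suc:
  "unit_ball_vol (real (Suc n)) = unit_ball_vol (real n) * Beta (1/2) (real n / 2 + 1)"
  by (auto simp: unit_ball_vol_def Beta_def Gamma_eq_zero_iff field_simps
        Gamma_one_half_real powr_half_sqrt [symmetric] powr_add [symmetric])

text \<open>The unit ball of the whole space is sliced: the section at height \<open>t\<close> is a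
  ball of radius \<open>sqrt (1 - t\<^sup>2)\<close>, whose measure is the unknown \<open>?m\<close>
  times a power of that radius. Integration over \<open>t\<close> produces the Beta factor linking
  consecutive ball volumes, which determines \<open>?m\<close>.\<close>

lemma slice_measure_unit_cball:
  fixes \<nu> :: "'a::euclidean_space"
  assumes \<nu>: "norm \<nu> = 1"
  shows "emeasure (slice_measure \<nu>) (cball 0 1) = ennreal (unit_ball_vol (real (DIM('a) - 1)))"
proof -
  define k where "k = DIM('a) - 1"
  have k: "DIM('a) = Suc k" by (simp add: k_def)
  let ?m = "emeasure (slice_measure \<nu>) (cball 0 1)" and ?b = "Beta (1 / 2) (real k / 2 + 1)"
  have "ennreal (unit_ball_vol (real (Suc k))) = emeasure lborel (cball (0::'a) 1)"
    using emeasure_cball[of 1 "0::'a"] by (simp add: k)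
  also have "\<dots> = (\<integral>\<^sup>+x. indicator (cball (0::'a) 1) x \<partial>lborel)" by simp
  also have "\<dots> = (\<integral>\<^sup>+t. \<integral>\<^sup>+y. indicator (cball 0 1) (y + t *\<^sub>R \<nu>) \<partial>slice_measure \<nu> \<partial>lborel)"
    by (rule nn_integral_slice[OF \<nu>]) (intro borel_measurable_indicator, simp)
  also have "\<dots> = (\<integral>\<^sup>+t. ?m * ennreal (indicator {-1..1} t * sqrt (1 - t\<^sup>2) ^ k) \<partial>lborel)"
  proof (rule nn_integral_cong_AE)
    \<comment> \<open>At these two heights the section has radius zero, where the scaling lemma does
      not apply.\<close>
    have "AE t in lborel. t \<notin> {-1,1::real}"
      by (intro AE_not_in countable_imp_null_set_lborel) auto
    then show "AE t in lborel. (\<integral>\<^sup>+y. indicator (cball 0 1) (y + t *\<^sub>R \<nu>) \<partial>slice_measure \<nu>)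
        = ?m * ennreal (indicator {-1..1} t * sqrt (1 - t\<^sup>2) ^ k)"
    proof eventually_elim
      case (elim t)
      have n: "(norm (y + t *\<^sub>R \<nu>))\<^sup>2 = (norm y)\<^sup>2 + t\<^sup>2" if "y \<bullet> \<nu> = 0" for y
        using \<nu> that unfolding power2_norm_eq_inner
        by (simp add: inner_add_left inner_add_right norm_eq_1 inner_commute power2_eq_square)
      show ?case
      proof (cases "\<bar>t\<bar> < 1")
        case True
        then have t: "t\<^sup>2 < 1" by (simp add: abs_square_less_1)
        have "(\<integral>\<^sup>+y. indicator (cball 0 1) (y + t *\<^sub>R \<nu>) \<partial>slice_measure \<nu>)
            = (\<integral>\<^sup>+y. indicator (cball 0 (sqrt (1 - t\<^sup>2))) y \<partial>slice_measure \<nu>)"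
        proof (rule nn_integral_cong_AE)
          show "AE y in slice_measure \<nu>. indicator (cball 0 1) (y + t *\<^sub>R \<nu>)
              = (indicator (cball 0 (sqrt (1 - t\<^sup>2))) y :: ennreal)"
            using slice_measure_AE_perp[OF \<nu>]
          proof eventually_elim
            case (elim y)
            have "norm (y + t *\<^sub>R \<nu>) \<le> 1 \<longleftrightarrow> (norm (y + t *\<^sub>R \<nu>))\<^sup>2 \<le> 1"
              by (simp add: abs_square_le_1)
            also have "\<dots> \<longleftrightarrow> (norm y)\<^sup>2 \<le> 1 - t\<^sup>2" using n[OF elim] by auto
            also have "\<dots> \<longleftrightarrow> norm y \<le> sqrt (1 - t\<^sup>2)"
              using t by (metis norm_ge_zero real_le_rsqrt real_sqrt_le_iff real_sqrt_unique)
            finally show ?case by (simp add: indicator_def)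
          qed
        qed
        also have "\<dots> = emeasure (slice_measure \<nu>) (cball 0 (sqrt (1 - t\<^sup>2)))" by simp
        also have "\<dots> = ennreal (sqrt (1 - t\<^sup>2) ^ k) * ?m"
          using t by (subst slice_measure_cball_scale[OF \<nu>]) (auto simp: k)
        finally show ?thesis using True by (simp add: mult.commute indicator_def abs_less_iff)
      next
        case False
        then have "\<bar>t\<bar> > 1" using elim by auto
        then have t: "t\<^sup>2 > 1" "t \<notin> {-1..1}" using abs_square_le_1[of t] by (auto simp: not_le[symmetric])
        have "(\<integral>\<^sup>+y. indicator (cball 0 1) (y + t *\<^sub>R \<nu>) \<partial>slice_measure \<nu>) = (\<integral>\<^sup>+y. 0 \<partial>slice_measure \<nu>)"
        proof (rule nn_integral_cong_AE)
          show "AE y in slice_measure \<nu>. indicator (cball 0 1) (y + t *\<^sub>R \<nu>) = (0 :: ennreal)"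
            using slice_measure_AE_perp[OF \<nu>]
          proof eventually_elim
            case (elim y)
            have "(norm (y + t *\<^sub>R \<nu>))\<^sup>2 > 1" using n[OF elim] t(1) by (smt (verit) zero_le_power2)
            then have "\<not> norm (y + t *\<^sub>R \<nu>) \<le> 1" by (smt (verit) norm_ge_zero power_le_one)
            then show ?case by simp
          qed
        qed
        then show ?thesis using t by simp
      qed
    qed
  qed
  also have "\<dots> = ?m * ennreal ?b"
    by (subst nn_integral_cmult) (auto simp: emeasure_cball_aux_integral)
  finally have *: "ennreal (unit_ball_vol (real (Suc k))) = ?m * ennreal ?b" .
  have b: "?b > 0" by (simp add: Beta_def)
  obtain m where m: "?m = ennreal m" "m \<ge> 0"
    using slice_measure_cball_finite[OF \<nu>, of 1] by (cases ?m) auto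
  have "unit_ball_vol (real (Suc k)) = m * ?b"
    using * b m by (simp add: ennreal_mult[symmetric])
  then have "m = unit_ball_vol (real k)" using b unfolding unit_ball_vol_Suc by simp
  then show ?thesis using m k by simp
qed

lemma slice_measure_cball:
  fixes \<nu> :: "'a::euclidean_space"
  assumes \<nu>: "norm \<nu> = 1" and c: "c \<bullet> \<nu> = 0" and r: "0 \<le> r"
  shows "emeasure (slice_measure \<nu>) (cball c r) = ennreal (unit_ball_vol (real (DIM('a) - 1)) * r ^ (DIM('a) - 1))"
proof -
  let ?k = "DIM('a) - 1"
  have pos: "emeasure (slice_measure \<nu>) (cball 0 s) = ennreal (unit_ball_vol (real ?k) * s ^ ?k)" if "0 < s" for s
    using slice_measure_cball_scale[OF \<nu> that] slice_measure_unit_cball[OF \<nu>] that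
    by (simp add: ennreal_mult mult.commute)
  have "emeasure (slice_measure \<nu>) (cball 0 r) = ennreal (unit_ball_vol (real ?k) * r ^ ?k)"
  \<comment> \<open>Here the value is \<open>0 ^ ?k\<close>, which equals 1 in dimension one, where
    the slice measure has an atom. It is found as the limit over shrinking balls.\<close>
  proof (cases "r = 0")
    case True
    have "(\<lambda>n. emeasure (slice_measure \<nu>) (cball 0 (1 / Suc n))) \<longlonglongrightarrow> emeasure (slice_measure \<nu>) (\<Inter>n. cball 0 (1 / Suc n))"
    proof (rule Lim_emeasure_decseq)
      show "decseq (\<lambda>n. cball (0::'a) (1 / Suc n))"
        by (intro decseq_SucI subset_cball frac_le) auto
      show "emeasure (slice_measure \<nu>) (cball 0 (1 / Suc i)) \<noteq> \<infinity>" for i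
        using slice_measure_cball_finite[OF \<nu>, of "1 / Suc i"] by simp
    qed auto
    then have lim: "(\<lambda>n. ennreal (unit_ball_vol (real ?k) * (1 / Suc n) ^ ?k)) \<longlonglongrightarrow> emeasure (slice_measure \<nu>) (\<Inter>n. cball 0 (1 / Suc n))"
      by (simp only: pos zero_less_divide_1_iff of_nat_0_less_iff zero_less_Suc)
    have "(\<Inter>n. cball (0::'a) (1 / Suc n)) = {0}"
    proof -
      have "x = 0" if "\<And>n. norm x \<le> 1 / Suc n" for x :: 'a
      proof (rule ccontr)
        assume "x \<noteq> 0"
        then obtain n where "1 / Suc n < norm x" using nat_approx_posE zero_less_norm_iff by blast
        with that[of n] show False by linarith
      qed
      then show ?thesis by auto
    qed
    moreover have "(\<lambda>n. ennreal (unit_ball_vol (real ?k) * (1 / Suc n) ^ ?k)) \<longlonglongrightarrow> ennreal (unit_ball_vol (real ?k) * 0 ^ ?k)"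
      by (intro tendsto_ennrealI tendsto_mult tendsto_power tendsto_const) (rule LIMSEQ_Suc[OF lim_1_over_n])
    ultimately show ?thesis using LIMSEQ_unique[OF lim] True by (metis cball_trivial)
  qed (use pos r in auto)
  moreover have "{y. y + c \<in> cball c r} = cball 0 r" by (auto simp: dist_norm)
  ultimately show ?thesis using slice_measure_shift[OF \<nu> c, of "cball c r"] by simp
qed

section \<open>The isodiametric inequality\<close>

text \<open>Half the Minkowski sum. With it Brunn-Minkowski takes the multiplicative form |A| |B|
  \<le> |(A + B)/2|^2, free of roots depending on the dimension. The shape as a scaled image of sums
  fits the rules on openness and boundedness.\<close>

definition midpoints :: "'a::real_normed_vector set \<Rightarrow> 'a set \<Rightarrow> 'a set" where
  "midpoints A B = (\<lambda>x. (1 / 2) *\<^sub>R x) ` (\<Union>a\<in>A. \<Union>b\<in>B. {a + b})"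

lemma mem_midpoints: "z \<in> midpoints A B \<longleftrightarrow> (\<exists>a\<in>A. \<exists>b\<in>B. z = (1 / 2) *\<^sub>R (a + b))"
  unfolding midpoints_def by blast

lemma open_midpoints: "open A \<Longrightarrow> open (midpoints A B)"
  unfolding midpoints_def by (intro open_scaling open_sums) auto

lemma midpoints_mono: "A \<subseteq> A' \<Longrightarrow> B \<subseteq> B' \<Longrightarrow> midpoints A B \<subseteq> midpoints A' B'"
  unfolding midpoints_def by (intro image_mono UN_mono) auto

lemma midpoints_commute: "midpoints A B = midpoints B A"
  unfolding midpoints_def by (rule arg_cong[where f="image _"]) (auto simp: add.commute)

lemma bounded_midpoints:
  assumes "bounded A" "bounded B"
  shows "bounded (midpoints A B)"
proof -
  have "(\<Union>a\<in>A. \<Union>b\<in>B. {a + b}) = {x + y |x y. x \<in> A \<and> y \<in> B}" by auto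
  then show ?thesis unfolding midpoints_def
    using bounded_plus[OF assms] by (intro bounded_scaling) (simp add: image_def case_prod_beta, auto elim!: bounded_subset)
qed

text \<open>Members are nonempty, so that every nonempty family has positive volume and the
  cardinality counts genuine boxes.\<close>

definition box_family :: "'a::euclidean_space set set \<Rightarrow> bool" where
  "box_family \<A> \<longleftrightarrow> finite \<A> \<and> disjoint \<A> \<and> (\<forall>A\<in>\<A>. A \<noteq> {} \<and> (\<exists>a b. A = box a b))"

lemma box_family_open: "box_family \<A> \<Longrightarrow> open (\<Union>\<A>)"
  unfolding box_family_def by (intro open_Union) (metis open_box)

lemma box_family_bounded: "box_family \<A> \<Longrightarrow> bounded (\<Union>\<A>)"
  unfolding box_family_def by (intro bounded_Union) (metis bounded_box)+

lemma box_inter_halfspaces: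
  fixes a b :: "'a::euclidean_space"
  assumes "i \<in> Basis"
  shows "\<exists>b'. box a b \<inter> {x. x \<bullet> i < c} = box a b'" "\<exists>a'. box a b \<inter> {x. x \<bullet> i > c} = box a' b"
proof -
  show "\<exists>b'. box a b \<inter> {x. x \<bullet> i < c} = box a b'"
    using assms by (intro exI[of _ "\<Sum>j\<in>Basis. (if j = i then min (b \<bullet> j) c else b \<bullet> j) *\<^sub>R j"])
      (auto simp: box_def)
  show "\<exists>a'. box a b \<inter> {x. x \<bullet> i > c} = box a' b"
    using assms by (intro exI[of _ "\<Sum>j\<in>Basis. (if j = i then max (a \<bullet> j) c else a \<bullet> j) *\<^sub>R j"])
      (auto simp: box_def)
qed

text \<open>A box cut by a coordinate half-space is a box or empty. The strict drop of the count
  when one box is missed altogether drives the induction on the number of boxes.\<close>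

lemma box_family_halfspace:
  fixes \<A> :: "'a::euclidean_space set set"
  assumes \<A>: "box_family \<A>" and i: "i \<in> Basis" and H: "H = {x. x \<bullet> i < c} \<or> H = {x. x \<bullet> i > c}"
  shows "\<exists>\<A>'. box_family \<A>' \<and> \<Union>\<A>' = \<Union>\<A> \<inter> H \<and> card \<A>' \<le> card \<A>
    \<and> ((\<exists>A\<in>\<A>. A \<inter> H = {}) \<longrightarrow> card \<A>' < card \<A>)"
proof -
  define \<A>' where "\<A>' = (\<lambda>A. A \<inter> H) ` {A\<in>\<A>. A \<inter> H \<noteq> {}}"
  have fin: "finite \<A>" using \<A> by (auto simp: box_family_def)
  have "box_family \<A>'"
    unfolding box_family_def
  proof (intro conjI ballI)
    show "finite \<A>'" using fin by (auto simp: \<A>'_def)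
    show "disjoint \<A>'"
      using \<A> unfolding box_family_def \<A>'_def pairwise_def disjnt_def by blast
    fix X assume "X \<in> \<A>'"
    then obtain A where A: "A \<in> \<A>" "A \<inter> H \<noteq> {}" "X = A \<inter> H" by (auto simp: \<A>'_def)
    then show "X \<noteq> {}" by simp
    obtain a b where "A = box a b" using A \<A> unfolding box_family_def by metis
    then show "\<exists>a b. X = box a b" using A(3) H box_inter_halfspaces[OF i, of a b c] by auto
  qed
  moreover have "\<Union>\<A>' = \<Union>\<A> \<inter> H" by (auto simp: \<A>'_def)
  moreover have c: "card \<A>' \<le> card {A\<in>\<A>. A \<inter> H \<noteq> {}}"
    unfolding \<A>'_def using fin by (intro card_image_le) auto
  moreover have "card {A\<in>\<A>. A \<inter> H \<noteq> {}} \<le> card \<A>" using fin by (intro card_mono) auto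
  moreover have "card {A\<in>\<A>. A \<inter> H \<noteq> {}} < card \<A>" if "\<exists>A\<in>\<A>. A \<inter> H = {}"
    using fin that by (intro psubset_card_mono) auto
  ultimately show ?thesis
    by (intro exI[of _ \<A>'] conjI impI) (blast intro: order_trans le_less_trans)+
qed

lemma measure_split_halfspace:
  fixes X :: "'a::euclidean_space set"
  assumes X: "open X" "bounded X" and i: "i \<in> Basis"
  shows "measure lborel X = measure lborel (X \<inter> {x. x \<bullet> i < c}) + measure lborel (X \<inter> {x. x \<bullet> i > c})"
proof -
  have [measurable]: "X \<in> sets borel" using X by simp
  have "negligible {x. i \<bullet> x = c}" using i by (intro negligible_hyperplane) auto
  then have n: "emeasure lborel {x. x \<bullet> i = c} = 0"
    by (simp add: negligible_iff_null_sets null_sets_completion_iff null_sets_def inner_commute)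
  have "AE x in lborel. x \<notin> {x. x \<bullet> i = c}"
    using n by (intro AE_not_in) (auto simp: null_sets_def)
  then have "emeasure lborel X = emeasure lborel ((X \<inter> {x. x \<bullet> i < c}) \<union> (X \<inter> {x. x \<bullet> i > c}))"
    by (intro emeasure_eq_AE) auto
  also have "\<dots> = emeasure lborel (X \<inter> {x. x \<bullet> i < c}) + emeasure lborel (X \<inter> {x. x \<bullet> i > c})"
    by (rule plus_emeasure[symmetric]) auto
  finally have e: "emeasure lborel X = emeasure lborel (X \<inter> {x. x \<bullet> i < c}) + emeasure lborel (X \<inter> {x. x \<bullet> i > c})" .
  have "emeasure lborel (X \<inter> H) \<noteq> \<infinity>" for H
    using emeasure_bounded_finite[of "X \<inter> H"] X by (auto simp: bounded_Int)
  then show ?thesis unfolding measure_def e by (intro enn2real_plus) (auto simp: less_top)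
qed

text \<open>The volume below level \<open>c\<close> is Lipschitz in \<open>c\<close>: the part
  between two levels fits into a cylinder over a ball of radius \<open>R\<close>, whose base has
  measure \<open>m\<close>. The intermediate value theorem then finds every ratio.\<close>

lemma measure_below_continuous:
  fixes X :: "'a::euclidean_space set"
  assumes X: "open X" "bounded X" and i: "i \<in> Basis" and \<tau>: "0 \<le> \<tau>" "\<tau> \<le> 1"
  shows "\<exists>c. measure lborel (X \<inter> {x. x \<bullet> i < c}) = \<tau> * measure lborel X"
proof -
  have [measurable]: "X \<in> sets borel" using X by simp
  obtain R where R: "R > 0" "\<And>x. x \<in> X \<Longrightarrow> norm x \<le> R" using X(2) bounded_pos by blast
  define g where "g c = measure lborel (X \<inter> {x. x \<bullet> i < c})" for c
  have ni: "norm i = 1" using i by simp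
  obtain m where m: "emeasure (slice_measure i) (cball 0 R) = ennreal m" "m \<ge> 0"
    using slice_measure_cball_finite[OF ni, of R] by (cases "emeasure (slice_measure i) (cball 0 R)") auto
  have fin: "emeasure lborel (X \<inter> H) \<noteq> \<infinity>" for H
    using emeasure_bounded_finite[of "X \<inter> H"] X by (auto simp: bounded_Int)
  have [measurable]: "cball (0::'a) R \<in> sets borel" by simp
  have lip: "g c \<le> g c' \<and> g c' \<le> g c + m * (c' - c)" if "c \<le> c'" for c c'
  proof -
    have "emeasure lborel (X \<inter> {x. x \<bullet> i < c'})
        = emeasure lborel (X \<inter> {x. x \<bullet> i < c}) + emeasure lborel (X \<inter> {x. x \<bullet> i \<in> {c..<c'}})"
      using that by (subst plus_emeasure) (auto intro!: arg_cong[where f="emeasure lborel"])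
    then have gg: "g c' = g c + measure lborel (X \<inter> {x. x \<bullet> i \<in> {c..<c'}})"
      unfolding g_def measure_def using fin by (auto simp: enn2real_plus less_top)
    have "emeasure lborel (X \<inter> {x. x \<bullet> i \<in> {c..<c'}}) \<le> emeasure lborel {x. perp_proj i x \<in> cball 0 R \<and> x \<bullet> i \<in> {c..<c'}}"
      using R norm_perp_proj_le[OF ni] by (intro emeasure_mono) (auto intro: order_trans)
    also have "\<dots> = ennreal (m * (c' - c))"
      using that m by (subst emeasure_slice_product[OF ni]) (auto simp: ennreal_mult)
    finally have "measure lborel (X \<inter> {x. x \<bullet> i \<in> {c..<c'}}) \<le> m * (c' - c)"
      unfolding measure_def using m that by (intro enn2real_leI) auto
    then show ?thesis using gg by simp
  qed
  have "dist (g x) (g y) \<le> m * dist x y" for x y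
    using lip[of x y] lip[of y x] by (cases "x \<le> y") (auto simp: dist_real_def algebra_simps)
  then have "m-lipschitz_on UNIV g" using m by (intro lipschitz_onI) auto
  then have cont: "continuous_on UNIV g" by (rule lipschitz_on_continuous_on)
  have xi: "\<bar>x \<bullet> i\<bar> \<le> R" if "x \<in> X" for x
    using R(2)[OF that] Basis_le_norm[OF i, of x] by linarith
  have "X \<inter> {x. x \<bullet> i < - R - 1} = {}" "X \<inter> {x. x \<bullet> i < R + 1} = X"
    using xi by fastforce+
  then have "g (- R - 1) = 0" "g (R + 1) = measure lborel X" by (auto simp: g_def)
  moreover have "0 \<le> \<tau> * measure lborel X" "\<tau> * measure lborel X \<le> measure lborel X"
    using \<tau> by (auto simp: mult_left_le_one_le)
  ultimately have "\<exists>c\<ge>- R - 1. c \<le> R + 1 \<and> g c = \<tau> * measure lborel X"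
    using R(1) by (intro IVT') (auto intro: continuous_on_subset[OF cont])
  then show ?thesis by (auto simp: g_def)
qed

text \<open>The midpoints contain the box with averaged corners, so its side lengths are averages
  and the inequality of arithmetic and geometric means applies in each coordinate.\<close>

lemma box_midpoint_measure:
  fixes a b c d :: "'a::euclidean_space"
  assumes "box a b \<noteq> {}" "box c d \<noteq> {}"
  shows "measure lborel (box a b) * measure lborel (box c d) \<le> (measure lborel (midpoints (box a b) (box c d)))\<^sup>2"
proof -
  have lt: "a \<bullet> i < b \<bullet> i" "c \<bullet> i < d \<bullet> i" if "i \<in> Basis" for i
    using assms that by (auto simp: box_ne_empty)
  let ?l = "(1/2) *\<^sub>R (a + c)" and ?u = "(1/2) *\<^sub>R (b + d)"
  have lu: "?l \<bullet> i < ?u \<bullet> i" if "i \<in> Basis" for i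
    using lt[OF that] by (simp add: inner_add_left)
  have "box ?l ?u \<subseteq> midpoints (box a b) (box c d)"
  proof
    fix x assume x: "x \<in> box ?l ?u"
    \<comment> \<open>The relative position of \<open>x\<close> in coordinate \<open>i\<close>.
      Taking the same relative position in both boxes gives the points \<open>p\<close> and
      \<open>q\<close> with midpoint \<open>x\<close>.\<close>
    define \<theta> where "\<theta> i = (x \<bullet> i - ?l \<bullet> i) / (?u \<bullet> i - ?l \<bullet> i)" for i
    have \<theta>: "0 < \<theta> i" "\<theta> i < 1" "x \<bullet> i = ?l \<bullet> i + \<theta> i * (?u \<bullet> i - ?l \<bullet> i)" if "i \<in> Basis" for i
      using x lu[OF that] that by (auto simp: \<theta>_def box_def field_simps)
    define p where "p = (\<Sum>i\<in>Basis. (a \<bullet> i + \<theta> i * (b \<bullet> i - a \<bullet> i)) *\<^sub>R i)"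
    define q where "q = (\<Sum>i\<in>Basis. (c \<bullet> i + \<theta> i * (d \<bullet> i - c \<bullet> i)) *\<^sub>R i)"
    have between: "u < u + t * (v - u) \<and> u + t * (v - u) < v" if "0 < t" "t < 1" "u < v" for t u v :: real
    proof -
      have "0 < t * (v - u)" "t * (v - u) < v - u"
        using that mult_strict_right_mono[of t 1 "v - u"] by auto
      then show ?thesis by (intro conjI) linarith+
    qed
    have pq: "p \<bullet> i = a \<bullet> i + \<theta> i * (b \<bullet> i - a \<bullet> i)" "q \<bullet> i = c \<bullet> i + \<theta> i * (d \<bullet> i - c \<bullet> i)" if "i \<in> Basis" for i
      using that by (auto simp: p_def q_def)
    have "p \<in> box a b" "q \<in> box c d"
      using lt \<theta>(1,2) between unfolding mem_box by (auto simp: pq)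
    moreover have "x = (1/2) *\<^sub>R (p + q)"
    proof (rule euclidean_eqI)
      fix i :: 'a assume i: "i \<in> Basis"
      show "x \<bullet> i = (1/2) *\<^sub>R (p + q) \<bullet> i"
        unfolding inner_scaleR_left inner_add_left pq[OF i] \<theta>(3)[OF i] by (simp add: algebra_simps)
    qed
    ultimately show "x \<in> midpoints (box a b) (box c d)" by (auto simp: mem_midpoints)
  qed
  then have "measure lborel (box ?l ?u) \<le> measure lborel (midpoints (box a b) (box c d))"
    by (intro measure_mono_fmeasurable)
       (auto intro!: fmeasurableI emeasure_bounded_finite borel_open open_midpoints bounded_midpoints simp: open_box)
  moreover have "measure lborel (box a b) * measure lborel (box c d) \<le> (measure lborel (box ?l ?u))\<^sup>2"
  proof -
    have "(\<Prod>i\<in>Basis. (b - a) \<bullet> i) * (\<Prod>i\<in>Basis. (d - c) \<bullet> i) = (\<Prod>i\<in>Basis. ((b - a) \<bullet> i) * ((d - c) \<bullet> i))"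
      by (simp add: prod.distrib)
    also have "\<dots> \<le> (\<Prod>i\<in>Basis. ((?u - ?l) \<bullet> i)\<^sup>2)"
    proof (rule prod_mono, intro conjI)
      fix i :: 'a assume i: "i \<in> Basis"
      show "0 \<le> (b - a) \<bullet> i * ((d - c) \<bullet> i)"
        using lt[OF i] by (simp add: inner_diff_left)
      have "u * v \<le> ((u + v) / 2)\<^sup>2" for u v :: real
        using zero_le_power2[of "u - v"] by (simp add: power2_eq_square algebra_simps)
      from this[of "(b - a) \<bullet> i" "(d - c) \<bullet> i"]
      show "(b - a) \<bullet> i * ((d - c) \<bullet> i) \<le> ((?u - ?l) \<bullet> i)\<^sup>2"
        by (simp add: inner_diff_left inner_add_left algebra_simps add_divide_distrib diff_divide_distrib)
    qed
    also have "\<dots> = (\<Prod>i\<in>Basis. (?u - ?l) \<bullet> i)\<^sup>2" by (simp add: prod_power_distrib)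
    finally show ?thesis
      using lt lu by (subst (1 2 3) measure_lborel_box) (auto intro: less_imp_le)
  qed
  ultimately show ?thesis by (meson order_trans power_mono measure_nonneg)
qed

text \<open>
  The Hadwiger--Ohmann induction on the number of boxes: one family is cut by a hyperplane
  separating two of its boxes, the other one by a parallel hyperplane in the same ratio.
\<close>

lemma box_family_midpoint_measure:
  fixes \<A> \<B> :: "'a::euclidean_space set set"
  assumes "box_family \<A>" "box_family \<B>" "\<A> \<noteq> {}" "\<B> \<noteq> {}"
  shows "measure lborel (\<Union>\<A>) * measure lborel (\<Union>\<B>) \<le> (measure lborel (midpoints (\<Union>\<A>) (\<Union>\<B>)))\<^sup>2"
  using assms
proof (induction "card \<A> + card \<B>" arbitrary: \<A> \<B> rule: less_induct)
  case less
  let ?m = "measure lborel :: 'a set \<Rightarrow> real"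
  \<comment> \<open>Stated for a pair whose first family has at least two boxes. It is used a second
    time with the roles of the families exchanged.\<close>
  have main: "?m (\<Union>\<A>) * ?m (\<Union>\<B>) \<le> (?m (midpoints (\<Union>\<A>) (\<Union>\<B>)))\<^sup>2"
    if \<A>: "box_family \<A>" "\<A> \<noteq> {}" and \<B>: "box_family \<B>" "\<B> \<noteq> {}"
      and big: "\<not> card \<A> \<le> 1" and IH: "\<And>\<A>' \<B>'. card \<A>' + card \<B>' < card \<A> + card \<B> \<Longrightarrow> box_family \<A>' \<Longrightarrow> box_family \<B>' \<Longrightarrow>
          \<A>' \<noteq> {} \<Longrightarrow> \<B>' \<noteq> {} \<Longrightarrow> ?m (\<Union>\<A>') * ?m (\<Union>\<B>') \<le> (?m (midpoints (\<Union>\<A>') (\<Union>\<B>')))\<^sup>2"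
    for \<A> \<B> :: "'a set set"
  proof -
    have "finite \<A>" using \<A> by (auto simp: box_family_def)
    then obtain A1 A2 where A12: "A1 \<in> \<A>" "A2 \<in> \<A>" "A1 \<noteq> A2"
      using big card_le_Suc0_iff_eq[of \<A>] by auto
    then have disj: "A1 \<inter> A2 = {}" and ne: "A1 \<noteq> {}" "A2 \<noteq> {}"
      using \<A>(1) disjointD[of \<A> A1 A2] unfolding box_family_def by metis+
    obtain a1 b1 a2 b2 where ab: "A1 = box a1 b1" "A2 = box a2 b2"
      using A12 \<A> unfolding box_family_def by meson
    have lt: "a1 \<bullet> j < b1 \<bullet> j" "a2 \<bullet> j < b2 \<bullet> j" if "j \<in> Basis" for j
      using ne ab that by (auto simp: box_ne_empty)
    \<comment> \<open>Disjoint nonempty boxes are separated in some coordinate. Each side of the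
      separating hyperplane misses one of the two, so both parts of the first family have fewer
      boxes.\<close>
    obtain i where i: "i \<in> Basis" and "b1 \<bullet> i \<le> a2 \<bullet> i \<or> b2 \<bullet> i \<le> a1 \<bullet> i"
      using disj lt unfolding ab disjoint_interval by (meson not_le)
    then obtain c where c: "(A1 \<inter> {x. x \<bullet> i > c} = {} \<and> A2 \<inter> {x. x \<bullet> i < c} = {})
        \<or> (A1 \<inter> {x. x \<bullet> i < c} = {} \<and> A2 \<inter> {x. x \<bullet> i > c} = {})"
    proof (elim disjE)
      assume "b1 \<bullet> i \<le> a2 \<bullet> i"
      then show thesis using i by (intro that[of "b1 \<bullet> i"] disjI1) (fastforce simp: ab box_def)
    next
      assume "b2 \<bullet> i \<le> a1 \<bullet> i"
      then show thesis using i by (intro that[of "b2 \<bullet> i"] disjI2) (fastforce simp: ab box_def)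
    qed
    let ?L = "{x::'a. x \<bullet> i < c}" and ?U = "{x::'a. x \<bullet> i > c}"
    obtain \<A>L where \<A>L: "box_family \<A>L" "\<Union>\<A>L = \<Union>\<A> \<inter> ?L" "card \<A>L < card \<A>"
      using box_family_halfspace[OF \<A>(1) i, of ?L c] c A12 by blast
    obtain \<A>U where \<A>U: "box_family \<A>U" "\<Union>\<A>U = \<Union>\<A> \<inter> ?U" "card \<A>U < card \<A>"
      using box_family_halfspace[OF \<A>(1) i, of ?U c] c A12 by blast
    have sA: "?m (\<Union>\<A>) = ?m (\<Union>\<A> \<inter> ?L) + ?m (\<Union>\<A> \<inter> ?U)"
      by (rule measure_split_halfspace[OF box_family_open[OF \<A>(1)] box_family_bounded[OF \<A>(1)] i])
    have pos: "?m X > 0" if "open X" "bounded X" "X \<noteq> {}" for X :: "'a set"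
    proof -
      obtain x e where xe: "0 < e" "ball x e \<subseteq> X" using \<open>open X\<close> \<open>X \<noteq> {}\<close> by (meson all_not_in_conv open_contains_ball)
      then have "0 < ?m (ball x e)" by simp
      also have "\<dots> \<le> ?m X"
        using xe that by (intro measure_mono_fmeasurable) (auto intro!: fmeasurableI emeasure_bounded_finite)
      finally show ?thesis .
    qed
    have A0: "?m (\<Union>\<A>) > 0" and B0: "?m (\<Union>\<B>) > 0"
      using \<A> \<B> by (auto intro!: pos box_family_open box_family_bounded simp: box_family_def)
    define \<tau> where "\<tau> = ?m (\<Union>\<A> \<inter> ?L) / ?m (\<Union>\<A>)"
    have mL: "?m (\<Union>\<A> \<inter> ?L) = \<tau> * ?m (\<Union>\<A>)" using A0 by (simp add: \<tau>_def)
    have mU: "?m (\<Union>\<A> \<inter> ?U) = (1 - \<tau>) * ?m (\<Union>\<A>)" using sA mL by (simp add: algebra_simps)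
    have \<tau>: "0 \<le> \<tau>" "\<tau> \<le> 1" using A0 sA by (auto simp: \<tau>_def)
    obtain c' where c': "?m (\<Union>\<B> \<inter> {x. x \<bullet> i < c'}) = \<tau> * ?m (\<Union>\<B>)"
      using measure_below_continuous[OF box_family_open[OF \<B>(1)] box_family_bounded[OF \<B>(1)] i \<tau>] by auto
    let ?L' = "{x::'a. x \<bullet> i < c'}" and ?U' = "{x::'a. x \<bullet> i > c'}"
    have c'U: "?m (\<Union>\<B> \<inter> ?U') = (1 - \<tau>) * ?m (\<Union>\<B>)"
      using measure_split_halfspace[OF box_family_open[OF \<B>(1)] box_family_bounded[OF \<B>(1)] i, of c'] c'
      by (simp add: algebra_simps)
    obtain \<B>L where \<B>L: "box_family \<B>L" "\<Union>\<B>L = \<Union>\<B> \<inter> ?L'" "card \<B>L \<le> card \<B>"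
      using box_family_halfspace[OF \<B>(1) i, of ?L' c'] by blast
    obtain \<B>U where \<B>U: "box_family \<B>U" "\<Union>\<B>U = \<Union>\<B> \<inter> ?U'" "card \<B>U \<le> card \<B>"
      using box_family_halfspace[OF \<B>(1) i, of ?U' c'] by blast
    let ?Mlo = "midpoints (\<Union>\<A>L) (\<Union>\<B>L)" and ?Mup = "midpoints (\<Union>\<A>U) (\<Union>\<B>U)"
    let ?ab = "?m (\<Union>\<A>) * ?m (\<Union>\<B>)"
    \<comment> \<open>Both families are cut in the same ratio \<open>t\<close>, hence the induction
      hypothesis for one half yields the share \<open>t\<close> of the full bound. For
      \<open>t = 0\<close> a half may be the empty family, which the induction does not
      cover.\<close>
    have part: "t * sqrt ?ab \<le> ?m (midpoints (\<Union>\<A>') (\<Union>\<B>'))"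
      if "box_family \<A>'" "box_family \<B>'" "?m (\<Union>\<A>') = t * ?m (\<Union>\<A>)" "?m (\<Union>\<B>') = t * ?m (\<Union>\<B>)"
        "card \<A>' < card \<A>" "card \<B>' \<le> card \<B>" "0 \<le> t" for \<A>' \<B>' :: "'a set set" and t
    proof (cases "t = 0")
      case False
      then have "?m (\<Union>\<A>') \<noteq> 0" "?m (\<Union>\<B>') \<noteq> 0"
        unfolding that(3,4) using A0 B0 by simp_all
      then have ne': "\<A>' \<noteq> {}" "\<B>' \<noteq> {}" by auto
      have "?m (\<Union>\<A>') * ?m (\<Union>\<B>') \<le> (?m (midpoints (\<Union>\<A>') (\<Union>\<B>')))\<^sup>2"
        by (rule IH[OF add_less_le_mono[OF that(5,6)] that(1,2) ne'])
      moreover have "(t * sqrt ?ab)\<^sup>2 = ?m (\<Union>\<A>') * ?m (\<Union>\<B>')"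
        unfolding that(3,4) power_mult_distrib using A0 B0 by (simp add: power2_eq_square)
      ultimately have "(t * sqrt ?ab)\<^sup>2 \<le> (?m (midpoints (\<Union>\<A>') (\<Union>\<B>')))\<^sup>2" by simp
      then show ?thesis by (rule power2_le_imp_le) simp
    qed simp
    have pL: "\<tau> * sqrt ?ab \<le> ?m ?Mlo"
      using \<A>L \<B>L mL c' \<tau> by (intro part) auto
    have pU: "(1 - \<tau>) * sqrt ?ab \<le> ?m ?Mup"
      using \<A>U \<B>U mU c'U \<tau> by (intro part) auto
    have fm: "midpoints (\<Union>\<A>') (\<Union>\<B>') \<in> fmeasurable lborel" if "box_family \<A>'" "box_family \<B>'" for \<A>' \<B>' :: "'a set set"
      using that by (auto intro!: fmeasurableI emeasure_bounded_finite borel_open open_midpoints bounded_midpoints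
          box_family_open box_family_bounded)
    have ss: "sqrt ?ab \<le> ?m (?Mlo \<union> ?Mup)"
    proof -
      \<comment> \<open>The hyperplane at level \<open>(c + c') / 2\<close> separates the two
        midpoint sets, so the shares \<open>\<tau>\<close> and \<open>1 - \<tau>\<close> add
        up.\<close>
      have "?Mlo \<inter> ?Mup = {}"
        by (auto simp: mem_midpoints \<A>L \<B>L \<A>U \<B>U) (smt (verit) inner_add_left inner_scaleR_left)
      then have "?m (?Mlo \<union> ?Mup) = ?m ?Mlo + ?m ?Mup"
        using fm[OF \<A>L(1) \<B>L(1)] fm[OF \<A>U(1) \<B>U(1)] by (simp add: measure_Un3)
      then show ?thesis using pL pU by (simp add: algebra_simps)
    qed
    also have "\<dots> \<le> ?m (midpoints (\<Union>\<A>) (\<Union>\<B>))"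
    proof (rule measure_mono_fmeasurable[OF _ _ fm[OF \<A>(1) \<B>(1)]])
      show "?Mlo \<union> ?Mup \<subseteq> midpoints (\<Union>\<A>) (\<Union>\<B>)"
        unfolding \<A>L \<B>L \<A>U \<B>U by (intro Un_least midpoints_mono Int_lower1)
      show "?Mlo \<union> ?Mup \<in> sets lborel"
        using fmeasurableD[OF fm[OF \<A>L(1) \<B>L(1)]] fmeasurableD[OF fm[OF \<A>U(1) \<B>U(1)]] by (rule sets.Un)
    qed
    finally have "(sqrt ?ab)\<^sup>2 \<le> (?m (midpoints (\<Union>\<A>) (\<Union>\<B>)))\<^sup>2"
      using A0 B0 by (intro power_mono) auto
    then show ?thesis using A0 B0 by simp
  qed
  show ?case
  proof (cases "card \<A> \<le> 1")
    case False
    then show ?thesis by (rule main[OF less.prems(1,3,2,4) _ less.hyps])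
  next
    case A: True
    show ?thesis
    proof (cases "card \<B> \<le> 1")
      case False
      have "?m (\<Union>\<B>) * ?m (\<Union>\<A>) \<le> (?m (midpoints (\<Union>\<B>) (\<Union>\<A>)))\<^sup>2"
      proof (rule main[OF less.prems(2,4,1,3) False])
        fix \<A>' \<B>' :: "'a set set"
        assume "card \<A>' + card \<B>' < card \<B> + card \<A>" and f: "box_family \<A>'" "box_family \<B>'" "\<A>' \<noteq> {}" "\<B>' \<noteq> {}"
        then have "card \<A>' + card \<B>' < card \<A> + card \<B>" by linarith
        then show "?m (\<Union>\<A>') * ?m (\<Union>\<B>') \<le> (?m (midpoints (\<Union>\<A>') (\<Union>\<B>')))\<^sup>2"
          by (rule less.hyps[OF _ f])
      qed
      then show ?thesis by (simp add: midpoints_commute mult.commute)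
    next
      case True
      have "card \<A> = 1" "card \<B> = 1" using A True less.prems
        by (auto simp: box_family_def le_Suc_eq)
      then obtain A B where AB: "\<A> = {A}" "\<B> = {B}" by (auto simp: card_1_singleton_iff)
      have "\<exists>a b. A = box a b" "\<exists>c d. B = box c d"
        using less.prems(1,2) unfolding box_family_def AB by simp_all
      then obtain a b c d where "A = box a b" "B = box c d" by metis
      then show ?thesis using less.prems AB by (auto simp: box_family_def intro: box_midpoint_measure)
    qed
  qed
qed

text \<open>An open set is a countable union of closed boxes, and finitely many of them exhaust its
  volume up to \<open>e\<close>. A division makes them non-overlapping; passing to interiors then
  costs no volume and makes them disjoint.\<close>

lemma open_box_family_approx:
  fixes O' :: "'a::euclidean_space set"
  assumes O: "open O'" "bounded O'" and e: "0 < e"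
  shows "\<exists>\<A>. box_family \<A> \<and> \<Union>\<A> \<subseteq> O' \<and> measure lborel O' \<le> measure lborel (\<Union>\<A>) + e"
proof -
  obtain \<D> where \<D>: "countable \<D>" "\<D> \<subseteq> Pow O'" "\<And>X. X \<in> \<D> \<Longrightarrow> \<exists>a b. X = cbox a b" "\<Union>\<D> = O'"
    using open_countable_Union_open_cbox[OF O(1)] by metis
  show ?thesis
  proof (cases "\<D> = {}")
    case True
    then show ?thesis using \<D> e by (intro exI[of _ "{}"]) (auto simp: box_family_def)
  next
    case False
    define K where "K = from_nat_into \<D>"
    have K: "K n \<in> \<D>" for n using False by (simp add: K_def from_nat_into)
    have KU: "(\<Union>n. \<Union>i<n. K i) = O'"
    proof -
      have "(\<Union>n. \<Union>i<n. K i) = \<Union>(range K)" by blast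
      then show ?thesis using range_from_nat_into[OF False \<D>(1)] \<D>(4) by (simp add: K_def)
    qed
    have Kb: "K i \<in> sets borel" for i using \<D>(3)[OF K] by (metis borel_closed closed_cbox)
    have fin: "emeasure lborel O' \<noteq> \<infinity>" using emeasure_bounded_finite[OF O(2)] by auto
    have "(\<lambda>n. measure lborel (\<Union>i<n. K i)) \<longlonglongrightarrow> measure lborel (\<Union>n. \<Union>i<n. K i)"
    proof (rule Lim_measure_incseq)
      show "range (\<lambda>n. \<Union>i<n. K i) \<subseteq> sets lborel" using Kb by (intro image_subsetI sets.finite_UN) auto
      show "incseq (\<lambda>n. \<Union>i<n. K i)" by (intro incseq_SucI UN_mono) auto
      show "emeasure lborel (\<Union>n. \<Union>i<n. K i) \<noteq> \<infinity>" unfolding KU by (rule fin)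
    qed
    then have "\<forall>\<^sub>F n in sequentially. measure lborel O' - e < measure lborel (\<Union>i<n. K i)"
      unfolding KU using e by (intro order_tendstoD(1)[where y="measure lborel O'"]) auto
    then obtain n where n: "measure lborel O' - e < measure lborel (\<Union>i<n. K i)"
      by (auto simp: eventually_sequentially)
    obtain p where p: "p division_of \<Union>(K ` {..<n})"
      using elementary_unions_intervals[of "K ` {..<n}"] \<D>(3) K by (metis finite_imageI finite_lessThan imageE)
    have fp: "finite p" using p by auto
    define \<A> where "\<A> = interior ` p - {{}}"
    have int: "\<exists>a b. Q = cbox a b \<and> interior Q = box a b" if "Q \<in> p" for Q
      using division_ofD(4)[OF p that] interior_cbox by blast
    have bf: "box_family \<A>"
      unfolding box_family_def
    proof (intro conjI)
      show "finite \<A>" using fp by (simp add: \<A>_def)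
      show "disjoint \<A>" using division_ofD(5)[OF p] unfolding \<A>_def pairwise_def disjnt_def by blast
      show "\<forall>A\<in>\<A>. A \<noteq> {} \<and> (\<exists>a b. A = box a b)" using int by (force simp: \<A>_def)
    qed
    have "measure lborel (\<Union>(K ` {..<n})) = measure lborel (\<Union>p)" using p by auto
    also have "\<dots> \<le> (\<Sum>Q\<in>p. measure lborel Q)"
    proof -
      have "measure lborel (\<Union>Q\<in>p. Q) \<le> (\<Sum>Q\<in>p. measure lborel Q)"
      proof (rule measure_subadditive_finite[OF fp])
        show "(\<lambda>Q. Q) ` p \<subseteq> sets lborel" using int by (force)
        show "emeasure lborel Q \<noteq> \<infinity>" if "Q \<in> p" for Q
          using int[OF that] emeasure_bounded_finite[OF bounded_cbox] by (metis infinity_ennreal_def less_irrefl)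
      qed
      then show ?thesis by simp
    qed
    also have "\<dots> = (\<Sum>Q\<in>p. measure lborel (interior Q))"
    proof (rule sum.cong)
      fix Q assume "Q \<in> p"
      then obtain a b where "Q = cbox a b" "interior Q = box a b" using int by blast
      then show "measure lborel Q = measure lborel (interior Q)" by (simp add: measure_def emeasure_lborel_box_eq emeasure_lborel_cbox_eq)
    qed simp
    also have "\<dots> = measure lborel (\<Union>Q\<in>p. interior Q)"
    proof (rule measure_finite_Union[symmetric, OF fp])
      show "interior ` p \<subseteq> sets lborel" by auto
      show "disjoint_family_on interior p" using division_ofD(5)[OF p] by (auto simp: disjoint_family_on_def)
      show "emeasure lborel (interior Q) \<noteq> \<infinity>" if "Q \<in> p" for Q
        using int[OF that] emeasure_bounded_finite[OF bounded_box] by (metis infinity_ennreal_def less_irrefl)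
    qed
    also have "(\<Union>Q\<in>p. interior Q) = \<Union>\<A>" by (auto simp: \<A>_def)
    finally have "measure lborel (\<Union>i<n. K i) \<le> measure lborel (\<Union>\<A>)" by simp
    moreover have "\<Union>\<A> \<subseteq> O'"
    proof -
      have "\<Union>\<A> \<subseteq> \<Union>p" using interior_subset by (auto simp: \<A>_def)
      also have "\<dots> \<subseteq> O'" unfolding division_ofD(6)[OF p] using K \<D>(2) by blast
      finally show ?thesis .
    qed
    ultimately show ?thesis using n bf by (intro exI[of _ \<A>]) auto
  qed
qed

lemma emeasure_lborel_uminus:
  fixes A :: "'a::euclidean_space set"
  assumes [measurable]: "A \<in> sets borel"
  shows "emeasure lborel {x. - x \<in> A} = emeasure lborel A"
proof -
  have "emeasure lborel A = emeasure (density (distr lborel borel (\<lambda>x. 0 + (- 1) *\<^sub>R x)) (\<lambda>_. ennreal (\<bar>- 1\<bar> ^ DIM('a)))) A"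
    using lborel_affine[of "- 1" "0::'a"] by simp
  also have "\<dots> = emeasure lborel {x. - x \<in> A}"
    by (simp add: density_1 emeasure_distr vimage_def)
  finally show ?thesis by simp
qed

text \<open>Brunn-Minkowski for \<open>O'\<close> and its reflection: both have the same volume, so
  the product on the left is a square and the roots can be compared. Box families approximate
  \<open>O'\<close> from inside.\<close>

lemma measure_le_midpoints_uminus:
  fixes O' :: "'a::euclidean_space set"
  assumes O: "open O'" "bounded O'"
  shows "measure lborel O' \<le> measure lborel (midpoints O' (uminus ` O'))"
proof (rule field_le_epsilon)
  fix e :: real assume e: "0 < e"
  have fm: "midpoints O' (uminus ` O') \<in> fmeasurable lborel"
    using O by (auto intro!: fmeasurableI emeasure_bounded_finite borel_open open_midpoints bounded_midpoints
         bounded_linear_image bounded_linear_minus bounded_linear_ident)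
  obtain \<A> where \<A>: "box_family \<A>" "\<Union>\<A> \<subseteq> O'" "measure lborel O' \<le> measure lborel (\<Union>\<A>) + e"
    using open_box_family_approx[OF O e] by blast
  have "measure lborel (\<Union>\<A>) \<le> measure lborel (midpoints O' (uminus ` O'))"
  proof (cases "\<A> = {}")
    case False
    define \<B> where "\<B> = (\<lambda>A. uminus ` A) ` \<A>"
    have mbox: "uminus ` box a b = box (- b) (- a)" for a b :: 'a
    proof -
      have "x \<in> uminus ` box a b \<longleftrightarrow> x \<in> box (- b) (- a)" for x
      proof -
        have "x \<in> uminus ` box a b \<longleftrightarrow> - x \<in> box a b" by (metis image_iff minus_minus)
        also have "\<dots> \<longleftrightarrow> x \<in> box (- b) (- a)" unfolding mem_box by (intro ball_cong) auto
        finally show ?thesis .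
      qed
      then show ?thesis by blast
    qed
    have B: "box_family \<B>" unfolding box_family_def
    proof (intro conjI)
      show "finite \<B>" using \<A>(1) by (simp add: \<B>_def box_family_def)
      show "disjoint \<B>"
        unfolding pairwise_def disjnt_def
      proof (intro ballI impI)
        fix X Y assume "X \<in> \<B>" "Y \<in> \<B>" "X \<noteq> Y"
        then obtain A A' where "A \<in> \<A>" "A' \<in> \<A>" "X = uminus ` A" "Y = uminus ` A'" "A \<noteq> A'" by (auto simp: \<B>_def)
        moreover then have "A \<inter> A' = {}" using \<A>(1) unfolding box_family_def pairwise_def disjnt_def by blast
        ultimately show "X \<inter> Y = {}" by auto
      qed
      show "\<forall>A\<in>\<B>. A \<noteq> {} \<and> (\<exists>a b. A = box a b)"
        using \<A>(1) mbox by (fastforce simp: \<B>_def box_family_def)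
    qed
    have UB: "\<Union>\<B> = uminus ` \<Union>\<A>" by (auto simp: \<B>_def)
    have "emeasure lborel (uminus ` \<Union>\<A>) = emeasure lborel (\<Union>\<A>)"
    proof -
      have "emeasure lborel {x. - x \<in> \<Union>\<A>} = emeasure lborel (\<Union>\<A>)"
        using box_family_open[OF \<A>(1)] by (intro emeasure_lborel_uminus) auto
      moreover have "{x. - x \<in> \<Union>\<A>} = uminus ` \<Union>\<A>" 
      proof -
        have "x \<in> uminus ` \<Union>\<A> \<longleftrightarrow> - x \<in> \<Union>\<A>" for x by (metis image_iff minus_minus)
        then show ?thesis by blast
      qed
      ultimately show ?thesis by simp
    qed
    then have mB: "measure lborel (\<Union>\<B>) = measure lborel (\<Union>\<A>)" by (simp add: UB measure_def)
    have "(measure lborel (\<Union>\<A>))\<^sup>2 \<le> (measure lborel (midpoints (\<Union>\<A>) (\<Union>\<B>)))\<^sup>2"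
      using box_family_midpoint_measure[OF \<A>(1) B False] False mB by (simp add: \<B>_def power2_eq_square)
    then have "measure lborel (\<Union>\<A>) \<le> measure lborel (midpoints (\<Union>\<A>) (\<Union>\<B>))"
      by (rule power2_le_imp_le) simp
    also have "\<dots> \<le> measure lborel (midpoints O' (uminus ` O'))"
      using \<A>(2) fm box_family_open[OF \<A>(1)]
      by (intro measure_mono_fmeasurable midpoints_mono) (auto simp: UB intro!: borel_open open_midpoints)
    finally show ?thesis .
  qed simp
  then show "measure lborel O' \<le> measure lborel (midpoints O' (uminus ` O')) + e" using \<A>(3) by linarith
qed

text \<open>The set (E - E)/2 has at least the measure of \<open>E\<close> by Brunn-Minkowski, and
  it lies in the centred ball of radius \<open>diameter E / 2\<close>. The argument is run on open
  neighbourhoods, of radius \<open>\<rho>\<close>, of the cylinder over \<open>E\<close>, because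
  the volume inequality holds for open sets of the whole space.\<close>

lemma isodiametric_slice:
  fixes \<nu> :: "'a::euclidean_space"
  assumes \<nu>: "norm \<nu> = 1" and E: "compact E" "E \<noteq> {}"
  shows "emeasure (slice_measure \<nu>) E \<le> ennreal (unit_ball_vol (real (DIM('a) - 1)) * (diameter E / 2) ^ (DIM('a) - 1))"
proof -
  let ?k = "DIM('a) - 1" and ?D = "diameter E"
  define X where "X = {x. perp_proj \<nu> x \<in> E \<and> 0 \<le> x \<bullet> \<nu> \<and> x \<bullet> \<nu> \<le> 1}"
  have [measurable]: "E \<in> sets borel" using E by (simp add: borel_compact)
  have D: "0 \<le> ?D" using E by (simp add: compact_imp_bounded diameter_ge_0)
  have MX: "emeasure (slice_measure \<nu>) E = emeasure lborel X" by (simp add: emeasure_slice_measure X_def)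
  have Xs: "X \<in> sets borel" unfolding X_def by measurable
  have bX: "bounded X"
  proof -
    obtain R where R: "\<And>x. x \<in> E \<Longrightarrow> norm x \<le> R" using E compact_imp_bounded bounded_pos by metis
    show ?thesis
    proof (rule boundedI[of _ "R + 1"])
      fix x assume x: "x \<in> X"
      have "norm (perp_proj \<nu> x + (x \<bullet> \<nu>) *\<^sub>R \<nu>) \<le> norm (perp_proj \<nu> x) + norm ((x \<bullet> \<nu>) *\<^sub>R \<nu>)"
        by (rule norm_triangle_ineq)
      then show "norm x \<le> R + 1" using x R \<nu> by (fastforce simp: perp_proj_decomp X_def)
    qed
  qed
  have step: "emeasure lborel X \<le> ennreal (unit_ball_vol (real ?k) * (?D / 2 + \<rho>) ^ ?k * (1 + 2 * \<rho>))" if \<rho>: "0 < \<rho>" for \<rho>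
  proof -
    define O' where "O' = (\<Union>x\<in>X. ball x \<rho>)"
    have O: "open O'" "X \<subseteq> O'" using \<rho> by (auto simp: O'_def)
    have bO: "bounded O'"
    proof -
      obtain R where R: "\<And>x. x \<in> X \<Longrightarrow> norm x \<le> R" using bX bounded_iff by blast
      show ?thesis
      proof (rule boundedI[of _ "R + \<rho>"])
        fix y assume "y \<in> O'"
        then obtain x where "x \<in> X" "dist x y < \<rho>" by (auto simp: O'_def)
        then show "norm y \<le> R + \<rho>" using R[of x] norm_triangle_sub[of y x] by (simp add: dist_norm norm_minus_commute)
      qed
    qed
    \<comment> \<open>Half the difference of two heights in [0,1] lies in [-1/2,1/2], so the
      symmetrised cylinder again has height one; the two neighbourhoods add an error of at most
      \<open>\<rho>\<close> to base radius and height.\<close>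
    let ?C = "{z. perp_proj \<nu> z \<in> cball 0 (?D / 2 + \<rho>) \<and> z \<bullet> \<nu> \<in> {-(1/2) - \<rho>..1/2 + \<rho>}}"
    have sub: "midpoints O' (uminus ` O') \<subseteq> ?C"
    proof
      fix z assume "z \<in> midpoints O' (uminus ` O')"
      then obtain o1 o2 where o: "o1 \<in> O'" "o2 \<in> O'" "z = (1/2) *\<^sub>R (o1 - o2)" by (auto simp: mem_midpoints)
      then obtain x1 x2 where x: "x1 \<in> X" "x2 \<in> X" "dist x1 o1 < \<rho>" "dist x2 o2 < \<rho>" by (auto simp: O'_def)
      define u where "u = (1/2) *\<^sub>R ((o1 - x1) - (o2 - x2))"
      have "norm ((o1 - x1) - (o2 - x2)) \<le> 2 * \<rho>"
        using x(3,4) norm_triangle_ineq4[of "o1 - x1" "o2 - x2"] by (simp add: dist_norm norm_minus_commute)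
      then have u: "norm u \<le> \<rho>" by (simp add: u_def)
      have z: "z = (1/2) *\<^sub>R (x1 - x2) + u" by (simp add: o u_def algebra_simps)
      have "norm (perp_proj \<nu> z) \<le> norm ((1/2) *\<^sub>R (perp_proj \<nu> x1 - perp_proj \<nu> x2)) + norm (perp_proj \<nu> u)"
      proof -
        have "perp_proj \<nu> z = (1/2) *\<^sub>R (perp_proj \<nu> x1 - perp_proj \<nu> x2) + perp_proj \<nu> u"
          unfolding z by (simp add: perp_proj_def algebra_simps inner_diff_left inner_add_left)
        then show ?thesis by (simp only: norm_triangle_ineq)
      qed
      also have "norm (perp_proj \<nu> u) \<le> \<rho>" using norm_perp_proj_le[OF \<nu>, of u] u by linarith
      also have "norm (perp_proj \<nu> x1 - perp_proj \<nu> x2) \<le> ?D"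
        using x diameter_bounded_bound[OF compact_imp_bounded[OF E(1)], of "perp_proj \<nu> x1" "perp_proj \<nu> x2"]
        by (simp add: X_def dist_norm)
      then have "norm ((1/2) *\<^sub>R (perp_proj \<nu> x1 - perp_proj \<nu> x2)) \<le> ?D / 2" by simp
      finally have 1: "norm (perp_proj \<nu> z) \<le> ?D / 2 + \<rho>" by simp
      have "z \<bullet> \<nu> = (x1 \<bullet> \<nu> - x2 \<bullet> \<nu>) / 2 + u \<bullet> \<nu>" by (simp add: z inner_add_left inner_diff_left)
      moreover have "\<bar>u \<bullet> \<nu>\<bar> \<le> \<rho>" using Cauchy_Schwarz_ineq2[of u \<nu>] \<nu> u by simp
      then have "- \<rho> \<le> u \<bullet> \<nu>" "u \<bullet> \<nu> \<le> \<rho>" by linarith+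
      moreover have "- 1 \<le> x1 \<bullet> \<nu> - x2 \<bullet> \<nu>" "x1 \<bullet> \<nu> - x2 \<bullet> \<nu> \<le> 1" using x by (auto simp: X_def)
      ultimately have "z \<bullet> \<nu> \<in> {-(1/2) - \<rho>..1/2 + \<rho>}" by (auto simp: field_simps)
      with 1 show "z \<in> ?C" by simp
    qed
    have [measurable]: "cball (0::'a) (?D / 2 + \<rho>) \<in> sets borel" by simp
    have "emeasure lborel X \<le> emeasure lborel O'" using O by (intro emeasure_mono) auto
    also have "\<dots> = ennreal (measure lborel O')"
      using emeasure_bounded_finite[OF bO] by (intro emeasure_eq_ennreal_measure) auto
    also have "\<dots> \<le> ennreal (measure lborel (midpoints O' (uminus ` O')))"
      by (intro ennreal_leI measure_le_midpoints_uminus O bO)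
    also have "\<dots> \<le> emeasure lborel (midpoints O' (uminus ` O'))"
      by (simp add: measure_def ennreal_enn2real_if)
    also have "\<dots> \<le> emeasure lborel ?C" by (intro emeasure_mono sub) measurable
    also have "\<dots> = emeasure (slice_measure \<nu>) (cball 0 (?D / 2 + \<rho>)) * ennreal (1 + 2 * \<rho>)"
      using \<rho> by (subst emeasure_slice_product[OF \<nu>]) auto
    also have "\<dots> = ennreal (unit_ball_vol (real ?k) * (?D / 2 + \<rho>) ^ ?k * (1 + 2 * \<rho>))"
      using \<rho> D by (subst slice_measure_cball[OF \<nu>]) (auto simp: ennreal_mult)
    finally show ?thesis .
  qed
  have "((\<lambda>\<rho>. ennreal (unit_ball_vol (real ?k) * (?D / 2 + \<rho>) ^ ?k * (1 + 2 * \<rho>)))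
      \<longlongrightarrow> ennreal (unit_ball_vol (real ?k) * (?D / 2 + 0) ^ ?k * (1 + 2 * 0))) (at_right 0)"
    by (intro tendsto_ennrealI tendsto_intros)
  moreover have "\<forall>\<^sub>F \<rho> in at_right 0. emeasure lborel X \<le> ennreal (unit_ball_vol (real ?k) * (?D / 2 + \<rho>) ^ ?k * (1 + 2 * \<rho>))"
    using step by (auto simp: eventually_at_filter intro: eventually_mono)
  ultimately have "emeasure lborel X \<le> ennreal (unit_ball_vol (real ?k) * (?D / 2 + 0) ^ ?k * (1 + 2 * 0))"
    by (intro tendsto_lowerbound) auto
  then show ?thesis by (simp add: MX)
qed

section \<open>Hausdorff measure on hyperplanes\<close>

text \<open>Every covering set is replaced by the closure of its trace on \<open>E\<close>, a
  compact set of no larger diameter, to which the isodiametric inequality applies; countable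
  subadditivity does the rest.\<close>

lemma slice_le_hausdorff:
  fixes \<nu> :: "'a::euclidean_space"
  assumes \<nu>: "norm \<nu> = 1" and E[measurable]: "E \<in> sets borel"
  shows "emeasure (slice_measure \<nu>) E \<le> hausdorff_outer (DIM('a) - 1) E"
proof -
  let ?k = "DIM('a) - 1"
  have "emeasure (slice_measure \<nu>) E \<le> hausdorff_premeasure ?k 1 E"
    unfolding hausdorff_premeasure_def
  proof (rule INF_greatest)
    fix C assume "C \<in> {C :: nat \<Rightarrow> 'a set. E \<subseteq> (\<Union>i. C i) \<and> (\<forall>i. bounded (C i) \<and> diameter (C i) \<le> 1)}"
    then have C: "E \<subseteq> \<Union> (range C)" "\<forall>i. bounded (C i) \<and> diameter (C i) \<le> 1" by auto
    define D where "D i = closure (E \<inter> C i)" for i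
    have b: "bounded (E \<inter> C i)" for i using C(2) by (auto intro: bounded_subset)
    have "emeasure (slice_measure \<nu>) E \<le> emeasure (slice_measure \<nu>) (\<Union>i. D i)"
    proof (rule emeasure_mono)
      show "E \<subseteq> (\<Union>i. D i)"
      proof
        fix x assume "x \<in> E"
        moreover then obtain i where "x \<in> C i" using C(1) by blast
        ultimately have "x \<in> D i" using closure_subset[of "E \<inter> C i"] unfolding D_def by blast
        then show "x \<in> (\<Union>i. D i)" by blast
      qed
      show "(\<Union>i. D i) \<in> sets (slice_measure \<nu>)" by (auto simp: D_def)
    qed
    also have "\<dots> \<le> (\<Sum>i. emeasure (slice_measure \<nu>) (D i))"
      by (intro emeasure_subadditive_countably) (auto simp: D_def)
    also have "\<dots> \<le> (\<Sum>i. hausdorff_weight ?k (C i))"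
    proof (intro suminf_le)
      fix i
      show "emeasure (slice_measure \<nu>) (D i) \<le> hausdorff_weight ?k (C i)"
      proof (cases "E \<inter> C i = {}")
        case False
        then have "emeasure (slice_measure \<nu>) (D i) \<le> ennreal (unit_ball_vol (real ?k) * (diameter (D i) / 2) ^ ?k)"
          unfolding D_def using b[of i] by (intro isodiametric_slice[OF \<nu>]) auto
        also have "diameter (D i) = diameter (E \<inter> C i)" unfolding D_def by (rule diameter_closure[OF b])
        also have "ennreal (unit_ball_vol (real ?k) * (diameter (E \<inter> C i) / 2) ^ ?k) \<le> hausdorff_weight ?k (C i)"
          using False C(2) diameter_ge_0[OF b[of i]]
          by (auto simp: hausdorff_weight_def intro!: ennreal_leI mult_left_mono power_mono diameter_subset divide_right_mono)
        finally show ?thesis .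
      qed (simp add: D_def)
    qed auto
    finally show "emeasure (slice_measure \<nu>) E \<le> (\<Sum>i. hausdorff_weight ?k (C i))" .
  qed
  also have "\<dots> \<le> hausdorff_outer ?k E" by (rule hausdorff_premeasure_le_outer) simp
  finally show ?thesis .
qed

text \<open>Sequences of closed balls are padded with balls of negative radius, which are empty.\<close>

lemma countable_cballs_enumerate:
  fixes C :: "('a::euclidean_space \<times> real) set"
  assumes "countable C" "pairwise (\<lambda>i j. disjnt (cball (fst i) (snd i)) (cball (fst j) (snd j))) C"
  shows "\<exists>b. (\<forall>n::nat. b n \<in> insert (0, -1) C) \<and> C \<subseteq> range b \<and>
    disjoint_family (\<lambda>n. cball (fst (b n)) (snd (b n)))"
proof -
  define b where "b n = (if n \<in> to_nat_on C ` C then from_nat_into C n else (0, -1))" for n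
  have 1: "b n \<in> insert (0, -1) C" for n using assms(1) by (auto simp: b_def)
  have "x \<in> range b" if "x \<in> C" for x
    using that assms(1) by (intro range_eqI[of _ _ "to_nat_on C x"]) (auto simp: b_def)
  moreover have "cball (fst (b m)) (snd (b m)) \<inter> cball (fst (b n)) (snd (b n)) = {}" if "m \<noteq> n" for m n
  proof (cases "m \<in> to_nat_on C ` C \<and> n \<in> to_nat_on C ` C")
    case True
    then obtain x y where xy: "x \<in> C" "y \<in> C" "m = to_nat_on C x" "n = to_nat_on C y" by auto
    then have "x \<noteq> y" "b m = x" "b n = y" using that assms(1) by (auto simp: b_def)
    then show ?thesis using assms(2) xy unfolding pairwise_def disjnt_def by auto
  qed (auto simp: b_def)
  ultimately show ?thesis using 1 by (intro exI[of _ b]) (auto simp: disjoint_family_on_def)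
qed

lemma sum_disjoint_cballs_le:
  fixes b :: "nat \<Rightarrow> 'a::euclidean_space \<times> real"
  assumes "disjoint_family (\<lambda>n. cball (fst (b n)) (snd (b n)))" "\<And>n. cball (fst (b n)) (snd (b n)) \<subseteq> T" "open T"
  shows "(\<Sum>n. emeasure lborel (cball (fst (b n)) (snd (b n)))) \<le> emeasure lborel T"
proof -
  have "(\<Sum>n. emeasure lborel (cball (fst (b n)) (snd (b n)))) = emeasure lborel (\<Union>n. cball (fst (b n)) (snd (b n)))"
    using assms(1) by (intro suminf_emeasure) auto
  also have "\<dots> \<le> emeasure lborel T" using assms by (intro emeasure_mono) auto
  finally show ?thesis .
qed

section \<open>Economical covers by balls\<close>

lemma open_superset_emeasure:
  fixes X :: "'a::euclidean_space set"
  assumes X: "X \<in> lmeasurable" and e: "0 < e"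
  shows "\<exists>T. open T \<and> X \<subseteq> T \<and> emeasure lborel T \<le> ennreal (measure lebesgue X + e)"
proof -
  have Xs: "X \<in> sets lebesgue" using X by (rule fmeasurableD)
  obtain T where T: "open T" "X \<subseteq> T" "T - X \<in> lmeasurable" "emeasure lebesgue (T - X) < ennreal e"
    using sets_lebesgue_outer_open[OF Xs e] by metis
  have "emeasure lborel T = emeasure lebesgue (X \<union> (T - X))" using T by (simp add: Un_absorb1)
  also have "\<dots> \<le> emeasure lebesgue X + emeasure lebesgue (T - X)"
    using Xs fmeasurableD[OF T(3)] by (intro emeasure_subadditive)
  also have "\<dots> \<le> ennreal (measure lebesgue X) + ennreal e"
    using T(4) emeasure_eq_measure2[OF X] by (intro add_mono) auto
  finally show ?thesis using T e by (intro exI[of _ T]) (simp add: ennreal_plus)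
qed

lemma cball_cover_null:
  fixes X :: "'a::euclidean_space set"
  assumes "negligible X" and e: "0 < e" and d: "0 < \<delta>"
  shows "\<exists>b :: nat \<Rightarrow> 'a \<times> real. (\<forall>n. snd (b n) \<le> \<delta>) \<and> X \<subseteq> (\<Union>n. cball (fst (b n)) (snd (b n)))
    \<and> (\<Sum>n. emeasure lborel (cball (fst (b n)) (snd (b n)))) \<le> ennreal e"
proof -
  let ?q = "5 ^ DIM('a) :: real"
  have X: "X \<in> lmeasurable" "measure lebesgue X = 0"
    using assms(1) by (auto simp: negligible_imp_measurable negligible_imp_measure0)
  obtain T where T: "open T" "X \<subseteq> T" "emeasure lborel T \<le> ennreal (e / ?q)"
    using open_superset_emeasure[OF X(1), of "e / ?q"] e X(2) by auto
  define K where "K = {(x::'a, r). 0 < r \<and> r \<le> \<delta> / 5 \<and> cball x r \<subseteq> T}"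
  have cov: "X \<subseteq> (\<Union>i\<in>K. cball (fst i) (snd i))"
  proof
    fix x assume "x \<in> X"
    then have "x \<in> T" using T(2) by blast
    then obtain r where r: "r > 0" "cball x r \<subseteq> T" using T(1) unfolding open_contains_cball by blast
    then have "(x, min r (\<delta> / 5)) \<in> K" using d by (auto simp: K_def)
    then show "x \<in> (\<Union>i\<in>K. cball (fst i) (snd i))" using r d by (force intro!: bexI[of _ "(x, min r (\<delta> / 5))"])
  qed
  have Kr: "0 < snd i \<and> snd i \<le> \<delta> / 5" if "i \<in> K" for i using that by (auto simp: K_def)
  obtain C where C: "countable C" "C \<subseteq> K"
     "pairwise (\<lambda>i j. disjnt (cball (fst i) (snd i)) (cball (fst j) (snd j))) C"
     "X \<subseteq> (\<Union>i\<in>C. cball (fst i) (5 * snd i))"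
    by (rule Vitali_covering_lemma_cballs[OF cov Kr])
  obtain b where b: "\<And>n::nat. b n \<in> insert (0, -1) C" "C \<subseteq> range b" "disjoint_family (\<lambda>n. cball (fst (b n)) (snd (b n)))"
    using countable_cballs_enumerate[OF C(1,3)] by blast
  have KT: "cball (fst i) (snd i) \<subseteq> T" if "i \<in> K" for i using that by (auto simp: K_def)
  have bT: "cball (fst (b n)) (snd (b n)) \<subseteq> T" for n
  proof (cases "b n \<in> C")
    case True
    then show ?thesis using C(2) KT by blast
  next
    case False
    then have "b n = (0, -1)" using b(1)[of n] by blast
    then show ?thesis by simp
  qed
  define b' where "b' n = (fst (b n), 5 * snd (b n))" for n
  have scale: "emeasure lborel (cball x (5 * r)) = ennreal ?q * emeasure lborel (cball x r)" for x :: 'a and r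
  proof (cases "0 \<le> r")
    case True
    then show ?thesis by (simp add: emeasure_cball power_mult_distrib ennreal_mult[symmetric] mult_ac)
  qed simp
  have "(\<Sum>n. emeasure lborel (cball (fst (b' n)) (snd (b' n)))) = ennreal ?q * (\<Sum>n. emeasure lborel (cball (fst (b n)) (snd (b n))))"
    by (simp add: b'_def scale)
  also have "\<dots> \<le> ennreal ?q * emeasure lborel T"
    by (intro mult_left_mono sum_disjoint_cballs_le b(3) bT T(1)) simp
  also have "\<dots> \<le> ennreal ?q * ennreal (e / ?q)" using T(3) by (intro mult_left_mono) auto
  also have "ennreal ?q * ennreal (e / ?q) = ennreal e" using e by (simp add: ennreal_mult[symmetric])
  finally have s: "(\<Sum>n. emeasure lborel (cball (fst (b' n)) (snd (b' n)))) \<le> ennreal e" .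
  have "snd (b' n) \<le> \<delta>" for n
  proof (cases "b n \<in> C")
    case True
    then have "b n \<in> K" using C(2) by blast
    then show ?thesis using Kr[of "b n"] by (simp add: b'_def)
  next
    case False
    then have "b n = (0, -1)" using b(1)[of n] by blast
    then show ?thesis using d by (simp add: b'_def)
  qed
  moreover have "X \<subseteq> (\<Union>n. cball (fst (b' n)) (snd (b' n)))"
  proof
    fix x assume "x \<in> X"
    then obtain i where i: "i \<in> C" "x \<in> cball (fst i) (5 * snd i)" using C(4) by blast
    moreover then obtain n where "i = b n" using b(2) by blast
    ultimately have "x \<in> cball (fst (b' n)) (snd (b' n))" by (simp add: b'_def)
    then show "x \<in> (\<Union>n. cball (fst (b' n)) (snd (b' n)))" by blast
  qed
  ultimately show ?thesis using s by blast
qed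

text \<open>The Vitali covering theorem selects disjoint balls inside an open set of almost the same
  measure and misses only a negligible set, which is covered separately at cost
  \<open>e / 2\<close>.\<close>

lemma cball_cover:
  fixes X :: "'a::euclidean_space set"
  assumes X: "X \<in> lmeasurable" and e: "0 < e" and d: "0 < \<delta>"
  shows "\<exists>b :: nat \<Rightarrow> 'a \<times> real. (\<forall>n. snd (b n) \<le> \<delta>) \<and> X \<subseteq> (\<Union>n. cball (fst (b n)) (snd (b n)))
    \<and> (\<Sum>n. emeasure lborel (cball (fst (b n)) (snd (b n)))) \<le> ennreal (measure lebesgue X + e)"
proof -
  obtain T where T: "open T" "X \<subseteq> T" "emeasure lborel T \<le> ennreal (measure lebesgue X + e / 2)"
    using open_superset_emeasure[OF X, of "e / 2"] e by auto
  define K where "K = {(x::'a, r). 0 < r \<and> r \<le> \<delta> \<and> cball x r \<subseteq> T}"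
  have fine: "\<exists>i. i \<in> K \<and> x \<in> cball (fst i) (snd i) \<and> snd i < d'" if "x \<in> X" "0 < d'" for x d'
  proof -
    have "x \<in> T" using T(2) that(1) by blast
    then obtain r where r: "r > 0" "cball x r \<subseteq> T" using T(1) unfolding open_contains_cball by blast
    then have "(x, min r (min \<delta> (d' / 2))) \<in> K" using d that by (auto simp: K_def)
    then show ?thesis using r d that by (intro exI[of _ "(x, min r (min \<delta> (d' / 2)))"]) auto
  qed
  have Kr: "0 < snd i" if "i \<in> K" for i using that by (auto simp: K_def)
  obtain C where C: "countable C" "C \<subseteq> K"
     "pairwise (\<lambda>i j. disjnt (cball (fst i) (snd i)) (cball (fst j) (snd j))) C"
     "negligible (X - (\<Union>i\<in>C. cball (fst i) (snd i)))"
    by (rule Vitali_covering_theorem_cballs[OF Kr fine])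
  obtain b where b: "\<And>n::nat. b n \<in> insert (0, -1) C" "C \<subseteq> range b" "disjoint_family (\<lambda>n. cball (fst (b n)) (snd (b n)))"
    using countable_cballs_enumerate[OF C(1,3)] by blast
  have KT: "cball (fst i) (snd i) \<subseteq> T" if "i \<in> K" for i using that by (auto simp: K_def)
  have bT: "cball (fst (b n)) (snd (b n)) \<subseteq> T" for n
  proof (cases "b n \<in> C")
    case True
    then show ?thesis using C(2) KT by blast
  next
    case False
    then have "b n = (0, -1)" using b(1)[of n] by blast
    then show ?thesis by simp
  qed
  have "e / 2 > 0" using e by simp
  then obtain b' :: "nat \<Rightarrow> 'a \<times> real" where b': "\<And>n. snd (b' n) \<le> \<delta>"
    "X - (\<Union>i\<in>C. cball (fst i) (snd i)) \<subseteq> (\<Union>n. cball (fst (b' n)) (snd (b' n)))"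
    "(\<Sum>n. emeasure lborel (cball (fst (b' n)) (snd (b' n)))) \<le> ennreal (e / 2)"
    using cball_cover_null[OF C(4) _ d] by blast
  \<comment> \<open>Two sequences are merged as the first two rows of a double sequence; all other
    rows consist of empty balls.\<close>
  define B where "B i j = (if i = 0 then b j else if i = Suc 0 then b' j else (0, -1))" for i j :: nat
  define f where "f p = emeasure lborel (cball (fst (case_prod B p)) (snd (case_prod B p)))" for p
  let ?c = "\<lambda>n. case_prod B (prod_decode n)"
  have "(\<Sum>n. f (prod_decode n)) = (\<Sum>i. \<Sum>j. f (i, j))"
    by (intro suminf_ennreal_2dimen) simp
  also have "\<dots> = (\<Sum>i\<in>{0, Suc 0}. \<Sum>j. f (i, j))"
    by (rule suminf_finite) (auto simp: f_def B_def)
  also have "\<dots> = (\<Sum>n. emeasure lborel (cball (fst (b n)) (snd (b n)))) + (\<Sum>n. emeasure lborel (cball (fst (b' n)) (snd (b' n))))"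
    by (simp add: f_def B_def)
  also have "\<dots> \<le> emeasure lborel T + ennreal (e / 2)"
    by (intro add_mono b' sum_disjoint_cballs_le b(3) bT T(1))
  also have "\<dots> \<le> ennreal (measure lebesgue X + e / 2) + ennreal (e / 2)"
    using T(3) by (intro add_right_mono)
  also have "\<dots> = ennreal (measure lebesgue X + e)"
    using e by (subst ennreal_plus[symmetric]) auto
  finally have s: "(\<Sum>n. emeasure lborel (cball (fst (?c n)) (snd (?c n)))) \<le> ennreal (measure lebesgue X + e)"
    by (simp add: f_def)
  have "snd (b j) \<le> \<delta>" for j
  proof (cases "b j \<in> C")
    case True
    then have "b j \<in> K" using C(2) by blast
    then show ?thesis by (auto simp: K_def)
  next
    case False
    then have "b j = (0, -1)" using b(1)[of j] by blast
    then show ?thesis using d by simp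
  qed
  then have "snd (B i j) \<le> \<delta>" for i j using b'(1)[of j] d by (simp add: B_def)
  then have "snd (?c n) \<le> \<delta>" for n by (cases "prod_decode n") simp
  moreover have "X \<subseteq> (\<Union>n. cball (fst (?c n)) (snd (?c n)))"
  proof
    fix x assume x: "x \<in> X"
    have "\<exists>i j. x \<in> cball (fst (B i j)) (snd (B i j))"
    proof (cases "x \<in> (\<Union>i\<in>C. cball (fst i) (snd i))")
      case True
      then obtain i where i: "i \<in> C" "x \<in> cball (fst i) (snd i)" by blast
      moreover then obtain n where "i = b n" using b(2) by blast
      ultimately show ?thesis by (intro exI[of _ 0] exI[of _ n]) (simp add: B_def)
    next
      case False
      then obtain n where "x \<in> cball (fst (b' n)) (snd (b' n))" using x b'(2) by blast
      then show ?thesis by (intro exI[of _ "Suc 0"] exI[of _ n]) (simp add: B_def)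
    qed
    then obtain i j where "x \<in> cball (fst (B i j)) (snd (B i j))" by blast
    then show "x \<in> (\<Union>n. cball (fst (?c n)) (snd (?c n)))" by (intro UN_I[of "prod_encode (i, j)"]) auto
  qed
  ultimately show ?thesis using s by (intro exI[of _ ?c]) blast
qed

text \<open>A hyperplane section of a ball is a ball within the hyperplane, the case in which the
  weight computed from the diameter is no larger than the flat measure.\<close>

lemma hausdorff_weight_cball_slice:
  fixes \<nu> :: "'a::euclidean_space"
  assumes \<nu>: "norm \<nu> = 1"
  shows "hausdorff_weight (DIM('a) - 1) {y. y \<bullet> \<nu> = 0 \<and> y + t *\<^sub>R \<nu> \<in> cball a r}
    \<le> emeasure (slice_measure \<nu>) {y. y + t *\<^sub>R \<nu> \<in> cball a r}"
proof (cases "{y. y \<bullet> \<nu> = 0 \<and> y + t *\<^sub>R \<nu> \<in> cball a r} = {}")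
  case False
  let ?k = "DIM('a) - 1" and ?S = "{y. y \<bullet> \<nu> = 0 \<and> y + t *\<^sub>R \<nu> \<in> cball a r}"
  have n: "(dist a (y + t *\<^sub>R \<nu>))\<^sup>2 = (dist (perp_proj \<nu> a) y)\<^sup>2 + (t - a \<bullet> \<nu>)\<^sup>2" if "y \<bullet> \<nu> = 0" for y
  proof -
    have "perp_proj \<nu> (y + t *\<^sub>R \<nu> - a) = y - perp_proj \<nu> a" "(y + t *\<^sub>R \<nu> - a) \<bullet> \<nu> = t - a \<bullet> \<nu>"
      using that \<nu> by (auto simp: perp_proj_def inner_diff_left inner_add_left norm_eq_1 algebra_simps)
    then show ?thesis using norm_perp_proj_decomp[OF \<nu>, of "y + t *\<^sub>R \<nu> - a"]
      by (simp add: dist_norm norm_minus_commute)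
  qed
  obtain y0 where y0: "y0 \<bullet> \<nu> = 0" "dist a (y0 + t *\<^sub>R \<nu>) \<le> r" using False by auto
  have r: "0 \<le> r" using y0(2) zero_le_dist order_trans by blast
  define \<rho> where "\<rho> = sqrt (r\<^sup>2 - (t - a \<bullet> \<nu>)\<^sup>2)"
  have "(dist a (y0 + t *\<^sub>R \<nu>))\<^sup>2 \<le> r\<^sup>2" using y0(2) by (intro power_mono) auto
  \<comment> \<open>By Pythagoras the nonempty section has a nonnegative squared radius.\<close>
  then have q: "0 \<le> r\<^sup>2 - (t - a \<bullet> \<nu>)\<^sup>2" unfolding n[OF y0(1)] by (smt (verit) zero_le_power2)
  then have \<rho>: "0 \<le> \<rho>" "\<rho>\<^sup>2 = r\<^sup>2 - (t - a \<bullet> \<nu>)\<^sup>2" by (auto simp: \<rho>_def)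
  have mem: "y + t *\<^sub>R \<nu> \<in> cball a r \<longleftrightarrow> y \<in> cball (perp_proj \<nu> a) \<rho>" if "y \<bullet> \<nu> = 0" for y
  proof -
    have "dist a (y + t *\<^sub>R \<nu>) \<le> r \<longleftrightarrow> (dist a (y + t *\<^sub>R \<nu>))\<^sup>2 \<le> r\<^sup>2" using r by (simp add: power_mono_iff)
    also have "\<dots> \<longleftrightarrow> (dist (perp_proj \<nu> a) y)\<^sup>2 \<le> \<rho>\<^sup>2" unfolding n[OF that] \<rho>(2) by auto
    also have "\<dots> \<longleftrightarrow> dist (perp_proj \<nu> a) y \<le> \<rho>" using \<rho>(1) by (simp add: power_mono_iff)
    finally show ?thesis by simp
  qed
  have "?S \<subseteq> cball (perp_proj \<nu> a) \<rho>" using mem by auto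
  then have "diameter ?S \<le> diameter (cball (perp_proj \<nu> a) \<rho>)" by (intro diameter_subset) auto
  then have d: "diameter ?S / 2 \<le> \<rho>" using \<rho>(1) by (simp add: diameter_cball)
  have b: "bounded ?S" by (rule bounded_subset[OF bounded_cball \<open>?S \<subseteq> _\<close>])
  have "hausdorff_weight ?k ?S \<le> ennreal (unit_ball_vol (real ?k) * \<rho> ^ ?k)"
    using False d diameter_ge_0[OF b]
    by (auto simp: hausdorff_weight_def intro!: ennreal_leI mult_left_mono power_mono)
  also have "\<dots> = emeasure (slice_measure \<nu>) (cball (perp_proj \<nu> a) \<rho>)"
    using slice_measure_cball[OF \<nu> perp_proj_inner[OF \<nu>] \<rho>(1)] by simp
  also have "\<dots> = emeasure (slice_measure \<nu>) {y. y + t *\<^sub>R \<nu> \<in> cball a r}"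
  proof (rule emeasure_eq_AE)
    show "AE x in slice_measure \<nu>. (x \<in> cball (perp_proj \<nu> a) \<rho>) = (x \<in> {y. y + t *\<^sub>R \<nu> \<in> cball a r})"
      using slice_measure_AE_perp[OF \<nu>] by eventually_elim (use mem in auto)
    have "closed {y. y + t *\<^sub>R \<nu> \<in> cball a r}"
      unfolding mem_cball by (intro closed_Collect_le continuous_intros)
    then show "{y. y + t *\<^sub>R \<nu> \<in> cball a r} \<in> sets (slice_measure \<nu>)" by auto
  qed auto
  finally show ?thesis .
next
  case True
  show ?thesis unfolding True by simp
qed

text \<open>Balls covering the cylinder over \<open>E\<close> economically are cut at one height:
  their sections cover \<open>E\<close>, and section weights are bounded by flat measures. Averaging
  over the heights finds a level at which the sum of these measures is at most the total volume up
  to an error.\<close>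

lemma hausdorff_le_slice:
  fixes \<nu> :: "'a::euclidean_space"
  assumes \<nu>: "norm \<nu> = 1" and E[measurable]: "E \<in> sets borel" and perp: "\<And>y. y \<in> E \<Longrightarrow> y \<bullet> \<nu> = 0"
  shows "hausdorff_outer (DIM('a) - 1) E \<le> emeasure (slice_measure \<nu>) E"
proof (cases "emeasure (slice_measure \<nu>) E = \<infinity>")
  case False
  let ?k = "DIM('a) - 1" and ?M = "slice_measure \<nu>"
  define X where "X = {x. perp_proj \<nu> x \<in> E \<and> 0 \<le> x \<bullet> \<nu> \<and> x \<bullet> \<nu> \<le> 1}"
  have Xs: "X \<in> sets borel" unfolding X_def by measurable
  have MX: "emeasure ?M E = emeasure lborel X" by (simp add: emeasure_slice_measure X_def)
  have Xl: "X \<in> lmeasurable" using Xs False MX by (intro fmeasurableI) (auto simp: less_top)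
  have mX: "ennreal (measure lebesgue X) = emeasure ?M E"
  proof -
    have "measure lebesgue X = measure lborel X" using Xs by simp
    then show ?thesis using emeasure_eq_ennreal_measure[of lborel X] MX False by simp
  qed
  have "hausdorff_premeasure ?k \<delta> E \<le> emeasure ?M E" if \<delta>: "0 < \<delta>" for \<delta>
  proof (rule ennreal_le_epsilon)
    fix e :: real assume e: "0 < e"
    obtain b :: "nat \<Rightarrow> 'a \<times> real" where b: "\<And>n. snd (b n) \<le> \<delta> / 2" "X \<subseteq> (\<Union>n. cball (fst (b n)) (snd (b n)))"
      "(\<Sum>n. emeasure lborel (cball (fst (b n)) (snd (b n)))) \<le> ennreal (measure lebesgue X + e / 2)"
      using cball_cover[OF Xl, of "e / 2" "\<delta> / 2"] e \<delta> by auto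
    let ?Q = "\<lambda>n. cball (fst (b n)) (snd (b n))"
    let ?s = "\<lambda>n t. emeasure ?M {y. y + t *\<^sub>R \<nu> \<in> ?Q n}"
    have Qs: "{y. y + t *\<^sub>R \<nu> \<in> ?Q n} \<in> sets borel" for n t
      unfolding mem_cball by (intro borel_closed closed_Collect_le continuous_intros)
    have sI: "(\<integral>\<^sup>+y. indicator (?Q n) (y + t *\<^sub>R \<nu>) \<partial>?M) = ?s n t" for n t
      using Qs by (intro emeasure_eq_nn_integral[symmetric]) (auto simp: indicator_def)
    interpret S: sigma_finite_measure ?M by (rule sigma_finite_slice_measure[OF \<nu>])
    have ms: "?s n \<in> borel_measurable lborel" for n
    proof -
      have [measurable]: "?Q n \<in> sets borel" by simp
      have "(\<lambda>t. \<integral>\<^sup>+y. indicator (?Q n) (y + t *\<^sub>R \<nu>) \<partial>?M) \<in> borel_measurable lborel"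
        by (rule S.borel_measurable_nn_integral) (simp add: case_prod_unfold, measurable)
      then show ?thesis by (simp only: sI)
    qed
    \<comment> \<open>Otherwise the sum of the section measures would exceed the bound at each
      height in [0,1], and integration over the heights would contradict the total volume of the
      balls.\<close>
    have "\<exists>t. 0 \<le> t \<and> t \<le> 1 \<and> (\<Sum>n. ?s n t) \<le> ennreal (measure lebesgue X + e)"
    proof (rule ccontr)
      assume "\<not> ?thesis"
      then have big: "ennreal (measure lebesgue X + e) \<le> (\<Sum>n. ?s n t)" if "0 \<le> t" "t \<le> 1" for t
        using that by (meson linear)
      have "ennreal (measure lebesgue X + e) = (\<integral>\<^sup>+t. ennreal (measure lebesgue X + e) * indicator {0..1::real} t \<partial>lborel)"
        by (subst nn_integral_cmult_indicator) auto
      also have "\<dots> \<le> (\<integral>\<^sup>+t. (\<Sum>n. ?s n t) \<partial>lborel)"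
        by (intro nn_integral_mono) (auto simp: indicator_def intro: big simp del: mem_cball)
      also have "\<dots> = (\<Sum>n. \<integral>\<^sup>+t. ?s n t \<partial>lborel)"
        by (intro nn_integral_suminf ms)
      also have "\<dots> = (\<Sum>n. emeasure lborel (?Q n))"
      proof (intro suminf_cong)
        fix n
        have "emeasure lborel (?Q n) = (\<integral>\<^sup>+x. indicator (?Q n) x \<partial>lborel)" by simp
        also have "\<dots> = (\<integral>\<^sup>+t. \<integral>\<^sup>+y. indicator (?Q n) (y + t *\<^sub>R \<nu>) \<partial>?M \<partial>lborel)"
          by (rule nn_integral_slice[OF \<nu>]) (intro borel_measurable_indicator, simp)
        finally show "(\<integral>\<^sup>+t. ?s n t \<partial>lborel) = emeasure lborel (?Q n)" by (simp only: sI)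
      qed
      also have "\<dots> \<le> ennreal (measure lebesgue X + e / 2)" by (rule b(3))
      finally have "measure lebesgue X + e \<le> measure lebesgue X + e / 2"
        using e by (subst (asm) ennreal_le_iff) (auto intro!: add_nonneg_nonneg)
      then show False using e by simp
    qed
    then obtain t where t: "0 \<le> t" "t \<le> 1" "(\<Sum>n. ?s n t) \<le> ennreal (measure lebesgue X + e)" by blast
    let ?C = "\<lambda>n. {y. y \<bullet> \<nu> = 0 \<and> y + t *\<^sub>R \<nu> \<in> ?Q n}"
    have dist: "dist y z \<le> \<delta>" if "y \<in> ?C n" "z \<in> ?C n" for y z n
    proof -
      have "dist y z = dist (y + t *\<^sub>R \<nu>) (z + t *\<^sub>R \<nu>)" by (simp add: dist_norm)
      also have "\<dots> \<le> dist (fst (b n)) (y + t *\<^sub>R \<nu>) + dist (fst (b n)) (z + t *\<^sub>R \<nu>)"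
        by (metis dist_commute dist_triangle)
      also have "\<dots> \<le> \<delta>" using that b(1)[of n] by auto
      finally show ?thesis .
    qed
    have "hausdorff_premeasure ?k \<delta> E \<le> (\<Sum>n. hausdorff_weight ?k (?C n))"
    proof (rule hausdorff_premeasure_le)
      show "E \<subseteq> (\<Union>n. ?C n)"
      proof
        fix y assume y: "y \<in> E"
        have "y + t *\<^sub>R \<nu> \<in> X"
          using y t perp[OF y] \<nu> by (simp add: X_def perp_proj_add_scaleR perp_proj_id inner_add_left norm_eq_1)
        then obtain n where "y + t *\<^sub>R \<nu> \<in> ?Q n" using b(2) by blast
        then show "y \<in> (\<Union>n. ?C n)" using perp[OF y] by blast
      qed
      show "bounded (?C n)" for n
        unfolding bounded_def using dist by (cases "?C n = {}") blast+
      show "diameter (?C n) \<le> \<delta>" for n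
        using dist \<delta> by (intro diameter_le) (auto simp: dist_norm)
    qed
    also have "\<dots> \<le> (\<Sum>n. ?s n t)"
      by (intro suminf_le hausdorff_weight_cball_slice[OF \<nu>]) auto
    also have "\<dots> \<le> ennreal (measure lebesgue X + e)" by (rule t(3))
    also have "\<dots> = emeasure ?M E + ennreal e" using e by (simp add: mX)
    finally show "hausdorff_premeasure ?k \<delta> E \<le> emeasure ?M E + ennreal e" .
  qed
  then show ?thesis unfolding hausdorff_outer_def by (intro SUP_least) auto
qed simp

lemma hausdorff_eq_slice:
  fixes \<nu> :: "'a::euclidean_space"
  assumes "norm \<nu> = 1" "E \<in> sets borel" "\<And>y. y \<in> E \<Longrightarrow> y \<bullet> \<nu> = 0"
  shows "hausdorff_outer (DIM('a) - 1) E = emeasure (slice_measure \<nu>) E"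
  using slice_le_hausdorff[OF assms(1,2)] hausdorff_le_slice[OF assms] by (rule antisym[rotated])

section \<open>Normals and cones\<close>

text \<open>Up to distance \<open>\<delta>\<close> the set is trapped between two cones with apex
  \<open>a\<close>, axis \<open>\<nu>\<close> and opening given by \<open>\<epsilon>\<close>. This
  quantifies differentiability of the boundary at one scale and without a chart.\<close>

definition pinched_at :: "'a::euclidean_space set \<Rightarrow> 'a \<Rightarrow> real \<Rightarrow> real \<Rightarrow> 'a \<Rightarrow> bool" where
  "pinched_at \<Omega> \<nu> \<epsilon> \<delta> a \<longleftrightarrow> (\<forall>x. dist x a < \<delta> \<longrightarrow>
     (\<nu> \<bullet> (x - a) < - \<epsilon> * norm (x - a) \<longrightarrow> x \<in> \<Omega>) \<and> (\<nu> \<bullet> (x - a) > \<epsilon> * norm (x - a) \<longrightarrow> x \<notin> \<Omega>))"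

definition unit_normal_at :: "'a::euclidean_space set \<Rightarrow> 'a \<Rightarrow> 'a \<Rightarrow> bool" where
  "unit_normal_at \<Omega> a \<nu> \<longleftrightarrow> norm \<nu> = 1 \<and> (\<forall>\<epsilon>>0. \<exists>\<delta>>0. pinched_at \<Omega> \<nu> \<epsilon> \<delta> a)"

text \<open>The uniform cone property of Lipschitz domains. A full ball of directions is kept
  because it provides both quantitative transversality and enough directions to span the space;
  \<open>c < norm w0\<close> keeps the zero vector out.\<close>

definition cone_patch :: "'a::euclidean_space set \<Rightarrow> 'a \<Rightarrow> real \<Rightarrow> 'a \<Rightarrow> real \<Rightarrow> bool" where
  "cone_patch \<Omega> z r w0 c \<longleftrightarrow> 0 < r \<and> 0 < c \<and> c < norm w0 \<and>
     (\<forall>w\<in>ball w0 c. \<forall>x\<in>\<Omega> \<inter> ball z r. \<forall>s>0. x - s *\<^sub>R w \<in> ball z r \<longrightarrow> x - s *\<^sub>R w \<in> \<Omega>)"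

text \<open>The outer cone, cut off at distance \<open>\<delta>\<close>, is open and misses
  \<open>\<Omega>\<close>, hence also its closure; the inner cone lies in the open set
  \<open>\<Omega>\<close>, which contains no frontier points.\<close>

lemma pinched_at_frontier:
  assumes "open \<Omega>" "pinched_at \<Omega> \<nu> \<epsilon> \<delta> a" "x \<in> frontier \<Omega>" "dist x a < \<delta>"
  shows "\<bar>\<nu> \<bullet> (x - a)\<bar> \<le> \<epsilon> * norm (x - a)"
proof -
  have x: "x \<notin> \<Omega>" "x \<in> closure \<Omega>" using assms(1,3) by (auto simp: frontier_def interior_open)
  have 1: "\<not> \<nu> \<bullet> (x - a) < - \<epsilon> * norm (x - a)" using assms(2,4) x(1) by (auto simp: pinched_at_def)
  have 2: "\<not> \<nu> \<bullet> (x - a) > \<epsilon> * norm (x - a)"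
  proof
    assume "\<nu> \<bullet> (x - a) > \<epsilon> * norm (x - a)"
    then have "x \<in> {x. dist x a < \<delta> \<and> \<nu> \<bullet> (x - a) > \<epsilon> * norm (x - a)}" using assms(4) by simp
    moreover have "open {x. dist x a < \<delta> \<and> \<nu> \<bullet> (x - a) > \<epsilon> * norm (x - a)}"
      by (intro open_Collect_conj open_Collect_less continuous_intros)
    ultimately have "\<Omega> \<inter> {x. dist x a < \<delta> \<and> \<nu> \<bullet> (x - a) > \<epsilon> * norm (x - a)} \<noteq> {}"
      using x(2) unfolding closure_iff_nhds_not_empty by (metis subset_refl)
    then show False using assms(2) by (auto simp: pinched_at_def)
  qed
  show ?thesis using 1 2 by (simp add: abs_le_iff)
qed

text \<open>For each fixed \<open>x\<close> the violation of pinching is an open condition on the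
  apex \<open>a\<close>. This is where Borel measurability of the flat boundary pieces comes
  from.\<close>

lemma closed_pinched:
  assumes "closed S"
  shows "closed {a \<in> S. pinched_at \<Omega> \<nu> \<epsilon> \<delta> a}"
proof -
  define P where "P x = {a. dist x a < \<delta> \<and> \<nu> \<bullet> (x - a) < - \<epsilon> * norm (x - a)}" for x
  define Q where "Q x = {a. dist x a < \<delta> \<and> \<nu> \<bullet> (x - a) > \<epsilon> * norm (x - a)}" for x
  have o: "open (P x)" "open (Q x)" for x
    unfolding P_def Q_def by (intro open_Collect_conj open_Collect_less continuous_intros)+
  have "{a \<in> S. pinched_at \<Omega> \<nu> \<epsilon> \<delta> a} = S \<inter> ((\<Inter>x\<in>- \<Omega>. - P x) \<inter> (\<Inter>x\<in>\<Omega>. - Q x))"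
    unfolding pinched_at_def P_def Q_def by blast
  then show ?thesis using assms o by (auto intro!: closed_Int closed_INT)
qed

text \<open>Test points are taken along \<open>v = \<nu> - n\<close>. Since
  \<open>n \<bullet> v = - (norm v)\<^sup>2 / 2\<close>, short steps along \<open>v\<close> enter
  \<open>\<Omega>\<close>; since \<open>\<nu> \<bullet> v\<close> has the opposite value, pinching
  forces \<open>(norm v)\<^sup>2 / 2\<close> to be at most
  \<open>\<epsilon> * norm v\<close>.\<close>

lemma unit_normal_at_close:
  assumes n: "unit_normal_at \<Omega> a n" and p: "pinched_at \<Omega> \<nu> \<epsilon> \<delta> a" and \<nu>: "norm \<nu> = 1" and \<delta>: "0 < \<delta>" and \<epsilon>: "0 \<le> \<epsilon>"
  shows "norm (\<nu> - n) \<le> 2 * \<epsilon>"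
proof (cases "\<nu> = n")
  case False
  define v where "v = \<nu> - n"
  have nv: "norm v > 0" using False by (simp add: v_def)
  have n1: "norm n = 1" using n by (simp add: unit_normal_at_def)
  have sq: "(norm v)\<^sup>2 = 2 - 2 * (\<nu> \<bullet> n)"
    using n1 \<nu> unfolding power2_norm_eq_inner v_def
    by (simp add: inner_diff_left inner_diff_right norm_eq_1 inner_commute)
  have vn: "n \<bullet> v = - (norm v)\<^sup>2 / 2" and v\<nu>: "\<nu> \<bullet> v = (norm v)\<^sup>2 / 2"
    using n1 \<nu> unfolding sq by (auto simp: v_def inner_diff_right norm_eq_1 inner_commute)
  obtain \<delta>' where \<delta>': "0 < \<delta>'" "pinched_at \<Omega> n (norm v / 4) \<delta>' a"
    using n nv unfolding unit_normal_at_def by (metis divide_pos_pos zero_less_numeral)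
  define t where "t = min \<delta> \<delta>' / (2 * norm v)"
  have t: "0 < t" "t * norm v < \<delta>" "t * norm v < \<delta>'" using \<delta> \<delta>'(1) nv by (auto simp: t_def)
  have ntv: "norm (t *\<^sub>R v) = t * norm v" using t(1) by simp
  have "- (norm v / 4) * norm (t *\<^sub>R v) = - (t * (norm v)\<^sup>2) / 4" using t(1) by (simp add: power2_eq_square)
  moreover have "n \<bullet> (t *\<^sub>R v) = - (t * (norm v)\<^sup>2) / 2" by (simp add: vn)
  moreover have "0 < t * (norm v)\<^sup>2" using t(1) nv by simp
  ultimately have "n \<bullet> (t *\<^sub>R v) < - (norm v / 4) * norm (t *\<^sub>R v)" by linarith
  then have "a + t *\<^sub>R v \<in> \<Omega>" using \<delta>'(2) t ntv unfolding pinched_at_def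
    by (auto simp: dist_norm dest!: spec[of _ "a + t *\<^sub>R v"])
  then have "\<not> \<nu> \<bullet> (t *\<^sub>R v) > \<epsilon> * norm (t *\<^sub>R v)" using p t ntv unfolding pinched_at_def
    by (auto simp: dist_norm dest!: spec[of _ "a + t *\<^sub>R v"])
  moreover have "\<nu> \<bullet> (t *\<^sub>R v) = t * ((norm v)\<^sup>2 / 2)" by (simp add: v\<nu>)
  moreover have "\<epsilon> * norm (t *\<^sub>R v) = t * (\<epsilon> * norm v)" unfolding ntv by simp
  ultimately have "t * ((norm v)\<^sup>2 / 2) \<le> t * (\<epsilon> * norm v)" by linarith
  then have "(norm v)\<^sup>2 / 2 \<le> \<epsilon> * norm v" using t(1) by (simp only: mult_le_cancel_left_pos)
  then have "norm v * norm v \<le> (2 * \<epsilon>) * norm v" by (simp add: power2_eq_square)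
  then have "norm v \<le> 2 * \<epsilon>" using nv by (simp only: mult_le_cancel_right_pos)
  then show ?thesis by (simp add: v_def)
qed (use \<epsilon> in simp)

lemma unit_normal_at_unique:
  assumes "unit_normal_at \<Omega> a n" "unit_normal_at \<Omega> a n'"
  shows "n = n'"
proof -
  have "norm (n' - n) \<le> 2 * (e / 2)" if e: "0 < e" for e
  proof -
    obtain \<delta> where "0 < \<delta>" "pinched_at \<Omega> n' (e / 2) \<delta> a" using assms(2) e unfolding unit_normal_at_def
      by (metis half_gt_zero)
    then show ?thesis using assms e by (intro unit_normal_at_close) (auto simp: unit_normal_at_def)
  qed
  then have "norm (n' - n) \<le> 0 + e" if "0 < e" for e using that by simp
  then have "norm (n' - n) \<le> 0" by (rule field_le_epsilon)
  then show ?thesis by simp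
qed

text \<open>A nearby point \<open>x'\<close> of \<open>\<Omega>\<close> replaces \<open>x\<close>,
  and the displacement is absorbed into the direction: \<open>w'\<close> leads from
  \<open>x'\<close> to the same end point and is still admissible.\<close>

lemma cone_patch_closure:
  assumes p: "cone_patch \<Omega> z r w0 c" and w: "w \<in> ball w0 c" and x: "x \<in> closure \<Omega>" "x \<in> ball z r"
    and s: "0 < s" and y: "x - s *\<^sub>R w \<in> ball z r"
  shows "x - s *\<^sub>R w \<in> \<Omega>"
proof -
  define e where "e = min (s * (c - dist w0 w)) (r - dist z x)"
  have e: "0 < e" using w x(2) s by (auto simp: e_def)
  obtain x' where x': "x' \<in> \<Omega>" "dist x' x < e" using x(1) e by (meson closure_approachable)
  define w' where "w' = w + (1 / s) *\<^sub>R (x' - x)"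
  have "dist w0 w' \<le> dist w0 w + norm ((1 / s) *\<^sub>R (x' - x))"
    unfolding w'_def dist_norm by (metis add_diff_eq diff_diff_eq norm_triangle_ineq4)
  also have "norm ((1 / s) *\<^sub>R (x' - x)) = dist x' x / s" using s by (simp add: dist_norm)
  also have "dist x' x / s < c - dist w0 w" using x'(2) s by (simp add: e_def field_simps)
  finally have "w' \<in> ball w0 c" by simp
  moreover have "dist z x' \<le> dist z x + dist x' x" by (metis dist_commute dist_triangle)
  then have "x' \<in> ball z r" using x'(2) by (simp add: e_def)
  moreover have "x' - s *\<^sub>R w' = x - s *\<^sub>R w" using s by (simp add: w'_def algebra_simps)
  ultimately show ?thesis using p s y x'(1) unfolding cone_patch_def by (metis IntI)
qed

text \<open>If \<open>n \<bullet> w\<close> were negative, small steps along \<open>- w\<close>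
  would lead into \<open>\<Omega>\<close> and, at the same time, into the outer cone. So the product
  is nonnegative on the whole ball of directions; testing with \<open>w - c' *\<^sub>R n\<close>
  turns this into a positive lower bound.\<close>

lemma cone_patch_normal:
  assumes p: "cone_patch \<Omega> z r w0 c" and w: "w \<in> ball w0 c" and a: "a \<in> closure \<Omega>" "a \<in> ball z r"
    and n: "unit_normal_at \<Omega> a n"
  shows "c - dist w0 w \<le> n \<bullet> w"
proof -
  have nonneg: "0 \<le> n \<bullet> w" if w: "w \<in> ball w0 c" for w
  proof (rule ccontr)
    assume neg: "\<not> 0 \<le> n \<bullet> w"
    then have w0: "w \<noteq> 0" by auto
    define \<epsilon> where "\<epsilon> = - (n \<bullet> w) / (2 * norm w)"
    have \<epsilon>: "0 < \<epsilon>" unfolding \<epsilon>_def by (intro divide_pos_pos) (use neg w0 in auto)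
    then obtain \<delta> where \<delta>: "0 < \<delta>" "pinched_at \<Omega> n \<epsilon> \<delta> a" using n by (auto simp: unit_normal_at_def)
    define s where "s = min \<delta> (r - dist z a) / (2 * norm w)"
    have s: "0 < s" "s * norm w < \<delta>" "s * norm w < r - dist z a"
      using \<delta>(1) a(2) w0 by (auto simp: s_def)
    have "dist z (a - s *\<^sub>R w) \<le> dist z a + norm (s *\<^sub>R w)"
      by (metis diff_diff_eq2 diff_diff_add dist_norm norm_triangle_ineq add.commute diff_add_eq)
    then have "a - s *\<^sub>R w \<in> ball z r" using s by simp
    then have in\<Omega>: "a - s *\<^sub>R w \<in> \<Omega>" by (intro cone_patch_closure[OF p w a s(1)])
    have "\<epsilon> * norm (- (s *\<^sub>R w)) = - (s * (n \<bullet> w)) / 2" using w0 s(1) by (simp add: \<epsilon>_def field_simps)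
    moreover have "0 < - (s * (n \<bullet> w))" using neg s(1) by (simp add: mult_pos_neg)
    ultimately have "n \<bullet> (- (s *\<^sub>R w)) > \<epsilon> * norm (- (s *\<^sub>R w))" by simp
    then show False using \<delta>(2) s in\<Omega> unfolding pinched_at_def
      by (auto simp: dist_norm dest!: spec[of _ "a - s *\<^sub>R w"])
  qed
  have nn: "n \<bullet> n = 1" using n by (simp add: unit_normal_at_def norm_eq_1)
  show ?thesis
  proof (rule field_le_epsilon)
    fix e :: real assume e: "0 < e"
    \<comment> \<open>Slightly below the distance of \<open>w\<close> to the boundary of the ball of
      directions, and nonnegative even for large \<open>e\<close>.\<close>
    define c' where "c' = c - dist w0 w - min e (c - dist w0 w)"
    have c': "0 \<le> c'" "c' < c - dist w0 w" "c - dist w0 w \<le> c' + e" using e w by (auto simp: c'_def)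
    have "dist w0 (w - c' *\<^sub>R n) \<le> dist w0 w + norm (c' *\<^sub>R n)"
      by (metis diff_diff_eq2 diff_diff_add dist_norm norm_triangle_ineq add.commute diff_add_eq)
    also have "norm (c' *\<^sub>R n) = c'" using c' n by (simp add: unit_normal_at_def)
    finally have "w - c' *\<^sub>R n \<in> ball w0 c" using c' by simp
    from nonneg[OF this] have "c' \<le> n \<bullet> w" by (simp add: inner_diff_right nn)
    then show "c - dist w0 w \<le> n \<bullet> w + e" using c' by simp
  qed
qed

section \<open>Oblique projections\<close>

definition oblique_proj :: "'a::euclidean_space \<Rightarrow> 'a \<Rightarrow> 'a \<Rightarrow> 'a" where
  "oblique_proj \<nu> w x = x - ((x \<bullet> \<nu>) / (w \<bullet> \<nu>)) *\<^sub>R w"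

lemma oblique_proj_measurable [measurable]: "oblique_proj \<nu> w \<in> borel_measurable borel"
  unfolding oblique_proj_def by measurable

lemma oblique_proj_inner: "w \<bullet> \<nu> \<noteq> 0 \<Longrightarrow> oblique_proj \<nu> w x \<bullet> \<nu> = 0"
  by (simp add: oblique_proj_def inner_diff_left)

lemma oblique_proj_add_scaleR: "w \<bullet> \<nu> \<noteq> 0 \<Longrightarrow> oblique_proj \<nu> w (x + t *\<^sub>R w) = oblique_proj \<nu> w x"
  by (simp add: oblique_proj_def inner_add_left add_divide_distrib algebra_simps)

lemma oblique_proj_id: "x \<bullet> \<nu> = 0 \<Longrightarrow> oblique_proj \<nu> w x = x"
  by (simp add: oblique_proj_def)

lemma perp_proj_sgn_add:
  assumes "w \<noteq> 0"
  shows "perp_proj (sgn w) (x + t *\<^sub>R w) = perp_proj (sgn w) x"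
proof -
  have "w = norm w *\<^sub>R sgn w" using assms by (simp add: sgn_div_norm)
  then have "x + t *\<^sub>R w = x + (t * norm w) *\<^sub>R sgn w" by (metis scaleR_scaleR)
  then show ?thesis using perp_proj_add_scaleR[of "sgn w" x "t * norm w"] assms by (simp add: norm_sgn)
qed

lemma perp_proj_oblique:
  assumes "w \<noteq> 0"
  shows "perp_proj (sgn w) (oblique_proj \<nu> w x) = perp_proj (sgn w) x"
  using perp_proj_sgn_add[OF assms, of x "- ((x \<bullet> \<nu>) / (w \<bullet> \<nu>))"] by (simp add: oblique_proj_def)

lemma oblique_perp_proj:
  assumes "w \<bullet> \<nu> \<noteq> 0"
  shows "oblique_proj \<nu> w (perp_proj (sgn w) x) = oblique_proj \<nu> w x"
proof -
  have "w \<noteq> 0" using assms by auto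
  have "perp_proj (sgn w) x = x + (- ((x \<bullet> sgn w) / norm w)) *\<^sub>R w"
    by (simp add: perp_proj_def sgn_div_norm divide_inverse mult_ac)
  then show ?thesis using oblique_proj_add_scaleR[OF assms] by metis
qed

text \<open>Rewriting the image as a preimage makes it Borel for Borel \<open>E\<close>.\<close>

lemma perp_proj_image_eq:
  assumes w: "w \<bullet> \<nu> \<noteq> 0" and E: "\<And>x. x \<in> E \<Longrightarrow> x \<bullet> \<nu> = 0"
  shows "perp_proj (sgn w) ` E = {y. y \<bullet> sgn w = 0 \<and> oblique_proj \<nu> w y \<in> E}"
proof (intro set_eqI iffI)
  have w0: "w \<noteq> 0" using w by auto
  fix y
  show "y \<in> perp_proj (sgn w) ` E \<Longrightarrow> y \<in> {y. y \<bullet> sgn w = 0 \<and> oblique_proj \<nu> w y \<in> E}"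
    using w w0 E by (auto simp: oblique_perp_proj oblique_proj_id perp_proj_inner norm_sgn)
  assume y: "y \<in> {y. y \<bullet> sgn w = 0 \<and> oblique_proj \<nu> w y \<in> E}"
  then have "perp_proj (sgn w) (oblique_proj \<nu> w y) = y" by (simp add: perp_proj_oblique w0 perp_proj_id)
  then show "y \<in> perp_proj (sgn w) ` E" using y by (metis (no_types, lifting) image_eqI mem_Collect_eq)
qed

text \<open>Both sides are the volume of the cylinder with base \<open>E\<close> and edge \<open>w\<close>.\<close>

lemma slice_measure_oblique:
  fixes \<nu> w :: "'a::euclidean_space"
  assumes \<nu>: "norm \<nu> = 1" and w: "w \<bullet> \<nu> > 0" and E[measurable]: "E \<in> sets borel" and perp: "\<And>x. x \<in> E \<Longrightarrow> x \<bullet> \<nu> = 0"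
  shows "ennreal (norm w) * emeasure (slice_measure (sgn w)) (perp_proj (sgn w) ` E)
       = ennreal (w \<bullet> \<nu>) * emeasure (slice_measure \<nu>) E"
proof -
  let ?u = "sgn w" and ?q = "w \<bullet> \<nu>"
  have w0: "w \<noteq> 0" using w by auto
  have u: "norm ?u = 1" using w0 by (simp add: norm_sgn)
  have uw: "?u \<bullet> \<nu> = ?q / norm w" by (simp add: sgn_div_norm divide_inverse mult.commute)
  have nw: "norm w > 0" using w0 by simp
  \<comment> \<open>The oblique cylinder; it is measured once by lines along \<open>w\<close> and
    once by hyperplanes orthogonal to \<open>\<nu>\<close>.\<close>
  define Q where "Q = {x. oblique_proj \<nu> w x \<in> E \<and> 0 \<le> x \<bullet> \<nu> \<and> x \<bullet> \<nu> \<le> ?q}"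
  have Q[measurable]: "Q \<in> sets borel" unfolding Q_def by measurable
  define E' where "E' = perp_proj ?u ` E"
  have E': "E' = {y. y \<bullet> ?u = 0 \<and> oblique_proj \<nu> w y \<in> E}"
    unfolding E'_def using w perp by (intro perp_proj_image_eq) auto
  have [measurable]: "E' \<in> sets borel" unfolding E' by measurable
  have iQ: "indicator Q \<in> borel_measurable borel" by measurable
  have "emeasure lborel Q = (\<integral>\<^sup>+x. indicator Q x \<partial>lborel)" by simp
  also have "\<dots> = (\<integral>\<^sup>+y. \<integral>\<^sup>+t. indicator Q (y + t *\<^sub>R ?u) \<partial>lborel \<partial>slice_measure ?u)"
    by (rule nn_integral_slice(1)[OF u iQ])
  also have "\<dots> = (\<integral>\<^sup>+y. ennreal (norm w) * indicator E' y \<partial>slice_measure ?u)"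
  proof (rule nn_integral_cong_AE)
    show "AE y in slice_measure ?u. (\<integral>\<^sup>+t. indicator Q (y + t *\<^sub>R ?u) \<partial>lborel) = ennreal (norm w) * indicator E' y"
      using slice_measure_AE_perp[OF u]
    proof eventually_elim
      case (elim y)
      have o: "oblique_proj \<nu> w (y + t *\<^sub>R ?u) = oblique_proj \<nu> w y" for t
        using oblique_proj_add_scaleR[of w \<nu> y "t / norm w"] w by (simp add: sgn_div_norm divide_inverse)
      show ?case
      proof (cases "y \<in> E'")
        case True
        \<comment> \<open>The parameter at which the line enters the slab; it leaves after length
          \<open>norm w\<close>.\<close>
        define \<tau> where "\<tau> = - (y \<bullet> \<nu>) * norm w / ?q"
        have "y + t *\<^sub>R ?u \<in> Q \<longleftrightarrow> t \<in> {\<tau>..\<tau> + norm w}" for t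
        proof -
          have "0 \<le> (y + t *\<^sub>R ?u) \<bullet> \<nu> \<longleftrightarrow> \<tau> \<le> t"
            using w nw by (simp add: \<tau>_def inner_add_left uw field_simps) linarith
          moreover have "(y + t *\<^sub>R ?u) \<bullet> \<nu> \<le> ?q \<longleftrightarrow> t \<le> \<tau> + norm w"
            using w nw by (simp add: \<tau>_def inner_add_left uw field_simps)
          ultimately show ?thesis using True o[of t] by (auto simp: Q_def E')
        qed
        then have "(\<lambda>t. indicator Q (y + t *\<^sub>R ?u)) = (indicator {\<tau>..\<tau> + norm w} :: real \<Rightarrow> ennreal)"
          by (auto simp: indicator_def fun_eq_iff)
        then show ?thesis using True nw by simp
      next
        case False
        then have "y + t *\<^sub>R ?u \<notin> Q" for t using o[of t] elim by (auto simp: Q_def E')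
        then show ?thesis using False by simp
      qed
    qed
  qed
  also have "\<dots> = ennreal (norm w) * emeasure (slice_measure ?u) E'"
    by (subst nn_integral_cmult_indicator) auto
  finally have 1: "emeasure lborel Q = ennreal (norm w) * emeasure (slice_measure ?u) E'" .
  \<comment> \<open>The section of \<open>Q\<close> at height \<open>t\<close> is \<open>E\<close>
    translated by \<open>- t *\<^sub>R v0\<close> within the hyperplane, so all sections have equal
    measure.\<close>
  define v0 where "v0 = \<nu> - (1 / ?q) *\<^sub>R w"
  have v0: "v0 \<bullet> \<nu> = 0" using \<nu> w by (simp add: v0_def inner_diff_left norm_eq_1)
  have "emeasure lborel Q = (\<integral>\<^sup>+x. indicator Q x \<partial>lborel)" by simp
  also have "\<dots> = (\<integral>\<^sup>+t. \<integral>\<^sup>+y. indicator Q (y + t *\<^sub>R \<nu>) \<partial>slice_measure \<nu> \<partial>lborel)"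
    by (rule nn_integral_slice(2)[OF \<nu> iQ])
  also have "\<dots> = (\<integral>\<^sup>+t. emeasure (slice_measure \<nu>) E * indicator {0..?q} t \<partial>lborel)"
  proof (rule nn_integral_cong)
    fix t :: real
    have "(\<integral>\<^sup>+y. indicator Q (y + t *\<^sub>R \<nu>) \<partial>slice_measure \<nu>)
        = (\<integral>\<^sup>+y. indicator {y. y + t *\<^sub>R v0 \<in> E} y * indicator {0..?q} t \<partial>slice_measure \<nu>)"
    proof (rule nn_integral_cong_AE)
      show "AE y in slice_measure \<nu>. indicator Q (y + t *\<^sub>R \<nu>)
          = (indicator {y. y + t *\<^sub>R v0 \<in> E} y * indicator {0..?q} t :: ennreal)"
        using slice_measure_AE_perp[OF \<nu>]
      proof eventually_elim
        case (elim y)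
        have i: "(y + t *\<^sub>R \<nu>) \<bullet> \<nu> = t" using elim \<nu> by (simp add: inner_add_left norm_eq_1)
        have "oblique_proj \<nu> w (y + t *\<^sub>R \<nu>) = y + t *\<^sub>R v0"
          unfolding oblique_proj_def i by (simp add: v0_def algebra_simps)
        then show ?case using i by (auto simp: Q_def indicator_def)
      qed
    qed
    also have "\<dots> = emeasure (slice_measure \<nu>) {y. y + t *\<^sub>R v0 \<in> E} * indicator {0..?q} t"
      by (subst nn_integral_multc) auto
    also have "emeasure (slice_measure \<nu>) {y. y + t *\<^sub>R v0 \<in> E} = emeasure (slice_measure \<nu>) E"
      by (rule slice_measure_shift[OF \<nu>]) (auto simp: v0)
    finally show "(\<integral>\<^sup>+y. indicator Q (y + t *\<^sub>R \<nu>) \<partial>slice_measure \<nu>) = emeasure (slice_measure \<nu>) E * indicator {0..?q} t" .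
  qed
  also have "\<dots> = ennreal ?q * emeasure (slice_measure \<nu>) E"
    using w by (subst nn_integral_cmult_indicator) (auto simp: mult.commute)
  finally show ?thesis using 1 by (simp add: E'_def)
qed

text \<open>On a flat piece the oblique projection along \<open>w\<close> changes differences by a
  relative error of at most \<open>\<kappa>\<close>, so it distorts Hausdorff measure by factors
  between \<open>(1 - \<kappa>) ^ k\<close> and \<open>(1 + \<kappa>) ^ k\<close>. The projected set
  lies in a hyperplane, where Hausdorff and slice measure agree and the volume of the oblique
  cylinder gives the factor \<open>w \<bullet> \<nu>\<close>.\<close>

lemma pinched_piece_measure:
  fixes \<nu> w :: "'a::euclidean_space"
  assumes \<nu>: "norm \<nu> = 1" and w: "0 < c1" "c1 \<le> w \<bullet> \<nu>"
    and A: "perp_proj (sgn w) ` A \<in> sets borel"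
    and flat: "\<And>a a'. a \<in> A \<Longrightarrow> a' \<in> A \<Longrightarrow> \<bar>\<nu> \<bullet> (a - a')\<bar> \<le> \<epsilon> * norm (a - a')"
    and \<epsilon>: "0 \<le> \<epsilon>"
  defines "\<kappa> \<equiv> \<epsilon> * norm w / c1" and "k \<equiv> DIM('a) - 1"
  shows "ennreal (norm w) * emeasure (slice_measure (sgn w)) (perp_proj (sgn w) ` A)
       \<le> ennreal ((w \<bullet> \<nu>) * (1 + \<kappa>) ^ k) * hausdorff_outer k A" (is ?A)
    and "\<kappa> < 1 \<Longrightarrow> ennreal ((w \<bullet> \<nu>) * (1 - \<kappa>) ^ k) * hausdorff_outer k A
       \<le> ennreal (norm w) * emeasure (slice_measure (sgn w)) (perp_proj (sgn w) ` A)" (is "_ \<Longrightarrow> ?B")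
proof -
  let ?\<pi> = "oblique_proj \<nu> w" and ?u = "sgn w" and ?q = "w \<bullet> \<nu>"
  have q: "?q > 0" using w by linarith
  have w0: "w \<noteq> 0" using q by auto
  have \<kappa>: "0 \<le> \<kappa>" using \<epsilon> w by (simp add: \<kappa>_def)
  define E where "E = ?\<pi> ` A"
  have perp: "x \<bullet> \<nu> = 0" if "x \<in> E" for x using that q by (auto simp: E_def oblique_proj_inner)
  have pE: "perp_proj ?u ` E = perp_proj ?u ` A"
    unfolding E_def image_image perp_proj_oblique[OF w0] ..
  \<comment> \<open>Points of the hyperplane are determined by their shadows along \<open>w\<close>,
    so \<open>E\<close> inherits Borel measurability from the shadow of \<open>A\<close>.\<close>
  have "E = {y. y \<bullet> \<nu> = 0 \<and> perp_proj ?u y \<in> perp_proj ?u ` A}"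
  proof (intro set_eqI iffI)
    fix y assume "y \<in> E"
    then show "y \<in> {y. y \<bullet> \<nu> = 0 \<and> perp_proj ?u y \<in> perp_proj ?u ` A}" using perp pE by blast
  next
    fix y assume y: "y \<in> {y. y \<bullet> \<nu> = 0 \<and> perp_proj ?u y \<in> perp_proj ?u ` A}"
    then obtain a where a: "a \<in> A" "perp_proj ?u y = perp_proj ?u a" by auto
    have "y = ?\<pi> y" using y by (simp add: oblique_proj_id)
    also have "\<dots> = ?\<pi> (perp_proj ?u y)" using q by (simp add: oblique_perp_proj)
    also have "\<dots> = ?\<pi> a" unfolding a(2) using q by (simp add: oblique_perp_proj)
    finally show "y \<in> E" using a(1) by (auto simp: E_def)
  qed
  also have "\<dots> \<in> sets borel" using A by measurable
  finally have E: "E \<in> sets borel" .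
  have main: "ennreal (norm w) * emeasure (slice_measure ?u) (perp_proj ?u ` A) = ennreal ?q * hausdorff_outer k E"
    using slice_measure_oblique[OF \<nu> q E perp] hausdorff_eq_slice[OF \<nu> E perp] by (simp add: pE k_def)
  have diff: "norm ((?\<pi> a - ?\<pi> a') - (a - a')) \<le> \<kappa> * norm (a - a')" if "a \<in> A" "a' \<in> A" for a a'
  proof -
    have "(?\<pi> a - ?\<pi> a') - (a - a') = - ((\<nu> \<bullet> (a - a') / ?q) *\<^sub>R w)"
      by (simp add: oblique_proj_def inner_diff_right inner_commute algebra_simps diff_divide_distrib)
    then have "norm ((?\<pi> a - ?\<pi> a') - (a - a')) = \<bar>\<nu> \<bullet> (a - a')\<bar> / ?q * norm w" using q by simp
    also have "\<dots> \<le> (\<epsilon> * norm (a - a')) / c1 * norm w"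
      using flat[OF that] w \<epsilon> by (intro mult_right_mono frac_le) auto
    finally show ?thesis by (simp add: \<kappa>_def mult_ac)
  qed
  have up: "norm (?\<pi> a - ?\<pi> a') \<le> (1 + \<kappa>) * norm (a - a')" if "a \<in> A" "a' \<in> A" for a a'
    using diff[OF that] norm_triangle_sub[of "?\<pi> a - ?\<pi> a'" "a - a'"] by (simp add: algebra_simps)
  have lo: "(1 - \<kappa>) * norm (a - a') \<le> norm (?\<pi> a - ?\<pi> a')" if "a \<in> A" "a' \<in> A" for a a'
    using diff[OF that] norm_triangle_sub[of "a - a'" "?\<pi> a - ?\<pi> a'"] by (simp add: algebra_simps norm_minus_commute)
  have "hausdorff_outer k E \<le> ennreal ((1 + \<kappa>) ^ k) * hausdorff_outer k A"
    unfolding E_def using up \<kappa>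
    by (intro hausdorff_outer_lipschitz_image lipschitz_onI) (auto simp: dist_norm)
  then have "ennreal ?q * hausdorff_outer k E \<le> ennreal ?q * (ennreal ((1 + \<kappa>) ^ k) * hausdorff_outer k A)"
    by (rule mult_left_mono) simp
  also have "\<dots> = ennreal (?q * (1 + \<kappa>) ^ k) * hausdorff_outer k A"
    using q \<kappa> by (simp add: ennreal_mult mult.assoc)
  finally show ?A unfolding main .
  assume \<kappa>1: "\<kappa> < 1"
  have inj: "inj_on ?\<pi> A"
  proof (rule inj_onI)
    fix a a' assume a: "a \<in> A" "a' \<in> A" "?\<pi> a = ?\<pi> a'"
    then have "(1 - \<kappa>) * norm (a - a') \<le> 0" using lo[OF a(1,2)] by simp
    then show "a = a'" using \<kappa>1 by (simp add: mult_le_0_iff)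
  qed
  define g where "g = inv_into A ?\<pi>"
  have gE: "g ` E = A" unfolding g_def E_def using inj by (simp add: image_image)
  have "hausdorff_outer k (g ` E) \<le> ennreal ((1 / (1 - \<kappa>)) ^ k) * hausdorff_outer k E"
  proof (intro hausdorff_outer_lipschitz_image lipschitz_onI)
    fix x y assume "x \<in> E" "y \<in> E"
    then obtain a a' where a: "a \<in> A" "a' \<in> A" "x = ?\<pi> a" "y = ?\<pi> a'" by (auto simp: E_def)
    then have "g x = a" "g y = a'" using inj by (auto simp: g_def)
    then show "dist (g x) (g y) \<le> 1 / (1 - \<kappa>) * dist x y"
      using lo[OF a(1,2)] \<kappa>1 a by (simp add: dist_norm field_simps)
  qed (use \<kappa>1 in auto)
  then have "ennreal (?q * (1 - \<kappa>) ^ k) * hausdorff_outer k A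
      \<le> ennreal (?q * (1 - \<kappa>) ^ k) * (ennreal ((1 / (1 - \<kappa>)) ^ k) * hausdorff_outer k E)"
    unfolding gE by (rule mult_left_mono) simp
  also have "\<dots> = ennreal (?q * (1 - \<kappa>) ^ k * (1 / (1 - \<kappa>)) ^ k) * hausdorff_outer k E"
    using q \<kappa>1 by (simp add: ennreal_mult mult.assoc)
  also have "?q * (1 - \<kappa>) ^ k * (1 / (1 - \<kappa>)) ^ k = ?q"
    using \<kappa>1 by (simp add: power_divide)
  finally show ?B unfolding main .
qed

section \<open>The surface measure in a cone patch\<close>

text \<open>Lets the true normal be replaced by a direction from a countable dense set at the cost
  of doubling the opening.\<close>

lemma pinched_at_perturb:
  assumes "pinched_at \<Omega> n (\<epsilon> / 2) \<delta> a" "norm (\<nu> - n) \<le> \<epsilon> / 2" "\<delta>' \<le> \<delta>"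
  shows "pinched_at \<Omega> \<nu> \<epsilon> \<delta>' a"
  unfolding pinched_at_def
proof (intro allI impI conjI)
  fix x assume x: "dist x a < \<delta>'"
  have "\<bar>(\<nu> - n) \<bullet> (x - a)\<bar> \<le> norm (\<nu> - n) * norm (x - a)" by (rule Cauchy_Schwarz_ineq2)
  also have "\<dots> \<le> \<epsilon> / 2 * norm (x - a)" using assms(2) by (intro mult_right_mono) auto
  finally have d: "\<bar>\<nu> \<bullet> (x - a) - n \<bullet> (x - a)\<bar> \<le> \<epsilon> / 2 * norm (x - a)" by (simp add: inner_diff_left)
  have p: "(n \<bullet> (x - a) < - (\<epsilon> / 2) * norm (x - a) \<longrightarrow> x \<in> \<Omega>) \<and> (n \<bullet> (x - a) > (\<epsilon> / 2) * norm (x - a) \<longrightarrow> x \<notin> \<Omega>)"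
    using assms(1,3) x unfolding pinched_at_def by auto
  have d1: "\<nu> \<bullet> (x - a) - n \<bullet> (x - a) \<le> \<epsilon> / 2 * norm (x - a)" and d2: "n \<bullet> (x - a) - \<nu> \<bullet> (x - a) \<le> \<epsilon> / 2 * norm (x - a)"
    using d by linarith+
  show "x \<in> \<Omega>" if "\<nu> \<bullet> (x - a) < - \<epsilon> * norm (x - a)"
  proof -
    have "n \<bullet> (x - a) < - (\<epsilon> / 2) * norm (x - a)" using that d2 by simp
    then show ?thesis using p by blast
  qed
  show "x \<notin> \<Omega>" if "\<nu> \<bullet> (x - a) > \<epsilon> * norm (x - a)"
  proof -
    have "n \<bullet> (x - a) > (\<epsilon> / 2) * norm (x - a)" using that d1 by simp
    then show ?thesis using p by blast
  qed
qed

text \<open>On a compact set the inverse of a continuous injection is continuous, so the image is a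
  preimage under the inverse.\<close>

lemma injective_image_borel:
  fixes f :: "'a::euclidean_space \<Rightarrow> 'b::euclidean_space"
  assumes K: "compact K" and f: "continuous_on K f" "inj_on f K" and A: "A \<in> sets borel" "A \<subseteq> K"
  shows "f ` A \<in> sets borel"
proof -
  define g where "g = inv_into K f"
  have g: "continuous_on (f ` K) g"
    unfolding g_def using f(2) by (intro continuous_on_inv[OF f(1) K]) auto
  have fK: "f ` K \<in> sets borel" using compact_continuous_image[OF f(1) K] by (simp add: borel_compact)
  have "g \<in> measurable (restrict_space borel (f ` K)) borel"
    by (rule borel_measurable_continuous_on_restrict[OF g])
  then have "g -` A \<inter> space (restrict_space borel (f ` K)) \<in> sets (restrict_space borel (f ` K))"
    using A(1) by (rule measurable_sets)
  then have "g -` A \<inter> f ` K \<in> sets borel"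
    using fK by (auto simp: sets_restrict_space space_restrict_space)
  moreover have "f ` A = g -` A \<inter> f ` K"
    using A(2) f(2) by (auto simp: g_def subset_eq)
  ultimately show ?thesis by simp
qed

text \<open>Only cone patches and normals in the sense of pinching are kept from the charts. The
  abstraction covers piecewise C1 domains, with \<open>B\<close> the exceptional set, and balls,
  with \<open>B\<close> empty.\<close>

locale lipschitz_gauss =
  fixes \<Omega> :: "'a::euclidean_space set" and n :: "'a \<Rightarrow> 'a" and B :: "'a set"
  assumes open_dom: "open \<Omega>" and bounded_dom: "bounded \<Omega>"
    and patch: "z \<in> frontier \<Omega> \<Longrightarrow> \<exists>r w0 c. cone_patch \<Omega> z r w0 c"
    and normal: "a \<in> frontier \<Omega> - B \<Longrightarrow> unit_normal_at \<Omega> a (n a)"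
    and null: "hausdorff_outer (DIM('a) - 1) B = 0"
begin

abbreviation S :: "'a set" where "S \<equiv> frontier \<Omega>"

abbreviation \<mu> :: "'a measure" where "\<mu> \<equiv> hausdorff_measure (DIM('a) - 1)"

text \<open>The normal is only known off the null set \<open>B\<close>, where it is replaced by \<open>0\<close>.\<close>

definition nn :: "'a \<Rightarrow> 'a" where "nn a = (if a \<in> S - B then n a else 0)"

lemma compact_S: "compact S" using bounded_dom by (rule compact_frontier_bounded)

lemma S_sets [measurable, simp]: "S \<in> sets borel" using compact_S by (rule borel_compact)

lemma borel_sets_\<mu>: "A \<in> sets borel \<Longrightarrow> A \<in> sets \<mu>" using sets_borel_subset_hausdorff by blast

lemma borel_measurable_\<mu>: "f \<in> borel_measurable borel \<Longrightarrow> f \<in> borel_measurable \<mu>"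
  using borel_sets_\<mu> measurable_sets[of f borel borel] by (intro measurableI) auto

lemma S_not_dom: "a \<in> S \<Longrightarrow> a \<notin> \<Omega>" using open_dom by (simp add: frontier_def interior_open)

lemma S_closure: "a \<in> S \<Longrightarrow> a \<in> closure \<Omega>" by (simp add: frontier_def)

lemma B_null: "B \<in> null_sets \<mu>"
  using hausdorff_null_sets[OF null] emeasure_hausdorff_measure[OF hausdorff_null_sets[OF null]]
  unfolding null null_sets_def by blast

lemma norm_nn_le: "norm (nn a) \<le> 1"
  using normal[of a] by (auto simp: nn_def unit_normal_at_def)

text \<open>Pieces are indexed by a scale, a direction from a dense set and a centre from a dense
  set. A point with a normal is pinched at some scale in a nearby direction of the index set. Two
  points of one piece are closer than its scale, so pinching at one controls the other.\<close>

lemma pieces: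
  assumes e: "0 < \<epsilon>"
  obtains A :: "nat \<Rightarrow> 'a set" and \<nu> where "\<And>j. A j \<in> sets borel" "disjoint_family A" "S - B \<subseteq> (\<Union>j. A j)"
    "\<And>j. norm (\<nu> j) = 1" "\<And>j a a'. a \<in> A j \<Longrightarrow> a' \<in> A j \<Longrightarrow> \<bar>\<nu> j \<bullet> (a - a')\<bar> \<le> \<epsilon> * norm (a - a')"
    "\<And>j a. a \<in> A j - B \<Longrightarrow> norm (\<nu> j - nn a) \<le> 2 * \<epsilon>"
proof -
  obtain D :: "'a set" where D: "countable D" "D \<subseteq> sphere 0 1" "sphere 0 1 \<subseteq> closure D"
    by (rule separable[of "sphere (0::'a) 1"])
  obtain C :: "'a set" where C: "countable C" "UNIV \<subseteq> closure C"
    by (rule separable[of "UNIV :: 'a set"])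
  obtain b :: 'a where "b \<in> Basis" using nonempty_Basis by blast
  then have "b \<in> sphere 0 1" by simp
  then have ne: "D \<noteq> {}" "C \<noteq> {}" using D(3) C(2) by auto
  define I where "I = (UNIV :: nat set) \<times> D \<times> C"
  have I: "countable I" "I \<noteq> {}" using D(1) C(1) ne by (auto simp: I_def)
  define r where "r m = 1 / real (Suc m)" for m
  \<comment> \<open>A third of the scale as radius keeps any two points of the piece within two
    thirds of the scale.\<close>
  define T where "T = (\<lambda>(m, \<nu>, c). {a \<in> S \<inter> cball c (r m / 3). pinched_at \<Omega> \<nu> \<epsilon> (r m) a})"
  define A where "A j = T (from_nat_into I j)" for j
  define \<nu> where "\<nu> j = fst (snd (from_nat_into I j))" for j
  have fI: "from_nat_into I j \<in> I" for j using I by (simp add: from_nat_into)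
  have closedT: "closed (A j)" for j
  proof -
    obtain m v c where "from_nat_into I j = (m, v, c)" by (cases "from_nat_into I j") auto
    then have eq: "A j = {a \<in> S \<inter> cball c (r m / 3). pinched_at \<Omega> v \<epsilon> (r m) a}" by (simp add: A_def T_def)
    show ?thesis
      unfolding eq by (intro closed_pinched closed_Int compact_imp_closed compact_S closed_cball)
  qed
  have AS: "A j \<subseteq> S" for j unfolding A_def T_def by (cases "from_nat_into I j") auto
  have \<nu>1: "norm (\<nu> j) = 1" for j using fI[of j] D(2) by (auto simp: \<nu>_def I_def)
  have flat: "\<bar>\<nu> j \<bullet> (a - a')\<bar> \<le> \<epsilon> * norm (a - a')" if "a \<in> A j" "a' \<in> A j" for a a' j
  proof -
    obtain m v c where mvc: "from_nat_into I j = (m, v, c)" by (cases "from_nat_into I j") auto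
    then have a: "a \<in> S" "a' \<in> S" "dist c a \<le> r m / 3" "dist c a' \<le> r m / 3" "pinched_at \<Omega> v \<epsilon> (r m) a'" and v: "\<nu> j = v"
      using that by (auto simp: A_def T_def \<nu>_def)
    have "dist a a' \<le> dist c a + dist c a'" by (metis dist_commute dist_triangle)
    moreover have "r m > 0" by (simp add: r_def)
    ultimately have "dist a a' < r m" using a by linarith
    then show ?thesis unfolding v by (rule pinched_at_frontier[OF open_dom a(5) a(1)])
  qed
  have close: "norm (\<nu> j - nn a) \<le> 2 * \<epsilon>" if "a \<in> A j" "a \<notin> B" for a j
  proof -
    obtain m v c where mvc: "from_nat_into I j = (m, v, c)" by (cases "from_nat_into I j") auto
    then have a: "a \<in> S" "pinched_at \<Omega> v \<epsilon> (r m) a" and v: "\<nu> j = v"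
      using that by (auto simp: A_def T_def \<nu>_def)
    have "norm v = 1" using \<nu>1[of j] v by simp
    then have "norm (v - n a) \<le> 2 * \<epsilon>"
      using normal[of a] a that e by (intro unit_normal_at_close[OF _ a(2)]) (auto simp: r_def)
    then show ?thesis using a that v by (simp add: nn_def)
  qed
  have cover: "S - B \<subseteq> (\<Union>j. A j)"
  proof
    fix a assume a: "a \<in> S - B"
    have un: "unit_normal_at \<Omega> a (n a)" using normal a by blast
    have "\<epsilon> / 2 > 0" using e by simp
    then obtain \<delta> where \<delta>: "0 < \<delta>" "pinched_at \<Omega> (n a) (\<epsilon> / 2) \<delta> a"
      using un unfolding unit_normal_at_def by blast
    obtain m where m: "r m < \<delta>" unfolding r_def using \<delta>(1) nat_approx_posE by metis
    have "n a \<in> closure D" using un D(3) by (auto simp: unit_normal_at_def)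
    then obtain v where v: "v \<in> D" "dist v (n a) < \<epsilon> / 2" using \<open>\<epsilon> / 2 > 0\<close> by (meson closure_approachable)
    have "a \<in> closure C" "r m / 3 > 0" using C(2) by (auto simp: r_def)
    then obtain c where c: "c \<in> C" "dist c a < r m / 3" by (meson closure_approachable)
    have "pinched_at \<Omega> v \<epsilon> (r m) a"
      using \<delta> m v by (intro pinched_at_perturb[OF \<delta>(2)]) (auto simp: dist_norm)
    then have aT: "a \<in> T (m, v, c)" using a c by (simp add: T_def)
    have "(m, v, c) \<in> I" using v c by (simp add: I_def)
    then obtain j where "from_nat_into I j = (m, v, c)" using from_nat_into_surj[OF I(1)] by blast
    then have "a \<in> A j" using aT by (simp add: A_def)
    then show "a \<in> (\<Union>j. A j)" by blast
  qed
  define A' where "A' = disjointed A"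
  have sub: "A' j \<subseteq> A j" for j unfolding A'_def by (rule disjointed_subset)
  have Ab: "A j \<in> sets borel" for j using closedT by (rule borel_closed)
  have "range A' \<subseteq> sets borel" unfolding A'_def
    using Ab sets.range_disjointed_sets[of A borel] by blast
  then have A'b: "A' j \<in> sets borel" for j by blast
  have A'd: "disjoint_family A'" unfolding A'_def by (rule disjoint_family_disjointed)
  have A'U: "S - B \<subseteq> (\<Union>j. A' j)" using cover unfolding A'_def UN_disjointed_eq .
  show thesis
  proof (rule that[OF A'b A'd A'U \<nu>1])
    show "\<bar>\<nu> j \<bullet> (a - a')\<bar> \<le> \<epsilon> * norm (a - a')" if "a \<in> A' j" "a' \<in> A' j" for j a a'
      by (rule flat[OF subsetD[OF sub that(1)] subsetD[OF sub that(2)]])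
    show "norm (\<nu> j - nn a) \<le> 2 * \<epsilon>" if "a \<in> A' j - B" for j a
      using close[of a j] subsetD[OF sub, of a j] that by blast
  qed
qed

text \<open>On \<open>S - B\<close> the normal is a uniform limit of functions that are constant on
  countably many Borel pieces.\<close>

lemma nn_measurable [measurable]: "nn \<in> borel_measurable \<mu>"
proof -
  have "\<exists>f. f \<in> borel_measurable \<mu> \<and> (\<forall>a\<in>S - B. norm (f a - nn a) \<le> 2 * (1 / Suc i))" for i
  proof -
    have i: "(0::real) < 1 / Suc i" by simp
    obtain A :: "nat \<Rightarrow> 'a set" and \<nu> where A: "\<And>j. A j \<in> sets borel" "disjoint_family A" "S - B \<subseteq> (\<Union>j. A j)"
      "\<And>j. norm (\<nu> j) = 1" "\<And>j a a'. a \<in> A j \<Longrightarrow> a' \<in> A j \<Longrightarrow> \<bar>\<nu> j \<bullet> (a - a')\<bar> \<le> 1 / Suc i * norm (a - a')"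
      "\<And>j a. a \<in> A j - B \<Longrightarrow> norm (\<nu> j - nn a) \<le> 2 * (1 / Suc i)"
      by (rule pieces[OF i]) (rule that)
    \<comment> \<open>By disjointness the least index is the index of the unique piece containing
      the point. Its value off the pieces is irrelevant, since the approximation is only claimed on
      \<open>S - B\<close>.\<close>
    define J where "J a = (LEAST j. a \<in> A j)" for a
    have J: "J a = j" if "a \<in> A j" for a j
      unfolding J_def
    proof (rule Least_equality[where P="\<lambda>j. a \<in> A j", OF that])
      fix l assume "a \<in> A l"
      then have "l = j" using that A(2) by (auto simp: disjoint_family_on_def)
      then show "j \<le> l" by simp
    qed
    have [measurable]: "J \<in> measurable borel (count_space UNIV)"
      unfolding J_def using A(1) by measurable
    have "(\<lambda>a. \<nu> (J a)) \<in> borel_measurable borel" by measurable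
    moreover have "norm (\<nu> (J a) - nn a) \<le> 2 * (1 / Suc i)" if a: "a \<in> S - B" for a
    proof -
      obtain j where "a \<in> A j" using A(3) a by blast
      then show ?thesis using A(6)[of a j] J[of a j] a by simp
    qed
    ultimately show ?thesis using borel_measurable_\<mu> by blast
  qed
  then obtain f where f: "\<And>i. f i \<in> borel_measurable \<mu>" "\<And>i a. a \<in> S - B \<Longrightarrow> norm (f i a - nn a) \<le> 2 * (1 / Suc i)"
    by metis
  have SB: "S - B \<in> sets \<mu>" using borel_sets_\<mu>[OF S_sets] B_null by auto
  show ?thesis
  proof (rule borel_measurable_LIMSEQ_metric)
    show "(\<lambda>a. if a \<in> S - B then f i a else 0) \<in> borel_measurable \<mu>" for i
      using SB f(1) by (intro measurable_If_set) auto
    show "(\<lambda>i. if a \<in> S - B then f i a else 0) \<longlonglongrightarrow> nn a" for a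
    proof (cases "a \<in> S - B")
      case True
      have "(\<lambda>i. 2 * (1 / Suc i)) \<longlonglongrightarrow> 2 * 0"
        by (intro tendsto_intros LIMSEQ_Suc[OF lim_1_over_n])
      then have g0: "(\<lambda>i. 2 * (1 / real (Suc i))) \<longlonglongrightarrow> 0" by simp
      have "(\<lambda>i. f i a - nn a) \<longlonglongrightarrow> 0"
        by (rule Lim_null_comparison[OF always_eventually g0]) (rule allI, rule f(2)[OF True])
      then show ?thesis using True by (simp add: LIM_zero_iff)
    next
      case False
      then have "nn a = 0" "(\<lambda>i. if a \<in> S - B then f i a else 0) = (\<lambda>_. 0)" by (auto simp: nn_def)
      then show ?thesis by (simp only: tendsto_const)
    qed
  qed
qed

end

locale gauss_patch = lipschitz_gauss +
  fixes z :: 'a and r :: real and w0 :: 'a and c :: real and w :: 'a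
  assumes cp: "cone_patch \<Omega> z r w0 c" and w: "w \<in> ball w0 c"
begin

text \<open>Half the radius leaves \<open>K\<close> compact and inside the open ball in which the
  cone property holds.\<close>

definition K :: "'a set" where "K = S \<inter> cball z (r / 2)"

abbreviation u :: 'a where "u \<equiv> sgn w"

definition c1 :: real where "c1 = c - dist w0 w"

lemma c1_pos: "0 < c1" using w by (simp add: c1_def)

lemma r_pos: "0 < r" using cp by (simp add: cone_patch_def)

lemma w_nz: "w \<noteq> 0"
  using w cp unfolding cone_patch_def by (auto simp: dist_norm)

lemma norm_u: "norm u = 1" using w_nz by (simp add: norm_sgn)

lemma norm_w_pos: "0 < norm w" using w_nz by simp

lemma compact_K: "compact K" unfolding K_def using compact_S by (simp add: compact_Int_closed)

lemma K_ball: "a \<in> K \<Longrightarrow> a \<in> ball z r" using r_pos by (auto simp: K_def)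

lemma K_S: "a \<in> K \<Longrightarrow> a \<in> S" by (simp add: K_def)

lemma nn_w_ge: "a \<in> K - B \<Longrightarrow> c1 \<le> nn a \<bullet> w"
  using cone_patch_normal[OF cp w S_closure K_ball normal] K_S by (auto simp: c1_def nn_def)

lemma nn_w_nonneg: "a \<in> K \<Longrightarrow> 0 \<le> nn a \<bullet> w"
  using nn_w_ge[of a] c1_pos by (cases "a \<in> B") (auto simp: nn_def)

lemma below_frontier:
  assumes "a \<in> closure \<Omega>" "a \<in> ball z r" "t < 0" "a + t *\<^sub>R u \<in> ball z r"
  shows "a + t *\<^sub>R u \<in> \<Omega>"
proof -
  have "a + t *\<^sub>R u = a - (- t / norm w) *\<^sub>R w" by (simp add: sgn_div_norm divide_inverse)
  then show ?thesis
    using assms norm_w_pos cone_patch_closure[OF cp w assms(1,2), of "- t / norm w"] by (simp add: divide_neg_pos)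
qed

text \<open>Of two frontier points on a line along \<open>w\<close>, the lower one would belong to
  the open set \<open>\<Omega>\<close> by the cone property.\<close>

lemma perp_proj_inj: "inj_on (perp_proj u) K"
proof (rule inj_onI)
  fix a a' assume a: "a \<in> K" "a' \<in> K" "perp_proj u a = perp_proj u a'"
  have no: False if "b \<in> K" "b' \<in> K" "b' = b + t *\<^sub>R u" "t < 0" for b b' t
    using below_frontier[of b t] that K_ball K_S S_closure S_not_dom by blast
  define t where "t = a' \<bullet> u - a \<bullet> u"
  have e: "a' = a + t *\<^sub>R u"
  proof -
    have "a' = perp_proj u a' + (a' \<bullet> u) *\<^sub>R u" by (simp add: perp_proj_decomp)
    also have "\<dots> = (a - (a \<bullet> u) *\<^sub>R u) + (a' \<bullet> u) *\<^sub>R u" unfolding a(3)[symmetric] by (simp add: perp_proj_def)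
    also have "\<dots> = a + t *\<^sub>R u" by (simp add: t_def scaleR_diff_left)
    finally show ?thesis .
  qed
  have e': "a = a' + (- t) *\<^sub>R u" using e by simp
  show "a = a'"
    using no[OF a(1,2) e] no[OF a(2,1) e'] e by (cases t "0::real" rule: linorder_cases) auto
qed

lemma image_borel: "A \<in> sets borel \<Longrightarrow> A \<subseteq> K \<Longrightarrow> perp_proj u ` A \<in> sets borel"
  by (rule injective_image_borel[OF compact_K continuous_on_perp_proj perp_proj_inj])

text \<open>The area of the shadow of \<open>A\<close> along \<open>w\<close>, scaled to be
  comparable with \<open>I A\<close>, the flux of the constant field \<open>w\<close> through
  \<open>A\<close>.\<close>

definition \<Lambda> :: "'a set \<Rightarrow> ennreal" where
  "\<Lambda> A = ennreal (norm w) * emeasure (slice_measure u) (perp_proj u ` A)"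

text \<open>The estimate for flat pieces with \<open>\<nu> = u\<close> and
  \<open>\<epsilon> = 1\<close>, for which flatness is just Cauchy-Schwarz; then
  \<open>\<kappa> = 1\<close> and the factor is a power of 2. The crude bound serves to show that
  null sets have null shadows.\<close>

lemma \<Lambda>_le_hausdorff:
  assumes "A \<in> sets borel" "A \<subseteq> K"
  shows "\<Lambda> A \<le> ennreal (norm w * 2 ^ (DIM('a) - 1)) * hausdorff_outer (DIM('a) - 1) A"
proof -
  have wu: "w \<bullet> u = norm w" using w_nz by (simp add: sgn_div_norm dot_square_norm power2_eq_square)
  have "\<bar>u \<bullet> (a - a')\<bar> \<le> 1 * norm (a - a')" for a a'
    using Cauchy_Schwarz_ineq2[of u "a - a'"] norm_u by simp
  then have "\<Lambda> A \<le> ennreal ((w \<bullet> u) * (1 + 1 * norm w / norm w) ^ (DIM('a) - 1)) * hausdorff_outer (DIM('a) - 1) A"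
    unfolding \<Lambda>_def using norm_u norm_w_pos wu image_borel[OF assms] by (intro pinched_piece_measure(1)) auto
  then show ?thesis using norm_w_pos by (simp add: wu)
qed

lemma \<Lambda>_null:
  assumes "A \<in> sets borel" "A \<subseteq> K" "A \<subseteq> B"
  shows "\<Lambda> A = 0"
proof -
  have "hausdorff_outer (DIM('a) - 1) A = 0"
    using hausdorff_outer_mono[OF assms(3), of "DIM('a) - 1"] null by simp
  then show ?thesis using \<Lambda>_le_hausdorff[OF assms(1,2)] by simp
qed

lemma \<Lambda>_suminf:
  assumes A: "\<And>j::nat. A j \<in> sets borel" "\<And>j. A j \<subseteq> K" "disjoint_family A"
  shows "\<Lambda> (\<Union>j. A j) = (\<Sum>j. \<Lambda> (A j))"
proof -
  have "disjoint_family (\<lambda>j. perp_proj u ` A j)"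
    unfolding disjoint_family_on_def
  proof (intro ballI impI)
    fix i j :: nat assume "i \<noteq> j"
    then have "A i \<inter> A j = {}" using A(3) by (auto simp: disjoint_family_on_def)
    then show "perp_proj u ` A i \<inter> perp_proj u ` A j = {}"
      using inj_on_image_Int[OF perp_proj_inj A(2) A(2), of i j] by simp
  qed
  then have "(\<Sum>j. emeasure (slice_measure u) (perp_proj u ` A j)) = emeasure (slice_measure u) (\<Union>j. perp_proj u ` A j)"
    using image_borel A by (intro suminf_emeasure) auto
  then show ?thesis unfolding \<Lambda>_def image_UN by simp
qed

definition I :: "'a set \<Rightarrow> ennreal" where
  "I A = (\<integral>\<^sup>+a. ennreal (nn a \<bullet> w) * indicator A a \<partial>\<mu>)"

lemma I_suminf:
  assumes A: "\<And>j::nat. A j \<in> sets borel" "disjoint_family A"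
  shows "I (\<Union>j. A j) = (\<Sum>j. I (A j))"
proof -
  have m[measurable]: "A j \<in> sets \<mu>" for j using borel_sets_\<mu>[OF A(1)] .
  have "I (\<Union>j. A j) = (\<integral>\<^sup>+a. (\<Sum>j. ennreal (nn a \<bullet> w) * indicator (A j) a) \<partial>\<mu>)"
    unfolding I_def by (intro nn_integral_cong) (simp add: suminf_indicator[OF A(2)])
  also have "\<dots> = (\<Sum>j. I (A j))"
    unfolding I_def by (rule nn_integral_suminf) measurable
  finally show ?thesis .
qed

lemma I_null:
  assumes "A \<subseteq> B"
  shows "I A = 0"
proof -
  have "I A = (\<integral>\<^sup>+a. 0 \<partial>\<mu>)" unfolding I_def
    using assms by (intro nn_integral_cong) (auto simp: nn_def indicator_def)
  then show ?thesis by simp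
qed

text \<open>On a flat piece both quantities are compared with \<open>w \<bullet> \<nu> j\<close>
  times the Hausdorff measure. Flatness costs one factor less than the dimension, the deviation of
  the normals from \<open>\<nu> j\<close> costs the remaining factor; the pieces are then
  summed.\<close>

lemma patch_measure_squeeze:
  assumes A: "A \<in> sets borel" "A \<subseteq> K" and \<kappa>: "0 < \<kappa>" "\<kappa> \<le> 1 / 2"
  shows "\<Lambda> A \<le> ennreal ((1 + \<kappa>) ^ DIM('a)) * I A" "ennreal ((1 - \<kappa>) ^ DIM('a)) * I A \<le> \<Lambda> A"
proof -
  let ?k = "DIM('a) - 1" and ?H = "hausdorff_outer (DIM('a) - 1)"
  have Dk: "x ^ DIM('a) = x * x ^ ?k" for x :: real by (simp flip: power_Suc)
  \<comment> \<open>This single choice makes the deviation of \<open>w \<bullet> \<nu> j\<close>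
    from the true value at most \<open>\<kappa> * c1\<close>, and makes the distortion on the piece,
    computed with the lower bound \<open>c1 / 2\<close>, equal to \<open>\<kappa>\<close>.\<close>
  define \<epsilon> where "\<epsilon> = \<kappa> * c1 / (2 * norm w)"
  have \<epsilon>: "0 < \<epsilon>" "2 * \<epsilon> * norm w = \<kappa> * c1" using \<kappa> c1_pos norm_w_pos by (auto simp: \<epsilon>_def)
  obtain P :: "nat \<Rightarrow> 'a set" and \<nu> where P: "\<And>j. P j \<in> sets borel" "disjoint_family P" "S - B \<subseteq> (\<Union>j. P j)"
      "\<And>j. norm (\<nu> j) = 1" "\<And>j a a'. a \<in> P j \<Longrightarrow> a' \<in> P j \<Longrightarrow> \<bar>\<nu> j \<bullet> (a - a')\<bar> \<le> \<epsilon> * norm (a - a')"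
      "\<And>j a. a \<in> P j - B \<Longrightarrow> norm (\<nu> j - nn a) \<le> 2 * \<epsilon>"
    by (rule pieces[OF \<epsilon>(1)]) (rule that)
  have piece: "\<Lambda> (A \<inter> P j) \<le> ennreal ((1 + \<kappa>) ^ DIM('a)) * I (A \<inter> P j) \<and>
      ennreal ((1 - \<kappa>) ^ DIM('a)) * I (A \<inter> P j) \<le> \<Lambda> (A \<inter> P j)" for j
  \<comment> \<open>Inside \<open>B\<close> both quantities vanish. Any other piece contains a point
    with a normal, and this point bounds \<open>w \<bullet> \<nu> j\<close> from below.\<close>
  proof (cases "A \<inter> P j \<subseteq> B")
    case True
    have "\<Lambda> (A \<inter> P j) = 0" using True A P(1) by (intro \<Lambda>_null) auto
    then show ?thesis using I_null[OF True] by simp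
  next
    case False
    let ?Q = "A \<inter> P j" and ?q = "w \<bullet> \<nu> j"
    have Q: "?Q \<in> sets borel" "?Q \<subseteq> K" using A P(1) by auto
    have Q\<mu>: "?Q \<in> sets \<mu>" by (rule borel_sets_\<mu>[OF Q(1)])
    have HQ: "emeasure \<mu> ?Q = ?H ?Q" by (rule emeasure_hausdorff_borel[OF Q(1)])
    have near: "\<bar>?q - nn a \<bullet> w\<bar> \<le> \<kappa> * c1" if "a \<in> ?Q - B" for a
    proof -
      have "\<bar>(\<nu> j - nn a) \<bullet> w\<bar> \<le> norm (\<nu> j - nn a) * norm w" by (rule Cauchy_Schwarz_ineq2)
      also have "\<dots> \<le> 2 * \<epsilon> * norm w" using P(6)[of a j] that by (intro mult_right_mono) auto
      finally show ?thesis unfolding \<epsilon>(2) by (simp add: inner_diff_left inner_commute[of w])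
    qed
    have near': "(1 - \<kappa>) * (nn a \<bullet> w) \<le> ?q" "?q \<le> (1 + \<kappa>) * (nn a \<bullet> w)" if "a \<in> ?Q - B" for a
    proof -
      have "\<kappa> * c1 \<le> \<kappa> * (nn a \<bullet> w)" using nn_w_ge[of a] that Q(2) \<kappa> by (intro mult_left_mono) auto
      then show "(1 - \<kappa>) * (nn a \<bullet> w) \<le> ?q" "?q \<le> (1 + \<kappa>) * (nn a \<bullet> w)"
        using near[OF that] by (auto simp: algebra_simps abs_le_iff)
    qed
    obtain a0 where a0: "a0 \<in> ?Q - B" using False by blast
    have "c1 \<le> nn a0 \<bullet> w" using nn_w_ge[of a0] a0 Q(2) by blast
    moreover have "\<kappa> * c1 \<le> (1 / 2) * c1" using \<kappa> c1_pos by (intro mult_right_mono) auto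
    ultimately have q: "c1 / 2 \<le> ?q" using near[OF a0] by (simp add: abs_le_iff)
    have kk: "\<epsilon> * norm w / (c1 / 2) = \<kappa>" using \<epsilon>(2) c1_pos by (simp add: field_simps)
    have c2: "0 < c1 / 2" using c1_pos by simp
    have fl: "\<bar>\<nu> j \<bullet> (a - a')\<bar> \<le> \<epsilon> * norm (a - a')" if "a \<in> ?Q" "a' \<in> ?Q" for a a'
      using that by (intro P(5)) auto
    note pm = pinched_piece_measure[OF P(4) c2 q image_borel[OF Q] fl less_imp_le[OF \<epsilon>(1)], unfolded kk, folded \<Lambda>_def]
    have up: "\<Lambda> ?Q \<le> ennreal (?q * (1 + \<kappa>) ^ ?k) * ?H ?Q" by (rule pm(1))
    have "\<kappa> < 1" using \<kappa> by simp
    then have lo: "ennreal (?q * (1 - \<kappa>) ^ ?k) * ?H ?Q \<le> \<Lambda> ?Q" using pm(2) by blast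
    have AEB: "AE a in \<mu>. a \<notin> B" using B_null by (rule AE_not_in)
    have qH: "ennreal ?q * ?H ?Q = (\<integral>\<^sup>+a. ennreal ?q * indicator ?Q a \<partial>\<mu>)"
      using Q\<mu> HQ by (simp add: nn_integral_cmult_indicator)
    have mI: "(\<lambda>a. ennreal (nn a \<bullet> w) * indicator ?Q a) \<in> borel_measurable \<mu>" using Q\<mu> by measurable
    have "ennreal ?q * ?H ?Q \<le> (\<integral>\<^sup>+a. ennreal (1 + \<kappa>) * (ennreal (nn a \<bullet> w) * indicator ?Q a) \<partial>\<mu>)"
      unfolding qH
    proof (rule nn_integral_mono_AE)
      show "AE a in \<mu>. ennreal ?q * indicator ?Q a \<le> ennreal (1 + \<kappa>) * (ennreal (nn a \<bullet> w) * indicator ?Q a)"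
        using AEB
      proof eventually_elim
        case (elim a)
        show ?case
        proof (cases "a \<in> ?Q")
          case True
          then have "ennreal ?q \<le> ennreal ((1 + \<kappa>) * (nn a \<bullet> w))" using near'(2)[of a] elim by (intro ennreal_leI) auto
          then show ?thesis using True \<kappa> nn_w_nonneg[of a] Q(2) by (auto simp: ennreal_mult)
        qed simp
      qed
    qed
    also have "\<dots> = ennreal (1 + \<kappa>) * I ?Q" unfolding I_def by (rule nn_integral_cmult[OF mI])
    finally have qI: "ennreal ?q * ?H ?Q \<le> ennreal (1 + \<kappa>) * I ?Q" .
    have "ennreal (1 - \<kappa>) * I ?Q = (\<integral>\<^sup>+a. ennreal (1 - \<kappa>) * (ennreal (nn a \<bullet> w) * indicator ?Q a) \<partial>\<mu>)"
      unfolding I_def by (rule nn_integral_cmult[OF mI, symmetric])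
    also have "\<dots> \<le> ennreal ?q * ?H ?Q"
      unfolding qH
    proof (rule nn_integral_mono_AE)
      show "AE a in \<mu>. ennreal (1 - \<kappa>) * (ennreal (nn a \<bullet> w) * indicator ?Q a) \<le> ennreal ?q * indicator ?Q a"
        using AEB
      proof eventually_elim
        case (elim a)
        show ?case
        proof (cases "a \<in> ?Q")
          case True
          then have "ennreal ((1 - \<kappa>) * (nn a \<bullet> w)) \<le> ennreal ?q" using near'(1)[of a] elim by (intro ennreal_leI) auto
          then show ?thesis using True \<kappa> nn_w_nonneg[of a] Q(2) by (auto simp: ennreal_mult)
        qed simp
      qed
    qed
    finally have Iq: "ennreal (1 - \<kappa>) * I ?Q \<le> ennreal ?q * ?H ?Q" .
    have split: "ennreal (?q * x ^ ?k) = ennreal (x ^ ?k) * ennreal ?q" "ennreal (x ^ DIM('a)) = ennreal (x ^ ?k) * ennreal x"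
      if "0 \<le> x" for x using that q c1_pos by (auto simp: Dk ennreal_mult[symmetric] mult.commute)
    have "\<Lambda> ?Q \<le> ennreal ((1 + \<kappa>) ^ ?k) * (ennreal ?q * ?H ?Q)"
      using up split(1)[of "1 + \<kappa>"] \<kappa> by (simp add: mult.assoc)
    also have "\<dots> \<le> ennreal ((1 + \<kappa>) ^ ?k) * (ennreal (1 + \<kappa>) * I ?Q)" by (intro mult_left_mono qI) simp
    finally have 1: "\<Lambda> ?Q \<le> ennreal ((1 + \<kappa>) ^ DIM('a)) * I ?Q"
      using split(2)[of "1 + \<kappa>"] \<kappa> by (simp add: mult.assoc)
    have "ennreal ((1 - \<kappa>) ^ DIM('a)) * I ?Q = ennreal ((1 - \<kappa>) ^ ?k) * (ennreal (1 - \<kappa>) * I ?Q)"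
      using split(2)[of "1 - \<kappa>"] \<kappa> by (simp add: mult.assoc)
    also have "\<dots> \<le> ennreal ((1 - \<kappa>) ^ ?k) * (ennreal ?q * ?H ?Q)" by (intro mult_left_mono Iq) simp
    also have "\<dots> \<le> \<Lambda> ?Q" using lo split(1)[of "1 - \<kappa>"] \<kappa> by (simp add: mult.assoc)
    finally show ?thesis using 1 by simp
  qed
  \<comment> \<open>The part of \<open>A\<close> outside all pieces is listed first; it lies in
    \<open>B\<close>.\<close>
  define Q where "Q j = (case j of 0 \<Rightarrow> A - (\<Union>j. P j) | Suc i \<Rightarrow> A \<inter> P i)" for j
  have QsA: "Q j \<subseteq> A" for j by (cases j) (auto simp: Q_def)
  have QA: "(\<Union>j. Q j) = A"
  proof (intro set_eqI iffI)
    fix x assume "x \<in> A"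
    then have "x \<in> Q 0 \<or> (\<exists>i. x \<in> Q (Suc i))" by (auto simp: Q_def)
    then show "x \<in> (\<Union>j. Q j)" by blast
  qed (use QsA in blast)
  have Qb: "Q j \<in> sets borel" "Q j \<subseteq> K" for j using A P(1) by (auto simp: Q_def split: nat.splits)
  have Qd: "disjoint_family Q"
    using P(2) by (auto simp: disjoint_family_on_def Q_def split: nat.splits)
  have Q0: "Q 0 \<subseteq> B" using P(3) A(2) K_S by (auto simp: Q_def)
  have comp: "\<Lambda> (Q j) \<le> ennreal ((1 + \<kappa>) ^ DIM('a)) * I (Q j) \<and>
      ennreal ((1 - \<kappa>) ^ DIM('a)) * I (Q j) \<le> \<Lambda> (Q j)" for j
  proof (cases j)
    case 0
    then show ?thesis using \<Lambda>_null[OF Qb Q0] I_null[OF Q0] by simp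
  qed (use piece in \<open>simp add: Q_def\<close>)
  have "\<Lambda> A = (\<Sum>j. \<Lambda> (Q j))" using \<Lambda>_suminf[OF Qb Qd] QA by simp
  moreover have "I A = (\<Sum>j. I (Q j))" using I_suminf[OF Qb(1) Qd] QA by simp
  moreover have "(\<Sum>j. \<Lambda> (Q j)) \<le> (\<Sum>j. ennreal ((1 + \<kappa>) ^ DIM('a)) * I (Q j))"
    "(\<Sum>j. ennreal ((1 - \<kappa>) ^ DIM('a)) * I (Q j)) \<le> (\<Sum>j. \<Lambda> (Q j))"
    by (intro suminf_le conjunct1[OF comp] conjunct2[OF comp] summableI)+
  ultimately show "\<Lambda> A \<le> ennreal ((1 + \<kappa>) ^ DIM('a)) * I A" "ennreal ((1 - \<kappa>) ^ DIM('a)) * I A \<le> \<Lambda> A"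
    by simp_all
qed

lemma \<Lambda>_finite:
  assumes "A \<subseteq> K"
  shows "\<Lambda> A < \<infinity>"
proof -
  have "compact (perp_proj u ` K)" using compact_K continuous_on_perp_proj by (rule compact_continuous_image[rotated])
  then obtain R where "\<forall>x\<in>perp_proj u ` K. norm x \<le> R" using compact_imp_bounded bounded_iff by metis
  then have R: "perp_proj u ` K \<subseteq> cball 0 R" by auto
  then have "emeasure (slice_measure u) (perp_proj u ` A) \<le> emeasure (slice_measure u) (cball 0 R)"
    using assms by (intro emeasure_mono) auto
  also have "\<dots> < \<infinity>" by (rule slice_measure_cball_finite[OF norm_u])
  finally show ?thesis by (simp add: \<Lambda>_def ennreal_mult_less_top)
qed

text \<open>Lets \<open>\<kappa>\<close> tend to 0 in the squeeze. Multiplication by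
  \<open>I A\<close> is continuous in the extended reals when \<open>I A\<close> is finite, which
  the squeeze with \<open>\<kappa> = 1/2\<close> supplies.\<close>

lemma patch_measure_eq:
  assumes A: "A \<in> sets borel" "A \<subseteq> K"
  shows "I A = \<Lambda> A"
proof -
  have lim: "((\<lambda>\<kappa>. ennreal ((1 + s * \<kappa>) ^ DIM('a))) \<longlongrightarrow> ennreal ((1 + s * 0) ^ DIM('a))) (at_right 0)" for s :: real
    by (intro tendsto_ennrealI tendsto_intros)
  have ev: "\<forall>\<^sub>F \<kappa> in at_right 0. 0 < \<kappa> \<and> \<kappa> \<le> (1 / 2 :: real)"
    using eventually_at_right_real[of 0 "1/2"] by (auto elim: eventually_mono)
  have half: "ennreal ((1 - 1 / 2) ^ DIM('a)) * I A \<le> \<Lambda> A"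
    by (rule patch_measure_squeeze(2)[OF A]) auto
  have fin: "I A < top"
  proof (rule ccontr)
    assume "\<not> I A < top"
    then have "I A = top" using less_top[of "I A"] by blast
    moreover have "ennreal ((1 - 1 / 2) ^ DIM('a)) * top = top" by (simp add: ennreal_mult_top)
    ultimately have "\<Lambda> A = top" using half by (simp add: top_unique)
    then show False using \<Lambda>_finite[OF A(2)] by simp
  qed
  have "((\<lambda>\<kappa>. I A * ennreal ((1 + 1 * \<kappa>) ^ DIM('a))) \<longlongrightarrow> I A * ennreal ((1 + 1 * 0) ^ DIM('a))) (at_right 0)"
    using fin by (intro ennreal_tendsto_cmult lim)
  then have "\<Lambda> A \<le> I A * ennreal ((1 + 1 * 0) ^ DIM('a))"
    using patch_measure_squeeze(1)[OF A] ev
    by (intro tendsto_lowerbound[where F="at_right 0"]) (auto elim!: eventually_mono simp: mult.commute)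
  moreover have "((\<lambda>\<kappa>. I A * ennreal ((1 + (-1) * \<kappa>) ^ DIM('a))) \<longlongrightarrow> I A * ennreal ((1 + (-1) * 0) ^ DIM('a))) (at_right 0)"
    using fin by (intro ennreal_tendsto_cmult lim)
  then have "I A * ennreal ((1 + (-1) * 0) ^ DIM('a)) \<le> \<Lambda> A"
    using patch_measure_squeeze(2)[OF A] ev
    by (intro tendsto_upperbound[where F="at_right 0"]) (auto elim!: eventually_mono simp: mult.commute)
  ultimately show ?thesis by simp
qed

text \<open>Transversality bounds \<open>c1\<close> times the surface measure by the flux
  \<open>I K\<close>, which is the scaled area of a bounded shadow.\<close>

lemma K_finite: "emeasure \<mu> K < \<infinity>"
proof -
  have K: "K \<in> sets borel" using compact_K by (rule borel_compact)
  have K\<mu>: "K \<in> sets \<mu>" by (rule borel_sets_\<mu>[OF K])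
  have "ennreal c1 * emeasure \<mu> K = (\<integral>\<^sup>+a. ennreal c1 * indicator K a \<partial>\<mu>)"
    using K\<mu> by (simp add: nn_integral_cmult_indicator)
  also have "\<dots> \<le> I K" unfolding I_def
  proof (rule nn_integral_mono_AE)
    show "AE a in \<mu>. ennreal c1 * indicator K a \<le> ennreal (nn a \<bullet> w) * indicator K a"
      using AE_not_in[OF B_null] by eventually_elim (use nn_w_ge in \<open>auto simp: indicator_def intro!: ennreal_leI\<close>)
  qed
  also have "\<dots> < \<infinity>" using patch_measure_eq[OF K order_refl] \<Lambda>_finite[OF order_refl] by simp
  finally show ?thesis using c1_pos by (auto simp: ennreal_mult_less_top)
qed

end

section \<open>The Gauss theorem\<close>

definition C1_grad :: "('a::euclidean_space \<Rightarrow> real) \<Rightarrow> ('a \<Rightarrow> 'a) \<Rightarrow> bool" where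
  "C1_grad \<phi> g \<longleftrightarrow> continuous_on UNIV g \<and> (\<forall>x. (\<phi> has_derivative (\<lambda>h. g x \<bullet> h)) (at x))"

lemma C1_grad_derivative: "C1_grad \<phi> g \<Longrightarrow> (\<phi> has_derivative (\<lambda>h. g x \<bullet> h)) (at x)"
  by (simp add: C1_grad_def)

lemma C1_grad_continuous: "C1_grad \<phi> g \<Longrightarrow> continuous_on A \<phi>"
  unfolding C1_grad_def by (meson continuous_at_imp_continuous_on has_derivative_continuous)

lemma C1_grad_continuous_grad: "C1_grad \<phi> g \<Longrightarrow> continuous_on A g"
  unfolding C1_grad_def by (meson continuous_on_subset subset_UNIV)

lemma C1_grad_line:
  assumes "C1_grad \<phi> g"
  shows "((\<lambda>t. \<phi> (y + t *\<^sub>R u)) has_real_derivative g (y + t *\<^sub>R u) \<bullet> u) (at t)"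
proof -
  have "((\<lambda>t. \<phi> (y + t *\<^sub>R u)) has_derivative (\<lambda>h. g (y + t *\<^sub>R u) \<bullet> (h *\<^sub>R u))) (at t)"
    by (rule has_derivative_compose[OF _ C1_grad_derivative[OF assms]]) (auto intro!: derivative_eq_intros)
  then show ?thesis by (simp add: has_field_derivative_def mult_commute_abs)
qed

lemma C1_grad_zero:
  assumes "C1_grad \<phi> g" "open U" "x \<in> U" "\<And>y. y \<in> U \<Longrightarrow> \<phi> y = 0"
  shows "g x = 0"
proof -
  have "(\<phi> has_derivative (\<lambda>h. 0)) (at x)"
    by (rule has_derivative_transform_within_open[OF has_derivative_const assms(2,3)]) (use assms(4) in auto)
  then have "(\<lambda>h. g x \<bullet> h) = (\<lambda>h. 0)"
    using has_derivative_unique C1_grad_derivative[OF assms(1)] by blast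
  then have "g x \<bullet> g x = 0" by meson
  then show ?thesis by simp
qed

lemma line_integral_FTC:
  assumes c: "C1_grad \<phi> g" and ab: "a \<le> (b::real)"
  shows "has_bochner_integral lborel (\<lambda>t. indicator {a..b} t * (g (y + t *\<^sub>R u) \<bullet> u)) (\<phi> (y + b *\<^sub>R u) - \<phi> (y + a *\<^sub>R u))"
proof -
  have "has_bochner_integral lborel (\<lambda>t. indicator {a..b} t *\<^sub>R (g (y + t *\<^sub>R u) \<bullet> u)) (\<phi> (y + b *\<^sub>R u) - \<phi> (y + a *\<^sub>R u))"
  proof (rule has_bochner_integral_FTC_Icc[OF ab])
    show "((\<lambda>t. \<phi> (y + t *\<^sub>R u)) has_vector_derivative g (y + t *\<^sub>R u) \<bullet> u) (at t within {a..b})" for t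
      using has_field_derivative_at_within[OF C1_grad_line[OF c]] by (simp add: has_real_derivative_iff_has_vector_derivative)
    show "continuous_on {a..b} (\<lambda>t. g (y + t *\<^sub>R u) \<bullet> u)"
      by (intro continuous_intros continuous_on_compose2[OF C1_grad_continuous_grad[OF c, of UNIV]]) auto
  qed
  then show ?thesis by simp
qed

text \<open>Extended by zero outside \<open>\<Omega>\<close>, \<open>\<phi>\<close> stays
  continuously differentiable along the line, because it vanishes near every crossing of the
  frontier; the integral of its derivative over a long interval is zero.\<close>

lemma line_integral_interior:
  fixes \<Omega> :: "'a::euclidean_space set"
  assumes c: "C1_grad \<phi> g" and \<Omega>: "open \<Omega>" "bounded \<Omega>" and u: "norm u = 1"
    and van: "\<And>t. y + t *\<^sub>R u \<in> frontier \<Omega> \<Longrightarrow> \<exists>U. open U \<and> y + t *\<^sub>R u \<in> U \<and> (\<forall>x\<in>U. \<phi> x = 0)"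
  shows "(LINT t|lborel. indicator \<Omega> (y + t *\<^sub>R u) * (g (y + t *\<^sub>R u) \<bullet> u)) = 0"
proof -
  let ?l = "\<lambda>t. y + t *\<^sub>R u"
  define F where "F t = indicator \<Omega> (?l t) * \<phi> (?l t)" for t
  define G where "G t = indicator \<Omega> (?l t) * (g (?l t) \<bullet> u)" for t
  have cl: "continuous_on UNIV ?l" by (intro continuous_intros)
  \<comment> \<open>Near each parameter the extended functions are either the original pair or
    identically zero, which reduces differentiability and continuity to a local check.\<close>
  have cases: "\<exists>V. open V \<and> t \<in> V \<and> ((\<forall>s\<in>V. F s = \<phi> (?l s) \<and> G s = g (?l s) \<bullet> u) \<or> (\<forall>s\<in>V. F s = 0 \<and> G s = 0))" for t
  proof -
    have vim: "open (?l -` U)" if "open U" for U using open_vimage[OF that cl] .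
    consider "?l t \<in> \<Omega>" | "?l t \<in> - closure \<Omega>" | "?l t \<in> frontier \<Omega>"
      using \<Omega>(1) by (auto simp: frontier_def interior_open)
    then show ?thesis
    proof cases
      case 1
      then show ?thesis using vim[OF \<Omega>(1)] by (intro exI[of _ "?l -` \<Omega>"]) (auto simp: F_def G_def)
    next
      case 2
      then show ?thesis using vim[of "- closure \<Omega>"] closure_subset[of \<Omega>]
        by (intro exI[of _ "?l -` (- closure \<Omega>)"]) (auto simp: F_def G_def indicator_def)
    next
      case 3
      then obtain U where U: "open U" "?l t \<in> U" "\<forall>x\<in>U. \<phi> x = 0" using van by blast
      have "g x = 0" if "x \<in> U" for x using C1_grad_zero[OF c U(1) that] U(3) by blast
      then show ?thesis using U vim[OF U(1)] by (intro exI[of _ "?l -` U"]) (auto simp: F_def G_def)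
    qed
  qed
  have FG: "(F has_real_derivative G t) (at t)" and Gc: "isCont G t" for t
  proof -
    obtain V where V: "open V" "t \<in> V" "(\<forall>s\<in>V. F s = \<phi> (?l s) \<and> G s = g (?l s) \<bullet> u) \<or> (\<forall>s\<in>V. F s = 0 \<and> G s = 0)"
      using cases[of t] by blast
    have ev: "eventually (\<lambda>s. s \<in> V) (nhds t)" using V(1,2) by (rule eventually_nhds_in_open)
    from V(3) have "(F has_real_derivative G t) (at t) \<and> isCont G t"
    proof
      assume a: "\<forall>s\<in>V. F s = \<phi> (?l s) \<and> G s = g (?l s) \<bullet> u"
      have "(F has_real_derivative g (?l t) \<bullet> u) (at t)"
        by (rule iffD2[OF DERIV_cong_ev[OF refl _ refl] C1_grad_line[OF c]]) (use ev a in \<open>auto elim: eventually_mono\<close>)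
      moreover have gc: "isCont g x" for x
        using C1_grad_continuous_grad[OF c, of UNIV] by (simp add: continuous_on_eq_continuous_at)
      have "isCont ?l t" by (intro continuous_intros)
      then have "isCont (\<lambda>s. g (?l s)) t" by (rule isCont_o2[OF _ gc])
      then have "isCont (\<lambda>s. g (?l s) \<bullet> u) t" by (intro continuous_intros)
      then have "isCont G t"
        by (rule iffD1[OF isCont_cong, rotated]) (use ev a in \<open>auto elim: eventually_mono\<close>)
      ultimately show ?thesis using a V(2) by auto
    next
      assume a: "\<forall>s\<in>V. F s = 0 \<and> G s = 0"
      have "(F has_real_derivative 0) (at t)"
        by (rule iffD2[OF DERIV_cong_ev[OF refl _ refl] DERIV_const[of 0]]) (use ev a in \<open>auto elim: eventually_mono\<close>)
      moreover have "isCont (\<lambda>s. 0 :: real) t" by simp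
      then have "isCont G t"
        by (rule iffD1[OF isCont_cong, rotated]) (use ev a in \<open>auto elim: eventually_mono\<close>)
      ultimately show ?thesis using a V(2) by auto
    qed
    then show "(F has_real_derivative G t) (at t)" "isCont G t" by auto
  qed
  obtain M where M: "\<And>x. x \<in> \<Omega> \<Longrightarrow> norm x \<le> M" using \<Omega>(2) bounded_iff by metis
  \<comment> \<open>Beyond this parameter the line has left the bounded set
    \<open>\<Omega>\<close>.\<close>
  define R where "R = \<bar>M\<bar> + norm y + 1"
  have out: "?l t \<notin> \<Omega>" if "\<bar>t\<bar> \<ge> R" for t
  proof
    assume "?l t \<in> \<Omega>"
    then have "norm (?l t) \<le> M" by (rule M)
    moreover have "norm (t *\<^sub>R u) \<le> norm (?l t) + norm y" using norm_triangle_ineq4[of "?l t" y] by simp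
    ultimately show False using that u unfolding R_def by simp
  qed
  have "has_bochner_integral lborel (\<lambda>t. indicator {-R..R} t *\<^sub>R G t) (F R - F (- R))"
  proof (rule has_bochner_integral_FTC_Icc)
    show "- R \<le> R" by (simp add: R_def)
    show "(F has_vector_derivative G t) (at t within {-R..R})" for t
      using has_field_derivative_at_within[OF FG] by (simp add: has_real_derivative_iff_has_vector_derivative)
    show "continuous_on {-R..R} G" using Gc by (simp add: continuous_at_imp_continuous_on)
  qed
  moreover have "F R - F (- R) = 0" using out[of R] out[of "- R"] by (simp add: F_def R_def)
  moreover have "(\<lambda>t. indicator {-R..R} t *\<^sub>R G t) = G"
  proof
    fix t
    show "indicator {-R..R} t *\<^sub>R G t = G t"
    proof (cases "t \<in> {-R..R}")
      case False
      then have "\<bar>t\<bar> \<ge> R" by auto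
      then show ?thesis using out[of t] by (simp add: G_def)
    qed simp
  qed
  ultimately have "has_bochner_integral lborel G 0" by simp
  then show ?thesis unfolding G_def by (rule has_bochner_integral_integral_eq)
qed

lemma integrable_indicator_continuous:
  fixes \<Omega> :: "'a::euclidean_space set" and f :: "'a \<Rightarrow> real"
  assumes \<Omega>: "\<Omega> \<in> sets borel" "bounded \<Omega>" and f: "continuous_on UNIV f"
  shows "integrable lborel (\<lambda>x. indicator \<Omega> x * f x)"
proof -
  have "compact (f ` closure \<Omega>)" using \<Omega>(2) f
    by (intro compact_continuous_image continuous_on_subset[OF f]) auto
  then have "bounded (f ` closure \<Omega>)" by (rule compact_imp_bounded)
  then obtain M where "\<forall>y\<in>f ` closure \<Omega>. norm y \<le> M" unfolding bounded_iff by blast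
  then have M: "norm (f x) \<le> M" if "x \<in> closure \<Omega>" for x using that by blast
  have [measurable]: "f \<in> borel_measurable borel" using f by (rule borel_measurable_continuous_onI)
  note [measurable] = \<Omega>(1)
  have fin: "emeasure lborel \<Omega> < \<infinity>" using \<Omega>(2) by (rule emeasure_bounded_finite)
  show ?thesis
  proof (rule Bochner_Integration.integrable_bound)
    show "integrable lborel (\<lambda>x. M * indicator \<Omega> x)" using fin \<Omega>(1) by simp
    show "AE x in lborel. norm (indicator \<Omega> x * f x) \<le> norm (M * indicator \<Omega> x)"
      using M closure_subset[of \<Omega>] by (intro AE_I2) (force simp: indicator_def)
  qed measurable
qed

lemma integral_slice_direction:
  fixes \<Omega> :: "'a::euclidean_space set"
  assumes c: "C1_grad \<phi> g" and \<Omega>: "open \<Omega>" "bounded \<Omega>" and u: "norm u = 1"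
  shows "(LINT x|lborel. indicator \<Omega> x * (g x \<bullet> u))
       = (LINT y|slice_measure u. LINT t|lborel. indicator \<Omega> (y + t *\<^sub>R u) * (g (y + t *\<^sub>R u) \<bullet> u))"
  using C1_grad_continuous_grad[OF c, of UNIV] \<Omega>
  by (intro integral_slice[OF u] integrable_indicator_continuous continuous_intros) auto

lemma integral_grad_interior:
  fixes \<Omega> :: "'a::euclidean_space set"
  assumes c: "C1_grad \<phi> g" and \<Omega>: "open \<Omega>" "bounded \<Omega>"
    and van: "open V" "frontier \<Omega> \<subseteq> V" "\<And>x. x \<in> V \<Longrightarrow> \<phi> x = 0"
  shows "(LINT x|lborel. indicator \<Omega> x * (g x \<bullet> w)) = 0"
proof (cases "w = 0")
  case False
  then have u: "norm (sgn w) = 1" by (simp add: norm_sgn)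
  have "(LINT x|lborel. indicator \<Omega> x * (g x \<bullet> sgn w)) = 0"
    unfolding integral_slice_direction[OF c \<Omega> u] using van
    by (subst line_integral_interior[OF c \<Omega> u]) auto
  moreover have gw: "indicator \<Omega> x * (g x \<bullet> w) = norm w * (indicator \<Omega> x * (g x \<bullet> sgn w))" for x
    using False by (simp add: sgn_div_norm)
  ultimately show ?thesis unfolding gw by simp
qed simp

context gauss_patch
begin

text \<open>A line along \<open>u\<close> that misses \<open>K\<close> meets the frontier only where
  \<open>\<phi>\<close> vanishes nearby. Otherwise it meets \<open>K\<close> in one point
  \<open>a\<close>, and within the patch \<open>\<Omega>\<close> is exactly the part of the line
  below \<open>a\<close>; the fundamental theorem leaves the value at \<open>a\<close>.\<close>

lemma line_integral_patch:
  assumes c: "C1_grad \<phi> g" and van: "\<And>x. x \<notin> cball z (r / 2) \<Longrightarrow> \<phi> x = 0" and y: "y \<bullet> u = 0"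
  shows "(LINT t|lborel. indicator \<Omega> (y + t *\<^sub>R u) * (g (y + t *\<^sub>R u) \<bullet> u))
    = indicator (perp_proj u ` K) y * \<phi> (inv_into K (perp_proj u) y)"
proof (cases "y \<in> perp_proj u ` K")
  case False
  have "(LINT t|lborel. indicator \<Omega> (y + t *\<^sub>R u) * (g (y + t *\<^sub>R u) \<bullet> u)) = 0"
  proof (rule line_integral_interior[OF c open_dom bounded_dom norm_u])
    fix t assume t: "y + t *\<^sub>R u \<in> S"
    have "perp_proj u (y + t *\<^sub>R u) = y" using y by (simp add: perp_proj_add_scaleR norm_u perp_proj_id)
    then have "y + t *\<^sub>R u \<notin> K" using False by (metis imageI)
    then have "y + t *\<^sub>R u \<in> - cball z (r / 2)" using t by (simp add: K_def)
    then show "\<exists>U. open U \<and> y + t *\<^sub>R u \<in> U \<and> (\<forall>x\<in>U. \<phi> x = 0)"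
      using van by (intro exI[of _ "- cball z (r / 2)"]) auto
  qed
  then show ?thesis using False by simp
next
  case True
  then obtain a where a: "a \<in> K" "y = perp_proj u a" by auto
  then have q: "inv_into K (perp_proj u) y = a" using perp_proj_inj by simp
  define \<tau> where "\<tau> = a \<bullet> u"
  have al: "a = y + \<tau> *\<^sub>R u" by (simp add: a(2) \<tau>_def perp_proj_decomp)
  have split: "y + t *\<^sub>R u = a + (t - \<tau>) *\<^sub>R u" for t by (simp add: al algebra_simps)
  have aS: "a \<in> closure \<Omega>" "a \<notin> \<Omega>" "a \<in> ball z r" using a(1) K_S S_closure S_not_dom K_ball by blast+
  have below: "y + t *\<^sub>R u \<in> \<Omega> \<longleftrightarrow> t < \<tau>" if b: "y + t *\<^sub>R u \<in> ball z r" for t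
  proof
    assume "t < \<tau>"
    then show "y + t *\<^sub>R u \<in> \<Omega>" using below_frontier[OF aS(1,3), of "t - \<tau>"] b unfolding split by simp
  next
    assume i: "y + t *\<^sub>R u \<in> \<Omega>"
    show "t < \<tau>"
    proof (rule ccontr)
      assume "\<not> t < \<tau>"
      then consider "t = \<tau>" | "\<tau> - t < 0" by linarith
      then show False
      proof cases
        case 1
        then show ?thesis using i aS(2) al by simp
      next
        case 2
        have e: "(y + t *\<^sub>R u) + (\<tau> - t) *\<^sub>R u = a" by (simp add: al algebra_simps)
        have "(y + t *\<^sub>R u) + (\<tau> - t) *\<^sub>R u \<in> \<Omega>"
          using i b 2 aS(3) closure_subset[of \<Omega>] e by (intro below_frontier) auto
        then show ?thesis using e aS(2) by simp
      qed
    qed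
  qed
  have gz: "g x = 0" if "x \<notin> cball z (r / 2)" for x
    using C1_grad_zero[OF c, of "- cball z (r / 2)" x] van that by auto
  \<comment> \<open>A starting parameter below which the line stays outside the ball supporting
    \<open>\<phi>\<close>.\<close>
  obtain m where m: "m \<le> \<tau>" "\<And>t. t \<le> m \<Longrightarrow> y + t *\<^sub>R u \<notin> cball z (r / 2)"
  proof
    define m where "m = min \<tau> (- (norm (y - z) + r))"
    show "m \<le> \<tau>" by (simp add: m_def)
    fix t assume "t \<le> m"
    then have "t \<le> - (norm (y - z) + r)" by (simp add: m_def)
    then have t: "norm (y - z) + r \<le> \<bar>t\<bar>" by linarith
    have "norm (t *\<^sub>R u) \<le> norm (y + t *\<^sub>R u - z) + norm (y - z)"
      using norm_triangle_ineq4[of "y + t *\<^sub>R u - z" "y - z"] by simp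
    then have "r \<le> norm (y + t *\<^sub>R u - z)" using t norm_u by simp
    then show "y + t *\<^sub>R u \<notin> cball z (r / 2)" using r_pos by (simp add: dist_norm norm_minus_commute)
  qed
  have hb: "has_bochner_integral lborel (\<lambda>t. indicator {m..\<tau>} t * (g (y + t *\<^sub>R u) \<bullet> u)) (\<phi> a)"
    using line_integral_FTC[OF c m(1), of y u] van[OF m(2)[OF order_refl]] al by simp
  have "(LINT t|lborel. indicator \<Omega> (y + t *\<^sub>R u) * (g (y + t *\<^sub>R u) \<bullet> u))
      = (LINT t|lborel. indicator {m..\<tau>} t * (g (y + t *\<^sub>R u) \<bullet> u))"
  proof (rule integral_cong_AE)
    have [measurable]: "g \<in> borel_measurable borel"
      using C1_grad_continuous_grad[OF c] by (rule borel_measurable_continuous_onI)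
    have [measurable]: "\<Omega> \<in> sets borel" using open_dom by simp
    show "(\<lambda>t. indicator \<Omega> (y + t *\<^sub>R u) * (g (y + t *\<^sub>R u) \<bullet> u)) \<in> borel_measurable lborel"
      "(\<lambda>t. indicator {m..\<tau>} t * (g (y + t *\<^sub>R u) \<bullet> u)) \<in> borel_measurable lborel" by measurable
    \<comment> \<open>The closed interval includes \<open>\<tau>\<close> although \<open>a\<close>
      is not in \<open>\<Omega>\<close>, so the integrands may differ at that one parameter.\<close>
    show "AE t in lborel. indicator \<Omega> (y + t *\<^sub>R u) * (g (y + t *\<^sub>R u) \<bullet> u) = indicator {m..\<tau>} t * (g (y + t *\<^sub>R u) \<bullet> u)"
      using AE_lborel_singleton[of \<tau>]
    proof eventually_elim
      case (elim t)
      show ?case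
      proof (cases "y + t *\<^sub>R u \<in> cball z (r / 2)")
        case True
        then have "y + t *\<^sub>R u \<in> ball z r" using r_pos by auto
        moreover have "m < t" using True m(2)[of t] by (meson not_le)
        ultimately show ?thesis using below[of t] elim by (auto simp: indicator_def)
      qed (simp add: gz)
    qed
  qed
  also have "\<dots> = \<phi> a" using hb by (rule has_bochner_integral_integral_eq)
  finally show ?thesis using True q by simp
qed

text \<open>The equality of flux and shadow area as an identity of measures, in the form that
  transfers integrals between shadow and surface.\<close>

lemma slice_density:
  "distr (density \<mu> (\<lambda>a. ennreal (nn a \<bullet> w) * indicator K a)) borel (perp_proj u)
   = density (slice_measure u) (\<lambda>y. ennreal (norm w) * indicator (perp_proj u ` K) y)"
proof (rule measure_eqI)
  have Kb: "K \<in> sets borel" using compact_K by (rule borel_compact)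
  have [measurable]: "K \<in> sets \<mu>" by (rule borel_sets_\<mu>[OF Kb])
  have pK[measurable]: "perp_proj u ` K \<in> sets borel" by (rule image_borel[OF Kb order_refl])
  have pm[measurable]: "perp_proj u \<in> borel_measurable \<mu>" by (rule borel_measurable_\<mu>[OF perp_proj_measurable])
  fix C assume "C \<in> sets (distr (density \<mu> (\<lambda>a. ennreal (nn a \<bullet> w) * indicator K a)) borel (perp_proj u))"
  then have C[measurable]: "C \<in> sets borel" by simp
  define A where "A = K \<inter> perp_proj u -` C"
  have "perp_proj u -` C \<in> sets borel" using measurable_sets[OF perp_proj_measurable C] by simp
  then have A: "A \<in> sets borel" "A \<subseteq> K" using Kb by (auto simp: A_def)
  have pA: "perp_proj u ` A = perp_proj u ` K \<inter> C" by (auto simp: A_def)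
  have vC[measurable]: "perp_proj u -` C \<in> sets \<mu>" using \<open>perp_proj u -` C \<in> sets borel\<close> by (rule borel_sets_\<mu>)
  have "emeasure (distr (density \<mu> (\<lambda>a. ennreal (nn a \<bullet> w) * indicator K a)) borel (perp_proj u)) C
      = emeasure (density \<mu> (\<lambda>a. ennreal (nn a \<bullet> w) * indicator K a)) (perp_proj u -` C)"
    using pm by (subst emeasure_distr) auto
  also have "\<dots> = (\<integral>\<^sup>+a. ennreal (nn a \<bullet> w) * indicator K a * indicator (perp_proj u -` C) a \<partial>\<mu>)"
    by (rule emeasure_density[OF _ vC]) measurable
  also have "\<dots> = I A" unfolding I_def A_def by (intro nn_integral_cong) (auto simp: indicator_def)
  also have "\<dots> = \<Lambda> A" by (rule patch_measure_eq[OF A])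
  also have "\<dots> = (\<integral>\<^sup>+y. ennreal (norm w) * indicator (perp_proj u ` K \<inter> C) y \<partial>slice_measure u)"
    unfolding \<Lambda>_def pA by (subst nn_integral_cmult_indicator) auto
  also have "\<dots> = (\<integral>\<^sup>+y. ennreal (norm w) * indicator (perp_proj u ` K) y * indicator C y \<partial>slice_measure u)"
    by (intro nn_integral_cong) (auto simp: indicator_def)
  also have "\<dots> = emeasure (density (slice_measure u) (\<lambda>y. ennreal (norm w) * indicator (perp_proj u ` K) y)) C"
    by (rule emeasure_density[symmetric]) auto
  finally show "emeasure (distr (density \<mu> (\<lambda>a. ennreal (nn a \<bullet> w) * indicator K a)) borel (perp_proj u)) C
      = emeasure (density (slice_measure u) (\<lambda>y. ennreal (norm w) * indicator (perp_proj u ` K) y)) C" .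
qed simp

lemma gauss_patch_direction:
  assumes c: "C1_grad \<phi> g" and van: "\<And>x. x \<notin> cball z (r / 2) \<Longrightarrow> \<phi> x = 0"
  shows "(LINT x|lborel. indicator \<Omega> x * (g x \<bullet> w)) = (LINT a|\<mu>. indicator S a * (\<phi> a * (nn a \<bullet> w)))"
proof -
  let ?p = "perp_proj u" and ?M = "slice_measure u"
  have Kb: "K \<in> sets borel" using compact_K by (rule borel_compact)
  have K\<mu>[measurable]: "K \<in> sets \<mu>" by (rule borel_sets_\<mu>[OF Kb])
  have pK[measurable]: "?p ` K \<in> sets borel" by (rule image_borel[OF Kb order_refl])
  have pm[measurable]: "?p \<in> borel_measurable \<mu>" by (rule borel_measurable_\<mu>[OF perp_proj_measurable])
  \<comment> \<open>The boundary values of \<open>\<phi>\<close> as a function on the shadow of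
    \<open>K\<close>, which is what integration along the lines produces.\<close>
  define h where "h y = indicator (?p ` K) y * \<phi> (inv_into K ?p y)" for y
  have "continuous_on (?p ` K) (inv_into K ?p)"
    using perp_proj_inj by (intro continuous_on_inv[OF continuous_on_perp_proj compact_K]) auto
  then have "continuous_on (?p ` K) (\<lambda>y. \<phi> (inv_into K ?p y))"
    by (rule continuous_on_compose2[OF C1_grad_continuous[OF c, of UNIV]]) auto
  then have "(\<lambda>y. indicator (?p ` K) y *\<^sub>R \<phi> (inv_into K ?p y)) \<in> borel_measurable borel"
    by (rule borel_measurable_continuous_on_indicator[OF pK])
  then have hm[measurable]: "h \<in> borel_measurable borel" unfolding h_def by simp
  have \<phi>m[measurable]: "\<phi> \<in> borel_measurable \<mu>"
    using C1_grad_continuous[OF c] by (intro borel_measurable_\<mu> borel_measurable_continuous_onI)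
  have gw: "indicator \<Omega> x * (g x \<bullet> w) = norm w * (indicator \<Omega> x * (g x \<bullet> u))" for x
    using w_nz by (simp add: sgn_div_norm)
  have "(LINT x|lborel. indicator \<Omega> x * (g x \<bullet> w)) = norm w * (LINT x|lborel. indicator \<Omega> x * (g x \<bullet> u))"
    unfolding gw by simp
  also have "(LINT x|lborel. indicator \<Omega> x * (g x \<bullet> u))
      = (LINT y|?M. LINT t|lborel. indicator \<Omega> (y + t *\<^sub>R u) * (g (y + t *\<^sub>R u) \<bullet> u))"
    by (rule integral_slice_direction[OF c open_dom bounded_dom norm_u])
  also have "\<dots> = (LINT y|?M. h y)"
  proof (rule integral_cong_AE)
    have [measurable]: "g \<in> borel_measurable borel"
      using C1_grad_continuous_grad[OF c] by (rule borel_measurable_continuous_onI)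
    have [measurable]: "\<Omega> \<in> sets borel" using open_dom by simp
    show "(\<lambda>y. LINT t|lborel. indicator \<Omega> (y + t *\<^sub>R u) * (g (y + t *\<^sub>R u) \<bullet> u)) \<in> borel_measurable ?M"
      by measurable
    show "AE y in ?M. (LINT t|lborel. indicator \<Omega> (y + t *\<^sub>R u) * (g (y + t *\<^sub>R u) \<bullet> u)) = h y"
      using slice_measure_AE_perp[OF norm_u]
    proof eventually_elim
      case (elim y)
      show ?case unfolding h_def by (rule line_integral_patch[OF c van elim])
    qed
  qed measurable
  also have "norm w * (LINT y|?M. h y) = (LINT y|?M. (norm w * indicator (?p ` K) y) *\<^sub>R h y)"
    by (simp add: h_def mult.assoc flip: integral_mult_right_zero) (auto intro!: Bochner_Integration.integral_cong simp: indicator_def)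
  also have "\<dots> = (LINT y|density ?M (\<lambda>y. ennreal (norm w * indicator (?p ` K) y)). h y)"
    by (rule integral_density[symmetric]) auto
  also have "density ?M (\<lambda>y. ennreal (norm w * indicator (?p ` K) y)) = density ?M (\<lambda>y. ennreal (norm w) * indicator (?p ` K) y)"
    by (intro arg_cong[where f="density ?M"]) (auto simp: indicator_def fun_eq_iff)
  also have "\<dots> = distr (density \<mu> (\<lambda>a. ennreal (nn a \<bullet> w) * indicator K a)) borel ?p"
    by (rule slice_density[symmetric])
  also have "(LINT y|\<dots>. h y) = (LINT a|density \<mu> (\<lambda>a. ennreal (nn a \<bullet> w) * indicator K a). h (?p a))"
    using pm hm by (intro integral_distr) simp_all
  also have "density \<mu> (\<lambda>a. ennreal (nn a \<bullet> w) * indicator K a) = density \<mu> (\<lambda>a. ennreal (indicator K a * (nn a \<bullet> w)))"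
    by (intro arg_cong[where f="density \<mu>"]) (auto simp: indicator_def fun_eq_iff)
  also have "(LINT a|\<dots>. h (?p a)) = (LINT a|\<mu>. (indicator K a * (nn a \<bullet> w)) *\<^sub>R h (?p a))"
  proof (rule integral_density)
    show "AE a in \<mu>. 0 \<le> indicator K a * (nn a \<bullet> w)" using nn_w_nonneg by (intro AE_I2) (auto simp: indicator_def)
  qed measurable
  also have "\<dots> = (LINT a|\<mu>. indicator S a * (\<phi> a * (nn a \<bullet> w)))"
  proof (rule Bochner_Integration.integral_cong)
    fix a
    show "(indicator K a * (nn a \<bullet> w)) *\<^sub>R h (?p a) = indicator S a * (\<phi> a * (nn a \<bullet> w))"
    proof (cases "a \<in> K")
      case True
      then have "h (?p a) = \<phi> a" using perp_proj_inj by (simp add: h_def)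
      then show ?thesis using True K_S by simp
    next
      case False
      then have "a \<notin> S \<or> \<phi> a = 0" using van by (auto simp: K_def)
      then show ?thesis using False by auto
    qed
  qed simp
  finally show ?thesis .
qed

end

section \<open>From patches to the whole boundary\<close>

context lipschitz_gauss
begin

lemma patch_finite:
  assumes "cone_patch \<Omega> z r w0 c"
  shows "emeasure \<mu> (S \<inter> cball z (r / 2)) < \<infinity>"
proof -
  interpret gauss_patch \<Omega> n B z r w0 c w0 using assms by unfold_locales (auto simp: cone_patch_def)
  show ?thesis using K_finite by (simp add: K_def)
qed

lemma finite_patches:
  "\<exists>(Z :: 'a set) (r :: 'a \<Rightarrow> real). finite Z \<and> S \<subseteq> (\<Union>z\<in>Z. ball z (r z / 2)) \<and>
    (\<forall>z\<in>Z. \<exists>w0 c. cone_patch \<Omega> z (r z) w0 c)"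
proof -
  obtain r where r: "\<And>z. z \<in> S \<Longrightarrow> \<exists>w0 c. cone_patch \<Omega> z (r z) w0 c" using patch by metis
  have "\<exists>Z\<subseteq>S. finite Z \<and> S \<subseteq> (\<Union>z\<in>Z. ball z (r z / 2))"
  proof (rule compactE_image[OF compact_S])
    show "S \<subseteq> (\<Union>z\<in>S. ball z (r z / 2))"
    proof
      fix z assume z: "z \<in> S"
      then have "0 < r z" using r unfolding cone_patch_def by blast
      then show "z \<in> (\<Union>z\<in>S. ball z (r z / 2))" using z by (intro UN_I[of z]) auto
    qed
  qed auto
  then obtain Z where Z: "Z \<subseteq> S" "finite Z" "S \<subseteq> (\<Union>z\<in>Z. ball z (r z / 2))" by blast
  have "\<forall>z\<in>Z. \<exists>w0 c. cone_patch \<Omega> z (r z) w0 c" using Z(1) r by blast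
  then show ?thesis using Z(2,3) by blast
qed

lemma S_finite: "emeasure \<mu> S < \<infinity>"
proof -
  obtain Z r where "finite Z \<and> S \<subseteq> (\<Union>z\<in>Z. ball z (r z / 2)) \<and> (\<forall>z\<in>Z. \<exists>w0 c. cone_patch \<Omega> z (r z) w0 c)"
    using finite_patches by blast
  then have Z: "finite Z" "S \<subseteq> (\<Union>z\<in>Z. ball z (r z / 2))" "\<And>z. z \<in> Z \<Longrightarrow> \<exists>w0 c. cone_patch \<Omega> z (r z) w0 c"
    by blast+
  have sets: "S \<inter> cball z (r z / 2) \<in> sets \<mu>" for z by (rule borel_sets_\<mu>) auto
  have "emeasure \<mu> S \<le> emeasure \<mu> (\<Union>z\<in>Z. S \<inter> cball z (r z / 2))"
  proof (rule emeasure_mono)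
    show "S \<subseteq> (\<Union>z\<in>Z. S \<inter> cball z (r z / 2))"
    proof
      fix x assume x: "x \<in> S"
      then obtain z where "z \<in> Z" "x \<in> ball z (r z / 2)" using Z(2) by blast
      then show "x \<in> (\<Union>z\<in>Z. S \<inter> cball z (r z / 2))" using x by (intro UN_I[of z]) auto
    qed
    show "(\<Union>z\<in>Z. S \<inter> cball z (r z / 2)) \<in> sets \<mu>" using sets Z(1) by (intro sets.finite_UN) auto
  qed
  also have "\<dots> < \<infinity>"
  proof -
    have "(\<Union>z\<in>Z. S \<inter> cball z (r z / 2)) \<in> fmeasurable \<mu>"
    proof (rule fmeasurable.finite_UN[OF Z(1)])
      fix z assume "z \<in> Z"
      then obtain w0 c where "cone_patch \<Omega> z (r z) w0 c" using Z(3) by blast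
      then show "S \<inter> cball z (r z / 2) \<in> fmeasurable \<mu>"
        using sets patch_finite[of z "r z" w0 c] by (intro fmeasurableI) auto
    qed
    then have "emeasure \<mu> (\<Union>z\<in>Z. S \<inter> cball z (r z / 2)) \<noteq> top" by (rule fmeasurableD2)
    then show ?thesis unfolding infinity_ennreal_def by (rule less_top[THEN iffD1])
  qed
  finally show ?thesis .
qed

lemma integrable_surface:
  assumes f: "continuous_on UNIV f"
  shows "integrable \<mu> (\<lambda>a. indicator S a * (f a * (nn a \<bullet> w)))"
proof -
  have "compact (f ` S)" using compact_S f by (meson compact_continuous_image continuous_on_subset subset_UNIV)
  then have "bounded (f ` S)" by (rule compact_imp_bounded)
  then obtain M where "\<forall>y\<in>f ` S. norm y \<le> M" unfolding bounded_iff by blast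
  then have M: "\<bar>f x\<bar> \<le> M" if "x \<in> S" for x using that by force
  have S\<mu>[measurable]: "S \<in> sets \<mu>" by (rule borel_sets_\<mu>) simp
  have [measurable]: "f \<in> borel_measurable \<mu>"
    using f by (intro borel_measurable_\<mu> borel_measurable_continuous_onI)
  show ?thesis
  proof (rule Bochner_Integration.integrable_bound)
    show "integrable \<mu> (\<lambda>a. (M * norm w) * indicator S a)" using S_finite S\<mu> by simp
    show "AE a in \<mu>. norm (indicator S a * (f a * (nn a \<bullet> w))) \<le> norm ((M * norm w) * indicator S a)"
    proof (rule AE_I2)
      fix a
      have "\<bar>nn a \<bullet> w\<bar> \<le> norm w"
        using Cauchy_Schwarz_ineq2[of "nn a" w] norm_nn_le[of a] mult_left_le_one_le[of "norm w" "norm (nn a)"] by simp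
      then have "\<bar>f a\<bar> * \<bar>nn a \<bullet> w\<bar> \<le> M * norm w" if "a \<in> S"
        using M[OF that] by (intro mult_mono) auto
      then show "norm (indicator S a * (f a * (nn a \<bullet> w))) \<le> norm ((M * norm w) * indicator S a)"
        using order_trans[OF _ abs_ge_self, of "\<bar>f a\<bar> * \<bar>nn a \<bullet> w\<bar>" "M * norm w"]
        by (cases "a \<in> S") (simp_all add: abs_mult)
    qed
  qed measurable
qed

lemma integrable_dom:
  assumes "C1_grad \<phi> g"
  shows "integrable lborel (\<lambda>x. indicator \<Omega> x * (g x \<bullet> w))"
  using open_dom bounded_dom C1_grad_continuous_grad[OF assms, of UNIV]
  by (intro integrable_indicator_continuous continuous_intros) auto

definition gauss_holds :: "('a \<Rightarrow> real) \<Rightarrow> ('a \<Rightarrow> 'a) \<Rightarrow> 'a \<Rightarrow> bool" where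
  "gauss_holds \<phi> g w \<longleftrightarrow>
     (LINT x|lborel. indicator \<Omega> x * (g x \<bullet> w)) = (LINT a|\<mu>. indicator S a * (\<phi> a * (nn a \<bullet> w)))"

text \<open>Both sides are linear in the direction, so two admissible directions that differ by a
  multiple of \<open>w\<close> settle \<open>w\<close>.\<close>

lemma gauss_holds_linear:
  assumes c: "C1_grad \<phi> g" and w: "gauss_holds \<phi> g v" "gauss_holds \<phi> g (v + t *\<^sub>R w)" and t: "t \<noteq> 0"
  shows "gauss_holds \<phi> g w"
proof -
  let ?L = "\<lambda>w. LINT x|lborel. indicator \<Omega> x * (g x \<bullet> w)" and ?R = "\<lambda>w. LINT a|\<mu>. indicator S a * (\<phi> a * (nn a \<bullet> w))"
  have "?L (v + t *\<^sub>R w) = (LINT x|lborel. indicator \<Omega> x * (g x \<bullet> v) + t * (indicator \<Omega> x * (g x \<bullet> w)))"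
    by (intro Bochner_Integration.integral_cong) (auto simp: inner_add_right algebra_simps)
  also have "\<dots> = ?L v + t * ?L w"
    using integrable_dom[OF c] by (subst Bochner_Integration.integral_add) auto
  finally have L: "?L (v + t *\<^sub>R w) = ?L v + t * ?L w" .
  have "?R (v + t *\<^sub>R w) = (LINT a|\<mu>. indicator S a * (\<phi> a * (nn a \<bullet> v)) + t * (indicator S a * (\<phi> a * (nn a \<bullet> w))))"
    by (intro Bochner_Integration.integral_cong) (auto simp: inner_add_right algebra_simps)
  also have "\<dots> = ?R v + t * ?R w"
    using integrable_surface[OF C1_grad_continuous[OF c]] by (subst Bochner_Integration.integral_add) auto
  finally have R: "?R (v + t *\<^sub>R w) = ?R v + t * ?R w" .
  have e: "?L v = ?R v" "?L (v + t *\<^sub>R w) = ?R (v + t *\<^sub>R w)" using w by (simp_all only: gauss_holds_def)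
  have "t * ?L w = t * ?R w" using e(2) unfolding L R e(1) by (rule add_left_imp_eq)
  then have "?L w = ?R w" by (rule mult_left_cancel[OF t, THEN iffD1])
  then show ?thesis by (simp only: gauss_holds_def)
qed

lemma gauss_holds_patch:
  assumes cp: "cone_patch \<Omega> z r w0 c" and c: "C1_grad \<phi> g" and van: "\<And>x. x \<notin> cball z (r / 2) \<Longrightarrow> \<phi> x = 0"
  shows "gauss_holds \<phi> g w"
proof -
  have dir: "gauss_holds \<phi> g v" if "v \<in> ball w0 c" for v
  proof -
    interpret gauss_patch \<Omega> n B z r w0 c v using cp that by unfold_locales
    show ?thesis unfolding gauss_holds_def by (rule gauss_patch_direction[OF c van])
  qed
  have c0: "0 < c" using cp by (simp add: cone_patch_def)
  \<comment> \<open>Small enough for \<open>w0 + t *\<^sub>R w\<close> to stay in the ball of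
    directions; the summand 1 covers \<open>w = 0\<close>.\<close>
  define t where "t = c / (2 * (norm w + 1))"
  have nw: "0 < norm w + 1" by (simp add: add_nonneg_pos)
  have t: "0 < t" using c0 nw by (simp add: t_def)
  have "c / (2 * N) * N = c / 2" if "0 < N" for N :: real using that by simp
  then have tn: "t * (norm w + 1) = c / 2" unfolding t_def using nw by blast
  have "t * norm w \<le> t * (norm w + 1)" using t by (intro mult_left_mono) auto
  then have "t * norm w < c" unfolding tn using c0 by linarith
  then have 1: "w0 + t *\<^sub>R w \<in> ball w0 c" using t by (simp add: dist_norm)
  have 2: "w0 \<in> ball w0 c" using c0 by simp
  have "t \<noteq> 0" using t by simp
  then show ?thesis by (rule gauss_holds_linear[OF c dir[OF 2] dir[OF 1]])
qed

end

section \<open>Calculus of gradients and cut-off functions\<close>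

lemma C1_grad_unique:
  assumes "C1_grad \<phi> g" "C1_grad \<phi> g'"
  shows "g = g'"
proof
  fix x
  have "(\<lambda>h. g x \<bullet> h) = (\<lambda>h. g' x \<bullet> h)"
    using has_derivative_unique C1_grad_derivative[OF assms(1)] C1_grad_derivative[OF assms(2)] by blast
  then have "g x \<bullet> h = g' x \<bullet> h" for h by meson
  then show "g x = g' x" by (metis vector_eq_rdot inner_commute)
qed

lemma C1_grad_mult:
  assumes "C1_grad \<phi> g" "C1_grad \<psi> h"
  shows "C1_grad (\<lambda>x. \<phi> x * \<psi> x) (\<lambda>x. \<phi> x *\<^sub>R h x + \<psi> x *\<^sub>R g x)"
  unfolding C1_grad_def
proof (intro conjI allI)
  show "continuous_on UNIV (\<lambda>x. \<phi> x *\<^sub>R h x + \<psi> x *\<^sub>R g x)"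
    using assms by (intro continuous_intros) (auto intro: C1_grad_continuous C1_grad_continuous_grad)
  fix x
  have "((\<lambda>x. \<phi> x * \<psi> x) has_derivative (\<lambda>k. \<phi> x * (h x \<bullet> k) + (g x \<bullet> k) * \<psi> x)) (at x)"
    by (rule has_derivative_mult[OF C1_grad_derivative[OF assms(1)] C1_grad_derivative[OF assms(2)]])
  then show "((\<lambda>x. \<phi> x * \<psi> x) has_derivative (\<lambda>k. (\<phi> x *\<^sub>R h x + \<psi> x *\<^sub>R g x) \<bullet> k)) (at x)"
    by (simp add: inner_add_left mult.commute)
qed

lemma C1_grad_add:
  assumes "C1_grad \<phi> g" "C1_grad \<psi> h"
  shows "C1_grad (\<lambda>x. \<phi> x + \<psi> x) (\<lambda>x. g x + h x)"
  unfolding C1_grad_def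
proof (intro conjI allI)
  show "continuous_on UNIV (\<lambda>x. g x + h x)"
    using assms by (intro continuous_intros) (auto intro: C1_grad_continuous_grad)
  show "((\<lambda>x. \<phi> x + \<psi> x) has_derivative (\<lambda>k. (g x + h x) \<bullet> k)) (at x)" for x
    unfolding inner_add_left
    by (rule has_derivative_add[OF C1_grad_derivative[OF assms(1)] C1_grad_derivative[OF assms(2)]])
qed

lemma C1_grad_const: "C1_grad (\<lambda>x. c) (\<lambda>x. 0)"
  by (simp add: C1_grad_def)

lemma C1_grad_inner: "C1_grad (\<lambda>x. x \<bullet> i) (\<lambda>x. i)"
  unfolding C1_grad_def by (auto intro!: derivative_eq_intros simp: inner_commute)

lemma C1_grad_quadratic: "C1_grad (\<lambda>x. c - (x - z) \<bullet> (x - z)) (\<lambda>x. - 2 *\<^sub>R (x - z))"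
  unfolding C1_grad_def
  by (auto intro!: derivative_eq_intros continuous_intros simp: fun_eq_iff inner_diff_left inner_diff_right inner_commute)

lemma C1_grad_compose:
  assumes "C1_grad \<phi> g" and f: "\<And>t. (f has_real_derivative f' t) (at t)" and c: "continuous_on UNIV f'"
  shows "C1_grad (\<lambda>x. f (\<phi> x)) (\<lambda>x. f' (\<phi> x) *\<^sub>R g x)"
  unfolding C1_grad_def
proof (intro conjI allI)
  show "continuous_on UNIV (\<lambda>x. f' (\<phi> x) *\<^sub>R g x)"
    using assms(1) by (intro continuous_intros continuous_on_compose2[OF c])
      (auto intro: C1_grad_continuous_grad C1_grad_continuous)
  fix x
  have "((\<lambda>x. f (\<phi> x)) has_derivative (\<lambda>k. f' (\<phi> x) * (g x \<bullet> k))) (at x)"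
    by (rule has_derivative_compose[OF C1_grad_derivative[OF assms(1)] f[of "\<phi> x", unfolded has_field_derivative_def]])
  then show "((\<lambda>x. f (\<phi> x)) has_derivative (\<lambda>k. (f' (\<phi> x) *\<^sub>R g x) \<bullet> k)) (at x)" by simp
qed

text \<open>Squaring smooths the kink of the positive part just enough: bump functions built from it
  are continuously differentiable, which is all the partition of unity has to provide.\<close>

lemma DERIV_pos_part_square: "((\<lambda>t::real. (max 0 t)\<^sup>2) has_real_derivative 2 * max 0 t) (at t)"
proof (cases t "0::real" rule: linorder_cases)
  case less
  have ev: "eventually (\<lambda>s. s \<in> {..<0}) (nhds t)" using less by (intro eventually_nhds_in_open) auto
  have "((\<lambda>t::real. (max 0 t)\<^sup>2) has_real_derivative 0) (at t)"
    by (rule iffD2[OF DERIV_cong_ev[OF refl _ refl] DERIV_const[of 0]]) (use ev in \<open>auto elim!: eventually_mono\<close>)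
  then show ?thesis using less by simp
next
  case greater
  have ev: "eventually (\<lambda>s. s \<in> {0<..}) (nhds t)" using greater by (intro eventually_nhds_in_open) auto
  have d: "((\<lambda>t::real. t\<^sup>2) has_real_derivative 2 * t) (at t)" by (auto intro!: derivative_eq_intros)
  have "((\<lambda>t::real. (max 0 t)\<^sup>2) has_real_derivative 2 * t) (at t)"
    by (rule iffD2[OF DERIV_cong_ev[OF refl _ refl] d]) (use ev in \<open>auto elim!: eventually_mono\<close>)
  then show ?thesis using greater by simp
next
  case equal
  have "((\<lambda>h. ((max 0 (0 + h))\<^sup>2 - (max 0 (0::real))\<^sup>2) / h) \<longlongrightarrow> 0) (at 0)"
  proof (rule Lim_null_comparison)
    have "norm (((max 0 (0 + h))\<^sup>2 - (max 0 0)\<^sup>2) / h) \<le> \<bar>h\<bar>" for h :: real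
      by (cases "h \<ge> 0") (auto simp: power2_eq_square max_def)
    then show "\<forall>\<^sub>F h::real in at 0. norm (((max 0 (0 + h))\<^sup>2 - (max 0 0)\<^sup>2) / h) \<le> \<bar>h\<bar>" by (intro always_eventually allI)
    show "((\<lambda>h::real. \<bar>h\<bar>) \<longlongrightarrow> 0) (at 0)" by (rule tendsto_rabs_zero) (rule tendsto_ident_at)
  qed
  then show ?thesis using equal by (simp add: DERIV_def)
qed

lemma C1_grad_pos_part_square:
  assumes "C1_grad \<phi> g"
  shows "\<exists>h. C1_grad (\<lambda>x. (max 0 (\<phi> x))\<^sup>2) h"
proof -
  have "continuous_on UNIV (\<lambda>t::real. 2 * max 0 t)" by (intro continuous_intros)
  then show ?thesis using C1_grad_compose[OF assms DERIV_pos_part_square] by blast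
qed

text \<open>\<open>cutoff c\<close> is \<open>1 / t\<close> for \<open>t \<ge> c\<close>, continued to a continuously differentiable function on the line.\<close>

definition cutoff :: "real \<Rightarrow> real \<Rightarrow> real" where
  "cutoff c t = t / (t\<^sup>2 + (max 0 (c - t))\<^sup>2)"

lemma cutoff_denominator_pos: "0 < (c::real) \<Longrightarrow> 0 < t\<^sup>2 + (max 0 (c - t))\<^sup>2"
  by (cases "t = 0") (simp_all add: max_def add_pos_nonneg)

lemma cutoff_inverse: "0 < c \<Longrightarrow> c \<le> t \<Longrightarrow> t * cutoff c t = 1"
  by (simp add: cutoff_def max_def power2_eq_square)

lemma C1_grad_cutoff:
  assumes "0 < c" "C1_grad \<phi> g"
  shows "\<exists>h. C1_grad (\<lambda>x. cutoff c (\<phi> x)) h"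
proof -
  let ?d = "\<lambda>t. t\<^sup>2 + (max 0 (c - t))\<^sup>2"
  let ?d' = "\<lambda>t. 2 * t + 2 * max 0 (c - t) * (- 1)"
  have d: "(?d has_real_derivative ?d' t) (at t)" for t
    by (rule derivative_eq_intros DERIV_chain2[OF DERIV_pos_part_square] refl | simp)+
  have D: "(cutoff c has_real_derivative (1 * ?d t - t * ?d' t) / (?d t * ?d t)) (at t)" for t
    unfolding cutoff_def
    by (intro DERIV_divide DERIV_ident d) (use cutoff_denominator_pos[OF assms(1), of t] in linarith)
  have C: "continuous_on UNIV (\<lambda>t. (1 * ?d t - t * ?d' t) / (?d t * ?d t))"
  proof (intro continuous_intros ballI)
    fix t
    note p = cutoff_denominator_pos[OF assms(1), of t]
    show "?d t * ?d t \<noteq> 0" by (rule less_imp_neq[OF mult_pos_pos[OF p p], symmetric])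
  qed
  show ?thesis by (rule exI, rule C1_grad_compose[OF assms(2) D C])
qed

context lipschitz_gauss
begin

definition gauss_fun :: "('a \<Rightarrow> real) \<Rightarrow> bool" where
  "gauss_fun \<phi> \<longleftrightarrow> (\<exists>g. C1_grad \<phi> g \<and> (\<forall>w. gauss_holds \<phi> g w))"

lemma gauss_fun_add:
  assumes "gauss_fun \<phi>" "gauss_fun \<psi>"
  shows "gauss_fun (\<lambda>x. \<phi> x + \<psi> x)"
proof -
  obtain g h where g: "C1_grad \<phi> g" "\<And>w. gauss_holds \<phi> g w" and h: "C1_grad \<psi> h" "\<And>w. gauss_holds \<psi> h w"
    using assms unfolding gauss_fun_def by blast
  have "gauss_holds (\<lambda>x. \<phi> x + \<psi> x) (\<lambda>x. g x + h x) w" for w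
  proof -
    have "(LINT x|lborel. indicator \<Omega> x * ((g x + h x) \<bullet> w))
        = (LINT x|lborel. indicator \<Omega> x * (g x \<bullet> w) + indicator \<Omega> x * (h x \<bullet> w))"
      by (simp add: inner_add_left distrib_left)
    also have "\<dots> = (LINT x|lborel. indicator \<Omega> x * (g x \<bullet> w)) + (LINT x|lborel. indicator \<Omega> x * (h x \<bullet> w))"
      by (rule Bochner_Integration.integral_add[OF integrable_dom[OF g(1)] integrable_dom[OF h(1)]])
    also have "\<dots> = (LINT a|\<mu>. indicator S a * (\<phi> a * (nn a \<bullet> w))) + (LINT a|\<mu>. indicator S a * (\<psi> a * (nn a \<bullet> w)))"
      using g(2) h(2) by (simp only: gauss_holds_def)
    also have "\<dots> = (LINT a|\<mu>. indicator S a * (\<phi> a * (nn a \<bullet> w)) + indicator S a * (\<psi> a * (nn a \<bullet> w)))"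
      by (rule Bochner_Integration.integral_add[symmetric, OF integrable_surface[OF C1_grad_continuous[OF g(1)]]
            integrable_surface[OF C1_grad_continuous[OF h(1)]]])
    also have "\<dots> = (LINT a|\<mu>. indicator S a * ((\<phi> a + \<psi> a) * (nn a \<bullet> w)))"
      by (simp add: algebra_simps)
    finally show ?thesis unfolding gauss_holds_def .
  qed
  then show ?thesis using C1_grad_add[OF g(1) h(1)] unfolding gauss_fun_def by blast
qed

lemma gauss_fun_sum:
  assumes "finite Z" "\<And>z. z \<in> Z \<Longrightarrow> gauss_fun (\<phi> z)"
  shows "gauss_fun (\<lambda>x. \<Sum>z\<in>Z. \<phi> z x)"
  using assms
proof (induction Z rule: finite_induct)
  case empty
  have "gauss_holds (\<lambda>x. 0) (\<lambda>x. 0) w" for w by (simp add: gauss_holds_def)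
  then show ?case using C1_grad_const[of 0] unfolding gauss_fun_def by auto
next
  case (insert z Z)
  then have "gauss_fun (\<lambda>x. \<phi> z x + (\<Sum>z\<in>Z. \<phi> z x))" by (intro gauss_fun_add) auto
  then show ?case using insert(1,2) by simp
qed

lemma gauss_fun_interior:
  assumes c: "C1_grad \<phi> g" and van: "open V" "S \<subseteq> V" "\<And>x. x \<in> V \<Longrightarrow> \<phi> x = 0"
  shows "gauss_fun \<phi>"
proof -
  have "gauss_holds \<phi> g w" for w
  proof -
    have z: "indicator S a * (\<phi> a * (nn a \<bullet> w)) = 0" for a
      using van(2,3) by (cases "a \<in> S") auto
    have "(LINT a|\<mu>. indicator S a * (\<phi> a * (nn a \<bullet> w))) = 0"
      by (simp only: z Bochner_Integration.integral_zero)
    then show ?thesis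
      unfolding gauss_holds_def using integral_grad_interior[OF c open_dom bounded_dom van(1,2,3), of w] by (simp only:)
  qed
  then show ?thesis using c unfolding gauss_fun_def by blast
qed

text \<open>The bumps \<open>\<psi> z\<close> are supported in the patches, and their sum
  \<open>\<Psi>\<close> is positive on the boundary. With \<open>\<theta>\<close> equal to
  \<open>1 / \<Psi>\<close> near the boundary, \<open>\<phi>\<close> splits into
  \<open>(1 - \<Psi> * \<theta>) * \<phi>\<close>, which vanishes near the boundary, and the patch
  parts \<open>\<psi> z * \<theta> * \<phi>\<close>.\<close>

theorem gauss:
  assumes c: "C1_grad \<phi> g"
  shows "(LINT x|lborel. indicator \<Omega> x * (g x \<bullet> w)) = (LINT a|\<mu>. indicator S a * (\<phi> a * (nn a \<bullet> w)))"
proof -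
  obtain Z r where "finite Z \<and> S \<subseteq> (\<Union>z\<in>Z. ball z (r z / 2)) \<and> (\<forall>z\<in>Z. \<exists>w0 c. cone_patch \<Omega> z (r z) w0 c)"
    using finite_patches by blast
  then have Z: "finite Z" "S \<subseteq> (\<Union>z\<in>Z. ball z (r z / 2))" "\<And>z. z \<in> Z \<Longrightarrow> \<exists>w0 c. cone_patch \<Omega> z (r z) w0 c"
    by blast+
  have rp: "0 < r z" if "z \<in> Z" for z using Z(3)[OF that] unfolding cone_patch_def by blast
  define \<psi> where "\<psi> z x = (max 0 ((r z / 2)\<^sup>2 - (x - z) \<bullet> (x - z)))\<^sup>2" for z x
  have \<psi>C: "\<exists>h. C1_grad (\<psi> z) h" for z
    unfolding \<psi>_def by (rule C1_grad_pos_part_square[OF C1_grad_quadratic])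
  have \<psi>nn: "0 \<le> \<psi> z x" for z x by (simp add: \<psi>_def)
  have dsq: "(x - z) \<bullet> (x - z) = (dist z x)\<^sup>2" for x z
    by (simp add: dist_norm norm_minus_commute power2_norm_eq_inner)
  have \<psi>out: "\<psi> z x = 0" if "z \<in> Z" "x \<notin> cball z (r z / 2)" for z x
  proof -
    have "(r z / 2)\<^sup>2 \<le> (dist z x)\<^sup>2" using that rp[OF that(1)] by (intro power_mono) auto
    then show ?thesis by (simp add: \<psi>_def dsq)
  qed
  have \<psi>pos: "0 < \<psi> z x" if "x \<in> ball z (r z / 2)" for z x
  proof -
    have "(dist z x)\<^sup>2 < (r z / 2)\<^sup>2" using that by (intro power_strict_mono) auto
    then show ?thesis by (simp add: \<psi>_def dsq)
  qed
  define \<Psi> where "\<Psi> x = (\<Sum>z\<in>Z. \<psi> z x)" for x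
  have "\<exists>h. C1_grad (\<lambda>x. \<Sum>z\<in>Z'. \<psi> z x) h" if "finite Z'" for Z'
    using that
  proof (induction Z' rule: finite_induct)
    case empty
    then show ?case using C1_grad_const[of 0] by auto
  next
    case (insert z Z')
    then obtain h h' where h: "C1_grad (\<psi> z) h" "C1_grad (\<lambda>x. \<Sum>z\<in>Z'. \<psi> z x) h'" using \<psi>C by blast
    show ?case using C1_grad_add[OF h] insert(1,2) by auto
  qed
  then obtain \<Psi>' where \<Psi>C: "C1_grad \<Psi> \<Psi>'" unfolding \<Psi>_def using Z(1) by blast
  have \<Psi>pos: "0 < \<Psi> x" if x: "x \<in> S" for x
  proof -
    obtain z where z: "z \<in> Z" "x \<in> ball z (r z / 2)" using Z(2) x by blast
    have "\<psi> z x \<le> \<Psi> x" unfolding \<Psi>_def using Z(1) z(1) \<psi>nn by (intro member_le_sum) auto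
    then show ?thesis using \<psi>pos[OF z(2)] by linarith
  qed
  have \<Psi>cont: "continuous_on UNIV \<Psi>" by (rule C1_grad_continuous[OF \<Psi>C])
  \<comment> \<open>The bound is strict so that \<open>{x. e < \<Psi> x}\<close> is an open
    neighbourhood of the boundary, on which the cut-off is an exact reciprocal.\<close>
  have "\<exists>c>0. \<forall>x\<in>S. c < \<Psi> x"
  proof (cases "S = {}")
    case False
    then obtain x0 where x0: "x0 \<in> S" "\<And>x. x \<in> S \<Longrightarrow> \<Psi> x0 \<le> \<Psi> x"
      using continuous_attains_inf[OF compact_S False continuous_on_subset[OF \<Psi>cont]] by auto
    have "\<Psi> x0 / 2 < \<Psi> x" if "x \<in> S" for x using x0(2)[OF that] \<Psi>pos[OF x0(1)] by linarith
    then show ?thesis using \<Psi>pos[OF x0(1)] by (intro exI[of _ "\<Psi> x0 / 2"]) auto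
  qed (auto intro: exI[of _ 1])
  then obtain e where e: "0 < e" "\<And>x. x \<in> S \<Longrightarrow> e < \<Psi> x" by blast
  define \<theta> where "\<theta> x = cutoff e (\<Psi> x)" for x
  obtain \<theta>' where \<theta>C: "C1_grad \<theta> \<theta>'" unfolding \<theta>_def using C1_grad_cutoff[OF e(1) \<Psi>C] by blast
  have \<theta>\<phi>C: "C1_grad (\<lambda>x. \<theta> x * \<phi> x) (\<lambda>x. \<theta> x *\<^sub>R g x + \<phi> x *\<^sub>R \<theta>' x)" by (rule C1_grad_mult[OF \<theta>C c])
  have patch_part: "gauss_fun (\<lambda>x. \<psi> z x * (\<theta> x * \<phi> x))" if z: "z \<in> Z" for z
  proof -
    obtain h where h: "C1_grad (\<psi> z) h" using \<psi>C by blast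
    obtain w0 c where cp: "cone_patch \<Omega> z (r z) w0 c" using Z(3)[OF z] by blast
    note C = C1_grad_mult[OF h \<theta>\<phi>C]
    have "\<psi> z x * (\<theta> x * \<phi> x) = 0" if "x \<notin> cball z (r z / 2)" for x using \<psi>out[OF z that] by simp
    then show ?thesis unfolding gauss_fun_def using C gauss_holds_patch[OF cp C] by blast
  qed
  obtain \<chi>' where \<chi>C: "C1_grad (\<lambda>x. 1 + (- 1) * (\<Psi> x * \<theta> x)) \<chi>'"
    using C1_grad_add[OF C1_grad_const[of 1] C1_grad_mult[OF C1_grad_const[of "- 1"] C1_grad_mult[OF \<Psi>C \<theta>C]]] by blast
  have inner_part: "gauss_fun (\<lambda>x. (1 + (- 1) * (\<Psi> x * \<theta> x)) * \<phi> x)"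
  proof (rule gauss_fun_interior[OF C1_grad_mult[OF \<chi>C c]])
    show "open {x. e < \<Psi> x}" using \<Psi>cont by (intro open_Collect_less continuous_on_const)
    show "S \<subseteq> {x. e < \<Psi> x}" using e(2) by blast
    show "(1 + (- 1) * (\<Psi> x * \<theta> x)) * \<phi> x = 0" if "x \<in> {x. e < \<Psi> x}" for x
      using cutoff_inverse[OF e(1), of "\<Psi> x"] that by (simp add: \<theta>_def)
  qed
  have "gauss_fun (\<lambda>x. (1 + (- 1) * (\<Psi> x * \<theta> x)) * \<phi> x + (\<Sum>z\<in>Z. \<psi> z x * (\<theta> x * \<phi> x)))"
    by (intro gauss_fun_add inner_part gauss_fun_sum Z(1) patch_part)
  also have "(\<lambda>x. (1 + (- 1) * (\<Psi> x * \<theta> x)) * \<phi> x + (\<Sum>z\<in>Z. \<psi> z x * (\<theta> x * \<phi> x))) = \<phi>"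
  proof
    fix x
    have "(\<Sum>z\<in>Z. \<psi> z x * (\<theta> x * \<phi> x)) = \<Psi> x * (\<theta> x * \<phi> x)"
      by (simp only: \<Psi>_def sum_distrib_right)
    then show "(1 + (- 1) * (\<Psi> x * \<theta> x)) * \<phi> x + (\<Sum>z\<in>Z. \<psi> z x * (\<theta> x * \<phi> x)) = \<phi> x"
      by (simp add: algebra_simps)
  qed
  finally obtain g' where g': "C1_grad \<phi> g'" "\<And>w. gauss_holds \<phi> g' w" unfolding gauss_fun_def by blast
  \<comment> \<open>\<open>gauss_fun\<close> only asserts the identity for some gradient; uniqueness
    identifies it with the given one.\<close>
  have "g' = g" by (rule C1_grad_unique[OF g'(1) c])
  then show ?thesis using g'(2)[of w] unfolding gauss_holds_def by simp
qed

end

section \<open>Lipschitz charts\<close>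

lemma lipschitz_chart_perp: "norm e = 1 \<Longrightarrow> perp_proj e x \<in> {y. y \<bullet> e = 0}"
  by (simp add: perp_proj_inner)

text \<open>Going back along a direction close to \<open>e\<close> lowers the height by more than
  the Lipschitz graph can fall over the sideways displacement, so points below the graph stay below
  it.\<close>

lemma lipschitz_chart_cone_patch:
  assumes "lipschitz_chart \<Omega> z r e \<gamma>"
  shows "\<exists>w0 c. cone_patch \<Omega> z r w0 c"
proof -
  obtain L where r: "0 < r" and e: "norm e = 1" and L: "L-lipschitz_on {y. y \<bullet> e = 0} \<gamma>"
    and chart: "\<And>x. x \<in> ball z r \<Longrightarrow> x \<in> \<Omega> \<longleftrightarrow> x \<bullet> e < \<gamma> (perp_proj e x)"
    using assms unfolding lipschitz_chart_def perp_proj_def by blast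
  have L0: "0 \<le> L" using L by (rule lipschitz_on_nonneg)
  \<comment> \<open>Then \<open>(L + 1) * c = 1/2\<close>, hence the sideways effect, at most
    \<open>L * c\<close>, does not exceed the height \<open>1 - c\<close> that every admissible
    direction keeps.\<close>
  define c where "c = 1 / (2 * (1 + L))"
  have c: "0 < c" "c < norm e" "L * c + c \<le> 1" using L0 e by (auto simp: c_def field_simps)
  have "x - s *\<^sub>R w \<in> \<Omega>" if w: "w \<in> ball e c" and x: "x \<in> \<Omega> \<inter> ball z r" and s: "0 < s" and y: "x - s *\<^sub>R w \<in> ball z r" for w x s
  proof -
    let ?P = "perp_proj e"
    have v: "norm (w - e) < c" using w by (simp add: dist_norm norm_minus_commute)
    have "?P w = ?P (w - e)" using e by (simp add: perp_proj_def inner_diff_left norm_eq_1 algebra_simps)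
    then have Pw: "norm (?P w) < c" using norm_perp_proj_le[OF e, of "w - e"] v by simp
    have "\<bar>(w - e) \<bullet> e\<bar> \<le> norm (w - e)" using Cauchy_Schwarz_ineq2[of "w - e" e] e by simp
    then have we: "1 - c < w \<bullet> e" using v e by (simp add: inner_diff_left norm_eq_1)
    have "L * norm (?P w) \<le> L * c" using Pw L0 by (intro mult_left_mono) auto
    then have "s * (L * norm (?P w)) < s * (w \<bullet> e)" using we c(3) s by (intro mult_strict_left_mono) auto
    moreover have "dist (\<gamma> (?P x)) (\<gamma> (?P (x - s *\<^sub>R w))) \<le> L * dist (?P x) (?P (x - s *\<^sub>R w))"
      by (rule lipschitz_onD[OF L lipschitz_chart_perp[OF e] lipschitz_chart_perp[OF e]])
    moreover have "dist (?P x) (?P (x - s *\<^sub>R w)) = s * norm (?P w)"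
    proof -
      have "?P x - ?P (x - s *\<^sub>R w) = s *\<^sub>R ?P w" by (simp add: perp_proj_def inner_diff_left algebra_simps)
      then show ?thesis using s by (simp add: dist_norm)
    qed
    moreover have "x \<bullet> e < \<gamma> (?P x)" using chart x by auto
    ultimately have "(x - s *\<^sub>R w) \<bullet> e < \<gamma> (?P (x - s *\<^sub>R w))"
      by (simp add: inner_diff_left dist_real_def abs_le_iff algebra_simps)
    then show ?thesis using chart y by auto
  qed
  then have "cone_patch \<Omega> z r e c" unfolding cone_patch_def using r c by blast
  then show ?thesis by blast
qed

text \<open>Membership in \<open>\<Omega>\<close> is decided by the sign of
  \<open>x \<bullet> e - \<gamma> (perp_proj e x)\<close>, to first order
  \<open>?D * (\<nu> \<bullet> (x - z))\<close> with \<open>?D \<ge> 1\<close>. So an error below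
  \<open>\<epsilon> * norm (x - z)\<close> cannot change the sign outside the double cone.\<close>

lemma is_outward_unit_normal_at:
  assumes \<Omega>: "open \<Omega>" and n: "is_outward_unit_normal \<Omega> z \<nu>"
  shows "unit_normal_at \<Omega> z \<nu>"
proof -
  obtain r e \<gamma> g where z: "z \<in> frontier \<Omega>" and lc: "lipschitz_chart \<Omega> z r e \<gamma>" and ge: "g \<bullet> e = 0"
    and d: "(\<gamma> has_derivative (\<lambda>h. g \<bullet> h)) (at (perp_proj e z) within {y. y \<bullet> e = 0})"
    and \<nu>: "\<nu> = (1 / sqrt (1 + (norm g)\<^sup>2)) *\<^sub>R (e - g)"
    using n unfolding is_outward_unit_normal_def perp_proj_def by blast
  obtain L where r: "0 < r" and e: "norm e = 1" and L: "L-lipschitz_on {y. y \<bullet> e = 0} \<gamma>"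
    and chart: "\<And>x. x \<in> ball z r \<Longrightarrow> x \<in> \<Omega> \<longleftrightarrow> x \<bullet> e < \<gamma> (perp_proj e x)"
    using lc unfolding lipschitz_chart_def perp_proj_def by blast
  let ?P = "perp_proj e" and ?D = "sqrt (1 + (norm g)\<^sup>2)"
  have D: "1 \<le> ?D" by simp
  have "(norm (e - g))\<^sup>2 = 1 + (norm g)\<^sup>2"
    using e ge unfolding power2_norm_eq_inner by (simp add: inner_diff_left inner_diff_right inner_commute norm_eq_1)
  then have "norm (e - g) = ?D" by (metis norm_ge_zero real_sqrt_unique)
  moreover have "1 + (norm g)\<^sup>2 \<noteq> 0" using zero_le_power2[of "norm g"] by linarith
  ultimately have n1: "norm \<nu> = 1" by (simp add: \<nu>)
  have \<nu>D: "(e - g) \<bullet> v = ?D * (\<nu> \<bullet> v)" for v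
  proof -
    have "?D \<noteq> 0" using D by linarith
    then show ?thesis unfolding \<nu> by simp
  qed
  \<comment> \<open>A frontier point lies on the graph: not below it because \<open>\<Omega>\<close>
    is open, not above it because the region above is open and disjoint from \<open>\<Omega>\<close>
    inside the ball.\<close>
  have ze: "z \<bullet> e = \<gamma> (?P z)"
  proof (rule antisym)
    have "z \<notin> \<Omega>" using z \<Omega> by (simp add: frontier_def interior_open)
    then show "\<gamma> (?P z) \<le> z \<bullet> e" using chart[of z] r by simp
    show "z \<bullet> e \<le> \<gamma> (?P z)"
    proof (rule ccontr)
      assume "\<not> z \<bullet> e \<le> \<gamma> (?P z)"
      then have zU: "z \<in> ball z r \<inter> {x. \<gamma> (?P x) < x \<bullet> e}" using r by simp
      have "continuous_on UNIV (\<lambda>x. \<gamma> (?P x))"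
        by (rule continuous_on_compose2[OF lipschitz_on_continuous_on[OF L] continuous_on_perp_proj])
           (use lipschitz_chart_perp[OF e] in auto)
      then have "open (ball z r \<inter> {x. \<gamma> (?P x) < x \<bullet> e})"
        by (intro open_Int open_ball open_Collect_less continuous_intros)
      then have "\<Omega> \<inter> (ball z r \<inter> {x. \<gamma> (?P x) < x \<bullet> e}) \<noteq> {}"
        using zU z unfolding frontier_def closure_iff_nhds_not_empty by (metis DiffD1 closure_iff_nhds_not_empty subset_refl)
      then show False using chart by force
    qed
  qed
  have "\<exists>\<delta>>0. pinched_at \<Omega> \<nu> \<epsilon> \<delta> z" if \<epsilon>: "0 < \<epsilon>" for \<epsilon>
  proof -
    obtain \<delta>1 where \<delta>1: "0 < \<delta>1"
      "\<And>y. y \<bullet> e = 0 \<Longrightarrow> norm (y - ?P z) < \<delta>1 \<Longrightarrow> norm (\<gamma> y - \<gamma> (?P z) - g \<bullet> (y - ?P z)) \<le> \<epsilon> * norm (y - ?P z)"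
      using d \<epsilon> unfolding has_derivative_within_alt by blast
    have "pinched_at \<Omega> \<nu> \<epsilon> (min \<delta>1 r) z"
      unfolding pinched_at_def
    proof (intro allI impI)
      fix x assume x: "dist x z < min \<delta>1 r"
      have xb: "x \<in> ball z r" using x by (simp add: dist_commute)
      have Pd: "?P x - ?P z = ?P (x - z)" by (simp add: perp_proj_def inner_diff_left algebra_simps)
      have nP: "norm (?P x - ?P z) \<le> norm (x - z)" unfolding Pd by (rule norm_perp_proj_le[OF e])
      then have "norm (?P x - ?P z) < \<delta>1" using x by (simp add: dist_norm)
      then have "norm (\<gamma> (?P x) - \<gamma> (?P z) - g \<bullet> (?P x - ?P z)) \<le> \<epsilon> * norm (?P x - ?P z)"
        by (intro \<delta>1(2)) (simp_all add: perp_proj_inner e)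
      also have "\<dots> \<le> \<epsilon> * norm (x - z)" using nP \<epsilon> by (intro mult_left_mono) auto
      finally have a: "\<bar>\<gamma> (?P x) - \<gamma> (?P z) - g \<bullet> (?P x - ?P z)\<bar> \<le> \<epsilon> * norm (x - z)" by simp
      have "g \<bullet> (?P x - ?P z) = g \<bullet> (x - z)" unfolding Pd perp_proj_def using ge by (simp add: inner_diff_right)
      then have "x \<bullet> e - \<gamma> (?P x) = (e - g) \<bullet> (x - z) - (\<gamma> (?P x) - \<gamma> (?P z) - g \<bullet> (?P x - ?P z))"
        using ze by (simp add: inner_diff_left inner_diff_right inner_commute)
      then have b: "\<bar>(x \<bullet> e - \<gamma> (?P x)) - ?D * (\<nu> \<bullet> (x - z))\<bar> \<le> \<epsilon> * norm (x - z)" using a unfolding \<nu>D by linarith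
      have De: "\<epsilon> * norm (x - z) \<le> ?D * (\<epsilon> * norm (x - z))"
        using mult_right_mono[OF D, of "\<epsilon> * norm (x - z)"] \<epsilon> by simp
      have pos: "0 < ?D" using D by linarith
      show "(\<nu> \<bullet> (x - z) < - \<epsilon> * norm (x - z) \<longrightarrow> x \<in> \<Omega>) \<and> (\<epsilon> * norm (x - z) < \<nu> \<bullet> (x - z) \<longrightarrow> x \<notin> \<Omega>)"
      proof (intro conjI impI)
        assume "\<nu> \<bullet> (x - z) < - \<epsilon> * norm (x - z)"
        then have "?D * (\<nu> \<bullet> (x - z)) < ?D * (- \<epsilon> * norm (x - z))" using pos by (rule mult_strict_left_mono)
        then have "x \<bullet> e - \<gamma> (?P x) < 0" using b De by (simp add: abs_le_iff)
        then show "x \<in> \<Omega>" using chart[OF xb] by simp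
      next
        assume "\<epsilon> * norm (x - z) < \<nu> \<bullet> (x - z)"
        then have "?D * (\<epsilon> * norm (x - z)) < ?D * (\<nu> \<bullet> (x - z))" using pos by (rule mult_strict_left_mono)
        then have "x \<bullet> e - \<gamma> (?P x) > 0" using b De by (simp add: abs_le_iff)
        then show "x \<notin> \<Omega>" using chart[OF xb] by simp
      qed
    qed
    then show ?thesis using \<delta>1(1) r by (intro exI[of _ "min \<delta>1 r"]) auto
  qed
  then show ?thesis using n1 by (simp add: unit_normal_at_def)
qed

text \<open>Pinching does not refer to a chart, so its uniqueness shows that all charts give the
  same normal and that the description by \<open>THE\<close> is meaningful.\<close>

lemma outward_normal_unit_normal_at:
  assumes \<Omega>: "open \<Omega>" and ex: "\<exists>\<nu>. is_outward_unit_normal \<Omega> z \<nu>"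
  shows "unit_normal_at \<Omega> z (outward_normal \<Omega> z)"
proof -
  have "\<exists>!\<nu>. is_outward_unit_normal \<Omega> z \<nu>"
    using ex unit_normal_at_unique is_outward_unit_normal_at[OF \<Omega>] by blast
  then have "is_outward_unit_normal \<Omega> z (outward_normal \<Omega> z)"
    unfolding outward_normal_def by (rule theI')
  then show ?thesis by (rule is_outward_unit_normal_at[OF \<Omega>])
qed

lemma lipschitz_gauss_piecewise_C1:
  fixes \<Omega> :: "'a::euclidean_space set"
  assumes "piecewise_C1_domain \<Omega>"
  shows "\<exists>B. lipschitz_gauss \<Omega> (outward_normal \<Omega>) B"
proof -
  obtain N G B where \<Omega>: "open \<Omega>" "bounded \<Omega>" "lipschitz_boundary \<Omega>" and dec: "piecewise_C1_decomposition \<Omega> N G B"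
    using assms unfolding piecewise_C1_domain_def by blast
  have "lipschitz_gauss \<Omega> (outward_normal \<Omega>) B"
  proof
    show "\<exists>r w0 c. cone_patch \<Omega> z r w0 c" if "z \<in> frontier \<Omega>" for z
      using \<Omega>(3) that lipschitz_chart_cone_patch unfolding lipschitz_boundary_def by meson
    show "unit_normal_at \<Omega> a (outward_normal \<Omega> a)" if "a \<in> frontier \<Omega> - B" for a
      using that dec unfolding piecewise_C1_decomposition_def
      by (intro outward_normal_unit_normal_at[OF \<Omega>(1)]) blast
    show "hausdorff_outer (DIM('a) - 1) B = 0" using dec unfolding piecewise_C1_decomposition_def by blast
  qed (use \<Omega> in auto)
  then show ?thesis by blast
qed

section \<open>Moments of the ball\<close>

text \<open>In a patch around \<open>z\<close> both the end point of a step and its direction are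
  close to \<open>z\<close>, so their inner product is nonnegative and stepping back does not
  increase the norm. Pinching follows from expanding \<open>(norm x)\<^sup>2\<close> around
  \<open>a\<close>.\<close>

lemma lipschitz_gauss_ball:
  assumes \<rho>: "0 < \<rho>"
  shows "lipschitz_gauss (ball (0::'a::euclidean_space) \<rho>) (\<lambda>a. (1 / \<rho>) *\<^sub>R a) {}"
proof
  fix z :: 'a assume "z \<in> frontier (ball 0 \<rho>)"
  then have z: "norm z = \<rho>" using \<rho> by (simp add: frontier_ball)
  have "x - s *\<^sub>R w \<in> ball 0 \<rho>"
    if w: "w \<in> ball z (\<rho> / 4)" and x: "x \<in> ball 0 \<rho> \<inter> ball z (\<rho> / 4)" and s: "0 < s" and y: "x - s *\<^sub>R w \<in> ball z (\<rho> / 4)" for w x s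
  proof -
    define a where "a = x - s *\<^sub>R w - z"
    define b where "b = w - z"
    have a: "norm a < \<rho> / 4" and b: "norm b < \<rho> / 4"
      using y w by (auto simp: a_def b_def dist_norm norm_minus_commute)
    have zz: "z \<bullet> z = \<rho> * \<rho>" using z by (simp add: dot_square_norm power2_eq_square)
    have cs: "\<bar>x \<bullet> y\<bar> \<le> p * q" if "norm x \<le> p" "norm y \<le> q" for x y :: 'a and p q
      using order_trans[OF Cauchy_Schwarz_ineq2 mult_mono[OF that]] that order_trans[OF norm_ge_zero that(1)] by simp
    have "\<bar>z \<bullet> b\<bar> \<le> \<rho> * (\<rho> / 4)" using z b by (intro cs) auto
    moreover have "\<bar>a \<bullet> z\<bar> \<le> (\<rho> / 4) * \<rho>" using z a by (intro cs) auto
    moreover have "\<bar>a \<bullet> b\<bar> \<le> (\<rho> / 4) * (\<rho> / 4)" using a b by (intro cs) auto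
    moreover have "(x - s *\<^sub>R w) \<bullet> w = z \<bullet> z + z \<bullet> b + a \<bullet> z + a \<bullet> b"
    proof -
      have "x - s *\<^sub>R w = z + a" "w = z + b" by (simp_all add: a_def b_def)
      then show ?thesis by (simp add: inner_add_left inner_add_right)
    qed
    moreover have "0 \<le> \<rho> * \<rho>" by simp
    \<comment> \<open>The three error terms sum to at most 9/16 of the leading term
      \<open>\<rho> * \<rho>\<close>.\<close>
    ultimately have yw: "0 \<le> (x - s *\<^sub>R w) \<bullet> w" unfolding zz by (simp add: abs_le_iff)
    have "(norm x)\<^sup>2 = (norm (x - s *\<^sub>R w))\<^sup>2 + 2 * s * ((x - s *\<^sub>R w) \<bullet> w) + s\<^sup>2 * (norm w)\<^sup>2"
      unfolding power2_norm_eq_inner by (simp add: inner_diff_left inner_diff_right inner_commute algebra_simps power2_eq_square)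
    then have "(norm (x - s *\<^sub>R w))\<^sup>2 \<le> (norm x)\<^sup>2" using yw s by simp
    then have "norm (x - s *\<^sub>R w) \<le> norm x" by (rule power2_le_imp_le) simp
    then show ?thesis using x by simp
  qed
  then have "cone_patch (ball 0 \<rho>) z (\<rho> / 4) z (\<rho> / 4)" unfolding cone_patch_def using \<rho> z by simp
  then show "\<exists>r w0 c. cone_patch (ball 0 \<rho>) z r w0 c" by blast
next
  fix a :: 'a assume "a \<in> frontier (ball 0 \<rho>) - {}"
  then have a: "norm a = \<rho>" using \<rho> by (simp add: frontier_ball)
  let ?\<nu> = "(1 / \<rho>) *\<^sub>R a"
  \<comment> \<open>Within this radius the quadratic term \<open>m\<^sup>2\<close> of the expansion
    is at most \<open>2 * \<rho> * \<epsilon> * m\<close>, the size of the linear term on the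
    cone.\<close>
  have "pinched_at (ball 0 \<rho>) ?\<nu> \<epsilon> (2 * \<rho> * \<epsilon>) a" if \<epsilon>: "0 < \<epsilon>" for \<epsilon>
    unfolding pinched_at_def
  proof (intro allI impI)
    fix x assume x: "dist x a < 2 * \<rho> * \<epsilon>"
    define m where "m = norm (x - a)"
    have m: "0 \<le> m" "m < 2 * \<rho> * \<epsilon>" using x by (auto simp: m_def dist_norm)
    have e1: "(norm x)\<^sup>2 = (norm a)\<^sup>2 + 2 * (a \<bullet> (x - a)) + m\<^sup>2"
      unfolding m_def power2_norm_eq_inner by (simp add: inner_diff_left inner_diff_right inner_commute)
    have e2: "a \<bullet> (x - a) = \<rho> * (?\<nu> \<bullet> (x - a))" using \<rho> by simp
    have eq: "(norm x)\<^sup>2 = \<rho>\<^sup>2 + 2 * \<rho> * (?\<nu> \<bullet> (x - a)) + m\<^sup>2"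
      by (simp only: e1 e2 a mult.assoc)
    show "(?\<nu> \<bullet> (x - a) < - \<epsilon> * norm (x - a) \<longrightarrow> x \<in> ball 0 \<rho>) \<and> (\<epsilon> * norm (x - a) < ?\<nu> \<bullet> (x - a) \<longrightarrow> x \<notin> ball 0 \<rho>)"
      unfolding m_def [symmetric]
    proof (intro conjI impI)
      assume "?\<nu> \<bullet> (x - a) < - \<epsilon> * m"
      then have "2 * \<rho> * (?\<nu> \<bullet> (x - a)) < 2 * \<rho> * (- \<epsilon> * m)" using \<rho> by (intro mult_strict_left_mono) auto
      moreover have "m * m \<le> (2 * \<rho> * \<epsilon>) * m" using m by (intro mult_right_mono) auto
      ultimately have "(norm x)\<^sup>2 < \<rho>\<^sup>2" unfolding eq by (simp add: power2_eq_square mult_ac)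
      then show "x \<in> ball 0 \<rho>" using \<rho> by (simp add: power_less_imp_less_base)
    next
      assume "\<epsilon> * m < ?\<nu> \<bullet> (x - a)"
      moreover have "0 \<le> \<epsilon> * m" using \<epsilon> m by simp
      ultimately have "0 \<le> 2 * \<rho> * (?\<nu> \<bullet> (x - a))" using \<rho> by (intro mult_nonneg_nonneg) auto
      then have "\<rho>\<^sup>2 \<le> (norm x)\<^sup>2" unfolding eq by simp
      then have "\<rho> \<le> norm x" by (rule power2_le_imp_le) simp
      then show "x \<notin> ball 0 \<rho>" by simp
    qed
  qed
  then have "\<exists>\<delta>>0. pinched_at (ball 0 \<rho>) ?\<nu> \<epsilon> \<delta> a" if "0 < \<epsilon>" for \<epsilon>
    using that \<rho> by (metis mult_pos_pos zero_less_numeral)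
  moreover have "a \<noteq> 0" using a \<rho> by auto
  then have "norm ?\<nu> = 1" using a \<rho> by simp
  ultimately show "unit_normal_at (ball 0 \<rho>) a ?\<nu>" unfolding unit_normal_at_def by blast
qed auto

text \<open>The Gauss theorem for \<open>\<rho>\<^sup>2 - x \<bullet> x\<close>, which vanishes on
  the sphere and has gradient \<open>- 2 *\<^sub>R x\<close>.\<close>

lemma integral_ball_linear:
  fixes v :: "'a::euclidean_space"
  assumes \<rho>: "0 < \<rho>"
  shows "(LINT h|lborel. indicator (ball 0 \<rho>) h * (h \<bullet> v)) = 0"
proof -
  interpret lipschitz_gauss "ball (0::'a) \<rho>" "\<lambda>a. (1 / \<rho>) *\<^sub>R a" "{}" by (rule lipschitz_gauss_ball[OF \<rho>])
  have c: "C1_grad (\<lambda>x::'a. \<rho>\<^sup>2 - (x - 0) \<bullet> (x - 0)) (\<lambda>x. - 2 *\<^sub>R (x - 0))" by (rule C1_grad_quadratic)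
  have z: "indicator S a * ((\<rho>\<^sup>2 - (a - 0) \<bullet> (a - 0)) * (nn a \<bullet> v)) = 0" for a :: 'a
    using \<rho> by (auto simp: indicator_def frontier_ball dot_square_norm)
  then have "(LINT x|lborel. indicator (ball 0 \<rho>) x * ((- 2 *\<^sub>R (x - 0)) \<bullet> v)) = 0"
    using gauss[OF c, of v] by (simp only: z Bochner_Integration.integral_zero)
  moreover have "indicator (ball 0 \<rho>) x * ((- 2 *\<^sub>R (x - 0)) \<bullet> v) = (- 2) * (indicator (ball 0 \<rho>) x * (x \<bullet> v))" for x :: 'a by simp
  ultimately show ?thesis by (simp only: Bochner_Integration.integral_mult_right_zero mult_eq_0_iff) simp
qed

text \<open>Gauss for a coordinate function in its own direction turns the volume of the ball into
  the surface integral of the squared coordinate; on the sphere the squares add up to 1.\<close>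

lemma measure_sphere_hausdorff:
  "measure (hausdorff_measure (DIM('a) - 1)) (sphere (0::'a::euclidean_space) 1) = real DIM('a) * unit_ball_vol (real DIM('a))"
proof -
  interpret lipschitz_gauss "ball (0::'a) 1" "\<lambda>a. a" "{}"
    using lipschitz_gauss_ball[of 1, where 'a='a] by simp
  have S: "S = sphere 0 1" by (simp add: frontier_ball)
  have vol: "(LINT a|\<mu>. indicator S a * ((a \<bullet> i) * (a \<bullet> i))) = unit_ball_vol (real DIM('a))" if i: "i \<in> Basis" for i :: 'a
  proof -
    have "(LINT x|lborel. indicator (ball (0::'a) 1) x * (i \<bullet> i)) = unit_ball_vol (real DIM('a))"
      using i content_ball[of 1 "0::'a"] by simp
    moreover have "indicator S a * ((a \<bullet> i) * (nn a \<bullet> i)) = indicator S a * ((a \<bullet> i) * (a \<bullet> i))" for a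
      by (cases "a \<in> S") (simp_all add: nn_def)
    ultimately show ?thesis using gauss[OF C1_grad_inner, of i i] by (simp only:)
  qed
  have int: "integrable \<mu> (\<lambda>a. indicator S a * ((a \<bullet> i) * (a \<bullet> i)))" for i :: 'a
  proof -
    have "integrable \<mu> (\<lambda>a. indicator S a * ((a \<bullet> i) * (nn a \<bullet> i)))" by (intro integrable_surface continuous_intros)
    then show ?thesis by (rule Bochner_Integration.integrable_cong[THEN iffD1, rotated 2]) (auto simp: nn_def indicator_def)
  qed
  have "measure \<mu> S = (LINT a|\<mu>. indicator S a)" by simp
  also have "\<dots> = (LINT a|\<mu>. (\<Sum>i\<in>Basis. indicator S a * ((a \<bullet> i) * (a \<bullet> i))))"
  proof (rule Bochner_Integration.integral_cong)
    fix a
    show "indicator S a = (\<Sum>i\<in>Basis. indicator S a * ((a \<bullet> i) * (a \<bullet> i)))"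
      unfolding sum_distrib_left[symmetric] euclidean_inner[symmetric]
      by (auto simp: S indicator_def dot_square_norm)
  qed simp
  also have "\<dots> = (\<Sum>i\<in>Basis. LINT a|\<mu>. indicator S a * ((a \<bullet> i) * (a \<bullet> i)))"
    by (rule Bochner_Integration.integral_sum[OF int])
  also have "\<dots> = (\<Sum>i\<in>(Basis :: 'a set). unit_ball_vol (real DIM('a)))" by (intro sum.cong refl vol)
  finally show ?thesis by (simp add: S)
qed

text \<open>Gauss for \<open>(\<rho>\<^sup>2 - x \<bullet> x) * (x \<bullet> i)\<close> in direction
  \<open>j\<close>, without boundary term, expresses every second moment through the single number
  \<open>q\<close>. Taking the trace determines \<open>q\<close>.\<close>

lemma integral_ball_quadratic:
  fixes i j :: "'a::euclidean_space"
  assumes \<rho>: "0 < \<rho>" and ij: "i \<in> Basis" "j \<in> Basis"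
  shows "(LINT h|lborel. indicator (ball 0 \<rho>) h * ((h \<bullet> i) * (h \<bullet> j)))
    = (if i = j then unit_ball_vol (real DIM('a)) * \<rho> ^ (DIM('a) + 2) / (real DIM('a) + 2) else 0)"
proof -
  interpret lipschitz_gauss "ball (0::'a) \<rho>" "\<lambda>a. (1 / \<rho>) *\<^sub>R a" "{}" by (rule lipschitz_gauss_ball[OF \<rho>])
  let ?B = "ball (0::'a) \<rho>"
  define q where "q = (LINT x|lborel. indicator ?B x * (\<rho>\<^sup>2 - x \<bullet> x))"
  have int: "integrable lborel (\<lambda>x. indicator ?B x * f x)" if "continuous_on UNIV f" for f :: "'a \<Rightarrow> real"
    using that by (intro integrable_indicator_continuous) auto
  have m: "2 * (LINT x|lborel. indicator ?B x * ((x \<bullet> i) * (x \<bullet> j))) = (i \<bullet> j) * q" for i j :: 'a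
  proof -
    have c: "C1_grad (\<lambda>x::'a. (\<rho>\<^sup>2 - (x - 0) \<bullet> (x - 0)) * (x \<bullet> i)) (\<lambda>x. (\<rho>\<^sup>2 - (x - 0) \<bullet> (x - 0)) *\<^sub>R i + (x \<bullet> i) *\<^sub>R (- 2 *\<^sub>R (x - 0)))"
      by (intro C1_grad_mult C1_grad_quadratic C1_grad_inner)
    have z: "indicator S a * (((\<rho>\<^sup>2 - (a - 0) \<bullet> (a - 0)) * (a \<bullet> i)) * (nn a \<bullet> j)) = 0" for a :: 'a
      using \<rho> by (auto simp: indicator_def frontier_ball dot_square_norm)
    then have "(LINT x|lborel. indicator ?B x * (((\<rho>\<^sup>2 - (x - 0) \<bullet> (x - 0)) *\<^sub>R i + (x \<bullet> i) *\<^sub>R (- 2 *\<^sub>R (x - 0))) \<bullet> j)) = 0"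
      using gauss[OF c, of j] by (simp only: z Bochner_Integration.integral_zero)
    moreover have "indicator ?B x * (((\<rho>\<^sup>2 - (x - 0) \<bullet> (x - 0)) *\<^sub>R i + (x \<bullet> i) *\<^sub>R (- 2 *\<^sub>R (x - 0))) \<bullet> j)
        = (i \<bullet> j) * (indicator ?B x * (\<rho>\<^sup>2 - x \<bullet> x)) - 2 * (indicator ?B x * ((x \<bullet> i) * (x \<bullet> j)))" for x
      by (simp add: inner_add_left inner_diff_left algebra_simps)
    moreover have "(LINT x|lborel. (i \<bullet> j) * (indicator ?B x * (\<rho>\<^sup>2 - x \<bullet> x)) - 2 * (indicator ?B x * ((x \<bullet> i) * (x \<bullet> j))))
        = (i \<bullet> j) * q - 2 * (LINT x|lborel. indicator ?B x * ((x \<bullet> i) * (x \<bullet> j)))"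
      unfolding q_def by (subst Bochner_Integration.integral_diff) (auto intro!: int continuous_intros)
    ultimately show ?thesis by simp
  qed
  have V: "(LINT x|lborel. indicator ?B x * \<rho>\<^sup>2) = unit_ball_vol (real DIM('a)) * \<rho> ^ (DIM('a) + 2)"
    using content_ball[of \<rho> "0::'a"] \<rho> by (simp add: power_add power2_eq_square mult_ac)
  have "(LINT x|lborel. indicator ?B x * (x \<bullet> x)) = (LINT x|lborel. (\<Sum>i\<in>Basis. indicator ?B x * ((x \<bullet> i) * (x \<bullet> i))))"
    by (intro Bochner_Integration.integral_cong) (auto simp: sum_distrib_left[symmetric] euclidean_inner[symmetric])
  also have "\<dots> = (\<Sum>i\<in>Basis. LINT x|lborel. indicator ?B x * ((x \<bullet> i) * (x \<bullet> i)))"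
    by (intro Bochner_Integration.integral_sum int continuous_intros)
  also have "\<dots> = (\<Sum>i\<in>(Basis :: 'a set). q / 2)"
  proof (intro sum.cong refl)
    fix i :: 'a assume "i \<in> Basis"
    then show "(LINT x|lborel. indicator ?B x * ((x \<bullet> i) * (x \<bullet> i))) = q / 2" using m[of i i] by simp
  qed
  finally have tr: "(LINT x|lborel. indicator ?B x * (x \<bullet> x)) = real DIM('a) * q / 2" by simp
  have "q = (LINT x|lborel. indicator ?B x * \<rho>\<^sup>2 - indicator ?B x * (x \<bullet> x))"
    unfolding q_def by (simp add: right_diff_distrib)
  also have "\<dots> = (LINT x|lborel. indicator ?B x * \<rho>\<^sup>2) - (LINT x|lborel. indicator ?B x * (x \<bullet> x))"
    by (intro Bochner_Integration.integral_diff int continuous_intros)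
  \<comment> \<open>Every diagonal moment is \<open>q / 2\<close>, so the definition of
    \<open>q\<close> turns into a linear equation for it.\<close>
  finally have "q = unit_ball_vol (real DIM('a)) * \<rho> ^ (DIM('a) + 2) - real DIM('a) * q / 2" unfolding V tr .
  then have "q * (real DIM('a) + 2) = 2 * (unit_ball_vol (real DIM('a)) * \<rho> ^ (DIM('a) + 2))" by (simp add: algebra_simps)
  then have "q = 2 * (unit_ball_vol (real DIM('a)) * \<rho> ^ (DIM('a) + 2)) / (real DIM('a) + 2)"
    by (simp add: eq_divide_eq add_nonneg_eq_0_iff)
  then show ?thesis using m[of i j] ij by (auto simp: inner_Basis)
qed

section \<open>The nonlocal flux\<close>

definition line_flux :: "('a::euclidean_space \<Rightarrow> 'a) \<Rightarrow> 'a \<Rightarrow> 'a \<Rightarrow> real" where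
  "line_flux F x h = (LINT t|lborel. indicator {0..1} t * (F (x + t *\<^sub>R h) \<bullet> h))"

lemma integrable_line:
  fixes f :: "real \<Rightarrow> real"
  assumes "continuous_on UNIV f"
  shows "integrable lborel (\<lambda>t. indicator {0..1} t * f t)"
  by (rule integrable_indicator_continuous) (use assms in auto)

lemma integral_unit_interval:
  "(LINT t|lborel. indicator {0..1::real} t * c) = c"
  "(LINT t|lborel. indicator {0..1::real} t * (t * c)) = c / 2"
proof -
  show "(LINT t|lborel. indicator {0..1::real} t * c) = c" by simp
  have "has_bochner_integral lborel (\<lambda>t. indicator {0..1} t *\<^sub>R (t * c)) (1\<^sup>2 / 2 * c - 0\<^sup>2 / 2 * c)"
    by (rule has_bochner_integral_FTC_Icc)
       (auto intro!: derivative_eq_intros continuous_intros simp: has_real_derivative_iff_has_vector_derivative[symmetric])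
  then show "(LINT t|lborel. indicator {0..1::real} t * (t * c)) = c / 2"
    by (simp add: has_bochner_integral_integral_eq)
qed

lemma line_flux_bound:
  assumes F: "continuous_on UNIV F" and M: "\<And>x. norm (F x) \<le> M"
  shows "\<bar>line_flux F x h\<bar> \<le> M * norm h"
proof -
  have c: "continuous_on UNIV (\<lambda>t. F (x + t *\<^sub>R h) \<bullet> h)"
    by (intro continuous_intros continuous_on_compose2[OF F]) auto
  have "norm (line_flux F x h) \<le> (LINT t|lborel. norm (indicator {0..1} t * (F (x + t *\<^sub>R h) \<bullet> h)))"
    unfolding line_flux_def by (rule integral_norm_bound)
  also have "\<dots> \<le> (LINT t|lborel. indicator {0..1::real} t * (M * norm h))"
  proof (rule integral_mono)
    show "integrable lborel (\<lambda>t. norm (indicator {0..1} t * (F (x + t *\<^sub>R h) \<bullet> h)))"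
      using integrable_line[OF c] by (rule integrable_norm)
    show "integrable lborel (\<lambda>t. indicator {0..1::real} t * (M * norm h))" by (intro integrable_line continuous_intros)
    fix t :: real
    have "\<bar>F (x + t *\<^sub>R h) \<bullet> h\<bar> \<le> norm (F (x + t *\<^sub>R h)) * norm h" by (rule Cauchy_Schwarz_ineq2)
    also have "\<dots> \<le> M * norm h" using M by (intro mult_right_mono) auto
    finally show "norm (indicator {0..1} t * (F (x + t *\<^sub>R h) \<bullet> h)) \<le> indicator {0..1} t * (M * norm h)"
      by (simp add: indicator_def)
  qed
  finally show ?thesis by (simp add: integral_unit_interval)
qed

text \<open>The factor 1/2 of the second-order term is the integral of \<open>t\<close> over the
  unit interval.\<close>

lemma line_flux_taylor:
  assumes F: "continuous_on UNIV F" and D: "linear D"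
    and t: "\<And>k. norm k < \<delta> \<Longrightarrow> norm (F (y + k) - F y - D k) \<le> \<eta> * norm k" and h: "norm h < \<delta>"
  shows "\<bar>line_flux F y h - F y \<bullet> h - (D h \<bullet> h) / 2\<bar> \<le> \<eta> * (norm h)\<^sup>2"
proof -
  have c: "continuous_on UNIV (\<lambda>t. F (y + t *\<^sub>R h) \<bullet> h)"
    by (intro continuous_intros continuous_on_compose2[OF F]) auto
  let ?r = "\<lambda>t. F (y + t *\<^sub>R h) \<bullet> h - F y \<bullet> h - t * (D h \<bullet> h)"
  have cr: "continuous_on UNIV ?r" by (intro continuous_intros c)
  have "(LINT t|lborel. indicator {0..1} t * ?r t)
      = (LINT t|lborel. indicator {0..1} t * (F (y + t *\<^sub>R h) \<bullet> h) - indicator {0..1} t * (F y \<bullet> h) - indicator {0..1} t * (t * (D h \<bullet> h)))"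
    by (simp add: right_diff_distrib)
  also have "\<dots> = line_flux F y h - (LINT t|lborel. indicator {0..1::real} t * (F y \<bullet> h)) - (LINT t|lborel. indicator {0..1::real} t * (t * (D h \<bullet> h)))"
    unfolding line_flux_def
    by (subst Bochner_Integration.integral_diff, (intro Bochner_Integration.integrable_diff integrable_line c continuous_intros)+)+ simp
  finally have eq: "line_flux F y h - F y \<bullet> h - (D h \<bullet> h) / 2 = (LINT t|lborel. indicator {0..1} t * ?r t)"
    by (simp only: integral_unit_interval)
  have "norm (LINT t|lborel. indicator {0..1} t * ?r t) \<le> (LINT t|lborel. norm (indicator {0..1} t * ?r t))"
    by (rule integral_norm_bound)
  also have "\<dots> \<le> (LINT t|lborel. indicator {0..1::real} t * (\<eta> * (norm h)\<^sup>2))"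
  proof (rule integral_mono)
    show "integrable lborel (\<lambda>t. norm (indicator {0..1} t * ?r t))"
      using integrable_line[OF cr] by (rule integrable_norm)
    show "integrable lborel (\<lambda>t. indicator {0..1::real} t * (\<eta> * (norm h)\<^sup>2))" by (intro integrable_line continuous_intros)
    fix t :: real
    have "\<bar>?r t\<bar> \<le> \<eta> * (norm h)\<^sup>2" if t01: "0 \<le> t" "t \<le> 1"
    proof -
      have n: "norm (t *\<^sub>R h) \<le> norm h" using t01 by (simp add: mult_left_le_one_le)
      have e: "0 \<le> \<eta> * norm h" using order_trans[OF norm_ge_zero t[OF h]] .
      have eta: "\<eta> * norm (t *\<^sub>R h) \<le> \<eta> * norm h"
        using mult_left_le_one_le[OF e t01] t01 by (simp add: mult_ac)
      have "?r t = (F (y + t *\<^sub>R h) - F y - D (t *\<^sub>R h)) \<bullet> h"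
        by (simp add: inner_diff_left linear_scale[OF D])
      also have "\<bar>\<dots>\<bar> \<le> norm (F (y + t *\<^sub>R h) - F y - D (t *\<^sub>R h)) * norm h" by (rule Cauchy_Schwarz_ineq2)
      also have "\<dots> \<le> (\<eta> * norm h) * norm h"
        using t[OF le_less_trans[OF n h]] eta by (intro mult_right_mono) auto
      finally show ?thesis by (simp add: power2_eq_square mult.assoc)
    qed
    then show "norm (indicator {0..1} t * ?r t) \<le> indicator {0..1} t * (\<eta> * (norm h)\<^sup>2)"
      by (cases "t \<in> {0..1}") auto
  qed
  finally show ?thesis unfolding eq by (simp add: integral_unit_interval)
qed

lemma line_flux_measurable:
  assumes "continuous_on UNIV F"
  shows "(\<lambda>z. line_flux F (fst z) (snd z)) \<in> borel_measurable (borel \<Otimes>\<^sub>M borel)"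
proof -
  have [measurable]: "F \<in> borel_measurable borel" using assms by (rule borel_measurable_continuous_onI)
  show ?thesis unfolding line_flux_def by measurable
qed

text \<open>The substitution of \<open>1 - t\<close> for \<open>t\<close> traverses the segment
  backwards; this is the source of the antisymmetry of the flux.\<close>

lemma line_flux_reverse: "line_flux F y (x - y) = - line_flux F x (y - x)"
proof -
  have "line_flux F y (x - y) = (LINT t|lborel. indicator {0..1} (1 + (- 1) * t) * (F (y + (1 + (- 1) * t) *\<^sub>R (x - y)) \<bullet> (x - y)))"
    unfolding line_flux_def by (subst lborel_integral_real_affine[where c="- 1" and t=1]) simp_all
  also have "\<dots> = (LINT t|lborel. - (indicator {0..1} t * (F (x + t *\<^sub>R (y - x)) \<bullet> (y - x))))"
  proof (rule Bochner_Integration.integral_cong)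
    fix t :: real
    have "y + (1 + (- 1) * t) *\<^sub>R (x - y) = x + t *\<^sub>R (y - x)" by (simp add: algebra_simps)
    then show "indicator {0..1} (1 + (- 1) * t) * (F (y + (1 + (- 1) * t) *\<^sub>R (x - y)) \<bullet> (x - y))
        = - (indicator {0..1} t * (F (x + t *\<^sub>R (y - x)) \<bullet> (y - x)))"
      by (auto simp: indicator_def inner_diff_right)
  qed simp
  finally show ?thesis by (simp add: line_flux_def)
qed

text \<open>Mixed second moments vanish and the diagonal ones agree, so only the trace survives; for
  a derivative this is the divergence.\<close>

lemma integral_ball_bilinear:
  fixes D :: "'a::euclidean_space \<Rightarrow> 'a"
  assumes \<rho>: "0 < \<rho>" and D: "linear D"
  shows "(LINT h|lborel. indicator (ball 0 \<rho>) h * (D h \<bullet> h))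
    = unit_ball_vol (real DIM('a)) * \<rho> ^ (DIM('a) + 2) / (real DIM('a) + 2) * (\<Sum>b\<in>Basis. D b \<bullet> b)"
proof -
  let ?m = "unit_ball_vol (real DIM('a)) * \<rho> ^ (DIM('a) + 2) / (real DIM('a) + 2)"
  have int: "integrable lborel (\<lambda>x. indicator (ball (0::'a) \<rho>) x * f x)" if "continuous_on UNIV f" for f :: "'a \<Rightarrow> real"
    using that by (intro integrable_indicator_continuous) auto
  have ex: "D h \<bullet> h = (\<Sum>i\<in>Basis. \<Sum>j\<in>Basis. (D i \<bullet> j) * ((h \<bullet> i) * (h \<bullet> j)))" for h
  proof -
    have "D h = D (\<Sum>i\<in>Basis. (h \<bullet> i) *\<^sub>R i)" by (simp add: euclidean_representation)
    also have "\<dots> = (\<Sum>i\<in>Basis. (h \<bullet> i) *\<^sub>R D i)" by (simp add: linear_sum[OF D] linear_scale[OF D])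
    finally have Dh: "D h = (\<Sum>i\<in>Basis. (h \<bullet> i) *\<^sub>R D i)" .
    have "D h \<bullet> h = (\<Sum>i\<in>Basis. (h \<bullet> i) * (D i \<bullet> h))" unfolding Dh by (simp add: inner_sum_left)
    also have "\<dots> = (\<Sum>i\<in>Basis. \<Sum>j\<in>Basis. (D i \<bullet> j) * ((h \<bullet> i) * (h \<bullet> j)))"
      by (subst euclidean_inner) (simp add: sum_distrib_left mult_ac)
    finally show ?thesis .
  qed
  have "(LINT h|lborel. indicator (ball 0 \<rho>) h * (D h \<bullet> h))
      = (LINT h|lborel. (\<Sum>i\<in>Basis. \<Sum>j\<in>Basis. (D i \<bullet> j) * (indicator (ball 0 \<rho>) h * ((h \<bullet> i) * (h \<bullet> j)))))"
    unfolding ex by (simp add: sum_distrib_left mult_ac)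
  also have "\<dots> = (\<Sum>i\<in>Basis. \<Sum>j\<in>Basis. (D i \<bullet> j) * (LINT h|lborel. indicator (ball 0 \<rho>) h * ((h \<bullet> i) * (h \<bullet> j))))"
    by (subst Bochner_Integration.integral_sum; (subst Bochner_Integration.integral_sum)?)
       (auto intro!: Bochner_Integration.integrable_sum integrable_mult_right int continuous_intros)
  also have "\<dots> = (\<Sum>i\<in>Basis. \<Sum>j\<in>Basis. (D i \<bullet> j) * (if i = j then ?m else 0))"
    by (intro sum.cong refl) (simp add: integral_ball_quadratic[OF \<rho>])
  also have "\<dots> = ?m * (\<Sum>b\<in>Basis. D b \<bullet> b)"
  proof -
    have "(\<Sum>j\<in>Basis. (D i \<bullet> j) * (if i = j then ?m else 0)) = ?m * (D i \<bullet> i)" if i: "i \<in> Basis" for i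
    proof -
      have "(\<Sum>j\<in>Basis. (D i \<bullet> j) * (if i = j then ?m else 0)) = (\<Sum>j\<in>Basis. if i = j then ?m * (D i \<bullet> j) else 0)"
        by (intro sum.cong refl) simp
      then show ?thesis using i by (simp only: sum.delta'[OF finite_Basis] if_True)
    qed
    then show ?thesis unfolding sum_distrib_left by (rule sum.cong[OF refl])
  qed
  finally show ?thesis .
qed

text \<open>The first-order term is odd in \<open>h\<close> and averages to zero; the second-order
  term gives half the trace times the second moment \<open>m\<close>, and the error is
  \<open>\<eta>\<close> times the integral of \<open>(norm h)\<^sup>2\<close>.\<close>

lemma flux_average_taylor:
  fixes F :: "'a::euclidean_space \<Rightarrow> 'a"
  assumes F: "continuous_on UNIV F" and M: "\<And>x. norm (F x) \<le> M" and D: "linear D"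
    and t: "\<And>k. norm k < \<delta> \<Longrightarrow> norm (F (y + k) - F y - D k) \<le> \<eta> * norm k" and \<rho>: "0 < \<rho>" "\<rho> \<le> \<delta>"
  defines "m \<equiv> unit_ball_vol (real DIM('a)) * \<rho> ^ (DIM('a) + 2) / (real DIM('a) + 2)"
  shows "\<bar>(LINT h|lborel. indicator (ball 0 \<rho>) h * line_flux F y h) - m / 2 * (\<Sum>b\<in>Basis. D b \<bullet> b)\<bar> \<le> \<eta> * (real DIM('a) * m)"
proof -
  let ?B = "ball (0::'a) \<rho>"
  have int: "integrable lborel (\<lambda>x. indicator ?B x * f x)" if "continuous_on UNIV f" for f :: "'a \<Rightarrow> real"
    using that by (intro integrable_indicator_continuous) auto
  have cD: "continuous_on UNIV D" using D by (simp add: linear_continuous_on linear_conv_bounded_linear)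
  have lm[measurable]: "line_flux F y \<in> borel_measurable borel"
    using measurable_compose[OF measurable_Pair1' line_flux_measurable[OF F], of y] by simp
  have [measurable]: "?B \<in> sets borel" by simp
  have il: "integrable lborel (\<lambda>h. indicator ?B h * line_flux F y h)"
  proof (rule Bochner_Integration.integrable_bound)
    show "integrable lborel (\<lambda>h. indicator ?B h * (M * norm h))" by (intro int continuous_intros)
    show "AE h in lborel. norm (indicator ?B h * line_flux F y h) \<le> norm (indicator ?B h * (M * norm h))"
    proof (rule AE_I2)
      fix h
      have "\<bar>line_flux F y h\<bar> \<le> M * norm h" by (rule line_flux_bound[OF F M])
      then show "norm (indicator ?B h * line_flux F y h) \<le> norm (indicator ?B h * (M * norm h))"
        by (simp add: indicator_def)
    qed
  qed measurable
  let ?r = "\<lambda>h. line_flux F y h - F y \<bullet> h - (D h \<bullet> h) / 2"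
  have split: "indicator ?B h * ?r h = indicator ?B h * line_flux F y h - indicator ?B h * (h \<bullet> F y) - indicator ?B h * ((D h \<bullet> h) / 2)" for h
    by (simp add: right_diff_distrib inner_commute)
  have ir: "integrable lborel (\<lambda>h. indicator ?B h * ?r h)"
    unfolding split by (intro Bochner_Integration.integrable_diff il int continuous_intros cD) simp
  have "(LINT h|lborel. indicator ?B h * ?r h)
      = (LINT h|lborel. indicator ?B h * line_flux F y h) - (LINT h|lborel. indicator ?B h * (h \<bullet> F y)) - (LINT h|lborel. indicator ?B h * ((D h \<bullet> h) / 2))"
  proof -
    have i2: "integrable lborel (\<lambda>h. indicator ?B h * (h \<bullet> F y))" by (intro int continuous_intros)
    have i3: "integrable lborel (\<lambda>h. indicator ?B h * ((D h \<bullet> h) / 2))" by (intro int continuous_intros cD) simp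
    show ?thesis
      unfolding split Bochner_Integration.integral_diff[OF Bochner_Integration.integrable_diff[OF il i2] i3]
        Bochner_Integration.integral_diff[OF il i2] ..
  qed
  also have "(LINT h|lborel. indicator ?B h * (h \<bullet> F y)) = 0" by (rule integral_ball_linear[OF \<rho>(1)])
  also have "(LINT h|lborel. indicator ?B h * ((D h \<bullet> h) / 2)) = m / 2 * (\<Sum>b\<in>Basis. D b \<bullet> b)"
    using integral_ball_bilinear[OF \<rho>(1) D] by (simp add: m_def)
  finally have eq: "(LINT h|lborel. indicator ?B h * line_flux F y h) - m / 2 * (\<Sum>b\<in>Basis. D b \<bullet> b) = (LINT h|lborel. indicator ?B h * ?r h)"
    by simp
  have "norm (LINT h|lborel. indicator ?B h * ?r h) \<le> (LINT h|lborel. norm (indicator ?B h * ?r h))"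
    by (rule integral_norm_bound)
  \<comment> \<open>The squared norm is written as the bilinear form of the identity, whose trace is
    the dimension, so that the preceding moment formula applies.\<close>
  also have "\<dots> \<le> (LINT h|lborel. \<eta> * (indicator ?B h * (id h \<bullet> h)))"
  proof (rule integral_mono)
    show "integrable lborel (\<lambda>h. norm (indicator ?B h * ?r h))" using ir by (rule integrable_norm)
    show "integrable lborel (\<lambda>h. \<eta> * (indicator ?B h * (id h \<bullet> h)))" by (intro integrable_mult_right int continuous_intros)
    fix h
    show "norm (indicator ?B h * ?r h) \<le> \<eta> * (indicator ?B h * (id h \<bullet> h))"
    proof (cases "h \<in> ?B")
      case True
      then have "norm h < \<delta>" using \<rho> by simp
      then have "\<bar>?r h\<bar> \<le> \<eta> * (norm h)\<^sup>2" by - (rule line_flux_taylor[OF F D], erule t)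
      moreover have "norm (indicator ?B h * ?r h) = \<bar>?r h\<bar>" "indicator ?B h * (id h \<bullet> h) = (norm h)\<^sup>2"
        unfolding indicator_simps(1)[OF True] by (simp_all only: mult_1 real_norm_def id_apply dot_square_norm)
      ultimately show ?thesis by (simp only:)
    qed simp
  qed
  also have "\<dots> = \<eta> * (LINT h|lborel. indicator ?B h * (id h \<bullet> h))" by simp
  also have "\<dots> = \<eta> * (real DIM('a) * m)"
    by (subst integral_ball_bilinear[OF \<rho>(1) linear_id]) (simp add: m_def)
  finally show ?thesis unfolding eq by simp
qed

text \<open>Uniform continuity of \<open>D\<close> on a compact ball makes the Taylor radius
  independent of the base point in \<open>\<Omega>\<close>.\<close>

lemma uniform_taylor:
  fixes F :: "'a::euclidean_space \<Rightarrow> 'a" and D :: "'a \<Rightarrow> 'a \<Rightarrow>\<^sub>L 'a"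
  assumes d: "\<And>x. (F has_derivative blinfun_apply (D x)) (at x)" and c: "continuous_on UNIV D"
    and \<Omega>: "bounded \<Omega>" and \<eta>: "0 < \<eta>"
  shows "\<exists>\<delta>>0. \<forall>y\<in>\<Omega>. \<forall>k. norm k < \<delta> \<longrightarrow> norm (F (y + k) - F y - D y k) \<le> \<eta> * norm k"
proof -
  obtain R where R: "\<And>x. x \<in> \<Omega> \<Longrightarrow> norm x \<le> R" using \<Omega> bounded_iff by metis
  \<comment> \<open>The margin 1 contains every segment from a point of \<open>\<Omega>\<close> with
    increment shorter than 1.\<close>
  have "uniformly_continuous_on (cball 0 (R + 1)) D"
    using c by (intro compact_uniformly_continuous continuous_on_subset[OF c]) auto
  then obtain \<delta> where \<delta>: "0 < \<delta>" "\<And>x x'. x \<in> cball 0 (R + 1) \<Longrightarrow> x' \<in> cball 0 (R + 1) \<Longrightarrow> dist x' x < \<delta> \<Longrightarrow> dist (D x') (D x) < \<eta>"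
    using \<eta> unfolding uniformly_continuous_on_def by metis
  have "norm (F (y + k) - F y - D y k) \<le> \<eta> * norm k" if y: "y \<in> \<Omega>" and k: "norm k < min \<delta> 1" for y k
  proof -
    have "norm (F (y + k) - F y - D y ((y + k) - y)) \<le> norm ((y + k) - y) * \<eta>"
    proof (rule differentiable_bound_linearization[where S="cball y (norm k)" and f'="\<lambda>x. blinfun_apply (D x)"])
      show "(F has_derivative blinfun_apply (D x)) (at x within cball y (norm k))" for x
        using d by (rule has_derivative_at_withinI)
      show "y + t *\<^sub>R (y + k - y) \<in> cball y (norm k)" if "t \<in> {0..1}" for t
        using that by (simp add: dist_norm mult_left_le_one_le)
      fix x assume x: "x \<in> cball y (norm k)"
      then have xy: "norm (x - y) \<le> norm k" by (simp add: dist_norm norm_minus_commute)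
      have "norm x \<le> R + 1" using R[OF y] xy k norm_triangle_sub[of x y] by simp
      moreover have "norm y \<le> R + 1" using R[OF y] by simp
      moreover have "dist x y < \<delta>" using xy k by (simp add: dist_norm)
      ultimately have "dist (D x) (D y) < \<eta>" by (intro \<delta>(2)) auto
      then have "onorm (blinfun_apply (D x - D y)) \<le> \<eta>" by (simp add: dist_norm norm_blinfun.rep_eq)
      moreover have "blinfun_apply (D x) - blinfun_apply (D y) = blinfun_apply (D x - D y)"
        by (simp add: blinfun.diff_left fun_eq_iff)
      ultimately show "onorm (blinfun_apply (D x) - blinfun_apply (D y)) \<le> \<eta>" by (simp only:)
    qed auto
    then show ?thesis by (simp add: mult.commute)
  qed
  then show ?thesis using \<delta>(1) by (intro exI[of _ "min \<delta> 1"]) auto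
qed

text \<open>The sphere has measure \<open>DIM('a)\<close> times the volume of the unit ball, which
  cancels one dimensional factor of the kernel. What remains is the reciprocal of the second moment
  of the ball of radius \<open>\<epsilon>\<close>.\<close>

lemma nonlocal_product:
  fixes F :: "'a::euclidean_space \<Rightarrow> 'a"
  assumes \<epsilon>: "0 < \<epsilon>"
  defines "\<kappa> \<equiv> (real DIM('a) + 2) / (unit_ball_vol (real DIM('a)) * \<epsilon> ^ (DIM('a) + 2))"
  shows "nonlocal_field (alpha_kernel \<epsilon>) F x y * mu_kernel \<epsilon> (y - x)
       = \<kappa> * (indicator (ball 0 \<epsilon>) (y - x) * line_flux F x (y - x))"
proof (cases "x = y")
  case True
  then show ?thesis by (simp add: nonlocal_field_def line_flux_def)
next
  case False
  have i: "indicator (ball 0 \<epsilon>) (x - y) = (indicator (ball 0 \<epsilon>) (y - x) :: real)"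
    by (simp add: indicator_def norm_minus_commute)
  have l: "(LINT t:{0..1}|lborel. F (x + t *\<^sub>R (y - x)) \<bullet> (y - x)) = line_flux F x (y - x)"
    by (simp add: set_lebesgue_integral_def line_flux_def)
  have k: "(1 / \<epsilon>) * (real (DIM('a) * (DIM('a) + 2)) / (real DIM('a) * unit_ball_vol (real DIM('a))) * (1 / \<epsilon> ^ (DIM('a) + 1))) = \<kappa>"
  proof -
    have gen: "(1 / \<epsilon>) * (N * (N + 2) / (N * U) * (1 / P)) = (N + 2) / (U * (\<epsilon> * P))" if "N \<noteq> 0" for N U P :: real
      using that by simp
    have p: "\<epsilon> ^ (DIM('a) + 2) = \<epsilon> * \<epsilon> ^ (DIM('a) + 1)" by simp
    have r: "real (DIM('a) * (DIM('a) + 2)) = real DIM('a) * (real DIM('a) + 2)"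
      by (simp only: of_nat_mult of_nat_add of_nat_numeral)
    have N0: "real DIM('a) \<noteq> 0" by simp
    show ?thesis unfolding \<kappa>_def p r by (rule gen[OF N0])
  qed
  have "nonlocal_field (alpha_kernel \<epsilon>) F x y * mu_kernel \<epsilon> (y - x)
     = ((1 / \<epsilon>) * (real (DIM('a) * (DIM('a) + 2)) / (real DIM('a) * unit_ball_vol (real DIM('a))) * (1 / \<epsilon> ^ (DIM('a) + 1))))
       * (indicator (ball 0 \<epsilon>) (y - x) * line_flux F x (y - x))"
    using False unfolding nonlocal_field_def alpha_kernel_def mu_kernel_def l i measure_sphere_hausdorff
    by (cases "y - x \<in> ball 0 \<epsilon>") simp_all
  then show ?thesis unfolding k .
qed

text \<open>
  Antisymmetry of the flux makes the contribution of \<open>\<Omega> \<times> \<Omega>\<close> vanish, so that the flux from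
  \<open>-\<Omega>\<close> into \<open>\<Omega>\<close> is an integral over all of \<open>\<Omega>\<close> of flux averages over small balls.
\<close>

lemma nonlocal_flux_eq:
  fixes F :: "'a::euclidean_space \<Rightarrow> 'a"
  assumes F: "continuous_on UNIV F" and M: "\<And>x. norm (F x) \<le> M" and \<Omega>: "open \<Omega>" "bounded \<Omega>" and \<epsilon>: "0 < \<epsilon>"
  defines "\<kappa> \<equiv> (real DIM('a) + 2) / (unit_ball_vol (real DIM('a)) * \<epsilon> ^ (DIM('a) + 2))"
  shows "integrable lborel (\<lambda>y. indicator \<Omega> y * (2 * \<kappa> * (LINT h|lborel. indicator (ball 0 \<epsilon>) h * line_flux F y h)))"
    and "(LINT x:- \<Omega>|lborel. nonlocal_normal \<Omega> (mu_kernel \<epsilon>) (nonlocal_field (alpha_kernel \<epsilon>) F) x)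
    = (LINT y|lborel. indicator \<Omega> y * (2 * \<kappa> * (LINT h|lborel. indicator (ball 0 \<epsilon>) h * line_flux F y h)))"
proof -
  let ?B = "ball (0::'a) \<epsilon>"
  define \<Phi> where "\<Phi> x y = \<kappa> * (indicator ?B (y - x) * line_flux F x (y - x))" for x y
  have [measurable]: "\<Omega> \<in> sets borel" "?B \<in> sets borel" using \<Omega> by auto
  have [measurable]: "(\<lambda>z. line_flux F (fst z) (snd z)) \<in> borel_measurable (borel \<Otimes>\<^sub>M borel)"
    by (rule line_flux_measurable[OF F])
  have "(\<lambda>z. (fst z, snd z - fst z)) \<in> measurable (borel \<Otimes>\<^sub>M borel) (borel \<Otimes>\<^sub>M (borel :: 'a measure))" by measurable
  from measurable_compose[OF this line_flux_measurable[OF F]]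
  have [measurable]: "(\<lambda>z. line_flux F (fst z) (snd z - fst z)) \<in> borel_measurable (borel \<Otimes>\<^sub>M borel)" by simp
  have \<Phi>m[measurable]: "(\<lambda>z. \<Phi> (fst z) (snd z)) \<in> borel_measurable (borel \<Otimes>\<^sub>M borel)"
    unfolding \<Phi>_def by measurable
  have M0: "0 \<le> M" using order_trans[OF norm_ge_zero M] .
  have \<Phi>b: "\<bar>\<Phi> x y\<bar> \<le> \<bar>\<kappa>\<bar> * (M * \<epsilon>) * indicator ?B (y - x)" for x y
  proof (cases "y - x \<in> ?B")
    case True
    have "\<bar>line_flux F x (y - x)\<bar> \<le> M * norm (y - x)" by (rule line_flux_bound[OF F M])
    also have "\<dots> \<le> M * \<epsilon>" using True M0 by (intro mult_left_mono) auto
    finally have "\<bar>\<kappa>\<bar> * \<bar>line_flux F x (y - x)\<bar> \<le> \<bar>\<kappa>\<bar> * (M * \<epsilon>)" by (rule mult_left_mono) simp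
    then show ?thesis using True by (simp add: \<Phi>_def abs_mult)
  qed (simp add: \<Phi>_def)
  have anti: "\<Phi> y x = - \<Phi> x y" for x y
    using line_flux_reverse[of F y x] by (simp add: \<Phi>_def indicator_def norm_minus_commute)
  obtain R where R: "\<And>x. x \<in> \<Omega> \<Longrightarrow> norm x \<le> R" using \<Omega>(2) bounded_iff by metis
  \<comment> \<open>Every point that interacts with \<open>\<Omega>\<close> lies in this ball, so
    the integrand vanishes off \<open>?C \<times> \<Omega>\<close> and Fubini is available.\<close>
  let ?C = "cball (0::'a) (R + \<epsilon>)"
  have finC: "emeasure lborel ?C < \<infinity>" "emeasure lborel \<Omega> < \<infinity>"
    using emeasure_bounded_finite[OF bounded_cball] emeasure_bounded_finite[OF \<Omega>(2)] by auto
  have J: "integrable (lborel \<Otimes>\<^sub>M lborel) (\<lambda>z. indicator \<Omega> (snd z) * \<Phi> (fst z) (snd z))"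
  proof (rule Bochner_Integration.integrable_bound)
    have "integrable (lborel \<Otimes>\<^sub>M lborel) (indicator (?C \<times> \<Omega>) :: _ \<Rightarrow> real)"
    proof (rule integrable_real_indicator)
      show "?C \<times> \<Omega> \<in> sets (lborel \<Otimes>\<^sub>M lborel)" using \<Omega>(1) by (intro pair_measureI) auto
      have "emeasure (lborel \<Otimes>\<^sub>M lborel) (?C \<times> \<Omega>) = emeasure lborel ?C * emeasure lborel \<Omega>"
        using \<Omega>(1) by (intro lborel.emeasure_pair_measure_Times) auto
      then show "emeasure (lborel \<Otimes>\<^sub>M lborel) (?C \<times> \<Omega>) < \<infinity>" using finC by (simp add: ennreal_mult_less_top)
    qed
    then show "integrable (lborel \<Otimes>\<^sub>M lborel) (\<lambda>z. (\<bar>\<kappa>\<bar> * (M * \<epsilon>)) * indicator (?C \<times> \<Omega>) z)"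
      by (rule integrable_mult_right)
    show "(\<lambda>z. indicator \<Omega> (snd z) * \<Phi> (fst z) (snd z)) \<in> borel_measurable (lborel \<Otimes>\<^sub>M lborel)"
      by measurable
    show "AE z in lborel \<Otimes>\<^sub>M lborel. norm (indicator \<Omega> (snd z) * \<Phi> (fst z) (snd z)) \<le> norm ((\<bar>\<kappa>\<bar> * (M * \<epsilon>)) * indicator (?C \<times> \<Omega>) z)"
    proof (intro AE_I2)
      fix z :: "'a \<times> 'a"
      obtain x y where z: "z = (x, y)" by (cases z)
      have nn: "0 \<le> \<bar>\<kappa>\<bar> * (M * \<epsilon>)" using M0 \<epsilon> by simp
      show "norm (indicator \<Omega> (snd z) * \<Phi> (fst z) (snd z)) \<le> norm ((\<bar>\<kappa>\<bar> * (M * \<epsilon>)) * indicator (?C \<times> \<Omega>) z)"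
      proof (cases "y \<in> \<Omega> \<and> y - x \<in> ?B")
        case True
        have "norm x \<le> norm y + norm (y - x)" using norm_triangle_ineq4[of y "y - x"] by simp
        then have "x \<in> ?C" using True R[of y] by simp
        then show ?thesis using \<Phi>b[of x y] True nn by (simp add: z)
      next
        case False
        then have z0: "indicator \<Omega> y * \<Phi> x y = 0" by (auto simp: \<Phi>_def)
        show ?thesis by (simp only: z fst_conv snd_conv z0 norm_zero norm_ge_zero)
      qed
    qed
  qed
  then have J': "integrable (lborel \<Otimes>\<^sub>M lborel) (\<lambda>(x, y). indicator \<Omega> y * \<Phi> x y)" by (simp add: case_prod_unfold)
  have "integrable (lborel \<Otimes>\<^sub>M lborel) (\<lambda>z. indicator \<Omega> (fst z) * (indicator \<Omega> (snd z) * \<Phi> (fst z) (snd z)))"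
    by (rule Bochner_Integration.integrable_bound[OF J]) (measurable, auto simp: indicator_def)
  then have T': "integrable (lborel \<Otimes>\<^sub>M lborel) (\<lambda>(x, y). indicator \<Omega> x * (indicator \<Omega> y * \<Phi> x y))" by (simp add: case_prod_unfold)
  \<comment> \<open>The contribution of pairs inside \<open>\<Omega>\<close>; exchanging the two
    variables turns it into its negative.\<close>
  define T where "T = (LINT x|lborel. LINT y|lborel. indicator \<Omega> x * (indicator \<Omega> y * \<Phi> x y))"
  have "T = (LINT y|lborel. LINT x|lborel. indicator \<Omega> x * (indicator \<Omega> y * \<Phi> x y))"
    unfolding T_def by (rule lborel_pair.Fubini_integral[symmetric, OF T'])
  also have "\<dots> = (LINT y|lborel. LINT x|lborel. - (indicator \<Omega> y * (indicator \<Omega> x * \<Phi> y x)))"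
    proof (intro Bochner_Integration.integral_cong refl)
    show "indicator \<Omega> x * (indicator \<Omega> y * \<Phi> x y) = - (indicator \<Omega> y * (indicator \<Omega> x * \<Phi> y x))" for x y
      unfolding anti[of y x] by (simp only: mult_minus_right minus_minus mult.left_commute)
  qed
  also have "\<dots> = - T" unfolding T_def by simp
  finally have T0: "T = 0" by simp
  have ix: "integrable lborel (\<lambda>x. LINT y|lborel. indicator \<Omega> y * \<Phi> x y)" using lborel_pair.integrable_fst[OF J'] .
  have iT: "integrable lborel (\<lambda>x. LINT y|lborel. indicator \<Omega> x * (indicator \<Omega> y * \<Phi> x y))" using lborel_pair.integrable_fst[OF T'] .
  have iy: "integrable lborel (\<lambda>y. LINT x|lborel. indicator \<Omega> y * \<Phi> x y)" using lborel_pair.integrable_snd[OF J'] .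
  \<comment> \<open>For fixed \<open>y\<close> in \<open>\<Omega>\<close> the variable
    \<open>x\<close> now ranges over the whole space, so the shift to \<open>h = x - y\<close> gives
    an average over the full ball.\<close>
  have inner: "(- 2) * (LINT x|lborel. indicator \<Omega> y * \<Phi> x y)
      = indicator \<Omega> y * (2 * \<kappa> * (LINT h|lborel. indicator ?B h * line_flux F y h))" for y
  proof -
    have "(LINT x|lborel. \<Phi> y x) = (LINT h|lborel. \<Phi> y (y + h))"
      using lborel_distr_plus[of y] integral_distr[of "(+) y" lborel borel "\<Phi> y"]
      by (simp add: measurable_compose[OF measurable_Pair1' \<Phi>m, of y, simplified])
    also have "\<dots> = \<kappa> * (LINT h|lborel. indicator ?B h * line_flux F y h)" by (simp add: \<Phi>_def)
    finally have 1: "(LINT x|lborel. \<Phi> y x) = \<kappa> * (LINT h|lborel. indicator ?B h * line_flux F y h)" .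
    have "(LINT x|lborel. indicator \<Omega> y * \<Phi> x y) = (LINT x|lborel. (- indicator \<Omega> y) * \<Phi> y x)"
      proof (intro Bochner_Integration.integral_cong refl)
      show "indicator \<Omega> y * \<Phi> x y = (- indicator \<Omega> y) * \<Phi> y x" for x
        unfolding anti[of y x] by (simp only: mult_minus_right mult_minus_left minus_minus)
    qed
    also have "\<dots> = - indicator \<Omega> y * (LINT x|lborel. \<Phi> y x)" by (rule Bochner_Integration.integral_mult_right_zero)
    finally show ?thesis unfolding 1 by simp
  qed
  show "integrable lborel (\<lambda>y. indicator \<Omega> y * (2 * \<kappa> * (LINT h|lborel. indicator ?B h * line_flux F y h)))"
    unfolding inner[symmetric] using iy by (rule integrable_mult_right)
  have norm_op: "nonlocal_normal \<Omega> (mu_kernel \<epsilon>) (nonlocal_field (alpha_kernel \<epsilon>) F) x = (- 2) * (LINT y|lborel. indicator \<Omega> y * \<Phi> x y)" for x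
    unfolding nonlocal_normal_def nonlocal_product[OF \<epsilon>] set_lebesgue_integral_def \<Phi>_def \<kappa>_def by simp
  have "(LINT x:- \<Omega>|lborel. nonlocal_normal \<Omega> (mu_kernel \<epsilon>) (nonlocal_field (alpha_kernel \<epsilon>) F) x)
      = (LINT x|lborel. (- 2) * ((LINT y|lborel. indicator \<Omega> y * \<Phi> x y) - (LINT y|lborel. indicator \<Omega> x * (indicator \<Omega> y * \<Phi> x y))))"
    unfolding norm_op set_lebesgue_integral_def
    by (intro Bochner_Integration.integral_cong refl) (simp add: indicator_def)
  also have "\<dots> = (- 2) * ((LINT x|lborel. LINT y|lborel. indicator \<Omega> y * \<Phi> x y) - T)"
    unfolding T_def Bochner_Integration.integral_diff[OF ix iT, symmetric] by (rule Bochner_Integration.integral_mult_right_zero)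
  also have "(LINT x|lborel. LINT y|lborel. indicator \<Omega> y * \<Phi> x y) = (LINT y|lborel. LINT x|lborel. indicator \<Omega> y * \<Phi> x y)"
    by (rule lborel_pair.Fubini_integral[symmetric, OF J'])
  also have "(- 2) * ((LINT y|lborel. LINT x|lborel. indicator \<Omega> y * \<Phi> x y) - T)
      = (LINT y|lborel. (- 2) * (LINT x|lborel. indicator \<Omega> y * \<Phi> x y))"
    unfolding T0 Bochner_Integration.integral_mult_right_zero by simp
  finally show "(LINT x:- \<Omega>|lborel. nonlocal_normal \<Omega> (mu_kernel \<epsilon>) (nonlocal_field (alpha_kernel \<epsilon>) F) x)
    = (LINT y|lborel. indicator \<Omega> y * (2 * \<kappa> * (LINT h|lborel. indicator ?B h * line_flux F y h)))"
    unfolding inner .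
qed

text \<open>Since \<open>\<kappa> * m = 1\<close>, the average \<open>2 * \<kappa> * E y\<close>
  equals the divergence at \<open>y\<close> up to \<open>2 * ?d * \<eta>\<close>, uniformly on
  \<open>\<Omega>\<close>, and \<open>\<Omega>\<close> has finite measure.\<close>

lemma nonlocal_flux_tendsto_divergence:
  fixes F :: "'a::euclidean_space \<Rightarrow> 'a" and D :: "'a \<Rightarrow> 'a \<Rightarrow>\<^sub>L 'a"
  assumes F: "continuous_on UNIV F" and M: "\<And>x. norm (F x) \<le> M" and \<Omega>: "open \<Omega>" "bounded \<Omega>"
    and d: "\<And>x. (F has_derivative blinfun_apply (D x)) (at x)" and c: "continuous_on UNIV D"
  shows "((\<lambda>\<epsilon>. LINT x:- \<Omega>|lborel. nonlocal_normal \<Omega> (mu_kernel \<epsilon>) (nonlocal_field (alpha_kernel \<epsilon>) F) x)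
    \<longlongrightarrow> (LINT x|lborel. indicator \<Omega> x * (\<Sum>b\<in>Basis. D x b \<bullet> b))) (at_right 0)"
proof (rule tendstoI)
  fix e :: real assume e: "0 < e"
  let ?d = "real DIM('a)"
  \<comment> \<open>Makes the total error \<open>2 * ?d * \<eta> * measure lborel \<Omega>\<close>
    smaller than \<open>e\<close>; adding 1 keeps the denominator positive.\<close>
  define \<eta> where "\<eta> = e / (2 * ?d * (measure lborel \<Omega> + 1))"
  have mpos: "0 < measure lborel \<Omega> + 1" by (simp add: add_nonneg_pos)
  have \<eta>: "0 < \<eta>" using e mpos by (simp add: \<eta>_def)
  have "2 * ?d * \<eta> * (measure lborel \<Omega> + 1) = e" using mpos by (simp add: \<eta>_def)
  moreover have "2 * ?d * \<eta> * measure lborel \<Omega> < 2 * ?d * \<eta> * (measure lborel \<Omega> + 1)"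
    using \<eta> by (intro mult_strict_left_mono) auto
  ultimately have \<eta>e: "2 * ?d * \<eta> * measure lborel \<Omega> < e" by simp
  obtain \<delta> where \<delta>: "0 < \<delta>" "\<And>y k. y \<in> \<Omega> \<Longrightarrow> norm k < \<delta> \<Longrightarrow> norm (F (y + k) - F y - D y k) \<le> \<eta> * norm k"
    using uniform_taylor[OF d c \<Omega>(2) \<eta>] by blast
  let ?div = "\<lambda>x. \<Sum>b\<in>Basis. D x b \<bullet> b"
  have idiv: "integrable lborel (\<lambda>x. indicator \<Omega> x * ?div x)"
    using \<Omega> by (intro integrable_indicator_continuous continuous_intros blinfun.continuous_on c) auto
  have "dist (LINT x:- \<Omega>|lborel. nonlocal_normal \<Omega> (mu_kernel \<epsilon>) (nonlocal_field (alpha_kernel \<epsilon>) F) x)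
      (LINT x|lborel. indicator \<Omega> x * ?div x) < e" if \<epsilon>: "0 < \<epsilon>" "\<epsilon> < \<delta>" for \<epsilon>
  proof -
    define \<kappa> where "\<kappa> = (?d + 2) / (unit_ball_vol ?d * \<epsilon> ^ (DIM('a) + 2))"
    define m where "m = unit_ball_vol ?d * \<epsilon> ^ (DIM('a) + 2) / (?d + 2)"
    define E where "E y = (LINT h|lborel. indicator (ball 0 \<epsilon>) h * line_flux F y h)" for y
    note eq = nonlocal_flux_eq[OF F M \<Omega> \<epsilon>(1), folded \<kappa>_def E_def]
    have UP: "0 < unit_ball_vol ?d * \<epsilon> ^ (DIM('a) + 2)" using \<epsilon>(1) by (intro mult_pos_pos) auto
    have "(q / p) * (p / q) = 1" if "0 < p" "0 < q" for p q :: real using that by simp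
    moreover have d2: "0 < ?d + 2" by (simp add: add_nonneg_pos)
    ultimately have "\<kappa> * m = 1" unfolding m_def \<kappa>_def using UP by blast
    moreover have "0 < m" "0 < \<kappa>" unfolding m_def \<kappa>_def by (rule divide_pos_pos[OF UP d2], rule divide_pos_pos[OF d2 UP])
    ultimately have m: "0 < m" "\<kappa> * m = 1" "0 < \<kappa>" by auto
    have pt: "\<bar>2 * \<kappa> * E y - ?div y\<bar> \<le> 2 * ?d * \<eta>" if y: "y \<in> \<Omega>" for y
    proof -
      have lin: "linear (blinfun_apply (D y))" by (rule bounded_linear.linear[OF blinfun.bounded_linear_right])
      have "\<bar>E y - m / 2 * ?div y\<bar> \<le> \<eta> * (?d * m)"
        unfolding E_def m_def
        by (rule flux_average_taylor[OF F M lin \<delta>(2)[OF y] \<epsilon>(1) less_imp_le[OF \<epsilon>(2)]])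
      then have "2 * \<kappa> * \<bar>E y - m / 2 * ?div y\<bar> \<le> 2 * \<kappa> * (\<eta> * (?d * m))" using m(3) by (intro mult_left_mono) auto
      also have "2 * \<kappa> * (\<eta> * (?d * m)) = 2 * ?d * \<eta> * (\<kappa> * m)" by simp
      also have "2 * \<kappa> * \<bar>E y - m / 2 * ?div y\<bar> = \<bar>2 * \<kappa> * E y - (\<kappa> * m) * ?div y\<bar>"
      proof -
        have "2 * \<kappa> * E y - (\<kappa> * m) * ?div y = 2 * \<kappa> * (E y - m / 2 * ?div y)" by (simp add: algebra_simps)
        then have "\<bar>2 * \<kappa> * E y - (\<kappa> * m) * ?div y\<bar> = \<bar>2 * \<kappa>\<bar> * \<bar>E y - m / 2 * ?div y\<bar>"
          by (simp only: abs_mult)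
        moreover have "\<bar>2 * \<kappa>\<bar> = 2 * \<kappa>" using m(3) by (intro abs_of_pos) simp
        ultimately show ?thesis by (simp only:)
      qed
      finally show ?thesis unfolding m(2) by simp
    qed
    have "(LINT x:- \<Omega>|lborel. nonlocal_normal \<Omega> (mu_kernel \<epsilon>) (nonlocal_field (alpha_kernel \<epsilon>) F) x) - (LINT x|lborel. indicator \<Omega> x * ?div x)
        = (LINT x|lborel. indicator \<Omega> x * (2 * \<kappa> * E x) - indicator \<Omega> x * ?div x)"
      unfolding eq(2) by (rule Bochner_Integration.integral_diff[symmetric, OF eq(1) idiv])
    also have "norm \<dots> \<le> (LINT x|lborel. norm (indicator \<Omega> x * (2 * \<kappa> * E x) - indicator \<Omega> x * ?div x))"
      by (rule integral_norm_bound)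
    also have "\<dots> \<le> (LINT x|lborel. 2 * ?d * \<eta> * indicator \<Omega> x)"
    proof (rule integral_mono)
      show "integrable lborel (\<lambda>x. norm (indicator \<Omega> x * (2 * \<kappa> * E x) - indicator \<Omega> x * ?div x))"
        by (intro integrable_norm Bochner_Integration.integrable_diff eq(1) idiv)
      show "integrable lborel (\<lambda>x. 2 * ?d * \<eta> * indicator \<Omega> x)"
        using emeasure_bounded_finite[OF \<Omega>(2)] \<Omega>(1) by simp
      show "norm (indicator \<Omega> x * (2 * \<kappa> * E x) - indicator \<Omega> x * ?div x) \<le> 2 * ?d * \<eta> * indicator \<Omega> x" for x
        using pt[of x] by (cases "x \<in> \<Omega>") simp_all
    qed
    also have "\<dots> = 2 * ?d * \<eta> * measure lborel \<Omega>" using \<Omega>(1) by simp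
    finally show ?thesis using \<eta>e by (simp add: dist_real_def)
  qed
  then show "\<forall>\<^sub>F \<epsilon> in at_right 0. dist (LINT x:- \<Omega>|lborel. nonlocal_normal \<Omega> (mu_kernel \<epsilon>) (nonlocal_field (alpha_kernel \<epsilon>) F) x)
      (LINT x|lborel. indicator \<Omega> x * ?div x) < e"
    using eventually_at_right_real[OF \<delta>(1)] by (auto elim: eventually_mono)
qed

section \<open>Divergence theorem and the surface integral\<close>

context lipschitz_gauss
begin

lemma divergence_theorem:
  fixes F :: "'a \<Rightarrow> 'a" and D :: "'a \<Rightarrow> 'a \<Rightarrow>\<^sub>L 'a"
  assumes d: "\<And>x. (F has_derivative blinfun_apply (D x)) (at x)" and c: "continuous_on UNIV D"
  shows "(LINT x|lborel. indicator \<Omega> x * (\<Sum>b\<in>Basis. D x b \<bullet> b)) = (LINT a|\<mu>. indicator S a * (F a \<bullet> nn a))"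
proof -
  \<comment> \<open>The adjoint of the derivative applied to \<open>b\<close>, that is, the gradient
    of the component \<open>F x \<bullet> b\<close>.\<close>
  define g where "g b x = (\<Sum>i\<in>Basis. (D x i \<bullet> b) *\<^sub>R i)" for b x
  have g: "C1_grad (\<lambda>x. F x \<bullet> b) (g b)" for b
    unfolding C1_grad_def
  proof (intro conjI allI)
    show "continuous_on UNIV (g b)" unfolding g_def by (intro continuous_intros blinfun.continuous_on c)
    fix x
    have "((\<lambda>x. F x \<bullet> b) has_derivative (\<lambda>h. D x h \<bullet> b)) (at x)"
      by (rule has_derivative_inner_left[OF d])
    moreover have "D x h \<bullet> b = g b x \<bullet> h" for h
    proof -
      have "D x h = D x (\<Sum>i\<in>Basis. (h \<bullet> i) *\<^sub>R i)" by (simp add: euclidean_representation)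
      also have "\<dots> = (\<Sum>i\<in>Basis. (h \<bullet> i) *\<^sub>R D x i)" by (simp add: blinfun.sum_right blinfun.scaleR_right)
      finally have "D x h \<bullet> b = (\<Sum>i\<in>Basis. (h \<bullet> i) * (D x i \<bullet> b))" by (simp add: inner_sum_left)
      also have "\<dots> = (\<Sum>i\<in>Basis. (D x i \<bullet> b) * (i \<bullet> h))"
        by (intro sum.cong refl) (simp add: inner_commute[of h])
      also have "\<dots> = g b x \<bullet> h" by (simp add: g_def inner_sum_left)
      finally show ?thesis .
    qed
    ultimately show "((\<lambda>x. F x \<bullet> b) has_derivative (\<lambda>h. g b x \<bullet> h)) (at x)" by simp
  qed
  have gb: "g b x \<bullet> b = D x b \<bullet> b" if "b \<in> Basis" for b x
    using that by (simp add: g_def inner_sum_left inner_Basis if_distrib cong: if_cong)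
  have "(LINT x|lborel. indicator \<Omega> x * (\<Sum>b\<in>Basis. D x b \<bullet> b)) = (LINT x|lborel. (\<Sum>b\<in>Basis. indicator \<Omega> x * (g b x \<bullet> b)))"
    by (simp add: sum_distrib_left gb)
  also have "\<dots> = (\<Sum>b\<in>Basis. LINT x|lborel. indicator \<Omega> x * (g b x \<bullet> b))"
    by (rule Bochner_Integration.integral_sum) (rule integrable_dom[OF g])
  also have "\<dots> = (\<Sum>b\<in>Basis. LINT a|\<mu>. indicator S a * ((F a \<bullet> b) * (nn a \<bullet> b)))"
    by (intro sum.cong refl gauss[OF g])
  also have "\<dots> = (LINT a|\<mu>. (\<Sum>b\<in>Basis. indicator S a * ((F a \<bullet> b) * (nn a \<bullet> b))))"
    by (rule Bochner_Integration.integral_sum[symmetric]) (rule integrable_surface[OF C1_grad_continuous[OF g]])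
  also have "\<dots> = (LINT a|\<mu>. indicator S a * (F a \<bullet> nn a))"
    by (simp add: sum_distrib_left[symmetric] euclidean_inner[symmetric])
  finally show ?thesis .
qed

text \<open>On \<open>B\<close> nothing is known about \<open>n\<close>, so measurability of the
  integrand rests on completeness: all subsets of the null set \<open>B\<close> are measurable. Off
  \<open>B\<close> the integrand equals a measurable one built from the continuous field
  \<open>G\<close>.\<close>

lemma integral_surface_measure:
  fixes F G :: "'a \<Rightarrow> 'a"
  assumes G: "continuous_on UNIV G" and FG: "\<And>x. x \<in> S \<Longrightarrow> G x = F x"
  shows "(LINT x|surface_measure \<Omega>. F x \<bullet> n x) = (LINT a|\<mu>. indicator S a * (G a \<bullet> nn a))"
proof -
  have S\<mu>[measurable]: "S \<in> sets \<mu>" by (rule borel_sets_\<mu>) simp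
  have B\<mu>: "B \<in> sets \<mu>" using B_null by blast
  have subB: "A \<in> sets \<mu>" if "A \<subseteq> B" for A
    using hausdorff_outer_mono[OF that, of "DIM('a) - 1"] null by (intro hausdorff_null_sets) simp
  have [measurable]: "G \<in> borel_measurable \<mu>"
    using G by (intro borel_measurable_\<mu> borel_measurable_continuous_onI)
  let ?f = "\<lambda>a. indicator S a * (G a \<bullet> nn a)" and ?h = "\<lambda>a. indicator S a * (F a \<bullet> n a)"
  have f[measurable]: "?f \<in> borel_measurable \<mu>" by measurable
  have fh: "?f a = ?h a" if "a \<notin> B" for a using that FG[of a] by (cases "a \<in> S") (simp_all add: nn_def)
  have h: "?h \<in> borel_measurable \<mu>"
  proof (rule measurableI)
    fix V :: "real set" assume V: "V \<in> sets borel"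
    have "?h -` V \<inter> space \<mu> = (?f -` V \<inter> space \<mu> - B) \<union> (?h -` V \<inter> B)"
    proof (intro set_eqI)
      fix a
      show "a \<in> ?h -` V \<inter> space \<mu> \<longleftrightarrow> a \<in> (?f -` V \<inter> space \<mu> - B) \<union> (?h -` V \<inter> B)"
      proof (cases "a \<in> B")
        case False
        then show ?thesis using fh[OF False]
          by (simp only: vimage_eq Int_iff Un_iff Diff_iff space_hausdorff_measure UNIV_I simp_thms)
      qed simp
    qed
    also have "\<dots> \<in> sets \<mu>"
      by (rule sets.Un[OF sets.Diff[OF measurable_sets[OF f V] B\<mu>] subB[OF Int_lower2]])
    finally show "?h -` V \<inter> space \<mu> \<in> sets \<mu>" .
  qed simp
  have "(LINT x|surface_measure \<Omega>. F x \<bullet> n x) = (LINT a|\<mu>. indicator S a *\<^sub>R (F a \<bullet> n a))"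
    unfolding surface_measure_def using S\<mu> by (subst integral_restrict_space) auto
  also have "\<dots> = (LINT a|\<mu>. ?h a)" by simp
  also have "\<dots> = (LINT a|\<mu>. ?f a)"
  proof (rule integral_cong_AE[OF h f])
    show "AE a in \<mu>. ?h a = ?f a" using AE_not_in[OF B_null] by eventually_elim (rule fh[symmetric])
  qed
  finally show ?thesis .
qed

end

theorem mainTheorem5:
  fixes \<Omega> :: "'a::euclidean_space set"
    and F Fx :: "'a \<Rightarrow> 'a"
  assumes "piecewise_C1_domain \<Omega>"
    and "accessible_from_exterior \<Omega>"
    and "C1_on_closure \<Omega> F"
    and "compact_C1_extension \<Omega> F Fx"
  shows "((\<lambda>\<epsilon>. LINT x:- \<Omega>|lborel.
            nonlocal_normal \<Omega> (mu_kernel \<epsilon>) (nonlocal_field (alpha_kernel \<epsilon>) Fx) x)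
          \<longlongrightarrow> (LINT x|surface_measure \<Omega>. F x \<bullet> outward_normal \<Omega> x)) (at_right 0)"
proof -
  obtain B where "lipschitz_gauss \<Omega> (outward_normal \<Omega>) B"
    using lipschitz_gauss_piecewise_C1[OF assms(1)] by blast
  then interpret lipschitz_gauss \<Omega> "outward_normal \<Omega>" B .
  have ext: "\<And>x. x \<in> closure \<Omega> \<Longrightarrow> Fx x = F x" and supp: "compact (closure {x. Fx x \<noteq> 0})"
    and cont: "continuous_on UNIV Fx"
    using assms(4) by (auto simp: compact_C1_extension_def C1_on_closure_def)
  obtain D :: "'a \<Rightarrow> 'a \<Rightarrow>\<^sub>L 'a" where c: "continuous_on UNIV D"
    and d: "\<And>x. (Fx has_derivative blinfun_apply (D x)) (at x)"
    using assms(4) by (auto simp: compact_C1_extension_def C1_on_closure_def)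
  have "compact (Fx ` closure {x. Fx x \<noteq> 0})"
    by (rule compact_continuous_image[OF continuous_on_subset[OF cont] supp]) simp
  then have "bounded (Fx ` closure {x. Fx x \<noteq> 0})" by (rule compact_imp_bounded)
  then obtain M where "\<forall>y\<in>Fx ` closure {x. Fx x \<noteq> 0}. norm y \<le> M" unfolding bounded_iff by blast
  \<comment> \<open>A bound on the compact support is a bound on the whole space once it is made
    nonnegative.\<close>
  then have M: "norm (Fx x) \<le> max M 0" for x
    using closure_subset[of "{x. Fx x \<noteq> 0}"] by (cases "Fx x = 0") (auto simp: le_max_iff_disj)
  have "(LINT x|lborel. indicator \<Omega> x * (\<Sum>b\<in>Basis. D x b \<bullet> b)) = (LINT x|surface_measure \<Omega>. F x \<bullet> outward_normal \<Omega> x)"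
    unfolding divergence_theorem[OF d c] using ext S_closure
    by (intro integral_surface_measure[symmetric] cont) blast
  then show ?thesis
    using nonlocal_flux_tendsto_divergence[OF cont M open_dom bounded_dom d c] by simp
qed

end
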